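(* Let $\mathcal{E}$ be a topos, let $Cat_\infty(\mathcal{E})$ be an $\mathcal{E}$-mono-coreflective subcategory of $Cat(\mathcal{E})$ with coreflector $(-)_\infty$ and counit $\iota^\infty$, and let $l : \mathbf{2} \to \mathbb{I}$ be an arrow in $Cat(\mathcal{E})$. Let $\mathbb{C}$ be a simply connected category in $\mathcal{E}$ such that the jet part $\mathbb{C}_\infty$ is path connected. Then $\iota_{\mathbb{C}}^\infty : \mathbb{C}_\infty \to \mathbb{C}$ is in the left class of the integral factorisation system. In other words, for every $r : \mathbb{X} \to \mathbb{Y}$ in the right class of the integral factorisation system and all internal functors $\phi : \mathbb{C}_\infty \to \mathbb{X}$ and $\xi : \mathbb{C} \to \mathbb{Y}$ with $r\phi = \xi \iota_{\mathbb{C}}^\infty$, there is a unique internal functor $\psi : \mathbb{C} \to \mathbb{X}$ such that $\psi \iota_{\mathbb{C}}^\infty = \phi$ and $r \psi = \xi$.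
   Context: $Cat(\mathcal{E})$ is the category of internal categories and internal functors in $\mathcal{E}$; it is cartesian closed, and $\mathbb{B}^{\mathbb{A}}$ denotes the exponential (internal functor category). $Cat(\mathcal{E})$ is also an $\mathcal{E}$-category: the $\mathcal{E}$-valued hom-object, also written $\mathbb{B}^{\mathbb{A}}$, is the object of objects of the exponential, i.e. the object of $\mathcal{E}$ whose generalised elements $X \to \mathbb{B}^{\mathbb{A}}$ are the internal functors $\mathbb{A} \times \dot{X} \to \mathbb{B}$, where $\dot X$ is the discrete category on $X$. $\mathcal{E}$-mono-coreflective subcategory: for $\mathcal{E}$-categories $\mathcal{U}$ and $\mathcal{C}$ with underlying categories $\mathcal{U}_0$, $\mathcal{C}_0$, $\mathcal{U}$ is an $\mathcal{E}$-mono-coreflective subcategory of $\mathcal{C}$ iff there is an adjunction between $\mathcal{U}_0$ and $\mathcal{C}_0$ with full and faithful left adjoint $\mathcal{U}_0 \to \mathcal{C}_0$, right adjoint $(-)_\infty : \mathcal{C}_0 \to \mathcal{U}_0$, such that the counit $\iota^\infty_{\mathbb{C}} : \mathbb{C}_\infty \to \mathbb{C}$ is a monomorphism and for all $\mathbb{U}$ in $\mathcal{U}$ and $\mathbb{C}$ in $\mathcal{C}$ the arrow $(\iota^\infty_{\mathbb{C}})^{\mathbb{U}} : \mathbb{C}_\infty^{\mathbb{U}} \to \mathbb{C}^{\mathbb{U}}$ of hom-objects is an isomorphism in $\mathcal{E}$. (The inclusion $\mathcal{U}_0\to\mathcal{C}_0$ is suppressed from notation.) $\mathbb{C}_\infty$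 is called the jet part of $\mathbb{C}$. Integral factorisation system: an internal functor $r : \mathbb{X} \to \mathbb{Y}$ is in the right class iff the square with sides $\mathbb{X}^{\iota_{\mathbb{I}}^\infty} : \mathbb{X}^{\mathbb{I}} \to \mathbb{X}^{\mathbb{I}_\infty}$, $r^{\mathbb{I}} : \mathbb{X}^{\mathbb{I}} \to \mathbb{Y}^{\mathbb{I}}$, $r^{\mathbb{I}_\infty} : \mathbb{X}^{\mathbb{I}_\infty} \to \mathbb{Y}^{\mathbb{I}_\infty}$, $\mathbb{Y}^{\iota_{\mathbb{I}}^\infty} : \mathbb{Y}^{\mathbb{I}} \to \mathbb{Y}^{\mathbb{I}_\infty}$ is a pullback in $Cat(\mathcal{E})$. An internal functor $k : \mathbb{A} \to \mathbb{B}$ is in the left class iff for every $r : \mathbb{X} \to \mathbb{Y}$ in the right class the square with sides $\mathbb{X}^k : \mathbb{X}^{\mathbb{B}} \to \mathbb{X}^{\mathbb{A}}$, $r^{\mathbb{B}}$, $r^{\mathbb{A}}$, $\mathbb{Y}^k : \mathbb{Y}^{\mathbb{B}} \to \mathbb{Y}^{\mathbb{A}}$ is a pullback in $Cat(\mathcal{E})$. $\mathbf{2}$ is the category with two objects and one non-identity arrow; precomposing $l$ with the source and target inclusions $1 \to \mathbf{2}$ gives $0, 1 : 1 \to \mathbb{I}$. $2_*\mathbb{I}$ is the pushout $\mathbb{I}\,{}_1{+}_0\,\mathbb{I}$ in $Cat(\mathcal{E})$, glueing $1$ in the first copy to $0$ in the second. $\delta : \mathbf{2} \to 2_*\mathbb{I}$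 picks out the composite of $l$ in the first copy followed by $l$ in the second copy. $\partial\mathbb{I}^2$ is the pushout in $Cat(\mathcal{E})$ of $\delta$ along $\delta$, with coprojections $\iota_1, \iota_2 : 2_*\mathbb{I} \to \partial \mathbb{I}^2$. $\iota : \partial \mathbb{I}^2 \to \mathbb{I}^2=\mathbb{I}\times\mathbb{I}$ is induced by the arrows $((0,1_{\mathbb{I}}),(1_{\mathbb{I}},1))$ and $((1_{\mathbb{I}},0),(1,1_{\mathbb{I}}))$ from $2_*\mathbb{I}$ to $\mathbb{I}^2$. A category $\mathbb{C}$ in $\mathcal{E}$ is path connected iff $\mathbb{C}^l : \mathbb{C}^{\mathbb{I}} \to \mathbb{C}^{\mathbf{2}}$ (of $\mathcal{E}$-valued hom-objects) is an epimorphism in $\mathcal{E}$; it is simply connected iff it is path connected and $\mathbb{C}^{\iota} : \mathbb{C}^{\mathbb{I}^2} \to \mathbb{C}^{\partial\mathbb{I}^2}$ (of $\mathcal{E}$-valued hom-objects) is an epimorphism in $\mathcal{E}$. *)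

theory Defs
  imports Main
begin

record ('o, 'a) cat =
  Ob :: "'o set"
  Ar :: "'a set"
  Dom :: "'a \<Rightarrow> 'o"
  Cod :: "'a \<Rightarrow> 'o"
  Ide :: "'o \<Rightarrow> 'a"
  Cmp :: "'a \<Rightarrow> 'a \<Rightarrow> 'a"  (infixl "\<cdot>\<index>" 70)

definition hom :: "('o, 'a) cat \<Rightarrow> 'o \<Rightarrow> 'o \<Rightarrow> 'a set" where
  "hom K a b = {f \<in> Ar K. Dom K f = a \<and> Cod K f = b}"

locale category =
  fixes K :: "('o, 'a) cat" (structure)
  assumes Dom_in: "f \<in> Ar K \<Longrightarrow> Dom K f \<in> Ob K"
    and Cod_in: "f \<in> Ar K \<Longrightarrow> Cod K f \<in> Ob K"
    and Ide_in: "a \<in> Ob K \<Longrightarrow> Ide K a \<in> hom K a a"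
    and Cmp_in: "g \<in> hom K b c \<Longrightarrow> f \<in> hom K a b \<Longrightarrow> g \<cdot> f \<in> hom K a c"
    and Cmp_Ide: "f \<in> hom K a b \<Longrightarrow> f \<cdot> Ide K a = f"
    and Ide_Cmp: "f \<in> hom K a b \<Longrightarrow> Ide K b \<cdot> f = f"
    and Cmp_assoc: "h \<in> hom K c d \<Longrightarrow> g \<in> hom K b c \<Longrightarrow> f \<in> hom K a b
      \<Longrightarrow> (h \<cdot> g) \<cdot> f = h \<cdot> (g \<cdot> f)"

locale is_functor = S: category S + T: category T
  for S :: "('o, 'a) cat" and T :: "('p, 'b) cat"
    and Fo :: "'o \<Rightarrow> 'p" and Fa :: "'a \<Rightarrow> 'b" +
  assumes Fo_in: "a \<in> Ob S \<Longrightarrow> Fo a \<in> Ob T"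
    and Fa_in: "f \<in> hom S a b \<Longrightarrow> Fa f \<in> hom T (Fo a) (Fo b)"
    and Fa_Ide: "a \<in> Ob S \<Longrightarrow> Fa (Ide S a) = Ide T (Fo a)"
    and Fa_Cmp: "g \<in> hom S b c \<Longrightarrow> f \<in> hom S a b
      \<Longrightarrow> Fa (g \<cdot>\<^bsub>S\<^esub> f) = Fa g \<cdot>\<^bsub>T\<^esub> Fa f"

text \<open>The functor \<open>(Lo, La) : S \<rightarrow> T\<close> is left adjoint to \<open>(Ro, Ra) : T \<rightarrow> S\<close> with unit
  \<open>\<eta>\<close> and counit \<open>\<epsilon>\<close>.\<close>

locale adjunction = L: is_functor S T Lo La + R: is_functor T S Ro Ra
  for S :: "('o, 'a) cat" and T :: "('p, 'b) cat"
    and Lo :: "'o \<Rightarrow> 'p" and La :: "'a \<Rightarrow> 'b" and Ro :: "'p \<Rightarrow> 'o" and Ra :: "'b \<Rightarrow> 'a"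
    and \<eta> :: "'o \<Rightarrow> 'a" and \<epsilon> :: "'p \<Rightarrow> 'b" +
  assumes unit_in: "u \<in> Ob S \<Longrightarrow> \<eta> u \<in> hom S u (Ro (Lo u))"
    and counit_in: "c \<in> Ob T \<Longrightarrow> \<epsilon> c \<in> hom T (Lo (Ro c)) c"
    and unit_natural: "f \<in> hom S u v \<Longrightarrow> \<eta> v \<cdot>\<^bsub>S\<^esub> f = Ra (La f) \<cdot>\<^bsub>S\<^esub> \<eta> u"
    and counit_natural: "g \<in> hom T c d \<Longrightarrow> \<epsilon> d \<cdot>\<^bsub>T\<^esub> La (Ra g) = g \<cdot>\<^bsub>T\<^esub> \<epsilon> c"
    and triangle_L: "u \<in> Ob S \<Longrightarrow> \<epsilon> (Lo u) \<cdot>\<^bsub>T\<^esub> La (\<eta> u) = Ide T (Lo u)"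
    and triangle_R: "c \<in> Ob T \<Longrightarrow> Ra (\<epsilon> c) \<cdot>\<^bsub>S\<^esub> \<eta> (Ro c) = Ide S (Ro c)"

definition is_mono :: "('o, 'a) cat \<Rightarrow> 'a \<Rightarrow> bool" where
  "is_mono K f \<longleftrightarrow> f \<in> Ar K \<and>
     (\<forall>x\<in>Ob K. \<forall>g\<in>hom K x (Dom K f). \<forall>h\<in>hom K x (Dom K f).
        f \<cdot>\<^bsub>K\<^esub> g = f \<cdot>\<^bsub>K\<^esub> h \<longrightarrow> g = h)"

definition is_epi :: "('o, 'a) cat \<Rightarrow> 'a \<Rightarrow> bool" where
  "is_epi K f \<longleftrightarrow> f \<in> Ar K \<and>
     (\<forall>x\<in>Ob K. \<forall>g\<in>hom K (Cod K f) x. \<forall>h\<in>hom K (Cod K f) x.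
        g \<cdot>\<^bsub>K\<^esub> f = h \<cdot>\<^bsub>K\<^esub> f \<longrightarrow> g = h)"

definition is_iso :: "('o, 'a) cat \<Rightarrow> 'a \<Rightarrow> bool" where
  "is_iso K f \<longleftrightarrow> f \<in> Ar K \<and>
     (\<exists>g\<in>hom K (Cod K f) (Dom K f).
        g \<cdot>\<^bsub>K\<^esub> f = Ide K (Dom K f) \<and> f \<cdot>\<^bsub>K\<^esub> g = Ide K (Cod K f))"

definition is_terminal :: "('o, 'a) cat \<Rightarrow> 'o \<Rightarrow> bool" where
  "is_terminal K t \<longleftrightarrow> t \<in> Ob K \<and> (\<forall>x\<in>Ob K. \<exists>!f. f \<in> hom K x t)"

definition is_product :: "('o, 'a) cat \<Rightarrow> 'o \<Rightarrow> 'o \<Rightarrow> 'a \<Rightarrow> 'a \<Rightarrow> bool" where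
  "is_product K a b p q \<longleftrightarrow>
     p \<in> hom K (Dom K p) a \<and> q \<in> hom K (Dom K p) b \<and>
     (\<forall>x\<in>Ob K. \<forall>u\<in>hom K x a. \<forall>v\<in>hom K x b.
        \<exists>!h. h \<in> hom K x (Dom K p) \<and> p \<cdot>\<^bsub>K\<^esub> h = u \<and> q \<cdot>\<^bsub>K\<^esub> h = v)"

text \<open>\<open>is_pullback K f g p q\<close>: the commuting square \<open>f p = g q\<close> is a pullback.\<close>

definition is_pullback :: "('o, 'a) cat \<Rightarrow> 'a \<Rightarrow> 'a \<Rightarrow> 'a \<Rightarrow> 'a \<Rightarrow> bool" where
  "is_pullback K f g p q \<longleftrightarrow>
     f \<in> Ar K \<and> g \<in> Ar K \<and> Cod K f = Cod K g \<and>
     p \<in> hom K (Dom K p) (Dom K f) \<and> q \<in> hom K (Dom K p) (Dom K g) \<and>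
     f \<cdot>\<^bsub>K\<^esub> p = g \<cdot>\<^bsub>K\<^esub> q \<and>
     (\<forall>x\<in>Ob K. \<forall>u\<in>hom K x (Dom K f). \<forall>v\<in>hom K x (Dom K g).
        f \<cdot>\<^bsub>K\<^esub> u = g \<cdot>\<^bsub>K\<^esub> v \<longrightarrow>
        (\<exists>!h. h \<in> hom K x (Dom K p) \<and> p \<cdot>\<^bsub>K\<^esub> h = u \<and> q \<cdot>\<^bsub>K\<^esub> h = v))"

text \<open>\<open>is_pushout K f g i j\<close>: the commuting square \<open>i f = j g\<close> is a pushout.\<close>

definition is_pushout :: "('o, 'a) cat \<Rightarrow> 'a \<Rightarrow> 'a \<Rightarrow> 'a \<Rightarrow> 'a \<Rightarrow> bool" where
  "is_pushout K f g i j \<longleftrightarrow>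
     f \<in> Ar K \<and> g \<in> Ar K \<and> Dom K f = Dom K g \<and>
     i \<in> hom K (Cod K f) (Cod K i) \<and> j \<in> hom K (Cod K g) (Cod K i) \<and>
     i \<cdot>\<^bsub>K\<^esub> f = j \<cdot>\<^bsub>K\<^esub> g \<and>
     (\<forall>x\<in>Ob K. \<forall>u\<in>hom K (Cod K f) x. \<forall>v\<in>hom K (Cod K g) x.
        u \<cdot>\<^bsub>K\<^esub> f = v \<cdot>\<^bsub>K\<^esub> g \<longrightarrow>
        (\<exists>!h. h \<in> hom K (Cod K i) x \<and> h \<cdot>\<^bsub>K\<^esub> i = u \<and> h \<cdot>\<^bsub>K\<^esub> j = v))"

text \<open>\<open>c\<close> is the coproduct of the domains of the coprojections listed in \<open>is\<close>.\<close>

definition is_coproduct :: "('o, 'a) cat \<Rightarrow> 'o \<Rightarrow> 'a list \<Rightarrow> bool" where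
  "is_coproduct K c is \<longleftrightarrow>
     c \<in> Ob K \<and> (\<forall>i\<in>set is. i \<in> hom K (Dom K i) c) \<and>
     (\<forall>x\<in>Ob K. \<forall>fs. list_all2 (\<lambda>i f. f \<in> hom K (Dom K i) x) is fs \<longrightarrow>
        (\<exists>!h. h \<in> hom K c x \<and> map (\<lambda>i. h \<cdot>\<^bsub>K\<^esub> i) is = fs))"

text \<open>The arrow induced by a span \<open>(u, v)\<close> into a product or pullback with projections \<open>p, q\<close>,
  and the arrow induced by a cospan \<open>(u, v)\<close> out of a pushout with coprojections \<open>i, j\<close>.\<close>

definition pair :: "('o, 'a) cat \<Rightarrow> 'a \<Rightarrow> 'a \<Rightarrow> 'a \<Rightarrow> 'a \<Rightarrow> 'a" where
  "pair K p q u v =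
     (THE h. h \<in> hom K (Dom K u) (Dom K p) \<and> p \<cdot>\<^bsub>K\<^esub> h = u \<and> q \<cdot>\<^bsub>K\<^esub> h = v)"

definition copair :: "('o, 'a) cat \<Rightarrow> 'a \<Rightarrow> 'a \<Rightarrow> 'a \<Rightarrow> 'a \<Rightarrow> 'a" where
  "copair K i j u v =
     (THE h. h \<in> hom K (Cod K i) (Cod K u) \<and> h \<cdot>\<^bsub>K\<^esub> i = u \<and> h \<cdot>\<^bsub>K\<^esub> j = v)"

definition prod_pr :: "('o, 'a) cat \<Rightarrow> 'o \<Rightarrow> 'o \<Rightarrow> 'a \<times> 'a" where
  "prod_pr K a b = (SOME (p, q). is_product K a b p q)"

definition pr1 :: "('o, 'a) cat \<Rightarrow> 'o \<Rightarrow> 'o \<Rightarrow> 'a" where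
  "pr1 K a b = fst (prod_pr K a b)"

definition pr2 :: "('o, 'a) cat \<Rightarrow> 'o \<Rightarrow> 'o \<Rightarrow> 'a" where
  "pr2 K a b = snd (prod_pr K a b)"

definition prod_ob :: "('o, 'a) cat \<Rightarrow> 'o \<Rightarrow> 'o \<Rightarrow> 'o" where
  "prod_ob K a b = Dom K (pr1 K a b)"

definition prod_pair :: "('o, 'a) cat \<Rightarrow> 'a \<Rightarrow> 'a \<Rightarrow> 'a" where
  "prod_pair K u v = pair K (pr1 K (Cod K u) (Cod K v)) (pr2 K (Cod K u) (Cod K v)) u v"

definition prod_ar :: "('o, 'a) cat \<Rightarrow> 'a \<Rightarrow> 'a \<Rightarrow> 'a" where
  "prod_ar K f g =
     prod_pair K (f \<cdot>\<^bsub>K\<^esub> pr1 K (Dom K f) (Dom K g)) (g \<cdot>\<^bsub>K\<^esub> pr2 K (Dom K f) (Dom K g))"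

text \<open>\<open>is_exponential K a b e ev\<close>: \<open>e\<close> is the exponential \<open>b\<^sup>a\<close>, with evaluation
  \<open>ev : e \<times> a \<rightarrow> b\<close>.\<close>

definition is_exponential :: "('o, 'a) cat \<Rightarrow> 'o \<Rightarrow> 'o \<Rightarrow> 'o \<Rightarrow> 'a \<Rightarrow> bool" where
  "is_exponential K a b e ev \<longleftrightarrow>
     e \<in> Ob K \<and> ev \<in> hom K (prod_ob K e a) b \<and>
     (\<forall>x\<in>Ob K. \<forall>f\<in>hom K (prod_ob K x a) b.
        \<exists>!g. g \<in> hom K x e \<and> ev \<cdot>\<^bsub>K\<^esub> prod_ar K g (Ide K a) = f)"

definition exponential :: "('o, 'a) cat \<Rightarrow> 'o \<Rightarrow> 'o \<Rightarrow> 'o \<times> 'a" where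
  "exponential K a b = (SOME (e, ev). is_exponential K a b e ev)"

text \<open>\<open>exp_ob K a b\<close> is \<open>b\<^sup>a\<close>: the exponent comes first, as for \<open>hom\<close>.\<close>

definition exp_ob :: "('o, 'a) cat \<Rightarrow> 'o \<Rightarrow> 'o \<Rightarrow> 'o" where
  "exp_ob K a b = fst (exponential K a b)"

definition exp_ev :: "('o, 'a) cat \<Rightarrow> 'o \<Rightarrow> 'o \<Rightarrow> 'a" where
  "exp_ev K a b = snd (exponential K a b)"

definition curry_ar :: "('o, 'a) cat \<Rightarrow> 'o \<Rightarrow> 'o \<Rightarrow> 'o \<Rightarrow> 'a \<Rightarrow> 'a" where
  "curry_ar K x a b f =
     (THE g. g \<in> hom K x (exp_ob K a b) \<and> exp_ev K a b \<cdot>\<^bsub>K\<^esub> prod_ar K g (Ide K a) = f)"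

text \<open>\<open>exp_post K a r\<close> is \<open>r\<^sup>a : x\<^sup>a \<rightarrow> y\<^sup>a\<close> for \<open>r : x \<rightarrow> y\<close>, and
  \<open>exp_pre K k x\<close> is \<open>x\<^sup>k : x\<^sup>b \<rightarrow> x\<^sup>a\<close> for \<open>k : a \<rightarrow> b\<close>.\<close>

definition exp_post :: "('o, 'a) cat \<Rightarrow> 'o \<Rightarrow> 'a \<Rightarrow> 'a" where
  "exp_post K a r =
     curry_ar K (exp_ob K a (Dom K r)) a (Cod K r) (r \<cdot>\<^bsub>K\<^esub> exp_ev K a (Dom K r))"

definition exp_pre :: "('o, 'a) cat \<Rightarrow> 'a \<Rightarrow> 'o \<Rightarrow> 'a" where
  "exp_pre K k x =
     curry_ar K (exp_ob K (Cod K k) x) (Dom K k) x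
       (exp_ev K (Cod K k) x \<cdot>\<^bsub>K\<^esub> prod_ar K (Ide K (exp_ob K (Cod K k) x)) k)"

definition is_subobject_classifier :: "('o, 'a) cat \<Rightarrow> 'a \<Rightarrow> bool" where
  "is_subobject_classifier K tr \<longleftrightarrow>
     tr \<in> Ar K \<and> is_terminal K (Dom K tr) \<and>
     (\<forall>m. is_mono K m \<longrightarrow>
        (\<exists>!\<chi>. \<chi> \<in> hom K (Cod K m) (Cod K tr) \<and> (\<exists>u. is_pullback K \<chi> tr m u)))"

locale topos = category +
  assumes ex_terminal: "\<exists>t. is_terminal K t"
    and ex_pullback: "f \<in> hom K a c \<Longrightarrow> g \<in> hom K b c \<Longrightarrow> \<exists>p q. is_pullback K f g p q"
    and ex_exponential: "a \<in> Ob K \<Longrightarrow> b \<in> Ob K \<Longrightarrow> \<exists>e ev. is_exponential K a b e ev"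
    and ex_classifier: "\<exists>tr. is_subobject_classifier K tr"

text \<open>The object \<open>C2\<close> of composable pairs is part of the data, as a pullback of \<open>tgt\<close> along
  \<open>src\<close>: \<open>fstp\<close> and \<open>sndp\<close> give the first and the second arrow of a composable pair, and
  composition \<open>mul\<close> is in diagrammatic order.\<close>

record ('o, 'a) icat =
  C0 :: 'o
  C1 :: 'o
  C2 :: 'o
  src :: 'a
  tgt :: 'a
  idn :: 'a
  fstp :: 'a
  sndp :: 'a
  mul :: 'a

text \<open>The composite of generalised arrows \<open>f, g : X \<rightarrow> C1\<close> with \<open>tgt f = src g\<close>.\<close>

definition icomp :: "('o, 'a) cat \<Rightarrow> ('o, 'a) icat \<Rightarrow> 'a \<Rightarrow> 'a \<Rightarrow> 'a" where
  "icomp E C f g = mul C \<cdot>\<^bsub>E\<^esub> pair E (fstp C) (sndp C) f g"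

definition is_icat :: "('o, 'a) cat \<Rightarrow> ('o, 'a) icat \<Rightarrow> bool" where
  "is_icat E C \<longleftrightarrow>
     C0 C \<in> Ob E \<and> C1 C \<in> Ob E \<and> C2 C \<in> Ob E \<and>
     src C \<in> hom E (C1 C) (C0 C) \<and> tgt C \<in> hom E (C1 C) (C0 C) \<and>
     idn C \<in> hom E (C0 C) (C1 C) \<and>
     fstp C \<in> hom E (C2 C) (C1 C) \<and> sndp C \<in> hom E (C2 C) (C1 C) \<and>
     mul C \<in> hom E (C2 C) (C1 C) \<and>
     is_pullback E (tgt C) (src C) (fstp C) (sndp C) \<and>
     src C \<cdot>\<^bsub>E\<^esub> idn C = Ide E (C0 C) \<and> tgt C \<cdot>\<^bsub>E\<^esub> idn C = Ide E (C0 C) \<and>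
     src C \<cdot>\<^bsub>E\<^esub> mul C = src C \<cdot>\<^bsub>E\<^esub> fstp C \<and>
     tgt C \<cdot>\<^bsub>E\<^esub> mul C = tgt C \<cdot>\<^bsub>E\<^esub> sndp C \<and>
     icomp E C (idn C \<cdot>\<^bsub>E\<^esub> src C) (Ide E (C1 C)) = Ide E (C1 C) \<and>
     icomp E C (Ide E (C1 C)) (idn C \<cdot>\<^bsub>E\<^esub> tgt C) = Ide E (C1 C) \<and>
     (\<forall>x\<in>Ob E. \<forall>f\<in>hom E x (C1 C). \<forall>g\<in>hom E x (C1 C). \<forall>h\<in>hom E x (C1 C).
        tgt C \<cdot>\<^bsub>E\<^esub> f = src C \<cdot>\<^bsub>E\<^esub> g \<longrightarrow> tgt C \<cdot>\<^bsub>E\<^esub> g = src C \<cdot>\<^bsub>E\<^esub> h \<longrightarrow>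
        icomp E C (icomp E C f g) h = icomp E C f (icomp E C g h))"

record ('o, 'a) ifun =
  fdom :: "('o, 'a) icat"
  fcod :: "('o, 'a) icat"
  f0 :: 'a
  f1 :: 'a

definition is_ifun :: "('o, 'a) cat \<Rightarrow> ('o, 'a) ifun \<Rightarrow> bool" where
  "is_ifun E F \<longleftrightarrow> (let A = fdom F; B = fcod F in
     is_icat E A \<and> is_icat E B \<and>
     f0 F \<in> hom E (C0 A) (C0 B) \<and> f1 F \<in> hom E (C1 A) (C1 B) \<and>
     src B \<cdot>\<^bsub>E\<^esub> f1 F = f0 F \<cdot>\<^bsub>E\<^esub> src A \<and>
     tgt B \<cdot>\<^bsub>E\<^esub> f1 F = f0 F \<cdot>\<^bsub>E\<^esub> tgt A \<and>
     f1 F \<cdot>\<^bsub>E\<^esub> idn A = idn B \<cdot>\<^bsub>E\<^esub> f0 F \<and>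
     f1 F \<cdot>\<^bsub>E\<^esub> mul A = icomp E B (f1 F \<cdot>\<^bsub>E\<^esub> fstp A) (f1 F \<cdot>\<^bsub>E\<^esub> sndp A))"

definition Cat :: "('o, 'a) cat \<Rightarrow> (('o, 'a) icat, ('o, 'a) ifun) cat" where
  "Cat E = \<lparr>Ob = {C. is_icat E C}, Ar = {F. is_ifun E F}, Dom = fdom, Cod = fcod,
     Ide = (\<lambda>C. \<lparr>fdom = C, fcod = C, f0 = Ide E (C0 C), f1 = Ide E (C1 C)\<rparr>),
     Cmp = (\<lambda>G F. \<lparr>fdom = fdom F, fcod = fcod G,
              f0 = f0 G \<cdot>\<^bsub>E\<^esub> f0 F, f1 = f1 G \<cdot>\<^bsub>E\<^esub> f1 F\<rparr>)\<rparr>"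

text \<open>The hom-object of the \<open>E\<close>-category \<open>Cat E\<close> is the object of objects \<open>C0\<close> of the
  exponential in \<open>Cat E\<close>; hence the arrows of hom-objects induced by an internal functor are
  the \<open>f0\<close>-components of \<^const>\<open>exp_post\<close> and \<^const>\<open>exp_pre\<close>.\<close>

definition hom_post ::
    "('o, 'a) cat \<Rightarrow> ('o, 'a) icat \<Rightarrow> ('o, 'a) ifun \<Rightarrow> 'a" where
  "hom_post E A r = f0 (exp_post (Cat E) A r)"

definition hom_pre ::
    "('o, 'a) cat \<Rightarrow> ('o, 'a) ifun \<Rightarrow> ('o, 'a) icat \<Rightarrow> 'a" where
  "hom_pre E k X = f0 (exp_pre (Cat E) k X)"

text \<open>The inclusion of \<open>U\<close> is the full and faithful functor \<open>(Lo, La)\<close>, along which \<open>U\<close>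
  inherits its hom-objects from \<open>Cat E\<close>. The jet part of \<open>C\<close>, seen in \<open>Cat E\<close>, is
  \<open>Lo (Ro C)\<close>, and \<open>\<epsilon> C\<close> is its comparison with \<open>C\<close>.\<close>

locale mono_coreflective =
  adjunction U "Cat E" Lo La Ro Ra \<eta> \<epsilon>
  for E :: "('o, 'a) cat" and U :: "('u, 'v) cat"
    and Lo :: "'u \<Rightarrow> ('o, 'a) icat" and La :: "'v \<Rightarrow> ('o, 'a) ifun"
    and Ro :: "('o, 'a) icat \<Rightarrow> 'u" and Ra :: "('o, 'a) ifun \<Rightarrow> 'v"
    and \<eta> :: "'u \<Rightarrow> 'v" and \<epsilon> :: "('o, 'a) icat \<Rightarrow> ('o, 'a) ifun" +
  assumes full_faithful: "u \<in> Ob U \<Longrightarrow> v \<in> Ob U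
      \<Longrightarrow> bij_betw La (hom U u v) (hom (Cat E) (Lo u) (Lo v))"
    and counit_mono: "C \<in> Ob (Cat E) \<Longrightarrow> is_mono (Cat E) (\<epsilon> C)"
    and counit_hom_iso: "u \<in> Ob U \<Longrightarrow> C \<in> Ob (Cat E)
      \<Longrightarrow> is_iso E (hom_post E (Lo u) (\<epsilon> C))"

text \<open>The square with sides \<open>x\<^sup>k\<close>, \<open>r\<^sup>b\<close>, \<open>r\<^sup>a\<close>, \<open>y\<^sup>k\<close>, for
  \<open>k : a \<rightarrow> b\<close> and \<open>r : x \<rightarrow> y\<close>, is a pullback.\<close>

definition exp_square_pullback :: "('o, 'a) cat \<Rightarrow> 'a \<Rightarrow> 'a \<Rightarrow> bool" where
  "exp_square_pullback K k r \<longleftrightarrow>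
     is_pullback K
       (exp_post K (Dom K k) r) (exp_pre K k (Cod K r))
       (exp_pre K k (Dom K r)) (exp_post K (Cod K k) r)"

text \<open>The two classes of the factorisation system; for the integral factorisation system,
  \<open>K\<close> is \<open>Cat E\<close> and \<open>i\<close> is the counit at \<open>\<I>\<close>.\<close>

definition right_class :: "('o, 'a) cat \<Rightarrow> 'a \<Rightarrow> 'a set" where
  "right_class K i = {r \<in> Ar K. exp_square_pullback K i r}"

definition left_class :: "('o, 'a) cat \<Rightarrow> 'a \<Rightarrow> 'a set" where
  "left_class K i = {k \<in> Ar K. \<forall>r\<in>right_class K i. exp_square_pullback K k r}"

text \<open>\<open>two\<close> is the category with exactly two objects, picked out by \<open>s, t : one \<rightarrow> two\<close>, and
  exactly one non-identity arrow \<open>a\<close>, which goes from \<open>s\<close> to \<open>t\<close>. Since \<open>one\<close> is terminal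
  in \<open>Cat E\<close>, its object of objects is terminal in \<open>E\<close>; so these conditions express that the
  objects of \<open>two\<close> form \<open>1 + 1\<close> and its arrows \<open>1 + 1 + 1\<close>.\<close>

definition is_walking_arrow ::
    "('o, 'a) cat \<Rightarrow> ('o, 'a) icat \<Rightarrow> ('o, 'a) icat \<Rightarrow> ('o, 'a) ifun \<Rightarrow> ('o, 'a) ifun \<Rightarrow> 'a
      \<Rightarrow> bool" where
  "is_walking_arrow E one two s t a \<longleftrightarrow>
     is_terminal (Cat E) one \<and>
     s \<in> hom (Cat E) one two \<and> t \<in> hom (Cat E) one two \<and>
     a \<in> hom E (C0 one) (C1 two) \<and>
     src two \<cdot>\<^bsub>E\<^esub> a = f0 s \<and> tgt two \<cdot>\<^bsub>E\<^esub> a = f0 t \<and>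
     is_coproduct E (C0 two) [f0 s, f0 t] \<and>
     is_coproduct E (C1 two) [idn two \<cdot>\<^bsub>E\<^esub> f0 s, idn two \<cdot>\<^bsub>E\<^esub> f0 t, a]"

text \<open>The arrow \<open>\<delta>\<close> from \<open>two\<close> to \<open>I +\<^bsub>1,0\<^esub> I\<close> (with coprojections \<open>j1, j2\<close>), which
  sends \<open>a\<close> to the composite of \<open>l\<close> in the first copy followed by \<open>l\<close> in the second.\<close>

definition delta ::
    "('o, 'a) cat \<Rightarrow> 'a \<Rightarrow> ('o, 'a) ifun \<Rightarrow> ('o, 'a) ifun \<Rightarrow> ('o, 'a) ifun \<Rightarrow> ('o, 'a) ifun" where
  "delta E a l j1 j2 =
     (THE d. d \<in> hom (Cat E) (fdom l) (fcod j1) \<and>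
        f1 d \<cdot>\<^bsub>E\<^esub> a = icomp E (fcod j1)
          (f1 (j1 \<cdot>\<^bsub>Cat E\<^esub> l) \<cdot>\<^bsub>E\<^esub> a) (f1 (j2 \<cdot>\<^bsub>Cat E\<^esub> l) \<cdot>\<^bsub>E\<^esub> a))"

definition const_ar :: "('o, 'a) cat \<Rightarrow> 'o \<Rightarrow> 'a \<Rightarrow> 'a" where
  "const_ar K x p = p \<cdot>\<^bsub>K\<^esub> (THE h. h \<in> hom K x (Dom K p))"

text \<open>The comparison \<open>\<iota>\<close> from the boundary of the square \<open>I \<times> I\<close> to the square, where
  \<open>z, e : 1 \<rightarrow> I\<close> are the end points \<open>0, 1\<close>, \<open>j1, j2\<close> the coprojections of
  \<open>I +\<^bsub>1,0\<^esub> I\<close> and \<open>i1, i2\<close> those of the boundary.\<close>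

definition boundary_incl ::
    "('o, 'a) cat \<Rightarrow> 'a \<Rightarrow> 'a \<Rightarrow> 'a \<Rightarrow> 'a \<Rightarrow> 'a \<Rightarrow> 'a \<Rightarrow> 'a" where
  "boundary_incl K z e j1 j2 i1 i2 =
     (let I = Cod K z; z' = const_ar K I z; e' = const_ar K I e; id = Ide K I in
      copair K i1 i2
        (copair K j1 j2 (prod_pair K z' id) (prod_pair K id e'))
        (copair K j1 j2 (prod_pair K id z') (prod_pair K e' id)))"

definition path_connected ::
    "('o, 'a) cat \<Rightarrow> ('o, 'a) ifun \<Rightarrow> ('o, 'a) icat \<Rightarrow> bool" where
  "path_connected E l C \<longleftrightarrow> C \<in> Ob (Cat E) \<and> is_epi E (hom_pre E l C)"

definition simply_connected ::
    "('o, 'a) cat \<Rightarrow> ('o, 'a) ifun \<Rightarrow> ('o, 'a) ifun \<Rightarrow> ('o, 'a) icat \<Rightarrow> bool" where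
  "simply_connected E l \<iota> C \<longleftrightarrow> path_connected E l C \<and> is_epi E (hom_pre E \<iota> C)"

end

theory Submission
  imports Defs
begin

text \<open>
  Write \<open>\<iota> : C' \<rightarrow> C\<close> for the inclusion of the jet part, and \<open>I'\<close> for the jet part of \<open>I\<close>. A path
  in \<open>C\<close> at stage \<open>W\<close> is a functor \<open>p : W \<times> I \<rightarrow> C\<close>, where \<open>W\<close> is an object of the topos, regarded as
  a discrete category; its arrow is its value at \<open>l\<close>. Because the arrow of hom-objects induced by
  \<open>\<iota>\<close> is invertible, \<open>p\<close> maps \<open>W \<times> I'\<close> into \<open>C'\<close>, and \<open>\<phi>\<close> carries this jet of \<open>p\<close> to \<open>X\<close>. As \<open>r\<close> is in
  the right class, there is exactly one path in \<open>X\<close> that extends the transported jet and lies over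
  \<open>\<xi> p\<close>: the lift of \<open>p\<close>. Any solution \<open>\<psi>\<close> sends the arrow of \<open>p\<close> to the arrow of its lift. Since \<open>C\<close>
  is path connected, every arrow of \<open>C\<close> is, over a cover of its stage, the arrow of a path; so
  \<open>\<psi>\<close> is unique, and its existence amounts to two facts: the arrow of the lift depends on the
  arrow of the path only, and lifting respects composition and identities.

  Both facts come from squares \<open>h : W \<times> (I \<times> I) \<rightarrow> C\<close>. These have unique lifts as well. Indeed
  \<open>I' \<times> I' \<rightarrow> I \<times> I\<close> is a composite of products of \<open>I' \<rightarrow> I\<close> with identities, against which \<open>r\<close> still
  has unique lifts; and \<open>h\<close> maps \<open>W \<times> (I' \<times> I')\<close> into \<open>C'\<close>, because every arrow of \<open>I' \<times> I'\<close> is a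
  composite of two arrows with one constant coordinate (\<open>square_jet\<close>). By uniqueness the sides of
  the lifted square are the lifts of the sides (\<open>square_lift\<close>). Uniqueness also makes lifting
  natural in endofunctors of \<open>I\<close>, as these restrict to \<open>I'\<close>; in particular, constant paths have
  constant lifts. Now suppose that two pairs of consecutive paths have the same composite arrow.
  They form the boundary of a square. Simple connectivity fills it locally, and the lifted square
  shows that the lifted pairs have the same composite (\<open>square_key\<close>). Taking some of the paths to
  be constant gives the two facts. The arrow part of \<open>\<psi>\<close> is then obtained by descent along a cover
  (\<open>functor_exists\<close>).

  This settles unique lifting in the plain sense. The left class asks for it after multiplication
  with an arbitrary category \<open>Z\<close>; by exponential transposition this is plain lifting against
  \<open>r\<^sup>Z\<close>, which lies in the right class together with \<open>r\<close> (\<open>left_class_of_ortho\<close>).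

  Two pieces of general theory support the argument. In a topos, equality may be tested on covers
  and arrows descend along epimorphisms (\<open>local_eq\<close> and \<open>epi_descent\<close>, both from the subobject
  classifier). And the category of internal categories is cartesian closed: functors and natural
  transformations with a parameter in the topos form representable presheaves, and the representing
  objects carry the structure of the exponential.
\<close>

section \<open>Elementary category theory\<close>

lemma hom_iff [simp]: "f \<in> hom K a b \<longleftrightarrow> f \<in> Ar K \<and> Dom K f = a \<and> Cod K f = b"
  by (simp add: hom_def)

context category
begin

lemma Ide_simps [simp]:
  "a \<in> Ob K \<Longrightarrow> Ide K a \<in> Ar K" "a \<in> Ob K \<Longrightarrow> Dom K (Ide K a) = a"
  "a \<in> Ob K \<Longrightarrow> Cod K (Ide K a) = a"
  using Ide_in by auto

lemma Dom_Ob [simp]: "f \<in> Ar K \<Longrightarrow> Dom K f \<in> Ob K"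
  by (rule Dom_in)

lemma Cod_Ob [simp]: "f \<in> Ar K \<Longrightarrow> Cod K f \<in> Ob K"
  by (rule Cod_in)

lemma Cmp_simps [simp]:
  assumes "g \<in> Ar K" "f \<in> Ar K" "Dom K g = Cod K f"
  shows "g \<cdot> f \<in> Ar K" "Dom K (g \<cdot> f) = Dom K f" "Cod K (g \<cdot> f) = Cod K g"
  using Cmp_in[of g "Cod K f" "Cod K g" f "Dom K f"] assms by auto

lemma Cmp_Ide_right [simp]: "f \<in> Ar K \<Longrightarrow> Dom K f = a \<Longrightarrow> f \<cdot> Ide K a = f"
  using Cmp_Ide[of f a "Cod K f"] by auto

lemma Cmp_Ide_left [simp]: "f \<in> Ar K \<Longrightarrow> Cod K f = b \<Longrightarrow> Ide K b \<cdot> f = f"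
  using Ide_Cmp[of f "Dom K f" b] by auto

lemma assoc [simp]:
  assumes "h \<in> Ar K" "g \<in> Ar K" "f \<in> Ar K" "Dom K h = Cod K g" "Dom K g = Cod K f"
  shows "(h \<cdot> g) \<cdot> f = h \<cdot> (g \<cdot> f)"
  using Cmp_assoc[of h "Cod K g" "Cod K h" g "Cod K f" f "Dom K f"] assms by auto

text \<open>An equation \<open>h g = k l\<close> is stable under precomposition, but the simplifier, which keeps
  composites bracketed to the right, does not see the redex \<open>h g\<close> inside \<open>h (g f)\<close>. The two
  lemmas below supply the whiskered equations.\<close>

lemma cmp_eq_assoc:
  assumes "h \<cdot> g = k \<cdot> l" "h \<in> Ar K" "g \<in> Ar K" "k \<in> Ar K" "l \<in> Ar K"
    "Dom K h = Cod K g" "Dom K k = Cod K l" "f \<in> Ar K" "Cod K f = Dom K g" "Dom K l = Dom K g"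
  shows "h \<cdot> (g \<cdot> f) = k \<cdot> (l \<cdot> f)"
proof -
  have "h \<cdot> (g \<cdot> f) = (h \<cdot> g) \<cdot> f" using assms(2-) by simp
  also have "\<dots> = k \<cdot> (l \<cdot> f)" using assms by simp
  finally show ?thesis .
qed

lemma cmp_eq_assoc1:
  assumes "h \<cdot> g = k" "h \<in> Ar K" "g \<in> Ar K"
    "Dom K h = Cod K g" "f \<in> Ar K" "Cod K f = Dom K g"
  shows "h \<cdot> (g \<cdot> f) = k \<cdot> f"
  using assms by (metis assoc)

lemma is_product_Ar:
  assumes "is_product K a b p q"
  shows "p \<in> Ar K" "q \<in> Ar K" "Cod K p = a" "Cod K q = b" "Dom K q = Dom K p"
    "a \<in> Ob K" "b \<in> Ob K"
  using assms by (auto simp: is_product_def)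

lemma pair_product:
  assumes P: "is_product K a b p q"
    and u: "u \<in> Ar K" "Cod K u = a" and v: "v \<in> Ar K" "Cod K v = b" and uv: "Dom K u = Dom K v"
  shows "pair K p q u v \<in> Ar K" "Dom K (pair K p q u v) = Dom K v"
    "Cod K (pair K p q u v) = Dom K p"
    "p \<cdot> pair K p q u v = u" "q \<cdot> pair K p q u v = v"
proof -
  have "\<exists>!h. h \<in> hom K (Dom K u) (Dom K p) \<and> p \<cdot> h = u \<and> q \<cdot> h = v"
    using assms unfolding is_product_def by simp
  from theI'[OF this] show "pair K p q u v \<in> Ar K" "Dom K (pair K p q u v) = Dom K v"
    "Cod K (pair K p q u v) = Dom K p"
    "p \<cdot> pair K p q u v = u" "q \<cdot> pair K p q u v = v"
    unfolding pair_def using uv by auto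
qed

lemma product_ext:
  assumes P: "is_product K a b p q"
    and "h \<in> Ar K" "k \<in> Ar K" "Dom K h = Dom K k" "Cod K h = Dom K p" "Cod K k = Dom K p"
    and "p \<cdot> h = p \<cdot> k" "q \<cdot> h = q \<cdot> k"
  shows "h = k"
proof -
  have "\<exists>!h. h \<in> hom K (Dom K k) (Dom K p) \<and> p \<cdot> h = p \<cdot> k \<and> q \<cdot> h = q \<cdot> k"
    using assms is_product_Ar[OF P] unfolding is_product_def by simp
  then show ?thesis using assms by auto
qed

lemma pair_cmp:
  assumes P: "is_product K a b p q"
    and u: "u \<in> Ar K" "Cod K u = a" and v: "v \<in> Ar K" "Cod K v = b" and uv: "Dom K u = Dom K v"
    and h: "h \<in> Ar K" "Cod K h = Dom K v"
  shows "pair K p q u v \<cdot> h = pair K p q (u \<cdot> h) (v \<cdot> h)"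
  by (rule product_ext[OF P])
    (use assms is_product_Ar[OF P] in
      \<open>simp_all add: pair_product[OF P] cmp_eq_assoc1[OF pair_product(4)[OF P]]
        cmp_eq_assoc1[OF pair_product(5)[OF P]]\<close>)

lemma pair_pullback:
  assumes P: "is_pullback K f g p q"
    and u: "u \<in> Ar K" "Cod K u = Dom K f" and v: "v \<in> Ar K" "Cod K v = Dom K g"
    and uv: "Dom K u = Dom K v" and e: "f \<cdot> u = g \<cdot> v"
  shows "pair K p q u v \<in> Ar K" "Dom K (pair K p q u v) = Dom K v"
    "Cod K (pair K p q u v) = Dom K p"
    "p \<cdot> pair K p q u v = u" "q \<cdot> pair K p q u v = v"
proof -
  have "\<exists>!h. h \<in> hom K (Dom K u) (Dom K p) \<and> p \<cdot> h = u \<and> q \<cdot> h = v"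
    using assms unfolding is_pullback_def by simp
  from theI'[OF this] show "pair K p q u v \<in> Ar K" "Dom K (pair K p q u v) = Dom K v"
    "Cod K (pair K p q u v) = Dom K p"
    "p \<cdot> pair K p q u v = u" "q \<cdot> pair K p q u v = v"
    unfolding pair_def using uv by auto
qed

lemma is_pullback_Ar:
  assumes "is_pullback K f g p q"
  shows "f \<in> Ar K" "g \<in> Ar K" "Cod K f = Cod K g" "p \<in> Ar K" "q \<in> Ar K"
    "Cod K p = Dom K f" "Cod K q = Dom K g" "Dom K q = Dom K p" "f \<cdot> p = g \<cdot> q"
  using assms by (auto simp: is_pullback_def)

lemma pullback_ext:
  assumes P: "is_pullback K f g p q"
    and "h \<in> Ar K" "k \<in> Ar K" "Dom K h = Dom K k" "Cod K h = Dom K p" "Cod K k = Dom K p"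
    and "p \<cdot> h = p \<cdot> k" "q \<cdot> h = q \<cdot> k"
  shows "h = k"
proof -
  note A = is_pullback_Ar[OF P]
  have "f \<cdot> (p \<cdot> k) = g \<cdot> (q \<cdot> k)" using A assms by (intro cmp_eq_assoc) auto
  then have "\<exists>!h. h \<in> hom K (Dom K k) (Dom K p) \<and> p \<cdot> h = p \<cdot> k \<and> q \<cdot> h = q \<cdot> k"
    using assms A P unfolding is_pullback_def by simp
  then show ?thesis using assms by auto
qed

lemma pair_pullback_cmp:
  assumes P: "is_pullback K f g p q"
    and u: "u \<in> Ar K" "Cod K u = Dom K f" and v: "v \<in> Ar K" "Cod K v = Dom K g"
    and uv: "Dom K u = Dom K v" and e: "f \<cdot> u = g \<cdot> v"
    and h: "h \<in> Ar K" "Cod K h = Dom K v"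
  shows "pair K p q u v \<cdot> h = pair K p q (u \<cdot> h) (v \<cdot> h)"
proof -
  note A = is_pullback_Ar[OF P]
  have e': "f \<cdot> (u \<cdot> h) = g \<cdot> (v \<cdot> h)" using A assms by (intro cmp_eq_assoc) auto
  note Q = pair_pullback[OF P u v uv e]
  note Q' = pair_pullback[OF P _ _ _ _ _ e']
  show ?thesis
    by (rule pullback_ext[OF P])
      (use A assms in \<open>simp_all add: Q Q' cmp_eq_assoc1[OF Q(4)] cmp_eq_assoc1[OF Q(5)]\<close>)
qed

lemma monoD:
  assumes "is_mono K m" "g \<in> Ar K" "h \<in> Ar K" "Cod K g = Dom K m" "Cod K h = Dom K m"
    "Dom K g = Dom K h" "m \<cdot> g = m \<cdot> h"
  shows "g = h"
  using assms unfolding is_mono_def by (metis hom_iff Dom_Ob)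

lemma is_monoI:
  assumes "m \<in> Ar K"
    and "\<And>g h. g \<in> Ar K \<Longrightarrow> h \<in> Ar K \<Longrightarrow> Cod K g = Dom K m \<Longrightarrow> Cod K h = Dom K m \<Longrightarrow>
      Dom K g = Dom K h \<Longrightarrow> m \<cdot> g = m \<cdot> h \<Longrightarrow> g = h"
  shows "is_mono K m"
  using assms unfolding is_mono_def by auto

lemma epiD:
  assumes "is_epi K e" "g \<in> Ar K" "h \<in> Ar K" "Dom K g = Cod K e" "Dom K h = Cod K e"
    "Cod K g = Cod K h" "g \<cdot> e = h \<cdot> e"
  shows "g = h"
  using assms unfolding is_epi_def by (metis hom_iff Cod_Ob)

lemma is_epiI:
  assumes "e \<in> Ar K"
    and "\<And>g h. g \<in> Ar K \<Longrightarrow> h \<in> Ar K \<Longrightarrow> Dom K g = Cod K e \<Longrightarrow> Dom K h = Cod K e \<Longrightarrow>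
      Cod K g = Cod K h \<Longrightarrow> g \<cdot> e = h \<cdot> e \<Longrightarrow> g = h"
  shows "is_epi K e"
  using assms unfolding is_epi_def by auto

lemma terminal_eq:
  assumes "is_terminal K t" "f \<in> Ar K" "g \<in> Ar K" "Dom K f = Dom K g" "Cod K f = t" "Cod K g = t"
  shows "f = g"
  using assms unfolding is_terminal_def by (metis hom_iff Dom_Ob)

lemma product_iso:
  assumes P: "is_product K a b p q" and h: "h \<in> Ar K" "Cod K h = Dom K p"
    and k: "k \<in> Ar K" "Dom K k = Dom K p" "Cod K k = Dom K h"
    and hk: "h \<cdot> k = Ide K (Dom K p)" and kh: "k \<cdot> h = Ide K (Dom K h)"
  shows "is_product K a b (p \<cdot> h) (q \<cdot> h)"
proof -
  note A = is_product_Ar[OF P]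
  note hk' = cmp_eq_assoc1[OF hk] and kh' = cmp_eq_assoc1[OF kh]
  show ?thesis unfolding is_product_def
  proof (intro conjI ballI)
    fix x u v assume x: "x \<in> Ob K" and u: "u \<in> hom K x a" and v: "v \<in> hom K x b"
    let ?m = "pair K p q u v"
    note Q = pair_product[OF P, of u v]
    show "\<exists>!m. m \<in> hom K x (Dom K (p \<cdot> h)) \<and> (p \<cdot> h) \<cdot> m = u \<and> (q \<cdot> h) \<cdot> m = v"
    proof (rule ex1I[of _ "k \<cdot> ?m"])
      show "k \<cdot> ?m \<in> hom K x (Dom K (p \<cdot> h)) \<and> (p \<cdot> h) \<cdot> (k \<cdot> ?m) = u \<and> (q \<cdot> h) \<cdot> (k \<cdot> ?m) = v"
        using A h k u v Q by (simp add: hk')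
    next
      fix m assume m: "m \<in> hom K x (Dom K (p \<cdot> h)) \<and> (p \<cdot> h) \<cdot> m = u \<and> (q \<cdot> h) \<cdot> m = v"
      have "h \<cdot> m = ?m" by (rule product_ext[OF P]) (use A h k u v Q m in auto)
      then have "k \<cdot> (h \<cdot> m) = k \<cdot> ?m" by simp
      then show "m = k \<cdot> ?m" using A h k m by (simp add: kh')
    qed
  qed (use A h in auto)
qed

text \<open>Comparing a given product with one that is convenient to compute with; chosen products of
  internal categories are shown to be componentwise products in this way.\<close>

lemma product_unique:
  assumes P: "is_product K a b p q" and P': "is_product K a b p' q'"
  obtains h k where "h \<in> Ar K" "Dom K h = Dom K p'" "Cod K h = Dom K p"
    "k \<in> Ar K" "Dom K k = Dom K p" "Cod K k = Dom K p'"
    "h \<cdot> k = Ide K (Dom K p)" "k \<cdot> h = Ide K (Dom K p')" "p \<cdot> h = p'" "q \<cdot> h = q'"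
proof -
  note A = is_product_Ar[OF P] is_product_Ar[OF P']
  let ?h = "pair K p q p' q'" and ?k = "pair K p' q' p q"
  note Q = pair_product[OF P, of p' q'] and Q' = pair_product[OF P', of p q]
  show ?thesis
  proof (rule that[of ?h ?k])
    show "?h \<cdot> ?k = Ide K (Dom K p)"
      by (rule product_ext[OF P])
        (use A Q Q' in \<open>simp_all add: cmp_eq_assoc1[OF Q(4)] cmp_eq_assoc1[OF Q(5)]\<close>)
    show "?k \<cdot> ?h = Ide K (Dom K p')"
      by (rule product_ext[OF P'])
        (use A Q Q' in \<open>simp_all add: cmp_eq_assoc1[OF Q'(4)] cmp_eq_assoc1[OF Q'(5)]\<close>)
  qed (use A Q Q' in auto)
qed

end

locale cartesian = category +
  assumes ex_product: "a \<in> Ob K \<Longrightarrow> b \<in> Ob K \<Longrightarrow> \<exists>p q. is_product K a b p q"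
begin

lemma prod_pr: "a \<in> Ob K \<Longrightarrow> b \<in> Ob K \<Longrightarrow> is_product K a b (pr1 K a b) (pr2 K a b)"
proof -
  assume "a \<in> Ob K" "b \<in> Ob K"
  then obtain p q where pq: "is_product K a b p q" using ex_product by blast
  have "(\<lambda>(p, q). is_product K a b p q) (prod_pr K a b)" unfolding prod_pr_def
    by (rule someI[where P = "\<lambda>(p, q). is_product K a b p q" and x = "(p, q)"]) (simp add: pq)
  then show ?thesis by (simp add: pr1_def pr2_def case_prod_beta)
qed

lemma prod_simps [simp]:
  assumes "a \<in> Ob K" "b \<in> Ob K"
  shows "pr1 K a b \<in> Ar K" "pr2 K a b \<in> Ar K" "Dom K (pr1 K a b) = prod_ob K a b"
    "Dom K (pr2 K a b) = prod_ob K a b" "Cod K (pr1 K a b) = a" "Cod K (pr2 K a b) = b"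
    "prod_ob K a b \<in> Ob K"
  using is_product_Ar[OF prod_pr[OF assms]] by (auto simp: prod_ob_def)

lemma prod_pair_simps [simp]:
  assumes "u \<in> Ar K" "v \<in> Ar K" "Dom K u = Dom K v"
  shows "prod_pair K u v \<in> Ar K" "Dom K (prod_pair K u v) = Dom K v"
    "Cod K (prod_pair K u v) = prod_ob K (Cod K u) (Cod K v)"
  using pair_product[OF prod_pr, of "Cod K u" "Cod K v" u v] assms
  by (auto simp: prod_pair_def)

lemma pr_prod_pair [simp]:
  assumes "u \<in> Ar K" "v \<in> Ar K" "Dom K u = Dom K v" "Cod K u = a" "Cod K v = b"
  shows "pr1 K a b \<cdot> prod_pair K u v = u" "pr2 K a b \<cdot> prod_pair K u v = v"
  using pair_product[OF prod_pr, of "Cod K u" "Cod K v" u v] assms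
  by (auto simp: prod_pair_def)

lemma pr_prod_pair_assoc [simp]:
  assumes "u \<in> Ar K" "v \<in> Ar K" "Dom K u = Dom K v" "Cod K u = a" "Cod K v = b"
    "h \<in> Ar K" "Cod K h = Dom K v"
  shows "pr1 K a b \<cdot> (prod_pair K u v \<cdot> h) = u \<cdot> h" "pr2 K a b \<cdot> (prod_pair K u v \<cdot> h) = v \<cdot> h"
proof -
  show "pr1 K a b \<cdot> (prod_pair K u v \<cdot> h) = u \<cdot> h" by (rule cmp_eq_assoc1) (use assms Cod_Ob[of u] Cod_Ob[of v] in simp_all)
  show "pr2 K a b \<cdot> (prod_pair K u v \<cdot> h) = v \<cdot> h" by (rule cmp_eq_assoc1) (use assms Cod_Ob[of u] Cod_Ob[of v] in simp_all)
qed

lemma prod_ext: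
  assumes "h \<in> Ar K" "k \<in> Ar K" "Dom K h = Dom K k" "Cod K h = prod_ob K a b"
    "Cod K k = prod_ob K a b" "a \<in> Ob K" "b \<in> Ob K"
    "pr1 K a b \<cdot> h = pr1 K a b \<cdot> k" "pr2 K a b \<cdot> h = pr2 K a b \<cdot> k"
  shows "h = k"
  using product_ext[OF prod_pr, of a b h k] assms by simp

lemma prod_pair_cmp [simp]:
  assumes "u \<in> Ar K" "v \<in> Ar K" "Dom K u = Dom K v" "h \<in> Ar K" "Cod K h = Dom K v"
  shows "prod_pair K u v \<cdot> h = prod_pair K (u \<cdot> h) (v \<cdot> h)"
  by (rule prod_ext[of _ _ "Cod K u" "Cod K v"]) (use assms in simp_all)

lemma prod_pair_pr [simp]:
  "a \<in> Ob K \<Longrightarrow> b \<in> Ob K \<Longrightarrow> prod_pair K (pr1 K a b) (pr2 K a b) = Ide K (prod_ob K a b)"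
  by (rule prod_ext[of _ _ a b]) simp_all

lemma prod_pair_eta [simp]:
  assumes "h \<in> Ar K" "Cod K h = prod_ob K a b" "a \<in> Ob K" "b \<in> Ob K"
  shows "prod_pair K (pr1 K a b \<cdot> h) (pr2 K a b \<cdot> h) = h"
  by (rule prod_ext[of _ _ a b]) (use assms in simp_all)

lemma prod_pair_eq_iff [simp]:
  assumes "u \<in> Ar K" "v \<in> Ar K" "u' \<in> Ar K" "v' \<in> Ar K" "Dom K u = Dom K v" "Dom K u' = Dom K v'"
    "Cod K u = Cod K u'" "Cod K v = Cod K v'"
  shows "prod_pair K u v = prod_pair K u' v' \<longleftrightarrow> u = u' \<and> v = v'"
proof
  assume e: "prod_pair K u v = prod_pair K u' v'"
  have "pr1 K (Cod K u) (Cod K v) \<cdot> prod_pair K u v = pr1 K (Cod K u) (Cod K v) \<cdot> prod_pair K u' v'"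
    "pr2 K (Cod K u) (Cod K v) \<cdot> prod_pair K u v = pr2 K (Cod K u) (Cod K v) \<cdot> prod_pair K u' v'"
    by (simp_all only: e)
  then show "u = u' \<and> v = v'" using assms by simp
qed simp

lemma prod_ar_simps [simp]:
  assumes "f \<in> Ar K" "g \<in> Ar K"
  shows "prod_ar K f g \<in> Ar K" "Dom K (prod_ar K f g) = prod_ob K (Dom K f) (Dom K g)"
    "Cod K (prod_ar K f g) = prod_ob K (Cod K f) (Cod K g)"
  using assms by (auto simp: prod_ar_def)

lemma prod_ar_pair [simp]:
  assumes "f \<in> Ar K" "g \<in> Ar K" "u \<in> Ar K" "v \<in> Ar K" "Dom K u = Dom K v"
    "Cod K u = Dom K f" "Cod K v = Dom K g"
  shows "prod_ar K f g \<cdot> prod_pair K u v = prod_pair K (f \<cdot> u) (g \<cdot> v)"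
  using assms by (simp add: prod_ar_def)

lemma prod_ar_Ide [simp]:
  "a \<in> Ob K \<Longrightarrow> b \<in> Ob K \<Longrightarrow> prod_ar K (Ide K a) (Ide K b) = Ide K (prod_ob K a b)"
  by (simp add: prod_ar_def)

lemma prod_ar_cmp [simp]:
  assumes "f \<in> Ar K" "g \<in> Ar K" "f' \<in> Ar K" "g' \<in> Ar K" "Dom K f = Cod K f'" "Dom K g = Cod K g'"
  shows "prod_ar K f g \<cdot> prod_ar K f' g' = prod_ar K (f \<cdot> f') (g \<cdot> g')"
  using assms by (simp add: prod_ar_def)

lemma prod_ar_cmp_assoc [simp]:
  assumes "f \<in> Ar K" "g \<in> Ar K" "f' \<in> Ar K" "g' \<in> Ar K" "Dom K f = Cod K f'" "Dom K g = Cod K g'"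
    "h \<in> Ar K" "Cod K h = prod_ob K (Dom K f') (Dom K g')"
  shows "prod_ar K f g \<cdot> (prod_ar K f' g' \<cdot> h) = prod_ar K (f \<cdot> f') (g \<cdot> g') \<cdot> h"
  using assms by (intro cmp_eq_assoc1) auto

lemma pr_prod_ar [simp]:
  assumes "f \<in> Ar K" "g \<in> Ar K" "Cod K f = a" "Cod K g = b"
  shows "pr1 K a b \<cdot> prod_ar K f g = f \<cdot> pr1 K (Dom K f) (Dom K g)"
    "pr2 K a b \<cdot> prod_ar K f g = g \<cdot> pr2 K (Dom K f) (Dom K g)"
  using assms by (simp_all add: prod_ar_def)

lemma pr_prod_ar_assoc [simp]:
  assumes "f \<in> Ar K" "g \<in> Ar K" "Cod K f = a" "Cod K g = b"
    "h \<in> Ar K" "Cod K h = prod_ob K (Dom K f) (Dom K g)"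
  shows "pr1 K a b \<cdot> (prod_ar K f g \<cdot> h) = f \<cdot> (pr1 K (Dom K f) (Dom K g) \<cdot> h)"
    "pr2 K a b \<cdot> (prod_ar K f g \<cdot> h) = g \<cdot> (pr2 K (Dom K f) (Dom K g) \<cdot> h)"
proof -
  show "pr1 K a b \<cdot> (prod_ar K f g \<cdot> h) = f \<cdot> (pr1 K (Dom K f) (Dom K g) \<cdot> h)"
    by (rule cmp_eq_assoc) (use assms Cod_Ob[of f] Cod_Ob[of g] in simp_all)
  show "pr2 K a b \<cdot> (prod_ar K f g \<cdot> h) = g \<cdot> (pr2 K (Dom K f) (Dom K g) \<cdot> h)"
    by (rule cmp_eq_assoc) (use assms Cod_Ob[of f] Cod_Ob[of g] in simp_all)
qed

end

section \<open>Cartesian closed categories and orthogonality\<close>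

locale ccc = cartesian +
  assumes ex_exp: "a \<in> Ob K \<Longrightarrow> b \<in> Ob K \<Longrightarrow> \<exists>e ev. is_exponential K a b e ev"
begin

lemma exponential: "a \<in> Ob K \<Longrightarrow> b \<in> Ob K \<Longrightarrow> is_exponential K a b (exp_ob K a b) (exp_ev K a b)"
proof -
  assume "a \<in> Ob K" "b \<in> Ob K"
  then obtain e ev where ev: "is_exponential K a b e ev" using ex_exp by blast
  have "(\<lambda>(e, ev). is_exponential K a b e ev) (exponential K a b)" unfolding exponential_def
    by (rule someI[where P = "\<lambda>(e, ev). is_exponential K a b e ev" and x = "(e, ev)"]) (simp add: ev)
  then show ?thesis by (simp add: exp_ob_def exp_ev_def case_prod_beta)
qed

lemma exp_simps [simp]:
  assumes "a \<in> Ob K" "b \<in> Ob K"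
  shows "exp_ob K a b \<in> Ob K" "exp_ev K a b \<in> Ar K"
    "Dom K (exp_ev K a b) = prod_ob K (exp_ob K a b) a" "Cod K (exp_ev K a b) = b"
  using exponential[OF assms] by (auto simp: is_exponential_def)

definition uncurry :: "'a \<Rightarrow> 'a \<Rightarrow> 'b \<Rightarrow> 'b" where
  "uncurry a b g = exp_ev K a b \<cdot> prod_ar K g (Ide K a)"

lemma uncurry_simps [simp]:
  assumes "a \<in> Ob K" "b \<in> Ob K" "g \<in> Ar K" "Cod K g = exp_ob K a b"
  shows "uncurry a b g \<in> Ar K" "Dom K (uncurry a b g) = prod_ob K (Dom K g) a"
    "Cod K (uncurry a b g) = b"
  using assms by (auto simp: uncurry_def)

lemma uncurry_cmp:
  assumes "a \<in> Ob K" "b \<in> Ob K" "g \<in> Ar K" "Cod K g = exp_ob K a b" "h \<in> Ar K" "Cod K h = Dom K g"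
  shows "uncurry a b (g \<cdot> h) = uncurry a b g \<cdot> prod_ar K h (Ide K a)"
  using assms by (simp add: uncurry_def)

lemma curry_simps [simp]:
  assumes "a \<in> Ob K" "b \<in> Ob K" "x \<in> Ob K" "f \<in> Ar K" "Dom K f = prod_ob K x a" "Cod K f = b"
  shows "curry_ar K x a b f \<in> Ar K" "Dom K (curry_ar K x a b f) = x"
    "Cod K (curry_ar K x a b f) = exp_ob K a b" "uncurry a b (curry_ar K x a b f) = f"
proof -
  have "\<exists>!g. g \<in> hom K x (exp_ob K a b) \<and> exp_ev K a b \<cdot> prod_ar K g (Ide K a) = f"
    using exponential[of a b] assms unfolding is_exponential_def by simp
  from theI'[OF this] show "curry_ar K x a b f \<in> Ar K" "Dom K (curry_ar K x a b f) = x"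
    "Cod K (curry_ar K x a b f) = exp_ob K a b" "uncurry a b (curry_ar K x a b f) = f"
    by (auto simp: curry_ar_def uncurry_def)
qed

lemma uncurry_inj:
  assumes "uncurry a b g = uncurry a b h" "a \<in> Ob K" "b \<in> Ob K" "g \<in> Ar K" "h \<in> Ar K"
    "Cod K g = exp_ob K a b" "Cod K h = exp_ob K a b" "Dom K g = Dom K h"
  shows "g = h"
proof -
  have "\<exists>!k. k \<in> hom K (Dom K g) (exp_ob K a b) \<and> exp_ev K a b \<cdot> prod_ar K k (Ide K a) = uncurry a b g"
    using exponential[of a b] assms unfolding is_exponential_def by simp
  then show ?thesis using assms unfolding uncurry_def by auto
qed

lemma exp_post_simps [simp]:
  assumes "a \<in> Ob K" "r \<in> Ar K"
  shows "exp_post K a r \<in> Ar K" "Dom K (exp_post K a r) = exp_ob K a (Dom K r)"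
    "Cod K (exp_post K a r) = exp_ob K a (Cod K r)"
  using assms by (auto simp: exp_post_def)

lemma exp_pre_simps [simp]:
  assumes "x \<in> Ob K" "k \<in> Ar K"
  shows "exp_pre K k x \<in> Ar K" "Dom K (exp_pre K k x) = exp_ob K (Cod K k) x"
    "Cod K (exp_pre K k x) = exp_ob K (Dom K k) x"
  using assms by (auto simp: exp_pre_def)

lemma uncurry_exp_post:
  assumes "a \<in> Ob K" "r \<in> Ar K" "g \<in> Ar K" "Cod K g = exp_ob K a (Dom K r)"
  shows "uncurry a (Cod K r) (exp_post K a r \<cdot> g) = r \<cdot> uncurry a (Dom K r) g"
proof -
  have "uncurry a (Cod K r) (exp_post K a r) = r \<cdot> exp_ev K a (Dom K r)"
    using assms by (simp add: exp_post_def)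
  then show ?thesis using assms by (simp add: uncurry_cmp) (simp add: uncurry_def)
qed

lemma uncurry_exp_pre:
  assumes "x \<in> Ob K" "k \<in> Ar K" "g \<in> Ar K" "Cod K g = exp_ob K (Cod K k) x"
  shows "uncurry (Dom K k) x (exp_pre K k x \<cdot> g)
    = uncurry (Cod K k) x g \<cdot> prod_ar K (Ide K (Dom K g)) k"
proof -
  have "uncurry (Dom K k) x (exp_pre K k x)
      = exp_ev K (Cod K k) x \<cdot> prod_ar K (Ide K (exp_ob K (Cod K k) x)) k"
    using assms by (simp add: exp_pre_def)
  then show ?thesis using assms by (simp add: uncurry_cmp) (simp add: uncurry_def)
qed

end

text \<open>Unique right lifting of \<open>r\<close> against \<open>b\<close>: the external counterpart of the pullback square of
  exponentials that defines the two classes.\<close>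

definition ortho :: "('o, 'a) cat \<Rightarrow> 'a \<Rightarrow> 'a \<Rightarrow> bool" where
  "ortho K b r \<longleftrightarrow>
     (\<forall>u v. u \<in> hom K (Dom K b) (Dom K r) \<and> v \<in> hom K (Cod K b) (Cod K r) \<and>
        r \<cdot>\<^bsub>K\<^esub> u = v \<cdot>\<^bsub>K\<^esub> b \<longrightarrow>
        (\<exists>!d. d \<in> hom K (Cod K b) (Dom K r) \<and> d \<cdot>\<^bsub>K\<^esub> b = u \<and> r \<cdot>\<^bsub>K\<^esub> d = v))"

lemma orthoI:
  assumes "\<And>u v. u \<in> Ar K \<Longrightarrow> Dom K u = Dom K b \<Longrightarrow> Cod K u = Dom K r \<Longrightarrow>
      v \<in> Ar K \<Longrightarrow> Dom K v = Cod K b \<Longrightarrow> Cod K v = Cod K r \<Longrightarrow>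
      r \<cdot>\<^bsub>K\<^esub> u = v \<cdot>\<^bsub>K\<^esub> b \<Longrightarrow>
      \<exists>d. d \<in> hom K (Cod K b) (Dom K r) \<and> d \<cdot>\<^bsub>K\<^esub> b = u \<and> r \<cdot>\<^bsub>K\<^esub> d = v"
    and "\<And>d d'. d \<in> Ar K \<Longrightarrow> Dom K d = Cod K b \<Longrightarrow> Cod K d = Dom K r \<Longrightarrow>
      d' \<in> Ar K \<Longrightarrow> Dom K d' = Cod K b \<Longrightarrow> Cod K d' = Dom K r \<Longrightarrow>
      d \<cdot>\<^bsub>K\<^esub> b = d' \<cdot>\<^bsub>K\<^esub> b \<Longrightarrow> r \<cdot>\<^bsub>K\<^esub> d = r \<cdot>\<^bsub>K\<^esub> d' \<Longrightarrow> d = d'"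
  shows "ortho K b r"
  unfolding ortho_def
proof (intro allI impI)
  fix u v
  assume *: "u \<in> hom K (Dom K b) (Dom K r) \<and> v \<in> hom K (Cod K b) (Cod K r) \<and>
    r \<cdot>\<^bsub>K\<^esub> u = v \<cdot>\<^bsub>K\<^esub> b"
  then obtain d where d: "d \<in> hom K (Cod K b) (Dom K r) \<and> d \<cdot>\<^bsub>K\<^esub> b = u \<and> r \<cdot>\<^bsub>K\<^esub> d = v"
    using assms(1)[of u v] by auto
  show "\<exists>!d. d \<in> hom K (Cod K b) (Dom K r) \<and> d \<cdot>\<^bsub>K\<^esub> b = u \<and> r \<cdot>\<^bsub>K\<^esub> d = v"
    by (rule ex1I[of _ d]) (use d assms(2) in auto)
qed

lemma ortho_ex:
  assumes "ortho K b r" "u \<in> Ar K" "Dom K u = Dom K b" "Cod K u = Dom K r"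
      "v \<in> Ar K" "Dom K v = Cod K b" "Cod K v = Cod K r" "r \<cdot>\<^bsub>K\<^esub> u = v \<cdot>\<^bsub>K\<^esub> b"
  obtains d where "d \<in> Ar K" "Dom K d = Cod K b" "Cod K d = Dom K r"
    "d \<cdot>\<^bsub>K\<^esub> b = u" "r \<cdot>\<^bsub>K\<^esub> d = v"
proof -
  have "\<exists>!d. d \<in> hom K (Cod K b) (Dom K r) \<and> d \<cdot>\<^bsub>K\<^esub> b = u \<and> r \<cdot>\<^bsub>K\<^esub> d = v"
    using assms unfolding ortho_def by simp
  then show ?thesis using that by auto
qed

lemma (in category) ortho_eq:
  assumes "ortho K b r" "b \<in> Ar K" "r \<in> Ar K" "d \<in> Ar K" "Dom K d = Cod K b" "Cod K d = Dom K r"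
      "d' \<in> Ar K" "Dom K d' = Cod K b" "Cod K d' = Dom K r" "d \<cdot> b = d' \<cdot> b" "r \<cdot> d = r \<cdot> d'"
  shows "d = d'"
proof -
  have "r \<cdot> (d \<cdot> b) = (r \<cdot> d) \<cdot> b" using assms(2-9) by simp
  then have "\<exists>!e. e \<in> hom K (Cod K b) (Dom K r) \<and> e \<cdot> b = d \<cdot> b \<and> r \<cdot> e = r \<cdot> d"
    using assms unfolding ortho_def by simp
  then show ?thesis using assms by auto
qed

lemma (in category) ortho_cmp:
  assumes b: "ortho K b r" and c: "ortho K c r"
    and A: "b \<in> Ar K" "c \<in> Ar K" "r \<in> Ar K" "Cod K b = Dom K c"
  shows "ortho K (c \<cdot> b) r"
proof (rule orthoI)
  fix u v assume *: "u \<in> Ar K" "Dom K u = Dom K (c \<cdot> b)" "Cod K u = Dom K r"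
      "v \<in> Ar K" "Dom K v = Cod K (c \<cdot> b)" "Cod K v = Cod K r" "r \<cdot> u = v \<cdot> (c \<cdot> b)"
  obtain d where d: "d \<in> Ar K" "Dom K d = Cod K b" "Cod K d = Dom K r" "d \<cdot> b = u" "r \<cdot> d = v \<cdot> c"
    by (rule ortho_ex[OF b, of u "v \<cdot> c"]) (use * A in auto)
  obtain f where f: "f \<in> Ar K" "Dom K f = Cod K c" "Cod K f = Dom K r" "f \<cdot> c = d" "r \<cdot> f = v"
    by (rule ortho_ex[OF c, of d v]) (use * A d in auto)
  have "f \<cdot> (c \<cdot> b) = (f \<cdot> c) \<cdot> b" using f(1-3) A by simp
  then show "\<exists>d. d \<in> hom K (Cod K (c \<cdot> b)) (Dom K r) \<and> d \<cdot> (c \<cdot> b) = u \<and> r \<cdot> d = v"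
    using f d A by auto
next
  fix d d' assume *: "d \<in> Ar K" "Dom K d = Cod K (c \<cdot> b)" "Cod K d = Dom K r"
      "d' \<in> Ar K" "Dom K d' = Cod K (c \<cdot> b)" "Cod K d' = Dom K r"
      "d \<cdot> (c \<cdot> b) = d' \<cdot> (c \<cdot> b)" "r \<cdot> d = r \<cdot> d'"
  have rd: "r \<cdot> (d \<cdot> c) = r \<cdot> (d' \<cdot> c)" by (rule cmp_eq_assoc) (use * A in simp_all)
  have "d \<cdot> c = d' \<cdot> c"
    by (rule ortho_eq[OF b]) (use *(1-7) A rd in simp_all)
  then show "d = d'" using ortho_eq[OF c] * A by auto
qed

lemma (in category) ortho_iso:
  assumes c: "ortho K c r"
    and A: "b \<in> Ar K" "c \<in> Ar K" "r \<in> Ar K"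
    and h: "h \<in> Ar K" "Dom K h = Dom K b" "Cod K h = Dom K c"
    and h': "h' \<in> Ar K" "Dom K h' = Dom K c" "Cod K h' = Dom K b"
    and k: "k \<in> Ar K" "Dom K k = Cod K b" "Cod K k = Cod K c"
    and k': "k' \<in> Ar K" "Dom K k' = Cod K c" "Cod K k' = Cod K b"
    and hh: "h' \<cdot> h = Ide K (Dom K b)" and kk: "k \<cdot> k' = Ide K (Cod K c)"
      and kk': "k' \<cdot> k = Ide K (Cod K b)"
    and e: "c \<cdot> h = k \<cdot> b" and e': "b \<cdot> h' = k' \<cdot> c"
  shows "ortho K b r"
proof (rule orthoI)
  fix u v assume *: "u \<in> Ar K" "Dom K u = Dom K b" "Cod K u = Dom K r"
      "v \<in> Ar K" "Dom K v = Cod K b" "Cod K v = Cod K r" "r \<cdot> u = v \<cdot> b"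
  have ru: "r \<cdot> (u \<cdot> h') = v \<cdot> (b \<cdot> h')" by (rule cmp_eq_assoc) (use * A h' in auto)
  obtain d where d: "d \<in> Ar K" "Dom K d = Cod K c" "Cod K d = Dom K r" "d \<cdot> c = u \<cdot> h'" "r \<cdot> d = v \<cdot> k'"
    by (rule ortho_ex[OF c, of "u \<cdot> h'" "v \<cdot> k'"])
      (use * A k' h' in \<open>auto simp: ru e'\<close>)
  show "\<exists>d. d \<in> hom K (Cod K b) (Dom K r) \<and> d \<cdot> b = u \<and> r \<cdot> d = v"
  proof (intro exI[of _ "d \<cdot> k"] conjI)
    show "d \<cdot> k \<in> hom K (Cod K b) (Dom K r)" using d k A by simp
    have "d \<cdot> (c \<cdot> h) = u \<cdot> (h' \<cdot> h)" by (rule cmp_eq_assoc) (use d * A h h' in auto)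
    then show "(d \<cdot> k) \<cdot> b = u" using d k A * by (simp add: e hh)
    have "r \<cdot> (d \<cdot> k) = v \<cdot> (k' \<cdot> k)" by (rule cmp_eq_assoc) (use d * A k k' in auto)
    then show "r \<cdot> (d \<cdot> k) = v" using * by (simp add: kk')
  qed
next
  fix d d' assume *: "d \<in> Ar K" "Dom K d = Cod K b" "Cod K d = Dom K r"
      "d' \<in> Ar K" "Dom K d' = Cod K b" "Cod K d' = Dom K r"
      "d \<cdot> b = d' \<cdot> b" "r \<cdot> d = r \<cdot> d'"
  have 1: "d \<cdot> (b \<cdot> h') = d' \<cdot> (b \<cdot> h')" and 2: "r \<cdot> (d \<cdot> k') = r \<cdot> (d' \<cdot> k')"
    by (rule cmp_eq_assoc; use * A h' k' in auto)+
  have "d \<cdot> k' = d' \<cdot> k'"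
    by (rule ortho_eq[OF c]) (use * A k' 1 2 in \<open>auto simp: e'\<close>)
  then have "d \<cdot> (k' \<cdot> k) = d' \<cdot> (k' \<cdot> k)"
    by (rule cmp_eq_assoc) (use * k k' in auto)
  then show "d = d'" using * by (simp add: kk')
qed

context ccc
begin

text \<open>Arrows \<open>z \<rightarrow> x\<^sup>b\<close> are arrows \<open>z \<times> b \<rightarrow> x\<close>. So the universal property of the pullback, tested
  on \<open>z\<close>, is unique lifting against \<open>z \<times> k\<close>.\<close>

lemma exp_square_pullback_iff:
  assumes k: "k \<in> Ar K" and r: "r \<in> Ar K"
  shows "exp_square_pullback K k r \<longleftrightarrow> (\<forall>z\<in>Ob K. ortho K (prod_ar K (Ide K z) k) r)"
proof
  let ?a = "Dom K k" and ?b = "Cod K k" and ?x = "Dom K r" and ?y = "Cod K r"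
  assume P: "exp_square_pullback K k r"
  show "\<forall>z\<in>Ob K. ortho K (prod_ar K (Ide K z) k) r"
  proof (intro ballI orthoI)
    fix z u v
    assume z: "z \<in> Ob K" and *: "u \<in> Ar K" "Dom K u = Dom K (prod_ar K (Ide K z) k)" "Cod K u = ?x"
      "v \<in> Ar K" "Dom K v = Cod K (prod_ar K (Ide K z) k)" "Cod K v = ?y"
      "r \<cdot> u = v \<cdot> prod_ar K (Ide K z) k"
    let ?u = "curry_ar K z ?a ?x u" and ?v = "curry_ar K z ?b ?y v"
    have "exp_post K ?a r \<cdot> ?u = exp_pre K k ?y \<cdot> ?v"
      by (rule uncurry_inj[of ?a ?y]) (use z k r * in \<open>simp_all add: uncurry_exp_post uncurry_exp_pre\<close>)
    then obtain h where h: "h \<in> hom K z (exp_ob K ?b ?x)" "exp_pre K k ?x \<cdot> h = ?u"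
        "exp_post K ?b r \<cdot> h = ?v"
      using pair_pullback[OF P[unfolded exp_square_pullback_def], of ?u ?v] z k r *
      by (intro that[of "pair K (exp_pre K k ?x) (exp_post K ?b r) ?u ?v"]) simp_all
    show "\<exists>d. d \<in> hom K (Cod K (prod_ar K (Ide K z) k)) ?x \<and> d \<cdot> prod_ar K (Ide K z) k = u \<and> r \<cdot> d = v"
    proof (intro exI[of _ "uncurry ?b ?x h"] conjI)
      show "uncurry ?b ?x h \<cdot> prod_ar K (Ide K z) k = u"
        using uncurry_exp_pre[of ?x k h] h z k r * by simp
      show "r \<cdot> uncurry ?b ?x h = v"
        using uncurry_exp_post[of ?b r h] h z k r * by simp
    qed (use h z k r in simp)
  next
    fix z d d'
    assume z: "z \<in> Ob K" and *: "d \<in> Ar K" "Dom K d = Cod K (prod_ar K (Ide K z) k)" "Cod K d = ?x"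
      "d' \<in> Ar K" "Dom K d' = Cod K (prod_ar K (Ide K z) k)" "Cod K d' = ?x"
      "d \<cdot> prod_ar K (Ide K z) k = d' \<cdot> prod_ar K (Ide K z) k" "r \<cdot> d = r \<cdot> d'"
    let ?d = "curry_ar K z ?b ?x d" and ?d' = "curry_ar K z ?b ?x d'"
    have 1: "exp_pre K k ?x \<cdot> ?d = exp_pre K k ?x \<cdot> ?d'"
      by (rule uncurry_inj[of ?a ?x]) (use z k r * in \<open>simp_all add: uncurry_exp_pre\<close>)
    have 2: "exp_post K ?b r \<cdot> ?d = exp_post K ?b r \<cdot> ?d'"
      by (rule uncurry_inj[of ?b ?y]) (use z k r * in \<open>simp_all add: uncurry_exp_post\<close>)
    have "?d = ?d'"
      by (rule pullback_ext[OF P[unfolded exp_square_pullback_def]]) (use 1 2 z k r * in simp_all)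
    then have "uncurry ?b ?x ?d = uncurry ?b ?x ?d'" by simp
    then show "d = d'" using z k r * by simp
  qed
next
  let ?a = "Dom K k" and ?b = "Cod K k" and ?x = "Dom K r" and ?y = "Cod K r"
  assume O: "\<forall>z\<in>Ob K. ortho K (prod_ar K (Ide K z) k) r"
  show "exp_square_pullback K k r"
    unfolding exp_square_pullback_def is_pullback_def
  proof (intro conjI ballI impI)
    show "exp_post K ?a r \<cdot> exp_pre K k ?x = exp_pre K k ?y \<cdot> exp_post K ?b r"
    proof (rule uncurry_inj[of ?a ?y])
      let ?e = "exp_ob K ?b ?x"
      have "uncurry ?a ?x (exp_pre K k ?x) = uncurry ?b ?x (Ide K ?e) \<cdot> prod_ar K (Ide K ?e) k"
        using uncurry_exp_pre[of ?x k "Ide K ?e"] k r by simp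
      moreover have "uncurry ?b ?y (exp_post K ?b r) = r \<cdot> uncurry ?b ?x (Ide K ?e)"
        using uncurry_exp_post[of ?b r "Ide K ?e"] k r by simp
      ultimately show "uncurry ?a ?y (exp_post K ?a r \<cdot> exp_pre K k ?x)
          = uncurry ?a ?y (exp_pre K k ?y \<cdot> exp_post K ?b r)"
        using k r by (simp add: uncurry_exp_post uncurry_exp_pre)
    qed (use k r in simp_all)
    fix z u v
    assume z: "z \<in> Ob K" and u: "u \<in> hom K z (Dom K (exp_post K ?a r))"
      and v: "v \<in> hom K z (Dom K (exp_pre K k ?y))" and e: "exp_post K ?a r \<cdot> u = exp_pre K k ?y \<cdot> v"
    let ?m = "prod_ar K (Ide K z) k"
    from e have "uncurry ?a ?y (exp_post K ?a r \<cdot> u) = uncurry ?a ?y (exp_pre K k ?y \<cdot> v)" by simp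
    then have e': "r \<cdot> uncurry ?a ?x u = uncurry ?b ?y v \<cdot> ?m"
      using u v z k r by (simp add: uncurry_exp_post uncurry_exp_pre)
    from O z have o: "ortho K ?m r" by blast
    obtain d where d: "d \<in> Ar K" "Dom K d = Cod K ?m" "Cod K d = ?x" "d \<cdot> ?m = uncurry ?a ?x u"
        "r \<cdot> d = uncurry ?b ?y v"
      by (rule ortho_ex[OF o, of "uncurry ?a ?x u" "uncurry ?b ?y v"]) (use u v z k r e' in simp_all)
    show "\<exists>!h. h \<in> hom K z (Dom K (exp_pre K k ?x)) \<and> exp_pre K k ?x \<cdot> h = u \<and> exp_post K ?b r \<cdot> h = v"
    proof (rule ex1I[of _ "curry_ar K z ?b ?x d"])
      have "exp_pre K k ?x \<cdot> curry_ar K z ?b ?x d = u"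
        by (rule uncurry_inj[of ?a ?x]) (use u z k r d in \<open>simp_all add: uncurry_exp_pre\<close>)
      moreover have "exp_post K ?b r \<cdot> curry_ar K z ?b ?x d = v"
        by (rule uncurry_inj[of ?b ?y]) (use v z k r d in \<open>simp_all add: uncurry_exp_post\<close>)
      ultimately show "curry_ar K z ?b ?x d \<in> hom K z (Dom K (exp_pre K k ?x)) \<and>
          exp_pre K k ?x \<cdot> curry_ar K z ?b ?x d = u \<and> exp_post K ?b r \<cdot> curry_ar K z ?b ?x d = v"
        using z k r d by simp
    next
      fix h assume h: "h \<in> hom K z (Dom K (exp_pre K k ?x)) \<and> exp_pre K k ?x \<cdot> h = u \<and> exp_post K ?b r \<cdot> h = v"
      have hu: "uncurry ?a ?x u = uncurry ?b ?x h \<cdot> ?m" using uncurry_exp_pre[of ?x k h] h k r by auto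
      have hv: "uncurry ?b ?y v = r \<cdot> uncurry ?b ?x h" using uncurry_exp_post[of ?b r h] h k r by auto
      have hd: "uncurry ?b ?x h = d"
        by (rule ortho_eq[OF o]) (use z k r d(1-3) h in \<open>simp_all add: d(4,5) hu hv\<close>)
      show "h = curry_ar K z ?b ?x d"
        by (rule uncurry_inj[of ?b ?x]) (use z k r d(1-3) h hd in simp_all)
    qed
  qed (use k r in simp_all)
qed

text \<open>Transposition along the adjunction between \<open>(-) \<times> z\<close> and \<open>(-)\<^sup>z\<close> matches the lifting
  problems on the two sides.\<close>

lemma ortho_exp_post:
  assumes k: "k \<in> Ar K" and r: "r \<in> Ar K" and z: "z \<in> Ob K"
  shows "ortho K k (exp_post K z r) \<longleftrightarrow> ortho K (prod_ar K k (Ide K z)) r"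
proof
  let ?x = "Dom K r" and ?y = "Cod K r" and ?m = "prod_ar K k (Ide K z)" and ?a = "Dom K k" and ?b = "Cod K k"
  assume o: "ortho K k (exp_post K z r)"
  show "ortho K ?m r"
  proof (rule orthoI)
    fix u v assume *: "u \<in> Ar K" "Dom K u = Dom K ?m" "Cod K u = ?x"
      "v \<in> Ar K" "Dom K v = Cod K ?m" "Cod K v = ?y" "r \<cdot> u = v \<cdot> ?m"
    have e: "exp_post K z r \<cdot> curry_ar K ?a z ?x u = curry_ar K ?b z ?y v \<cdot> k"
      by (rule uncurry_inj[of z ?y])
        (use k r z * in \<open>simp_all add: uncurry_exp_post uncurry_cmp[of z ?y "curry_ar K ?b z ?y v" k]\<close>)
    obtain d where d: "d \<in> Ar K" "Dom K d = ?b" "Cod K d = exp_ob K z ?x"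
        "d \<cdot> k = curry_ar K ?a z ?x u" "exp_post K z r \<cdot> d = curry_ar K ?b z ?y v"
      by (rule ortho_ex[OF o _ _ _ _ _ _ e]) (use k r z * in simp_all)
    show "\<exists>d. d \<in> hom K (Cod K ?m) ?x \<and> d \<cdot> ?m = u \<and> r \<cdot> d = v"
      by (intro exI[of _ "uncurry z ?x d"])
        (use d k r z * uncurry_cmp[of z ?x d k] uncurry_exp_post[of z r d] in simp)
  next
    fix d d' assume *: "d \<in> Ar K" "Dom K d = Cod K ?m" "Cod K d = ?x"
      "d' \<in> Ar K" "Dom K d' = Cod K ?m" "Cod K d' = ?x" "d \<cdot> ?m = d' \<cdot> ?m" "r \<cdot> d = r \<cdot> d'"
    let ?d = "curry_ar K ?b z ?x d" and ?d' = "curry_ar K ?b z ?x d'"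
    have 1: "?d \<cdot> k = ?d' \<cdot> k"
      by (rule uncurry_inj[of z ?x]) (use k r z * in \<open>simp_all add: uncurry_cmp\<close>)
    have 2: "exp_post K z r \<cdot> ?d = exp_post K z r \<cdot> ?d'"
      by (rule uncurry_inj[of z ?y]) (use k r z * in \<open>simp_all add: uncurry_exp_post\<close>)
    have "?d = ?d'" by (rule ortho_eq[OF o]) (use 1 2 k r z * in simp_all)
    then have "uncurry z ?x ?d = uncurry z ?x ?d'" by simp
    then show "d = d'" using z k r * by simp
  qed
next
  let ?x = "Dom K r" and ?y = "Cod K r" and ?m = "prod_ar K k (Ide K z)" and ?a = "Dom K k" and ?b = "Cod K k"
  assume o: "ortho K ?m r"
  show "ortho K k (exp_post K z r)"
  proof (rule orthoI)
    fix u v assume *: "u \<in> Ar K" "Dom K u = ?a" "Cod K u = Dom K (exp_post K z r)"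
      "v \<in> Ar K" "Dom K v = ?b" "Cod K v = Cod K (exp_post K z r)" "exp_post K z r \<cdot> u = v \<cdot> k"
    have e: "r \<cdot> uncurry z ?x u = uncurry z ?y v \<cdot> ?m"
      using uncurry_exp_post[of z r u] uncurry_cmp[of z ?y v k] k r z * by simp
    obtain d where d: "d \<in> Ar K" "Dom K d = Cod K ?m" "Cod K d = ?x"
        "d \<cdot> ?m = uncurry z ?x u" "r \<cdot> d = uncurry z ?y v"
      by (rule ortho_ex[OF o _ _ _ _ _ _ e]) (use k r z * in simp_all)
    have 1: "curry_ar K ?b z ?x d \<cdot> k = u"
      by (rule uncurry_inj[of z ?x]) (use k r z * d in \<open>simp_all add: uncurry_cmp\<close>)
    have 2: "exp_post K z r \<cdot> curry_ar K ?b z ?x d = v"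
      by (rule uncurry_inj[of z ?y]) (use k r z * d in \<open>simp_all add: uncurry_exp_post\<close>)
    show "\<exists>d. d \<in> hom K ?b (Dom K (exp_post K z r)) \<and> d \<cdot> k = u \<and> exp_post K z r \<cdot> d = v"
      by (intro exI[of _ "curry_ar K ?b z ?x d"]) (use 1 2 d k r z in simp)
  next
    fix d d' assume *: "d \<in> Ar K" "Dom K d = ?b" "Cod K d = Dom K (exp_post K z r)"
      "d' \<in> Ar K" "Dom K d' = ?b" "Cod K d' = Dom K (exp_post K z r)"
      "d \<cdot> k = d' \<cdot> k" "exp_post K z r \<cdot> d = exp_post K z r \<cdot> d'"
    have 1: "uncurry z ?x d \<cdot> ?m = uncurry z ?x d' \<cdot> ?m"
      using uncurry_cmp[of z ?x d k] uncurry_cmp[of z ?x d' k] k r z * by simp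
    have 2: "r \<cdot> uncurry z ?x d = r \<cdot> uncurry z ?x d'"
      using uncurry_exp_post[of z r d] uncurry_exp_post[of z r d'] k r z * by simp
    have "uncurry z ?x d = uncurry z ?x d'"
      by (rule ortho_eq[OF o]) (use 1 2 k r z *(1-6) in simp_all)
    then show "d = d'" by (rule uncurry_inj) (use k r z * in simp_all)
  qed
qed

text \<open>Lifting \<open>w \<times> i\<close> against \<open>r\<^sup>z\<close> is lifting \<open>(w \<times> i) \<times> z\<close> against \<open>r\<close>, and up to a permutation of
  the factors this is \<open>(w \<times> z) \<times> i\<close>.\<close>

lemma right_class_exp_post:
  assumes r: "r \<in> right_class K i" and i: "i \<in> Ar K" and z: "z \<in> Ob K"
  shows "exp_post K z r \<in> right_class K i"
proof -
  from r have rA: "r \<in> Ar K" and P: "exp_square_pullback K i r" by (auto simp: right_class_def)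
  have "ortho K (prod_ar K (Ide K w) i) (exp_post K z r)" if w: "w \<in> Ob K" for w
  proof -
    let ?swap = "\<lambda>a. prod_pair K
      (prod_pair K (pr1 K w a \<cdot> pr1 K (prod_ob K w a) z) (pr2 K (prod_ob K w a) z))
      (pr2 K w a \<cdot> pr1 K (prod_ob K w a) z)"
    let ?swap' = "\<lambda>a. prod_pair K
      (prod_pair K (pr1 K w z \<cdot> pr1 K (prod_ob K w z) a) (pr2 K (prod_ob K w z) a))
      (pr2 K w z \<cdot> pr1 K (prod_ob K w z) a)"
    have o: "ortho K (prod_ar K (Ide K (prod_ob K w z)) i) r"
      using P i rA w z by (simp add: exp_square_pullback_iff)
    have "ortho K (prod_ar K (prod_ar K (Ide K w) i) (Ide K z)) r"
      by (rule ortho_iso[OF o, of _ "?swap (Dom K i)" "?swap' (Dom K i)" "?swap (Cod K i)" "?swap' (Cod K i)"])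
        (use i rA w z in simp_all)
    then show ?thesis using i rA w z by (simp add: ortho_exp_post)
  qed
  then show ?thesis using rA i z by (simp add: right_class_def exp_square_pullback_iff)
qed

text \<open>Membership of the left class asks for lifts against \<open>z \<times> k\<close> for every \<open>z\<close>. These are
  lifts of \<open>k\<close> against \<open>r\<^sup>z\<close>, which is again in the right class; so lifts against \<open>k\<close> itself
  suffice.\<close>

lemma left_class_of_ortho:
  assumes k: "k \<in> Ar K" and i: "i \<in> Ar K" and O: "\<And>r. r \<in> right_class K i \<Longrightarrow> ortho K k r"
  shows "k \<in> left_class K i"
proof -
  have "ortho K (prod_ar K (Ide K z) k) r" if r: "r \<in> right_class K i" and z: "z \<in> Ob K" for r z
  proof -
    have rA: "r \<in> Ar K" using r by (simp add: right_class_def)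
    have o: "ortho K (prod_ar K k (Ide K z)) r"
      using O[OF right_class_exp_post[OF r i z]] k rA z by (simp add: ortho_exp_post)
    let ?swap = "\<lambda>a b. prod_pair K (pr2 K a b) (pr1 K a b)"
    show ?thesis
      by (rule ortho_iso[OF o, of _ "?swap z (Dom K k)" "?swap (Dom K k) z" "?swap z (Cod K k)" "?swap (Cod K k) z"])
        (use k rA z in simp_all)
  qed
  then show ?thesis using k by (auto simp: left_class_def right_class_def exp_square_pullback_iff)
qed

end

section \<open>Covers in a topos\<close>

definition jointly_epic :: "('o, 'a) cat \<Rightarrow> 'o \<Rightarrow> 'a set \<Rightarrow> bool" where
  "jointly_epic K b F \<longleftrightarrow> b \<in> Ob K \<and> (\<forall>f\<in>F. f \<in> Ar K \<and> Cod K f = b) \<and>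
     (\<forall>g\<in>Ar K. \<forall>h\<in>Ar K. Dom K g = b \<longrightarrow> Dom K h = b \<longrightarrow> Cod K g = Cod K h \<longrightarrow>
        (\<forall>f\<in>F. g \<cdot>\<^bsub>K\<^esub> f = h \<cdot>\<^bsub>K\<^esub> f) \<longrightarrow> g = h)"

lemma jointly_epicD:
  assumes "jointly_epic K b F" "g \<in> Ar K" "h \<in> Ar K" "Dom K g = b" "Dom K h = b"
    "Cod K g = Cod K h" "\<And>f. f \<in> F \<Longrightarrow> g \<cdot>\<^bsub>K\<^esub> f = h \<cdot>\<^bsub>K\<^esub> f"
  shows "g = h"
  using assms unfolding jointly_epic_def by blast

lemma (in category) epi_jointly_epic: "is_epi K e \<Longrightarrow> jointly_epic K (Cod K e) {e}"
  unfolding jointly_epic_def using epiD by (auto simp: is_epi_def)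

context topos
begin

sublocale ccc
proof
  fix a b assume a: "a \<in> Ob K" and b: "b \<in> Ob K"
  obtain t where t: "is_terminal K t" using ex_terminal by blast
  then have tO: "t \<in> Ob K" by (simp add: is_terminal_def)
  obtain f where f: "f \<in> hom K a t" using t a unfolding is_terminal_def by blast
  obtain g where g: "g \<in> hom K b t" using t b unfolding is_terminal_def by blast
  obtain p q where P: "is_pullback K f g p q" using ex_pullback[OF f g] by blast
  note A = is_pullback_Ar[OF P]
  have "is_product K a b p q" unfolding is_product_def
  proof (intro conjI ballI)
    fix x u v assume "x \<in> Ob K" and u: "u \<in> hom K x a" and v: "v \<in> hom K x b"
    moreover have "f \<cdot> u = g \<cdot> v" by (rule terminal_eq[OF t]) (use f g u v in simp_all)
    ultimately show "\<exists>!h. h \<in> hom K x (Dom K p) \<and> p \<cdot> h = u \<and> q \<cdot> h = v"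
      using P f g unfolding is_pullback_def by simp
  qed (use A f g in simp_all)
  then show "\<exists>p q. is_product K a b p q" by blast
next
  fix a b assume "a \<in> Ob K" "b \<in> Ob K"
  then show "\<exists>e ev. is_exponential K a b e ev" by (rule ex_exponential)
qed

lemma equalizer:
  assumes f: "f \<in> Ar K" and g: "g \<in> Ar K" and D: "Dom K f = Dom K g" and C: "Cod K f = Cod K g"
  obtains m where "m \<in> Ar K" "Cod K m = Dom K f" "is_mono K m" "f \<cdot> m = g \<cdot> m"
    "\<And>u. u \<in> Ar K \<Longrightarrow> Cod K u = Dom K f \<Longrightarrow> f \<cdot> u = g \<cdot> u \<Longrightarrow>
      \<exists>k\<in>Ar K. Dom K k = Dom K u \<and> Cod K k = Dom K m \<and> m \<cdot> k = u"
proof -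
  let ?i = "Ide K (Dom K f)"
  let ?f = "prod_pair K ?i f" and ?g = "prod_pair K ?i g"
  have "?f \<in> hom K (Dom K f) (prod_ob K (Dom K f) (Cod K f))"
    "?g \<in> hom K (Dom K f) (prod_ob K (Dom K f) (Cod K f))" using f g C D by simp_all
  then obtain p q where P: "is_pullback K ?f ?g p q" using ex_pullback by blast
  note A = is_pullback_Ar[OF P]
  have pA: "p \<in> Ar K" "q \<in> Ar K" "Cod K p = Dom K f" "Cod K q = Dom K f" "Dom K q = Dom K p"
    using A f g C D by simp_all
  have "p = q \<and> f \<cdot> p = g \<cdot> q" using A(9) pA f g C D by auto
  then have pq: "p = q" and fg: "f \<cdot> p = g \<cdot> p" by auto
  show ?thesis
  proof (rule that[of p])
    show "is_mono K p"
    proof (rule is_monoI)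
      fix u v assume *: "u \<in> Ar K" "v \<in> Ar K" "Cod K u = Dom K p" "Cod K v = Dom K p"
        "Dom K u = Dom K v" "p \<cdot> u = p \<cdot> v"
      have "q \<cdot> u = q \<cdot> v" using *(6) unfolding pq .
      then show "u = v" by (intro pullback_ext[OF P, of u v]) (use * in simp_all)
    qed (use pA in simp)
    fix u assume u: "u \<in> Ar K" "Cod K u = Dom K f" "f \<cdot> u = g \<cdot> u"
    then have "?f \<cdot> u = ?g \<cdot> u" using f g C D by simp
    then show "\<exists>k\<in>Ar K. Dom K k = Dom K u \<and> Cod K k = Dom K p \<and> p \<cdot> k = u"
      using pair_pullback[OF P, of u u] u f g D by (intro bexI[of _ "pair K p q u u"]) simp_all
  qed (use pA fg in simp_all)
qed

definition truth :: 'b where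
  "truth = (SOME tr. is_subobject_classifier K tr)"

lemma truth: "is_subobject_classifier K truth"
  unfolding truth_def using ex_classifier by (rule someI_ex)

abbreviation Omega :: 'a where
  "Omega \<equiv> Cod K truth"

definition holds :: "'b \<Rightarrow> bool" where
  "holds c \<longleftrightarrow> (\<exists>u\<in>Ar K. Dom K u = Dom K c \<and> Cod K u = Dom K truth \<and> c = truth \<cdot> u)"

lemma truth_Ar: "truth \<in> Ar K" "Omega \<in> Ob K" "is_terminal K (Dom K truth)"
  using truth by (auto simp: is_subobject_classifier_def)

lemma holds_cmp:
  assumes "holds c" "z \<in> Ar K" "Cod K z = Dom K c" shows "holds (c \<cdot> z)"
proof -
  obtain u where "u \<in> Ar K" "Dom K u = Dom K c" "Cod K u = Dom K truth" "c = truth \<cdot> u"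
    using assms by (auto simp: holds_def)
  then show ?thesis using assms truth_Ar unfolding holds_def by (intro bexI[of _ "u \<cdot> z"]) simp_all
qed

text \<open>There is one arrow to the terminal object, hence one true truth value at each stage.\<close>

lemma holds_eq:
  assumes "holds c" "holds d" "Dom K c = Dom K d" shows "c = d"
proof -
  obtain u where u: "u \<in> Ar K" "Dom K u = Dom K c" "Cod K u = Dom K truth" "c = truth \<cdot> u"
    using assms by (auto simp: holds_def)
  obtain v where v: "v \<in> Ar K" "Dom K v = Dom K d" "Cod K v = Dom K truth" "d = truth \<cdot> v"
    using assms by (auto simp: holds_def)
  have "u = v" by (rule terminal_eq[OF truth_Ar(3)]) (use u v assms in simp_all)
  then show ?thesis using u v by simp
qed

lemma holds_top:
  assumes "b \<in> Ob K"
  obtains c where "c \<in> Ar K" "Dom K c = b" "Cod K c = Omega" "holds c"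
proof -
  obtain u where u: "u \<in> hom K b (Dom K truth)"
    using truth_Ar(3) assms unfolding is_terminal_def by blast
  show ?thesis
    by (rule that[of "truth \<cdot> u"]) (use u truth_Ar in \<open>auto simp: holds_def\<close>)
qed

lemma classifier:
  assumes m: "is_mono K m"
  obtains c where "c \<in> Ar K" "Dom K c = Cod K m" "Cod K c = Omega"
    "\<And>z. z \<in> Ar K \<Longrightarrow> Cod K z = Cod K m \<Longrightarrow>
      holds (c \<cdot> z) \<longleftrightarrow> (\<exists>k\<in>Ar K. Dom K k = Dom K z \<and> Cod K k = Dom K m \<and> m \<cdot> k = z)"
proof -
  obtain c u where c: "c \<in> hom K (Cod K m) Omega" and P: "is_pullback K c truth m u"
    using truth m unfolding is_subobject_classifier_def by blast
  note A = is_pullback_Ar[OF P]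
  show ?thesis
  proof (rule that[of c])
    fix z assume z: "z \<in> Ar K" "Cod K z = Cod K m"
    show "holds (c \<cdot> z) \<longleftrightarrow> (\<exists>k\<in>Ar K. Dom K k = Dom K z \<and> Cod K k = Dom K m \<and> m \<cdot> k = z)"
    proof
      assume "holds (c \<cdot> z)"
      then obtain v where v: "v \<in> Ar K" "Dom K v = Dom K z" "Cod K v = Dom K truth" "c \<cdot> z = truth \<cdot> v"
        using c z by (auto simp: holds_def)
      show "\<exists>k\<in>Ar K. Dom K k = Dom K z \<and> Cod K k = Dom K m \<and> m \<cdot> k = z"
        using pair_pullback[OF P, of z v] v c z by (intro bexI[of _ "pair K m u z v"]) auto
    next
      assume "\<exists>k\<in>Ar K. Dom K k = Dom K z \<and> Cod K k = Dom K m \<and> m \<cdot> k = z"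
      then obtain k where k: "k \<in> Ar K" "Dom K k = Dom K z" "Cod K k = Dom K m" "m \<cdot> k = z" by blast
      have "c \<cdot> (m \<cdot> k) = truth \<cdot> (u \<cdot> k)" by (rule cmp_eq_assoc) (use A k in simp_all)
      then show "holds (c \<cdot> z)" using k A c z
        unfolding holds_def by (intro bexI[of _ "u \<cdot> k"]) auto
    qed
  qed (use c in auto)
qed

text \<open>Subobjects are determined by their generalised elements: the pullback of \<open>truth\<close> along \<open>c\<close>
  is also a pullback along \<open>d\<close>, so that both classify the same monomorphism.\<close>

lemma Omega_ext:
  assumes c: "c \<in> Ar K" "Cod K c = Omega" and d: "d \<in> Ar K" "Cod K d = Omega" "Dom K d = Dom K c"
    and cd: "\<And>z. z \<in> Ar K \<Longrightarrow> Cod K z = Dom K c \<Longrightarrow> holds (c \<cdot> z) \<longleftrightarrow> holds (d \<cdot> z)"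
  shows "c = d"
proof -
  have "c \<in> hom K (Dom K c) Omega" "truth \<in> hom K (Dom K truth) Omega" using c truth_Ar by simp_all
  then obtain m u where P: "is_pullback K c truth m u" using ex_pullback by blast
  note A = is_pullback_Ar[OF P]
  have m: "is_mono K m"
  proof (rule is_monoI)
    fix g h assume *: "g \<in> Ar K" "h \<in> Ar K" "Cod K g = Dom K m" "Cod K h = Dom K m"
      "Dom K g = Dom K h" "m \<cdot> g = m \<cdot> h"
    have "u \<cdot> g = u \<cdot> h" by (rule terminal_eq[OF truth_Ar(3)]) (use A * in simp_all)
    then show "g = h" using pullback_ext[OF P] * by simp
  qed (use A in simp)
  have "holds (c \<cdot> m)" using A by (auto simp: holds_def)
  moreover have "holds (c \<cdot> m) \<longleftrightarrow> holds (d \<cdot> m)" by (rule cd) (use A in simp_all)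
  ultimately have "holds (d \<cdot> m)" by blast
  then obtain v where v: "v \<in> Ar K" "Dom K v = Dom K m" "Cod K v = Dom K truth" "d \<cdot> m = truth \<cdot> v"
    using A d by (auto simp: holds_def)
  have "is_pullback K d truth m v" unfolding is_pullback_def
  proof (intro conjI ballI impI)
    fix x y w assume x: "x \<in> Ob K" and y: "y \<in> hom K x (Dom K d)" and w: "w \<in> hom K x (Dom K truth)"
      and e: "d \<cdot> y = truth \<cdot> w"
    have "holds (d \<cdot> y)" unfolding e holds_def using w truth_Ar by auto
    then have "holds (c \<cdot> y)" using cd y d by simp
    then obtain w' where w': "w' \<in> Ar K" "Dom K w' = x" "Cod K w' = Dom K truth" "c \<cdot> y = truth \<cdot> w'"
      using y c d by (auto simp: holds_def)
    note Q = pair_pullback[OF P, of y w']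
    show "\<exists>!h. h \<in> hom K x (Dom K m) \<and> m \<cdot> h = y \<and> v \<cdot> h = w"
    proof (rule ex1I[of _ "pair K m u y w'"])
      have "v \<cdot> pair K m u y w' = w"
        by (rule terminal_eq[OF truth_Ar(3)]) (use Q v w w' y d in simp_all)
      then show "pair K m u y w' \<in> hom K x (Dom K m) \<and> m \<cdot> pair K m u y w' = y \<and> v \<cdot> pair K m u y w' = w"
        using Q y d w' by simp
    next
      fix h assume h: "h \<in> hom K x (Dom K m) \<and> m \<cdot> h = y \<and> v \<cdot> h = w"
      show "h = pair K m u y w'" by (rule monoD[OF m]) (use Q h y d w' in simp_all)
    qed
  qed (use A c d v truth_Ar in auto)
  moreover have "Cod K m = Dom K c" using A by simp
  ultimately show ?thesis using P m c d truth unfolding is_subobject_classifier_def by (metis hom_iff)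
qed

text \<open>The functor \<open>w \<times> (-)\<close> is a left adjoint and so preserves epic families.\<close>

lemma jointly_epic_prod:
  assumes F: "jointly_epic K b F" and w: "w \<in> Ob K"
    and c: "c \<in> Ar K" "Dom K c = prod_ob K w b" and d: "d \<in> Ar K" "Dom K d = prod_ob K w b"
    and C: "Cod K c = Cod K d"
    and cd: "\<And>f. f \<in> F \<Longrightarrow> c \<cdot> prod_ar K (Ide K w) f = d \<cdot> prod_ar K (Ide K w) f"
  shows "c = d"
proof -
  have b: "b \<in> Ob K" and FA: "\<And>f. f \<in> F \<Longrightarrow> f \<in> Ar K \<and> Cod K f = b"
    using F by (auto simp: jointly_epic_def)
  let ?s = "prod_pair K (pr2 K b w) (pr1 K b w)"
  let ?c = "curry_ar K b w (Cod K d) (c \<cdot> ?s)" and ?d = "curry_ar K b w (Cod K d) (d \<cdot> ?s)"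
  have "?c = ?d"
  proof (rule jointly_epicD[OF F])
    fix f assume f: "f \<in> F"
    let ?sf = "prod_pair K (pr2 K (Dom K f) w) (pr1 K (Dom K f) w)"
    have sf: "?s \<cdot> prod_ar K f (Ide K w) = prod_ar K (Ide K w) f \<cdot> ?sf"
      using FA[OF f] b w by simp
    have "c \<cdot> (prod_ar K (Ide K w) f \<cdot> ?sf) = d \<cdot> (prod_ar K (Ide K w) f \<cdot> ?sf)"
      by (rule cmp_eq_assoc[OF cd[OF f]]) (use FA[OF f] b w c d in simp_all)
    then have e: "(c \<cdot> ?s) \<cdot> prod_ar K f (Ide K w) = (d \<cdot> ?s) \<cdot> prod_ar K f (Ide K w)"
      using FA[OF f] b w c d by (simp del: prod_pair_cmp prod_ar_pair add: sf)
    show "?c \<cdot> f = ?d \<cdot> f"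
      by (rule uncurry_inj[of w "Cod K d"])
        (use e FA[OF f] b w c d C in \<open>simp_all add: uncurry_cmp del: prod_pair_cmp\<close>)
  qed (use b w c d C in simp_all)
  then have "uncurry w (Cod K d) ?c = uncurry w (Cod K d) ?d" by simp
  then have e: "c \<cdot> ?s = d \<cdot> ?s" using b w c d C by simp
  have "c \<cdot> (?s \<cdot> prod_pair K (pr2 K w b) (pr1 K w b)) = d \<cdot> (?s \<cdot> prod_pair K (pr2 K w b) (pr1 K w b))"
    by (rule cmp_eq_assoc[OF e]) (use b w c d in simp_all)
  then show ?thesis using b w c d by simp
qed

text \<open>Epic families are stable under pullback, in the form in which this is used: \<open>g = h\<close> may be
  checked at those stages \<open>z\<close> where \<open>y\<close> factors through a member of the family. The graph of
  \<open>y\<close> and its restriction to the equalizer of \<open>g\<close> and \<open>h\<close> are two subobjects of \<open>w \<times> b\<close>. Their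
  characteristic arrows agree after composition with every \<open>w \<times> f\<close>, because there \<open>g\<close> and \<open>h\<close>
  agree by assumption. As the family of the \<open>w \<times> f\<close> is epic, the two subobjects coincide, and
  the equalizer is everything.\<close>

lemma local_eq:
  assumes F: "jointly_epic K b F" and y: "y \<in> Ar K" "Cod K y = b"
    and g: "g \<in> Ar K" "Dom K g = Dom K y" and h: "h \<in> Ar K" "Dom K h = Dom K y" "Cod K h = Cod K g"
    and gh: "\<And>f z t. f \<in> F \<Longrightarrow> z \<in> Ar K \<Longrightarrow> Cod K z = Dom K y \<Longrightarrow> t \<in> Ar K \<Longrightarrow>
      Dom K t = Dom K z \<Longrightarrow> Cod K t = Dom K f \<Longrightarrow> y \<cdot> z = f \<cdot> t \<Longrightarrow> g \<cdot> z = h \<cdot> z"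
  shows "g = h"
proof -
  have b: "b \<in> Ob K" and FA: "\<And>f. f \<in> F \<Longrightarrow> f \<in> Ar K \<and> Cod K f = b"
    using F by (auto simp: jointly_epic_def)
  let ?w = "Dom K y"
  obtain m where m: "m \<in> Ar K" "Cod K m = ?w" "is_mono K m" "g \<cdot> m = h \<cdot> m"
    and mu: "\<And>u. u \<in> Ar K \<Longrightarrow> Cod K u = ?w \<Longrightarrow> g \<cdot> u = h \<cdot> u \<Longrightarrow>
      \<exists>k\<in>Ar K. Dom K k = Dom K u \<and> Cod K k = Dom K m \<and> m \<cdot> k = u"
    by (rule equalizer[of g h, unfolded g(2)]) (use g h that in auto)
  let ?n = "prod_pair K (Ide K ?w) y"
  have n: "is_mono K ?n"
  proof (rule is_monoI)
    fix u v assume *: "u \<in> Ar K" "v \<in> Ar K" "Cod K u = Dom K ?n" "Cod K v = Dom K ?n"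
      "Dom K u = Dom K v" "?n \<cdot> u = ?n \<cdot> v"
    then show "u = v" using y b by simp
  qed (use y in simp)
  have nm: "is_mono K (?n \<cdot> m)"
  proof (rule is_monoI)
    fix u v assume *: "u \<in> Ar K" "v \<in> Ar K" "Cod K u = Dom K (?n \<cdot> m)" "Cod K v = Dom K (?n \<cdot> m)"
      "Dom K u = Dom K v" "(?n \<cdot> m) \<cdot> u = (?n \<cdot> m) \<cdot> v"
    then have "?n \<cdot> (m \<cdot> u) = ?n \<cdot> (m \<cdot> v)" using y m by simp
    then have e: "m \<cdot> u = m \<cdot> v"
      by (rule monoD[OF n, rotated -1]) (use *(1-5) y m in simp_all)
    show "u = v" by (rule monoD[OF m(3) _ _ _ _ _ e]) (use *(1-5) y m in simp_all)
  qed (use y m in simp)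
  have nC: "Cod K (?n \<cdot> m) = prod_ob K ?w b" "Cod K ?n = prod_ob K ?w b" using y m by simp_all
  obtain c where c: "c \<in> Ar K" "Dom K c = prod_ob K ?w b" "Cod K c = Omega"
    and cz: "\<And>z. z \<in> Ar K \<Longrightarrow> Cod K z = prod_ob K ?w b \<Longrightarrow>
      holds (c \<cdot> z) \<longleftrightarrow> (\<exists>k\<in>Ar K. Dom K k = Dom K z \<and> Cod K k = Dom K ?n \<and> ?n \<cdot> k = z)"
    by (rule classifier[OF n, unfolded nC]) (rule that)
  obtain d where d: "d \<in> Ar K" "Dom K d = prod_ob K ?w b" "Cod K d = Omega"
    and dz: "\<And>z. z \<in> Ar K \<Longrightarrow> Cod K z = prod_ob K ?w b \<Longrightarrow>
      holds (d \<cdot> z) \<longleftrightarrow> (\<exists>k\<in>Ar K. Dom K k = Dom K z \<and> Cod K k = Dom K (?n \<cdot> m) \<and> (?n \<cdot> m) \<cdot> k = z)"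
    by (rule classifier[OF nm, unfolded nC]) (rule that)
  have "c = d"
  proof (rule jointly_epic_prod[OF F, of ?w])
    fix f assume f: "f \<in> F"
    let ?f = "prod_ar K (Ide K ?w) f"
    have fA: "f \<in> Ar K" "Cod K f = b" using FA f by auto
    show "c \<cdot> ?f = d \<cdot> ?f"
    proof (rule Omega_ext)
      fix v assume v: "v \<in> Ar K" "Cod K v = Dom K (c \<cdot> ?f)"
      let ?z = "pr1 K ?w (Dom K f) \<cdot> v" and ?t = "pr2 K ?w (Dom K f) \<cdot> v"
      have vC: "Cod K v = prod_ob K ?w (Dom K f)" using v c fA y by simp
      have zt: "?z \<in> Ar K" "Cod K ?z = ?w" "Dom K ?z = Dom K v" "?t \<in> Ar K" "Dom K ?t = Dom K v"
        "Cod K ?t = Dom K f" using v vC fA y by simp_all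
      have fv: "?f \<cdot> v = prod_pair K ?z (f \<cdot> ?t)"
        by (rule prod_ext[of _ _ ?w b]) (use v(1) vC fA y b in simp_all)
      have fvA: "?f \<cdot> v \<in> Ar K" "Cod K (?f \<cdot> v) = prod_ob K ?w b" "Dom K (?f \<cdot> v) = Dom K v"
        using v(1) vC fA y by simp_all
      have "holds (c \<cdot> (?f \<cdot> v)) \<longleftrightarrow> y \<cdot> ?z = f \<cdot> ?t"
      proof
        assume "holds (c \<cdot> (?f \<cdot> v))"
        then obtain k where k: "k \<in> Ar K" "Dom K k = Dom K v" "Cod K k = ?w" "?n \<cdot> k = ?f \<cdot> v"
          using cz[OF fvA(1,2)] fvA y by auto
        then have e: "prod_pair K k (y \<cdot> k) = prod_pair K ?z (f \<cdot> ?t)" using y fv by simp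
        then show "y \<cdot> ?z = f \<cdot> ?t" using b k(1-3) zt y fA by auto
      next
        assume "y \<cdot> ?z = f \<cdot> ?t"
        then show "holds (c \<cdot> (?f \<cdot> v))" using cz[OF fvA(1,2)] fvA y zt fv
          by (auto intro!: bexI[of _ ?z])
      qed
      moreover have "holds (d \<cdot> (?f \<cdot> v)) \<longleftrightarrow> y \<cdot> ?z = f \<cdot> ?t"
      proof
        assume "holds (d \<cdot> (?f \<cdot> v))"
        then obtain k where k: "k \<in> Ar K" "Dom K k = Dom K v" "Cod K k = Dom K m" "(?n \<cdot> m) \<cdot> k = ?f \<cdot> v"
          using dz[OF fvA(1,2)] fvA y m by auto
        then have e: "prod_pair K (m \<cdot> k) (y \<cdot> (m \<cdot> k)) = prod_pair K ?z (f \<cdot> ?t)" using y fv m by simp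
        then show "y \<cdot> ?z = f \<cdot> ?t" using b k(1-3) zt y fA m by auto
      next
        assume e: "y \<cdot> ?z = f \<cdot> ?t"
        then have "g \<cdot> ?z = h \<cdot> ?z" using gh[OF f, of ?z ?t] zt by simp
        then obtain k where k: "k \<in> Ar K" "Dom K k = Dom K v" "Cod K k = Dom K m" "m \<cdot> k = ?z"
          using mu[of ?z] zt by auto
        have "(?n \<cdot> m) \<cdot> k = ?f \<cdot> v" using k m y zt e fv by simp
        then show "holds (d \<cdot> (?f \<cdot> v))" using dz[OF fvA(1,2)] fvA y m k
          by (auto intro!: bexI[of _ k])
      qed
      ultimately show "holds ((c \<cdot> ?f) \<cdot> v) \<longleftrightarrow> holds ((d \<cdot> ?f) \<cdot> v)"
        using c d v(1) vC fA y by simp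
    qed (use c d y fA in simp_all)
  qed (use c d y in simp_all)
  have "holds (c \<cdot> ?n)" using cz[of ?n] y b by (auto intro!: bexI[of _ "Ide K ?w"])
  then have "holds (d \<cdot> ?n)" using \<open>c = d\<close> by simp
  then obtain k where k: "k \<in> Ar K" "Dom K k = ?w" "Cod K k = Dom K m" "(?n \<cdot> m) \<cdot> k = ?n"
    using dz[of ?n] y m b by auto
  then have "pr1 K ?w b \<cdot> ((?n \<cdot> m) \<cdot> k) = pr1 K ?w b \<cdot> ?n" by simp
  then have mk: "m \<cdot> k = Ide K ?w" using y m k(1-3) b by simp
  have "g \<cdot> (m \<cdot> k) = h \<cdot> (m \<cdot> k)" by (rule cmp_eq_assoc[OF m(4)]) (use m g h k in simp_all)
  then show ?thesis using mk g h by simp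
qed

lemma local_eq_epi:
  assumes e: "is_epi K e" and y: "y \<in> Ar K" "Cod K y = Cod K e"
    and g: "g \<in> Ar K" "Dom K g = Dom K y" and h: "h \<in> Ar K" "Dom K h = Dom K y" "Cod K h = Cod K g"
    and gh: "\<And>z t. z \<in> Ar K \<Longrightarrow> Cod K z = Dom K y \<Longrightarrow> t \<in> Ar K \<Longrightarrow>
      Dom K t = Dom K z \<Longrightarrow> Cod K t = Dom K e \<Longrightarrow> y \<cdot> z = e \<cdot> t \<Longrightarrow> g \<cdot> z = h \<cdot> z"
  shows "g = h"
  by (rule local_eq[OF epi_jointly_epic[OF e] y g h]) (use gh in auto)

lemma epi_pullback:
  assumes e: "is_epi K e" and y: "y \<in> Ar K" "Cod K y = Cod K e"
  obtains z t where "is_epi K z" "z \<in> Ar K" "Cod K z = Dom K y" "t \<in> Ar K" "Dom K t = Dom K z"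
    "Cod K t = Dom K e" "y \<cdot> z = e \<cdot> t"
proof -
  have eA: "e \<in> Ar K" using e by (simp add: is_epi_def)
  have "y \<in> hom K (Dom K y) (Cod K e)" "e \<in> hom K (Dom K e) (Cod K e)" using y eA by simp_all
  then obtain z t where P: "is_pullback K y e z t" using ex_pullback by blast
  note A = is_pullback_Ar[OF P]
  have "is_epi K z"
  proof (rule is_epiI)
    fix g h assume *: "g \<in> Ar K" "h \<in> Ar K" "Dom K g = Cod K z" "Dom K h = Cod K z"
      "Cod K g = Cod K h" "g \<cdot> z = h \<cdot> z"
    show "g = h"
    proof (rule local_eq_epi[OF e y])
      fix z' t' assume z': "z' \<in> Ar K" "Cod K z' = Dom K y" "t' \<in> Ar K"
        "Dom K t' = Dom K z'" "Cod K t' = Dom K e" "y \<cdot> z' = e \<cdot> t'"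
      note Q = pair_pullback[OF P, of z' t']
      have "g \<cdot> (z \<cdot> pair K z t z' t') = h \<cdot> (z \<cdot> pair K z t z' t')"
        by (rule cmp_eq_assoc[OF *(6)]) (use A * Q z' in simp_all)
      then show "g \<cdot> z' = h \<cdot> z'" using Q z' by simp
    qed (use * A in simp_all)
  qed (use A in simp)
  then show ?thesis using that[of z t] A by simp
qed

text \<open>A topos is balanced: the characteristic arrow of \<open>m\<close> becomes true after composition with the
  epimorphism, hence is true, and the identity factors through \<open>m\<close>.\<close>

lemma mono_of_epi_section:
  assumes m: "is_mono K m" and e: "is_epi K (m \<cdot> k)" and k: "k \<in> Ar K" "Cod K k = Dom K m"
  obtains n where "n \<in> Ar K" "Dom K n = Cod K m" "Cod K n = Dom K m" "m \<cdot> n = Ide K (Cod K m)"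
proof -
  have mA: "m \<in> Ar K" using m by (simp add: is_mono_def)
  obtain c where c: "c \<in> Ar K" "Dom K c = Cod K m" "Cod K c = Omega"
    and cz: "\<And>z. z \<in> Ar K \<Longrightarrow> Cod K z = Cod K m \<Longrightarrow>
      holds (c \<cdot> z) \<longleftrightarrow> (\<exists>k\<in>Ar K. Dom K k = Dom K z \<and> Cod K k = Dom K m \<and> m \<cdot> k = z)"
    by (rule classifier[OF m]) (rule that)
  obtain d where d: "d \<in> Ar K" "Dom K d = Cod K m" "Cod K d = Omega" "holds d"
    using holds_top[of "Cod K m"] mA by auto
  have "c = d"
  proof (rule epiD[OF e])
    have "holds (c \<cdot> (m \<cdot> k))" using cz[of "m \<cdot> k"] mA k by auto
    moreover have "holds (d \<cdot> (m \<cdot> k))" using d mA k by (intro holds_cmp) simp_all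
    ultimately show "c \<cdot> (m \<cdot> k) = d \<cdot> (m \<cdot> k)" by (rule holds_eq) (use c d mA k in simp)
  qed (use c d mA k in simp_all)
  then have "holds (c \<cdot> Ide K (Cod K m))" using c d mA by simp
  then show ?thesis using cz[of "Ide K (Cod K m)"] mA that by auto
qed

text \<open>Epimorphisms are effective. Let \<open>R \<subseteq> B \<times> X\<close> consist of the pairs \<open>(b, x)\<close> such that \<open>t p = x\<close> for
  all \<open>p\<close> with \<open>e p = b\<close>; it is the equalizer of the two arrows \<open>B \<times> X \<rightarrow> \<Omega>\<^sup>P\<close> that send \<open>(b, x)\<close> to
  \<open>{p. e p = b}\<close> and to \<open>{p. e p = b \<and> t p = x}\<close>. Its projection to \<open>B\<close> is a monomorphism,
  because \<open>b\<close> locally has a preimage, which determines \<open>x\<close>; and \<open>e\<close> factors through it, since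
  \<open>(e p, t p)\<close> lies in \<open>R\<close> by the assumption on \<open>t\<close>. So the projection is invertible, and \<open>R\<close> is
  the graph of the required arrow.\<close>

lemma epi_descent:
  assumes e: "is_epi K e" and t: "t \<in> Ar K" "Dom K t = Dom K e"
    and ker: "\<And>p p'. p \<in> Ar K \<Longrightarrow> p' \<in> Ar K \<Longrightarrow> Cod K p = Dom K e \<Longrightarrow> Cod K p' = Dom K e \<Longrightarrow>
      Dom K p = Dom K p' \<Longrightarrow> e \<cdot> p = e \<cdot> p' \<Longrightarrow> t \<cdot> p = t \<cdot> p'"
  obtains d where "d \<in> Ar K" "Dom K d = Cod K e" "Cod K d = Cod K t" "d \<cdot> e = t"
proof -
  have eA: "e \<in> Ar K" using e by (simp add: is_epi_def)
  let ?P = "Dom K e" and ?B = "Cod K e" and ?X = "Cod K t"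
  let ?BX = "prod_ob K ?B ?X" and ?XP = "prod_ob K ?X ?P"
  let ?x = "pr1 K ?X ?P" and ?p = "pr2 K ?X ?P"
  \<comment> \<open>the subobjects of \<open>(B \<times> X) \<times> P\<close> whose transposes are the two arrows into \<open>\<Omega>\<^sup>P\<close>\<close>
  let ?m1 = "prod_pair K (prod_pair K (e \<cdot> ?p) ?x) ?p"
  let ?m2 = "prod_pair K (prod_pair K e t) (Ide K ?P)"
  let ?Z = "prod_ob K ?BX ?P"
  have m1: "is_mono K ?m1"
  proof (rule is_monoI)
    fix g h assume *: "g \<in> Ar K" "h \<in> Ar K" "Cod K g = Dom K ?m1" "Cod K h = Dom K ?m1"
      "Dom K g = Dom K h" "?m1 \<cdot> g = ?m1 \<cdot> h"
    have C: "Cod K g = ?XP" "Cod K h = ?XP" using * eA t by simp_all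
    have e1: "prod_pair K (prod_pair K (e \<cdot> (?p \<cdot> g)) (?x \<cdot> g)) (?p \<cdot> g)
        = prod_pair K (prod_pair K (e \<cdot> (?p \<cdot> h)) (?x \<cdot> h)) (?p \<cdot> h)"
      using *(6) *(1,2,5) C eA t by simp
    then have "?x \<cdot> g = ?x \<cdot> h" "?p \<cdot> g = ?p \<cdot> h" using *(1,2,5) C eA t by simp_all
    then show "g = h"
      by (rule prod_ext[of g h ?X ?P, rotated -2]) (use *(1,2,5) C eA t in simp_all)
  qed (use eA t in simp)
  have m2: "is_mono K ?m2"
  proof (rule is_monoI)
    fix g h assume *: "g \<in> Ar K" "h \<in> Ar K" "Cod K g = Dom K ?m2" "Cod K h = Dom K ?m2"
      "Dom K g = Dom K h" "?m2 \<cdot> g = ?m2 \<cdot> h"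
    then show "g = h" using *(1-5) eA t by simp
  qed (use eA t in simp)
  have mC: "Cod K ?m1 = ?Z" "Cod K ?m2 = ?Z" "Dom K ?m1 = ?XP" "Dom K ?m2 = ?P" using eA t by simp_all
  obtain c where c: "c \<in> Ar K" "Dom K c = ?Z" "Cod K c = Omega"
    and cz: "\<And>z. z \<in> Ar K \<Longrightarrow> Cod K z = ?Z \<Longrightarrow>
      holds (c \<cdot> z) \<longleftrightarrow> (\<exists>k\<in>Ar K. Dom K k = Dom K z \<and> Cod K k = ?XP \<and> ?m1 \<cdot> k = z)"
    by (rule classifier[OF m1, unfolded mC]) (rule that)
  obtain d where d: "d \<in> Ar K" "Dom K d = ?Z" "Cod K d = Omega"
    and dz: "\<And>z. z \<in> Ar K \<Longrightarrow> Cod K z = ?Z \<Longrightarrow>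
      holds (d \<cdot> z) \<longleftrightarrow> (\<exists>k\<in>Ar K. Dom K k = Dom K z \<and> Cod K k = ?P \<and> ?m2 \<cdot> k = z)"
    by (rule classifier[OF m2, unfolded mC]) (rule that)
  have cz': "holds (c \<cdot> prod_pair K (prod_pair K b x) p) \<longleftrightarrow> e \<cdot> p = b"
    if A: "b \<in> Ar K" "x \<in> Ar K" "p \<in> Ar K" "Dom K b = Dom K p" "Dom K x = Dom K p"
      "Cod K b = ?B" "Cod K x = ?X" "Cod K p = ?P" for b x p
  proof -
    have Q: "prod_pair K (prod_pair K b x) p \<in> Ar K" "Cod K (prod_pair K (prod_pair K b x) p) = ?Z"
      "Dom K (prod_pair K (prod_pair K b x) p) = Dom K p" using A by simp_all
    show ?thesis
  proof
    assume "holds (c \<cdot> prod_pair K (prod_pair K b x) p)"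
    then obtain k where k: "k \<in> Ar K" "Dom K k = Dom K p" "Cod K k = ?XP"
        and e0: "?m1 \<cdot> k = prod_pair K (prod_pair K b x) p"
      using cz[OF Q(1,2), unfolded Q(3)] by blast
    have e1: "prod_pair K (prod_pair K (e \<cdot> (?p \<cdot> k)) (?x \<cdot> k)) (?p \<cdot> k) = prod_pair K (prod_pair K b x) p"
      using e0 k eA t by simp
    then show "e \<cdot> p = b" using A k eA t by auto
  next
    assume "e \<cdot> p = b"
    then show "holds (c \<cdot> prod_pair K (prod_pair K b x) p)"
      unfolding cz[OF Q(1,2), unfolded Q(3)] using A eA t
      by (intro bexI[of _ "prod_pair K x p"]) simp_all
  qed
  qed
  have dz': "holds (d \<cdot> prod_pair K (prod_pair K b x) p) \<longleftrightarrow> e \<cdot> p = b \<and> t \<cdot> p = x"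
    if A: "b \<in> Ar K" "x \<in> Ar K" "p \<in> Ar K" "Dom K b = Dom K p" "Dom K x = Dom K p"
      "Cod K b = ?B" "Cod K x = ?X" "Cod K p = ?P" for b x p
  proof -
    have Q: "prod_pair K (prod_pair K b x) p \<in> Ar K" "Cod K (prod_pair K (prod_pair K b x) p) = ?Z"
      "Dom K (prod_pair K (prod_pair K b x) p) = Dom K p" using A by simp_all
    show ?thesis
  proof
    assume "holds (d \<cdot> prod_pair K (prod_pair K b x) p)"
    then obtain k where k: "k \<in> Ar K" "Dom K k = Dom K p" "Cod K k = ?P"
        and e0: "?m2 \<cdot> k = prod_pair K (prod_pair K b x) p"
      using dz[OF Q(1,2), unfolded Q(3)] by blast
    have e1: "prod_pair K (prod_pair K (e \<cdot> k) (t \<cdot> k)) k = prod_pair K (prod_pair K b x) p"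
      using e0 k eA t by simp
    then show "e \<cdot> p = b \<and> t \<cdot> p = x" using A k eA t by auto
  next
    assume "e \<cdot> p = b \<and> t \<cdot> p = x"
    then show "holds (d \<cdot> prod_pair K (prod_pair K b x) p)"
      unfolding dz[OF Q(1,2), unfolded Q(3)] using A eA t
      by (intro bexI[of _ p]) simp_all
  qed
  qed
  let ?c = "curry_ar K ?BX ?P Omega c" and ?d = "curry_ar K ?BX ?P Omega d"
  have BXO: "?BX \<in> Ob K" "?P \<in> Ob K" "?B \<in> Ob K" "?X \<in> Ob K" using eA t by simp_all
  have cdA: "?c \<in> Ar K" "?d \<in> Ar K" "Dom K ?c = ?BX" "Dom K ?d = ?BX" "Cod K ?c = Cod K ?d"
    using c d BXO truth_Ar by simp_all
  obtain n where n: "n \<in> Ar K" "Cod K n = ?BX" "is_mono K n" "?c \<cdot> n = ?d \<cdot> n"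
    and nu: "\<And>u. u \<in> Ar K \<Longrightarrow> Cod K u = ?BX \<Longrightarrow> ?c \<cdot> u = ?d \<cdot> u \<Longrightarrow>
      \<exists>k\<in>Ar K. Dom K k = Dom K u \<and> Cod K k = Dom K n \<and> n \<cdot> k = u"
    by (rule equalizer[of ?c ?d, unfolded cdA(3)]) (use cdA that in auto)
  let ?nb = "pr1 K ?B ?X \<cdot> n" and ?nx = "pr2 K ?B ?X \<cdot> n"
  have nbx: "?nb \<in> Ar K" "?nx \<in> Ar K" "Dom K ?nb = Dom K n" "Dom K ?nx = Dom K n"
    "Cod K ?nb = ?B" "Cod K ?nx = ?X" using n BXO by simp_all
  have n_pair: "prod_pair K ?nb ?nx = n" using n BXO by simp
  have n_tp: "t \<cdot> p = ?nx \<cdot> v"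
    if p: "p \<in> Ar K" "Cod K p = ?P" and v: "v \<in> Ar K" "Cod K v = Dom K n" "Dom K v = Dom K p"
      and ep: "e \<cdot> p = ?nb \<cdot> v" for p v
  proof -
    have "?c \<cdot> (n \<cdot> v) = ?d \<cdot> (n \<cdot> v)" by (rule cmp_eq_assoc[OF n(4)]) (use n v cdA in simp_all)
    then have "uncurry ?P Omega (?c \<cdot> (n \<cdot> v)) = uncurry ?P Omega (?d \<cdot> (n \<cdot> v))" by simp
    then have e1: "c \<cdot> prod_ar K (n \<cdot> v) (Ide K ?P) = d \<cdot> prod_ar K (n \<cdot> v) (Ide K ?P)"
      using c d BXO truth_Ar n v by (simp add: uncurry_cmp)
    have "c \<cdot> (prod_ar K (n \<cdot> v) (Ide K ?P) \<cdot> prod_pair K (Ide K (Dom K p)) p)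
        = d \<cdot> (prod_ar K (n \<cdot> v) (Ide K ?P) \<cdot> prod_pair K (Ide K (Dom K p)) p)"
      by (rule cmp_eq_assoc[OF e1]) (use c d BXO n v p in simp_all)
    then have "c \<cdot> prod_pair K (prod_pair K (?nb \<cdot> v) (?nx \<cdot> v)) p
        = d \<cdot> prod_pair K (prod_pair K (?nb \<cdot> v) (?nx \<cdot> v)) p"
      using c d BXO n v p by simp
    moreover have "holds (c \<cdot> prod_pair K (prod_pair K (?nb \<cdot> v) (?nx \<cdot> v)) p)"
      by (subst cz') (use n v p BXO ep nbx in simp_all)
    ultimately have "holds (d \<cdot> prod_pair K (prod_pair K (?nb \<cdot> v) (?nx \<cdot> v)) p)" by simp
    then show ?thesis by (subst (asm) dz') (use n v p BXO nbx in simp_all)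
  qed
  have "?c \<cdot> prod_pair K e t = ?d \<cdot> prod_pair K e t"
  proof (rule uncurry_inj[of ?P Omega])
    have "c \<cdot> prod_ar K (prod_pair K e t) (Ide K ?P) = d \<cdot> prod_ar K (prod_pair K e t) (Ide K ?P)"
    proof (rule Omega_ext)
      fix v assume v: "v \<in> Ar K" "Cod K v = Dom K (c \<cdot> prod_ar K (prod_pair K e t) (Ide K ?P))"
      have vC: "Cod K v = prod_ob K ?P ?P" using v c eA t BXO by simp
      let ?v1 = "pr1 K ?P ?P \<cdot> v" and ?v2 = "pr2 K ?P ?P \<cdot> v"
      have vA: "?v1 \<in> Ar K" "?v2 \<in> Ar K" "Dom K ?v1 = Dom K v" "Dom K ?v2 = Dom K v"
        "Cod K ?v1 = ?P" "Cod K ?v2 = ?P" using v(1) vC BXO by simp_all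
      have ve: "v = prod_pair K ?v1 ?v2" using v(1) vC BXO by simp
      have e1: "prod_ar K (prod_pair K e t) (Ide K ?P) \<cdot> v = prod_pair K (prod_pair K (e \<cdot> ?v1) (t \<cdot> ?v1)) ?v2"
        by (subst ve) (use vA eA t BXO in simp)
      have "holds (c \<cdot> prod_pair K (prod_pair K (e \<cdot> ?v1) (t \<cdot> ?v1)) ?v2) \<longleftrightarrow>
          holds (d \<cdot> prod_pair K (prod_pair K (e \<cdot> ?v1) (t \<cdot> ?v1)) ?v2)"
        by (subst cz', use vA eA t in simp_all, subst dz', use vA eA t in simp_all)
          (use ker[of ?v2 ?v1] vA in auto)
      then show "holds ((c \<cdot> prod_ar K (prod_pair K e t) (Ide K ?P)) \<cdot> v) \<longleftrightarrow>
          holds ((d \<cdot> prod_ar K (prod_pair K e t) (Ide K ?P)) \<cdot> v)"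
        using e1 v(1) vC c d eA t BXO by simp
    qed (use c d eA t BXO in simp_all)
    then show "uncurry ?P Omega (?c \<cdot> prod_pair K e t) = uncurry ?P Omega (?d \<cdot> prod_pair K e t)"
      using c d eA t BXO truth_Ar by (simp add: uncurry_cmp)
  qed (use c d eA t BXO truth_Ar in simp_all)
  then obtain k where k: "k \<in> Ar K" "Dom K k = ?P" "Cod K k = Dom K n" "n \<cdot> k = prod_pair K e t"
    using nu[of "prod_pair K e t"] eA t by auto
  have nbk: "?nb \<cdot> k = e" and nxk: "?nx \<cdot> k = t" using k n BXO eA t by simp_all
  have mono: "is_mono K ?nb"
  proof (rule is_monoI)
    fix g h assume *: "g \<in> Ar K" "h \<in> Ar K" "Cod K g = Dom K ?nb" "Cod K h = Dom K ?nb"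
      "Dom K g = Dom K h" "?nb \<cdot> g = ?nb \<cdot> h"
    have "?nx \<cdot> g = ?nx \<cdot> h"
    proof (rule local_eq_epi[OF e, of "?nb \<cdot> g"])
      fix z p assume zp: "z \<in> Ar K" "Cod K z = Dom K (?nb \<cdot> g)" "p \<in> Ar K" "Dom K p = Dom K z"
        "Cod K p = ?P" "(?nb \<cdot> g) \<cdot> z = e \<cdot> p"
      have zC: "Cod K z = Dom K g" using zp * nbx by simp
      have g1: "e \<cdot> p = ?nb \<cdot> (g \<cdot> z)" using zp(6) zp(1) zC *(1-5) nbx n BXO by simp
      have "?nb \<cdot> (g \<cdot> z) = ?nb \<cdot> (h \<cdot> z)"
        by (rule cmp_eq_assoc[OF *(6)]) (use zp(1) zC *(1-5) nbx in simp_all)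
      then have h1: "e \<cdot> p = ?nb \<cdot> (h \<cdot> z)" using g1 by simp
      have "t \<cdot> p = ?nx \<cdot> (g \<cdot> z)" by (rule n_tp) (use g1 zp zC *(1-5) nbx in simp_all)
      moreover have "t \<cdot> p = ?nx \<cdot> (h \<cdot> z)" by (rule n_tp) (use h1 zp zC *(1-5) nbx in simp_all)
      ultimately show "(?nx \<cdot> g) \<cdot> z = (?nx \<cdot> h) \<cdot> z" using zp(1) zC *(1-5) nbx n BXO by simp
    qed (use * nbx in simp_all)
    then have e1: "n \<cdot> g = n \<cdot> h"
      by (intro prod_ext[of "n \<cdot> g" "n \<cdot> h" ?B ?X]) (use * nbx n BXO in simp_all)
    show "g = h" by (rule monoD[OF n(3) _ _ _ _ _ e1]) (use *(1-5) nbx in simp_all)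
  qed (use nbx in simp)
  obtain i where i: "i \<in> Ar K" "Dom K i = ?B" "Cod K i = Dom K n" "?nb \<cdot> i = Ide K ?B"
  proof (rule mono_of_epi_section[OF mono, of k])
    show "is_epi K (?nb \<cdot> k)" using e nbk by simp
  qed (use k nbx that in auto)
  have "t \<cdot> Ide K ?P = ?nx \<cdot> (i \<cdot> e)"
  proof (rule n_tp)
    have "?nb \<cdot> (i \<cdot> e) = Ide K ?B \<cdot> e" by (rule cmp_eq_assoc1[OF i(4)]) (use i nbx eA in simp_all)
    then show "e \<cdot> Ide K ?P = ?nb \<cdot> (i \<cdot> e)" using eA by simp
  qed (use i eA in simp_all)
  then have "(?nx \<cdot> i) \<cdot> e = t" using i nbx eA t n BXO by simp
  then show ?thesis by (intro that[of "?nx \<cdot> i"]) (use i nbx in simp_all)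
qed

end

section \<open>Internal categories and functors\<close>

lemma Cat_sel [simp]:
  "f0 (G \<cdot>\<^bsub>Cat E\<^esub> F) = f0 G \<cdot>\<^bsub>E\<^esub> f0 F" "f1 (G \<cdot>\<^bsub>Cat E\<^esub> F) = f1 G \<cdot>\<^bsub>E\<^esub> f1 F"
  "f0 (Ide (Cat E) A) = Ide E (C0 A)" "f1 (Ide (Cat E) A) = Ide E (C1 A)"
  by (simp_all add: Cat_def)

lemma Ob_Cat [simp]: "A \<in> Ob (Cat E) \<longleftrightarrow> is_icat E A"
  by (simp add: Cat_def)

context topos
begin

abbreviation fcmp :: "('a, 'b) ifun \<Rightarrow> ('a, 'b) ifun \<Rightarrow> ('a, 'b) ifun" (infixl "\<odot>" 70) where
  "G \<odot> F \<equiv> G \<cdot>\<^bsub>Cat K\<^esub> F"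

lemma icat_data:
  assumes "is_icat K C"
  shows "is_pullback K (tgt C) (src C) (fstp C) (sndp C)"
    "mul C \<in> Ar K" "Dom K (mul C) = C2 C" "Cod K (mul C) = C1 C"
    "fstp C \<in> Ar K" "Dom K (fstp C) = C2 C" "Cod K (fstp C) = C1 C"
    "sndp C \<in> Ar K" "Dom K (sndp C) = C2 C" "Cod K (sndp C) = C1 C"
    "src C \<cdot> mul C = src C \<cdot> fstp C" "tgt C \<cdot> mul C = tgt C \<cdot> sndp C"
    "icomp K C (idn C \<cdot> src C) (Ide K (C1 C)) = Ide K (C1 C)"
    "icomp K C (Ide K (C1 C)) (idn C \<cdot> tgt C) = Ide K (C1 C)"
proof -
  have "mul C \<in> hom K (C2 C) (C1 C)" "fstp C \<in> hom K (C2 C) (C1 C)" "sndp C \<in> hom K (C2 C) (C1 C)"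
    using assms unfolding is_icat_def by blast+
  then show "mul C \<in> Ar K" "Dom K (mul C) = C2 C" "Cod K (mul C) = C1 C"
    "fstp C \<in> Ar K" "Dom K (fstp C) = C2 C" "Cod K (fstp C) = C1 C"
    "sndp C \<in> Ar K" "Dom K (sndp C) = C2 C" "Cod K (sndp C) = C1 C" by simp_all
qed (use assms in \<open>unfold is_icat_def, blast+\<close>)

lemma icat_simps [simp]:
  assumes "is_icat K C"
  shows "C0 C \<in> Ob K" "C1 C \<in> Ob K" "C2 C \<in> Ob K" "src C \<in> Ar K" "tgt C \<in> Ar K" "idn C \<in> Ar K"
    "Dom K (src C) = C1 C" "Cod K (src C) = C0 C" "Dom K (tgt C) = C1 C" "Cod K (tgt C) = C0 C"
    "Dom K (idn C) = C0 C" "Cod K (idn C) = C1 C"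
    "src C \<cdot> idn C = Ide K (C0 C)" "tgt C \<cdot> idn C = Ide K (C0 C)"
proof -
  have "src C \<in> hom K (C1 C) (C0 C)" "tgt C \<in> hom K (C1 C) (C0 C)" "idn C \<in> hom K (C0 C) (C1 C)"
    using assms unfolding is_icat_def by blast+
  then show "src C \<in> Ar K" "tgt C \<in> Ar K" "idn C \<in> Ar K"
    "Dom K (src C) = C1 C" "Cod K (src C) = C0 C" "Dom K (tgt C) = C1 C" "Cod K (tgt C) = C0 C"
    "Dom K (idn C) = C0 C" "Cod K (idn C) = C1 C" by simp_all
qed (use assms in \<open>unfold is_icat_def, blast+\<close>)

lemma icat_idn_elem [simp]:
  assumes "is_icat K C" "x \<in> Ar K" "Cod K x = C0 C"
  shows "src C \<cdot> (idn C \<cdot> x) = x" "tgt C \<cdot> (idn C \<cdot> x) = x"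
  using assms cmp_eq_assoc1[of "src C" "idn C" _ x] cmp_eq_assoc1[of "tgt C" "idn C" _ x] by simp_all

lemma icomp_simps [simp]:
  assumes C: "is_icat K C" and f: "f \<in> Ar K" "Cod K f = C1 C" and g: "g \<in> Ar K" "Cod K g = C1 C"
    and D: "Dom K f = Dom K g" and e: "tgt C \<cdot> f = src C \<cdot> g"
  shows "icomp K C f g \<in> Ar K" "Dom K (icomp K C f g) = Dom K g" "Cod K (icomp K C f g) = C1 C"
    "src C \<cdot> icomp K C f g = src C \<cdot> f" "tgt C \<cdot> icomp K C f g = tgt C \<cdot> g"
proof -
  note P = icat_data(1)[OF C] and m = icat_data(2-4)[OF C] and p = icat_data(5-10)[OF C]
    and sm = icat_data(11,12)[OF C]
  have fC: "Cod K f = Dom K (tgt C)" and gC: "Cod K g = Dom K (src C)" using C f g by simp_all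
  note Q = pair_pullback[OF P f(1) fC g(1) gC D e]
  let ?p = "pair K (fstp C) (sndp C) f g"
  show "icomp K C f g \<in> Ar K" "Dom K (icomp K C f g) = Dom K g" "Cod K (icomp K C f g) = C1 C"
    using Q C f g D e m p by (simp_all add: icomp_def)
  have "src C \<cdot> (mul C \<cdot> ?p) = src C \<cdot> (fstp C \<cdot> ?p)"
    by (rule cmp_eq_assoc[OF sm(1)]) (use Q C f g D e m p in simp_all)
  then show "src C \<cdot> icomp K C f g = src C \<cdot> f" using Q C f g D e by (simp add: icomp_def)
  have "tgt C \<cdot> (mul C \<cdot> ?p) = tgt C \<cdot> (sndp C \<cdot> ?p)"
    by (rule cmp_eq_assoc[OF sm(2)]) (use Q C f g D e m p in simp_all)
  then show "tgt C \<cdot> icomp K C f g = tgt C \<cdot> g" using Q C f g D e by (simp add: icomp_def)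
qed

lemma icomp_cmp [simp]:
  assumes C: "is_icat K C" and f: "f \<in> Ar K" "Cod K f = C1 C" and g: "g \<in> Ar K" "Cod K g = C1 C"
    and D: "Dom K f = Dom K g" and e: "tgt C \<cdot> f = src C \<cdot> g"
    and h: "h \<in> Ar K" "Cod K h = Dom K g"
  shows "icomp K C f g \<cdot> h = icomp K C (f \<cdot> h) (g \<cdot> h)"
proof -
  note P = icat_data(1)[OF C] and m = icat_data(2-4,6)[OF C]
  have fC: "Cod K f = Dom K (tgt C)" and gC: "Cod K g = Dom K (src C)" using C f g by simp_all
  note Q = pair_pullback[OF P f(1) fC g(1) gC D e]
  show ?thesis unfolding icomp_def
    using pair_pullback_cmp[OF P f(1) fC g(1) gC D e h] Q m h by simp
qed

lemma icomp_unit [simp]: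
  assumes C: "is_icat K C" and f: "f \<in> Ar K" "Cod K f = C1 C"
  shows "x = src C \<cdot> f \<Longrightarrow> icomp K C (idn C \<cdot> x) f = f" "x = tgt C \<cdot> f \<Longrightarrow> icomp K C f (idn C \<cdot> x) = f"
proof -
  note 1 = icat_data(13,14)[OF C]
  have "icomp K C (idn C \<cdot> src C) (Ide K (C1 C)) \<cdot> f = icomp K C (idn C \<cdot> (src C \<cdot> f)) f"
    using C f by simp
  then show "x = src C \<cdot> f \<Longrightarrow> icomp K C (idn C \<cdot> x) f = f" using 1 f by simp
  have "icomp K C (Ide K (C1 C)) (idn C \<cdot> tgt C) \<cdot> f = icomp K C f (idn C \<cdot> (tgt C \<cdot> f))"
    using C f by simp
  then show "x = tgt C \<cdot> f \<Longrightarrow> icomp K C f (idn C \<cdot> x) = f" using 1 f by simp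
qed

lemma icomp_assoc [simp]:
  assumes C: "is_icat K C" and f: "f \<in> Ar K" "Cod K f = C1 C" and g: "g \<in> Ar K" "Cod K g = C1 C"
    and h: "h \<in> Ar K" "Cod K h = C1 C" and D: "Dom K f = Dom K g" "Dom K g = Dom K h"
    and e: "tgt C \<cdot> f = src C \<cdot> g" "tgt C \<cdot> g = src C \<cdot> h"
  shows "icomp K C (icomp K C f g) h = icomp K C f (icomp K C g h)"
proof -
  have "\<forall>x\<in>Ob K. \<forall>f\<in>hom K x (C1 C). \<forall>g\<in>hom K x (C1 C). \<forall>h\<in>hom K x (C1 C).
        tgt C \<cdot> f = src C \<cdot> g \<longrightarrow> tgt C \<cdot> g = src C \<cdot> h \<longrightarrow>
        icomp K C (icomp K C f g) h = icomp K C f (icomp K C g h)"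
    using C unfolding is_icat_def by blast
  then show ?thesis using assms by (metis Dom_Ob hom_iff)
qed

lemma icomp_generic:
  assumes C: "is_icat K C"
  shows "fstp C \<in> Ar K" "sndp C \<in> Ar K" "Dom K (fstp C) = C2 C" "Dom K (sndp C) = C2 C"
    "Cod K (fstp C) = C1 C" "Cod K (sndp C) = C1 C" "tgt C \<cdot> fstp C = src C \<cdot> sndp C"
    "icomp K C (fstp C) (sndp C) = mul C" "mul C \<in> Ar K" "Dom K (mul C) = C2 C" "Cod K (mul C) = C1 C"
proof -
  note P = icat_data(1)[OF C]
  show 1: "fstp C \<in> Ar K" "sndp C \<in> Ar K" "Dom K (fstp C) = C2 C" "Dom K (sndp C) = C2 C"
    "Cod K (fstp C) = C1 C" "Cod K (sndp C) = C1 C" "mul C \<in> Ar K" "Dom K (mul C) = C2 C" "Cod K (mul C) = C1 C"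
    using icat_data[OF C] by simp_all
  show 2: "tgt C \<cdot> fstp C = src C \<cdot> sndp C" using is_pullback_Ar[OF P] by simp
  note Q = pair_pullback[OF P, of "fstp C" "sndp C"]
  have "pair K (fstp C) (sndp C) (fstp C) (sndp C) = Ide K (C2 C)"
    by (rule pullback_ext[OF P]) (use Q C 1 2 in simp_all)
  then show "icomp K C (fstp C) (sndp C) = mul C" using 1 by (simp add: icomp_def)
qed

text \<open>By the Yoneda lemma, composition may be prescribed on generalised elements as long as the
  prescription is natural in the stage; the arrow \<open>mul\<close> is its value at the generic composable
  pair.\<close>

lemma icat_exists:
  assumes N: "N \<in> Ob K" and M: "M \<in> Ob K"
    and s: "s \<in> Ar K" "Dom K s = M" "Cod K s = N" and t: "t \<in> Ar K" "Dom K t = M" "Cod K t = N"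
    and i: "i \<in> Ar K" "Dom K i = N" "Cod K i = M" and si: "s \<cdot> i = Ide K N" and ti: "t \<cdot> i = Ide K N"
    and cmp: "\<And>f g. f \<in> Ar K \<Longrightarrow> g \<in> Ar K \<Longrightarrow> Cod K f = M \<Longrightarrow> Cod K g = M \<Longrightarrow> Dom K f = Dom K g \<Longrightarrow>
      t \<cdot> f = s \<cdot> g \<Longrightarrow> cmp f g \<in> Ar K \<and> Dom K (cmp f g) = Dom K g \<and> Cod K (cmp f g) = M \<and>
        s \<cdot> cmp f g = s \<cdot> f \<and> t \<cdot> cmp f g = t \<cdot> g"
    and nat: "\<And>f g h. f \<in> Ar K \<Longrightarrow> g \<in> Ar K \<Longrightarrow> Cod K f = M \<Longrightarrow> Cod K g = M \<Longrightarrow> Dom K f = Dom K g \<Longrightarrow>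
      t \<cdot> f = s \<cdot> g \<Longrightarrow> h \<in> Ar K \<Longrightarrow> Cod K h = Dom K g \<Longrightarrow> cmp f g \<cdot> h = cmp (f \<cdot> h) (g \<cdot> h)"
    and unit: "\<And>f. f \<in> Ar K \<Longrightarrow> Cod K f = M \<Longrightarrow>
      cmp (i \<cdot> (s \<cdot> f)) f = f \<and> cmp f (i \<cdot> (t \<cdot> f)) = f"
    and assoc: "\<And>f g h. f \<in> Ar K \<Longrightarrow> g \<in> Ar K \<Longrightarrow> h \<in> Ar K \<Longrightarrow> Cod K f = M \<Longrightarrow> Cod K g = M \<Longrightarrow>
      Cod K h = M \<Longrightarrow> Dom K f = Dom K h \<Longrightarrow> Dom K g = Dom K h \<Longrightarrow>
      t \<cdot> f = s \<cdot> g \<Longrightarrow> t \<cdot> g = s \<cdot> h \<Longrightarrow> cmp (cmp f g) h = cmp f (cmp g h)"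
  obtains C where "is_icat K C" "C0 C = N" "C1 C = M" "src C = s" "tgt C = t" "idn C = i"
    "\<And>f g. f \<in> Ar K \<Longrightarrow> g \<in> Ar K \<Longrightarrow> Cod K f = M \<Longrightarrow> Cod K g = M \<Longrightarrow> Dom K f = Dom K g \<Longrightarrow>
      t \<cdot> f = s \<cdot> g \<Longrightarrow> icomp K C f g = cmp f g"
proof -
  have "t \<in> hom K M N" "s \<in> hom K M N" using s t by simp_all
  then obtain p q where P: "is_pullback K t s p q" using ex_pullback by blast
  note A = is_pullback_Ar[OF P]
  have pq: "p \<in> Ar K" "q \<in> Ar K" "Cod K p = M" "Cod K q = M" "Dom K p = Dom K q" "t \<cdot> p = s \<cdot> q"
    using A s t by simp_all
  let ?C = "\<lparr>C0 = N, C1 = M, C2 = Dom K p, src = s, tgt = t, idn = i, fstp = p, sndp = q, mul = cmp p q\<rparr>"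
  have c: "icomp K ?C f g = cmp f g"
    if f: "f \<in> Ar K" and g: "g \<in> Ar K" and fg: "Cod K f = M" "Cod K g = M" "Dom K f = Dom K g" "t \<cdot> f = s \<cdot> g"
    for f g
  proof -
    note Q = pair_pullback[OF P, of f g]
    have "cmp p q \<cdot> pair K p q f g = cmp (p \<cdot> pair K p q f g) (q \<cdot> pair K p q f g)"
      by (rule nat[OF pq]) (use Q s t f g fg A in simp_all)
    then show ?thesis using Q s t f g fg by (simp add: icomp_def)
  qed
  have e1: "icomp K ?C (i \<cdot> s) (Ide K M) = Ide K M"
    using s t i M N ti unit[of "Ide K M"] by (subst c) (simp_all add: cmp_eq_assoc1[OF ti])
  have e2: "icomp K ?C (Ide K M) (i \<cdot> t) = Ide K M"
    using s t i M N si unit[of "Ide K M"] by (subst c) (simp_all add: cmp_eq_assoc1[OF si])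
  have as: "\<forall>x\<in>Ob K. \<forall>f\<in>hom K x (C1 ?C). \<forall>g\<in>hom K x (C1 ?C). \<forall>h\<in>hom K x (C1 ?C).
      tgt ?C \<cdot> f = src ?C \<cdot> g \<longrightarrow> tgt ?C \<cdot> g = src ?C \<cdot> h \<longrightarrow>
      icomp K ?C (icomp K ?C f g) h = icomp K ?C f (icomp K ?C g h)"
  proof (intro ballI impI)
    fix x f g h
    assume fA: "f \<in> hom K x (C1 ?C)" and gA: "g \<in> hom K x (C1 ?C)" and hA: "h \<in> hom K x (C1 ?C)"
      and e: "tgt ?C \<cdot> f = src ?C \<cdot> g" "tgt ?C \<cdot> g = src ?C \<cdot> h"
    then have A: "f \<in> Ar K" "g \<in> Ar K" "h \<in> Ar K" "Cod K f = M" "Cod K g = M" "Cod K h = M"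
      "Dom K f = x" "Dom K g = x" "Dom K h = x" and e: "t \<cdot> f = s \<cdot> g" "t \<cdot> g = s \<cdot> h" by simp_all
    have 1: "cmp f g \<in> Ar K \<and> Dom K (cmp f g) = Dom K g \<and> Cod K (cmp f g) = M \<and>
        s \<cdot> cmp f g = s \<cdot> f \<and> t \<cdot> cmp f g = t \<cdot> g"
      and 2: "cmp g h \<in> Ar K \<and> Dom K (cmp g h) = Dom K h \<and> Cod K (cmp g h) = M \<and>
        s \<cdot> cmp g h = s \<cdot> g \<and> t \<cdot> cmp g h = t \<cdot> h"
      by (rule cmp; use A e in simp)+
    have "icomp K ?C (cmp f g) h = cmp (cmp f g) h" "icomp K ?C f (cmp g h) = cmp f (cmp g h)"
      "icomp K ?C f g = cmp f g" "icomp K ?C g h = cmp g h"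
      by (rule c; use A 1 2 e in simp)+
    then show "icomp K ?C (icomp K ?C f g) h = icomp K ?C f (icomp K ?C g h)"
      using assoc[of f g h] A e by simp
  qed
  have "is_icat K ?C"
    unfolding is_icat_def
    by (intro conjI as) (use e1 e2 P s t i si ti pq cmp[OF pq] N M in simp_all)
  then show ?thesis using c by (intro that[of ?C]) simp_all
qed

section \<open>Internal functors\<close>

lemma ifun_data:
  assumes "F \<in> Ar (Cat K)"
  shows "is_icat K (Dom (Cat K) F)" "is_icat K (Cod (Cat K) F)"
    "f0 F \<in> hom K (C0 (Dom (Cat K) F)) (C0 (Cod (Cat K) F))"
    "f1 F \<in> hom K (C1 (Dom (Cat K) F)) (C1 (Cod (Cat K) F))"
    "src (Cod (Cat K) F) \<cdot> f1 F = f0 F \<cdot> src (Dom (Cat K) F)"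
    "tgt (Cod (Cat K) F) \<cdot> f1 F = f0 F \<cdot> tgt (Dom (Cat K) F)"
    "f1 F \<cdot> idn (Dom (Cat K) F) = idn (Cod (Cat K) F) \<cdot> f0 F"
    "f1 F \<cdot> mul (Dom (Cat K) F)
      = icomp K (Cod (Cat K) F) (f1 F \<cdot> fstp (Dom (Cat K) F)) (f1 F \<cdot> sndp (Dom (Cat K) F))"
proof -
  have F: "is_ifun K F" and D: "Dom (Cat K) F = fdom F" "Cod (Cat K) F = fcod F"
    using assms by (simp_all add: Cat_def)
  show "is_icat K (Dom (Cat K) F)" "is_icat K (Cod (Cat K) F)"
    "f0 F \<in> hom K (C0 (Dom (Cat K) F)) (C0 (Cod (Cat K) F))"
    "f1 F \<in> hom K (C1 (Dom (Cat K) F)) (C1 (Cod (Cat K) F))"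
    "src (Cod (Cat K) F) \<cdot> f1 F = f0 F \<cdot> src (Dom (Cat K) F)"
    "tgt (Cod (Cat K) F) \<cdot> f1 F = f0 F \<cdot> tgt (Dom (Cat K) F)"
    "f1 F \<cdot> idn (Dom (Cat K) F) = idn (Cod (Cat K) F) \<cdot> f0 F"
    "f1 F \<cdot> mul (Dom (Cat K) F)
      = icomp K (Cod (Cat K) F) (f1 F \<cdot> fstp (Dom (Cat K) F)) (f1 F \<cdot> sndp (Dom (Cat K) F))"
    unfolding D using F unfolding is_ifun_def Let_def by blast+
qed

lemma ifun_simps [simp]:
  assumes "F \<in> Ar (Cat K)"
  shows "is_icat K (Dom (Cat K) F)" "is_icat K (Cod (Cat K) F)"
    "f0 F \<in> Ar K" "f1 F \<in> Ar K" "Dom K (f0 F) = C0 (Dom (Cat K) F)" "Cod K (f0 F) = C0 (Cod (Cat K) F)"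
    "Dom K (f1 F) = C1 (Dom (Cat K) F)" "Cod K (f1 F) = C1 (Cod (Cat K) F)"
  using ifun_data[OF assms] by simp_all

lemma ifun_eqs [simp]:
  assumes "F \<in> Ar (Cat K)" "Cod (Cat K) F = B"
  shows "src B \<cdot> f1 F = f0 F \<cdot> src (Dom (Cat K) F)" "tgt B \<cdot> f1 F = f0 F \<cdot> tgt (Dom (Cat K) F)"
  using ifun_data[OF assms(1)] assms(2) by simp_all

lemma ifun_idn [simp]:
  assumes "F \<in> Ar (Cat K)" "Dom (Cat K) F = A"
  shows "f1 F \<cdot> idn A = idn (Cod (Cat K) F) \<cdot> f0 F"
  using ifun_data[OF assms(1)] assms(2) by simp_all

lemma ifun_elem [simp]:
  assumes F: "F \<in> Ar (Cat K)" "Cod (Cat K) F = B" and x: "x \<in> Ar K" "Cod K x = C1 (Dom (Cat K) F)"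
  shows "src B \<cdot> (f1 F \<cdot> x) = f0 F \<cdot> (src (Dom (Cat K) F) \<cdot> x)"
    "tgt B \<cdot> (f1 F \<cdot> x) = f0 F \<cdot> (tgt (Dom (Cat K) F) \<cdot> x)"
proof -
  have "is_icat K B" using F by auto
  note B = icat_simps[OF this]
  show "src B \<cdot> (f1 F \<cdot> x) = f0 F \<cdot> (src (Dom (Cat K) F) \<cdot> x)"
    by (rule cmp_eq_assoc) (use F x B in simp_all)
  show "tgt B \<cdot> (f1 F \<cdot> x) = f0 F \<cdot> (tgt (Dom (Cat K) F) \<cdot> x)"
    by (rule cmp_eq_assoc) (use F x B in simp_all)
qed

lemma ifun_idn_elem [simp]:
  assumes F: "F \<in> Ar (Cat K)" "Dom (Cat K) F = A" and x: "x \<in> Ar K" "Cod K x = C0 A"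
  shows "f1 F \<cdot> (idn A \<cdot> x) = idn (Cod (Cat K) F) \<cdot> (f0 F \<cdot> x)"
proof -
  have "is_icat K A" using F by auto
  then show ?thesis by (intro cmp_eq_assoc) (use F x in simp_all)
qed

lemma ifun_icomp [simp]:
  assumes F: "F \<in> Ar (Cat K)" "Dom (Cat K) F = A"
    and f: "f \<in> Ar K" "Cod K f = C1 A" and g: "g \<in> Ar K" "Cod K g = C1 A"
    and D: "Dom K f = Dom K g" and e: "tgt A \<cdot> f = src A \<cdot> g"
  shows "f1 F \<cdot> icomp K A f g = icomp K (Cod (Cat K) F) (f1 F \<cdot> f) (f1 F \<cdot> g)"
proof -
  let ?B = "Cod (Cat K) F"
  have A: "is_icat K A" using F by auto
  have B: "is_icat K ?B" using F by auto
  note P = icat_data(1)[OF A]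
  note G = icomp_generic[OF A]
  note Q = pair_pullback[OF P, of f g]
  let ?p = "pair K (fstp A) (sndp A) f g"
  have m: "f1 F \<cdot> mul A = icomp K ?B (f1 F \<cdot> fstp A) (f1 F \<cdot> sndp A)"
    using ifun_data[OF F(1)] F(2) by simp
  have t: "tgt ?B \<cdot> (f1 F \<cdot> fstp A) = src ?B \<cdot> (f1 F \<cdot> sndp A)" using F A G by simp
  have "f1 F \<cdot> (mul A \<cdot> ?p) = icomp K ?B (f1 F \<cdot> fstp A) (f1 F \<cdot> sndp A) \<cdot> ?p"
    by (rule cmp_eq_assoc1[OF m]) (use F G Q f g D e A in simp_all)
  also have "\<dots> = icomp K ?B ((f1 F \<cdot> fstp A) \<cdot> ?p) ((f1 F \<cdot> sndp A) \<cdot> ?p)"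
    by (rule icomp_cmp) (use F G Q f g D e A t in simp_all)
  also have "\<dots> = icomp K ?B (f1 F \<cdot> f) (f1 F \<cdot> g)"
    using F G Q f g D e A by simp
  finally show ?thesis by (simp add: icomp_def)
qed

text \<open>Again it is enough to look at generalised elements: the law for \<open>mul\<close> is the instance at the
  generic composable pair.\<close>

lemma ifunI:
  assumes A: "is_icat K A" and B: "is_icat K B"
    and u: "u \<in> Ar K" "Dom K u = C0 A" "Cod K u = C0 B" and v: "v \<in> Ar K" "Dom K v = C1 A" "Cod K v = C1 B"
    and s: "src B \<cdot> v = u \<cdot> src A" and t: "tgt B \<cdot> v = u \<cdot> tgt A" and i: "v \<cdot> idn A = idn B \<cdot> u"
    and c: "\<And>f g. f \<in> Ar K \<Longrightarrow> g \<in> Ar K \<Longrightarrow> Cod K f = C1 A \<Longrightarrow> Cod K g = C1 A \<Longrightarrow> Dom K f = Dom K g \<Longrightarrow>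
      tgt A \<cdot> f = src A \<cdot> g \<Longrightarrow> v \<cdot> icomp K A f g = icomp K B (v \<cdot> f) (v \<cdot> g)"
  obtains F where "F \<in> Ar (Cat K)" "Dom (Cat K) F = A" "Cod (Cat K) F = B" "f0 F = u" "f1 F = v"
proof -
  note G = icomp_generic[OF A]
  let ?F = "\<lparr>fdom = A, fcod = B, f0 = u, f1 = v\<rparr>"
  have "is_ifun K ?F"
    using A B u v s t i c[of "fstp A" "sndp A"] G by (simp add: is_ifun_def)
  then show ?thesis by (intro that[of ?F]) (simp_all add: Cat_def)
qed

lemma ifun_ext0:
  assumes "F \<in> Ar (Cat K)" "G \<in> Ar (Cat K)" "Dom (Cat K) F = Dom (Cat K) G" "Cod (Cat K) F = Cod (Cat K) G"
    "f0 F = f0 G" "f1 F = f1 G"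
  shows "F = G"
  using assms by (auto simp: Cat_def intro: ifun.equality)

lemma ifun_f0:
  assumes "F \<in> Ar (Cat K)"
  shows "f0 F = src (Cod (Cat K) F) \<cdot> (f1 F \<cdot> idn (Dom (Cat K) F))"
  using assms by simp

text \<open>Objects are recovered from their identity arrows.\<close>

lemma ifun_ext:
  assumes "F \<in> Ar (Cat K)" "G \<in> Ar (Cat K)" "Dom (Cat K) F = Dom (Cat K) G" "Cod (Cat K) F = Cod (Cat K) G"
    "f1 F = f1 G"
  shows "F = G"
proof (rule ifun_ext0)
  show "f0 F = f0 G" by (simp only: ifun_f0[OF assms(1)] ifun_f0[OF assms(2)] assms(3-5))
qed (use assms in simp_all)

lemma Cat_cmp:
  assumes "G \<in> Ar (Cat K)" "F \<in> Ar (Cat K)" "Dom (Cat K) G = Cod (Cat K) F"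
  shows "G \<odot> F \<in> Ar (Cat K)" "Dom (Cat K) (G \<odot> F) = Dom (Cat K) F" "Cod (Cat K) (G \<odot> F) = Cod (Cat K) G"
proof -
  obtain H where "H \<in> Ar (Cat K)" "Dom (Cat K) H = Dom (Cat K) F" "Cod (Cat K) H = Cod (Cat K) G"
      "f0 H = f0 G \<cdot> f0 F" "f1 H = f1 G \<cdot> f1 F"
    by (rule ifunI[of "Dom (Cat K) F" "Cod (Cat K) G" "f0 G \<cdot> f0 F" "f1 G \<cdot> f1 F"]) (use assms in simp_all)
  moreover from this have "H = G \<odot> F" by (intro ifun.equality) (auto simp: Cat_def)
  ultimately show "G \<odot> F \<in> Ar (Cat K)" "Dom (Cat K) (G \<odot> F) = Dom (Cat K) F" "Cod (Cat K) (G \<odot> F) = Cod (Cat K) G"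
    by auto
qed

lemma Cat_Ide:
  assumes "is_icat K A"
  shows "Ide (Cat K) A \<in> Ar (Cat K)" "Dom (Cat K) (Ide (Cat K) A) = A" "Cod (Cat K) (Ide (Cat K) A) = A"
proof -
  obtain H where "H \<in> Ar (Cat K)" "Dom (Cat K) H = A" "Cod (Cat K) H = A"
      "f0 H = Ide K (C0 A)" "f1 H = Ide K (C1 A)"
    by (rule ifunI[of A A "Ide K (C0 A)" "Ide K (C1 A)"]) (use assms in simp_all)
  moreover from this have "H = Ide (Cat K) A" by (intro ifun.equality) (auto simp: Cat_def)
  ultimately show "Ide (Cat K) A \<in> Ar (Cat K)" "Dom (Cat K) (Ide (Cat K) A) = A" "Cod (Cat K) (Ide (Cat K) A) = A"
    by auto
qed

end

sublocale topos \<subseteq> Cat: category "Cat K"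
proof
  show "f \<in> Ar (Cat K) \<Longrightarrow> Dom (Cat K) f \<in> Ob (Cat K)" for f by simp
  show "f \<in> Ar (Cat K) \<Longrightarrow> Cod (Cat K) f \<in> Ob (Cat K)" for f by simp
  show "a \<in> Ob (Cat K) \<Longrightarrow> Ide (Cat K) a \<in> hom (Cat K) a a" for a by (simp add: Cat_Ide)
  show "g \<in> hom (Cat K) b c \<Longrightarrow> f \<in> hom (Cat K) a b \<Longrightarrow> g \<odot> f \<in> hom (Cat K) a c" for f g a b c
    by (simp add: Cat_cmp)
  show "f \<in> hom (Cat K) a b \<Longrightarrow> f \<odot> Ide (Cat K) a = f" for f a b
    by (intro ifun_ext) (auto simp: Cat_cmp Cat_Ide)
  show "f \<in> hom (Cat K) a b \<Longrightarrow> Ide (Cat K) b \<odot> f = f" for f a b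
    by (intro ifun_ext) (auto simp: Cat_cmp Cat_Ide)
  show "h \<in> hom (Cat K) c d \<Longrightarrow> g \<in> hom (Cat K) b c \<Longrightarrow> f \<in> hom (Cat K) a b \<Longrightarrow> h \<odot> g \<odot> f = h \<odot> (g \<odot> f)"
    for h g f a b c d
    by (intro ifun_ext) (auto simp: Cat_cmp)
qed

context topos
begin

section \<open>Products of internal categories\<close>

lemma icat_product:
  assumes A: "is_icat K A" and B: "is_icat K B"
  obtains p q where "is_product (Cat K) A B p q" "is_product K (C0 A) (C0 B) (f0 p) (f0 q)"
    "is_product K (C1 A) (C1 B) (f1 p) (f1 q)"
proof -
  let ?N = "prod_ob K (C0 A) (C0 B)" and ?M = "prod_ob K (C1 A) (C1 B)"
  let ?p = "pr1 K (C1 A) (C1 B)" and ?q = "pr2 K (C1 A) (C1 B)"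
  let ?po = "pr1 K (C0 A) (C0 B)" and ?qo = "pr2 K (C0 A) (C0 B)"
  let ?s = "prod_ar K (src A) (src B)" and ?t = "prod_ar K (tgt A) (tgt B)" and ?i = "prod_ar K (idn A) (idn B)"
  let ?c = "\<lambda>f g. prod_pair K (icomp K A (?p \<cdot> f) (?p \<cdot> g)) (icomp K B (?q \<cdot> f) (?q \<cdot> g))"
  have prod_arE: "prod_ar K (u A) (u B) \<cdot> f = prod_pair K (u A \<cdot> (?p \<cdot> f)) (u B \<cdot> (?q \<cdot> f))"
    if "u A \<in> Ar K" "u B \<in> Ar K" "Dom K (u A) = C1 A" "Dom K (u B) = C1 B" "f \<in> Ar K" "Cod K f = ?M" for u f
    using that A B by (simp add: prod_ar_def)
  have tsD: "tgt A \<cdot> (?p \<cdot> f) = src A \<cdot> (?p \<cdot> g) \<and> tgt B \<cdot> (?q \<cdot> f) = src B \<cdot> (?q \<cdot> g)"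
    if "f \<in> Ar K" "g \<in> Ar K" "Cod K f = ?M" "Cod K g = ?M" "Dom K f = Dom K g" "?t \<cdot> f = ?s \<cdot> g" for f g
    using that A B prod_arE[of tgt f] prod_arE[of src g] by simp
  obtain P where P: "is_icat K P" "C0 P = ?N" "C1 P = ?M" "src P = ?s" "tgt P = ?t" "idn P = ?i"
    and Pc: "\<And>f g. f \<in> Ar K \<Longrightarrow> g \<in> Ar K \<Longrightarrow> Cod K f = ?M \<Longrightarrow> Cod K g = ?M \<Longrightarrow> Dom K f = Dom K g \<Longrightarrow>
      ?t \<cdot> f = ?s \<cdot> g \<Longrightarrow> icomp K P f g = ?c f g"
  proof (rule icat_exists[of ?N ?M ?s ?t ?i ?c])
    fix f g assume fg: "f \<in> Ar K" "g \<in> Ar K" "Cod K f = ?M" "Cod K g = ?M" "Dom K f = Dom K g" "?t \<cdot> f = ?s \<cdot> g"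
    note ts = tsD[OF fg]
    show "?c f g \<in> Ar K \<and> Dom K (?c f g) = Dom K g \<and> Cod K (?c f g) = ?M \<and>
        ?s \<cdot> ?c f g = ?s \<cdot> f \<and> ?t \<cdot> ?c f g = ?t \<cdot> g"
      using fg(1-5) ts A B prod_arE[of src f] prod_arE[of tgt g] by simp
    fix h assume h: "h \<in> Ar K" "Cod K h = Dom K g"
    show "?c f g \<cdot> h = ?c (f \<cdot> h) (g \<cdot> h)" using fg(1-5) ts A B h by simp
  next
    fix f assume f: "f \<in> Ar K" "Cod K f = ?M"
    show "?c (?i \<cdot> (?s \<cdot> f)) f = f \<and> ?c f (?i \<cdot> (?t \<cdot> f)) = f"
      using f A B prod_arE[of src f] prod_arE[of tgt f] by simp
  next
    fix f g h assume f: "f \<in> Ar K" "g \<in> Ar K" "h \<in> Ar K" "Cod K f = ?M" "Cod K g = ?M"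
      "Cod K h = ?M" "Dom K f = Dom K h" "Dom K g = Dom K h" "?t \<cdot> f = ?s \<cdot> g" "?t \<cdot> g = ?s \<cdot> h"
    show "?c (?c f g) h = ?c f (?c g h)" using f(1-8) tsD[of f g] tsD[of g h] f(9-10) A B by simp
  qed (use A B that in simp_all)
  obtain p where p: "p \<in> Ar (Cat K)" "Dom (Cat K) p = P" "Cod (Cat K) p = A" "f0 p = ?po" "f1 p = ?p"
  proof (rule ifunI[OF P(1) A, of ?po ?p])
    fix f g assume fg: "f \<in> Ar K" "g \<in> Ar K" "Cod K f = C1 P" "Cod K g = C1 P" "Dom K f = Dom K g" "tgt P \<cdot> f = src P \<cdot> g"
    then show "?p \<cdot> icomp K P f g = icomp K A (?p \<cdot> f) (?p \<cdot> g)"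
      using P A B Pc[of f g] tsD[of f g] by simp
  qed (use A B P that in simp_all)
  obtain q where q: "q \<in> Ar (Cat K)" "Dom (Cat K) q = P" "Cod (Cat K) q = B" "f0 q = ?qo" "f1 q = ?q"
  proof (rule ifunI[OF P(1) B, of ?qo ?q])
    fix f g assume fg: "f \<in> Ar K" "g \<in> Ar K" "Cod K f = C1 P" "Cod K g = C1 P" "Dom K f = Dom K g" "tgt P \<cdot> f = src P \<cdot> g"
    then show "?q \<cdot> icomp K P f g = icomp K B (?q \<cdot> f) (?q \<cdot> g)"
      using P A B Pc[of f g] tsD[of f g] by simp
  qed (use A B P that in simp_all)
  have "is_product (Cat K) A B p q" unfolding is_product_def
  proof (intro conjI ballI)
    fix X F G assume "X \<in> Ob (Cat K)" "F \<in> hom (Cat K) X A" "G \<in> hom (Cat K) X B"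
    then have X: "is_icat K X" and F: "F \<in> Ar (Cat K)" "Dom (Cat K) F = X" "Cod (Cat K) F = A"
      and G: "G \<in> Ar (Cat K)" "Dom (Cat K) G = X" "Cod (Cat K) G = B" by simp_all
    obtain H where H: "H \<in> Ar (Cat K)" "Dom (Cat K) H = X" "Cod (Cat K) H = P"
      "f0 H = prod_pair K (f0 F) (f0 G)" "f1 H = prod_pair K (f1 F) (f1 G)"
    proof (rule ifunI[OF X P(1), of "prod_pair K (f0 F) (f0 G)" "prod_pair K (f1 F) (f1 G)"])
      fix f g assume fg: "f \<in> Ar K" "g \<in> Ar K" "Cod K f = C1 X" "Cod K g = C1 X" "Dom K f = Dom K g" "tgt X \<cdot> f = src X \<cdot> g"
      have "icomp K P (prod_pair K (f1 F \<cdot> f) (f1 G \<cdot> f)) (prod_pair K (f1 F \<cdot> g) (f1 G \<cdot> g))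
          = ?c (prod_pair K (f1 F \<cdot> f) (f1 G \<cdot> f)) (prod_pair K (f1 F \<cdot> g) (f1 G \<cdot> g))"
        by (rule Pc) (use X A B P F G fg in simp_all)
      then show "prod_pair K (f1 F) (f1 G) \<cdot> icomp K X f g
          = icomp K P (prod_pair K (f1 F) (f1 G) \<cdot> f) (prod_pair K (f1 F) (f1 G) \<cdot> g)"
        using X A B P F G fg by simp
    qed (use X A B P F G that in simp_all)
    show "\<exists>!h. h \<in> hom (Cat K) X (Dom (Cat K) p) \<and> p \<odot> h = F \<and> q \<odot> h = G"
    proof (rule ex1I[of _ H])
      have "p \<odot> H = F" by (rule ifun_ext) (use p H F G X in simp_all)
      moreover have "q \<odot> H = G" by (rule ifun_ext) (use q H F G X in simp_all)
      ultimately show "H \<in> hom (Cat K) X (Dom (Cat K) p) \<and> p \<odot> H = F \<and> q \<odot> H = G" using p H by simp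
    next
      fix h assume h: "h \<in> hom (Cat K) X (Dom (Cat K) p) \<and> p \<odot> h = F \<and> q \<odot> h = G"
      then have e: "?p \<cdot> f1 h = f1 F" "?q \<cdot> f1 h = f1 G" using p q by auto
      have "f1 h = f1 H"
        by (rule prod_ext[of _ _ "C1 A" "C1 B"]) (use h H p P A B F G e in simp_all)
      then show "h = H" by (intro ifun_ext) (use h H p in simp_all)
    qed
  qed (use p q in simp_all)
  then show ?thesis using that[of p q] p q prod_pr[of "C0 A" "C0 B"] prod_pr[of "C1 A" "C1 B"] A B by simp
qed

end

sublocale topos \<subseteq> Cat: cartesian "Cat K"
proof
  fix a b assume "a \<in> Ob (Cat K)" "b \<in> Ob (Cat K)"
  then have "is_icat K a" "is_icat K b" by simp_all
  then obtain p q where "is_product (Cat K) a b p q" by (rule icat_product)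
  then show "\<exists>p q. is_product (Cat K) a b p q" by blast
qed

context topos
begin

text \<open>True of one product by construction, hence of all, as products of the same factors are
  isomorphic.\<close>

lemma Cat_product_components:
  assumes P': "is_product (Cat K) A B p' q'"
  shows "is_product K (C0 A) (C0 B) (f0 p') (f0 q')" "is_product K (C1 A) (C1 B) (f1 p') (f1 q')"
proof -
  have AB: "is_icat K A" "is_icat K B" using Cat.is_product_Ar[OF P'] by simp_all
  obtain p q where P: "is_product (Cat K) A B p q" and P0: "is_product K (C0 A) (C0 B) (f0 p) (f0 q)"
    and P1: "is_product K (C1 A) (C1 B) (f1 p) (f1 q)" by (rule icat_product[OF AB])
  have p: "p \<in> Ar (Cat K)" using Cat.is_product_Ar[OF P] by simp
  have p': "p' \<in> Ar (Cat K)" using Cat.is_product_Ar[OF P'] by simp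
  obtain h k where h: "h \<in> Ar (Cat K)" "Dom (Cat K) h = Dom (Cat K) p'" "Cod (Cat K) h = Dom (Cat K) p"
    and k: "k \<in> Ar (Cat K)" "Dom (Cat K) k = Dom (Cat K) p" "Cod (Cat K) k = Dom (Cat K) p'"
    and hk: "h \<odot> k = Ide (Cat K) (Dom (Cat K) p)" and kh: "k \<odot> h = Ide (Cat K) (Dom (Cat K) p')"
    and ph: "p \<odot> h = p'" "q \<odot> h = q'"
    by (rule Cat.product_unique[OF P P'])
  have hk0: "f0 h \<cdot> f0 k = Ide K (C0 (Dom (Cat K) p))" and hk1: "f1 h \<cdot> f1 k = Ide K (C1 (Dom (Cat K) p))"
    using arg_cong[OF hk, of f0] arg_cong[OF hk, of f1] by simp_all
  have kh0: "f0 k \<cdot> f0 h = Ide K (C0 (Dom (Cat K) p'))" and kh1: "f1 k \<cdot> f1 h = Ide K (C1 (Dom (Cat K) p'))"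
    using arg_cong[OF kh, of f0] arg_cong[OF kh, of f1] by simp_all
  have ph': "f0 p \<cdot> f0 h = f0 p'" "f0 q \<cdot> f0 h = f0 q'" "f1 p \<cdot> f1 h = f1 p'" "f1 q \<cdot> f1 h = f1 q'"
    using arg_cong[OF ph(1), of f0] arg_cong[OF ph(1), of f1] arg_cong[OF ph(2), of f0]
      arg_cong[OF ph(2), of f1] by simp_all
  show "is_product K (C0 A) (C0 B) (f0 p') (f0 q')"
    using product_iso[OF P0, of "f0 h" "f0 k"] h k hk0 kh0 p by (simp add: ph')
  show "is_product K (C1 A) (C1 B) (f1 p') (f1 q')"
    using product_iso[OF P1, of "f1 h" "f1 k"] h k hk1 kh1 p by (simp add: ph')
qed

end

context topos
begin

section \<open>Generalised elements of products\<close>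

definition el0 :: "('a, 'b) icat \<Rightarrow> ('a, 'b) icat \<Rightarrow> 'b \<Rightarrow> 'b \<Rightarrow> 'b" where
  "el0 A B x y = pair K (f0 (pr1 (Cat K) A B)) (f0 (pr2 (Cat K) A B)) x y"

definition el1 :: "('a, 'b) icat \<Rightarrow> ('a, 'b) icat \<Rightarrow> 'b \<Rightarrow> 'b \<Rightarrow> 'b" where
  "el1 A B x y = pair K (f1 (pr1 (Cat K) A B)) (f1 (pr2 (Cat K) A B)) x y"

lemma Cat_prod0:
  "is_icat K A \<Longrightarrow> is_icat K B \<Longrightarrow>
    is_product K (C0 A) (C0 B) (f0 (pr1 (Cat K) A B)) (f0 (pr2 (Cat K) A B))"
  using Cat_product_components(1)[OF Cat.prod_pr] by simp

lemma Cat_prod1: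
  "is_icat K A \<Longrightarrow> is_icat K B \<Longrightarrow>
    is_product K (C1 A) (C1 B) (f1 (pr1 (Cat K) A B)) (f1 (pr2 (Cat K) A B))"
  using Cat_product_components(2)[OF Cat.prod_pr] by simp

lemma el0_simps [simp]:
  assumes "is_icat K A" "is_icat K B" "x \<in> Ar K" "y \<in> Ar K" "Dom K x = Dom K y"
    "Cod K x = C0 A" "Cod K y = C0 B"
  shows "el0 A B x y \<in> Ar K" "Dom K (el0 A B x y) = Dom K y"
    "Cod K (el0 A B x y) = C0 (prod_ob (Cat K) A B)"
    "f0 (pr1 (Cat K) A B) \<cdot> el0 A B x y = x" "f0 (pr2 (Cat K) A B) \<cdot> el0 A B x y = y"
  using pair_product[OF Cat_prod0[OF assms(1,2)] assms(3,6,4,7,5)] assms(1,2)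
  by (simp_all add: el0_def)

lemma el1_simps [simp]:
  assumes "is_icat K A" "is_icat K B" "x \<in> Ar K" "y \<in> Ar K" "Dom K x = Dom K y"
    "Cod K x = C1 A" "Cod K y = C1 B"
  shows "el1 A B x y \<in> Ar K" "Dom K (el1 A B x y) = Dom K y"
    "Cod K (el1 A B x y) = C1 (prod_ob (Cat K) A B)"
    "f1 (pr1 (Cat K) A B) \<cdot> el1 A B x y = x" "f1 (pr2 (Cat K) A B) \<cdot> el1 A B x y = y"
  using pair_product[OF Cat_prod1[OF assms(1,2)] assms(3,6,4,7,5)] assms(1,2)
  by (simp_all add: el1_def)

lemma el0_cmp [simp]:
  assumes "is_icat K A" "is_icat K B" "x \<in> Ar K" "y \<in> Ar K" "Dom K x = Dom K y"
    "Cod K x = C0 A" "Cod K y = C0 B" "h \<in> Ar K" "Cod K h = Dom K y"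
  shows "el0 A B x y \<cdot> h = el0 A B (x \<cdot> h) (y \<cdot> h)"
  using pair_cmp[OF Cat_prod0[OF assms(1,2)] assms(3,6,4,7,5,8,9)] by (simp add: el0_def)

lemma el1_cmp [simp]:
  assumes "is_icat K A" "is_icat K B" "x \<in> Ar K" "y \<in> Ar K" "Dom K x = Dom K y"
    "Cod K x = C1 A" "Cod K y = C1 B" "h \<in> Ar K" "Cod K h = Dom K y"
  shows "el1 A B x y \<cdot> h = el1 A B (x \<cdot> h) (y \<cdot> h)"
  using pair_cmp[OF Cat_prod1[OF assms(1,2)] assms(3,6,4,7,5,8,9)] by (simp add: el1_def)

lemma el0_ext:
  assumes "is_icat K A" "is_icat K B" "z \<in> Ar K" "w \<in> Ar K" "Dom K z = Dom K w"
    "Cod K z = C0 (prod_ob (Cat K) A B)" "Cod K w = C0 (prod_ob (Cat K) A B)"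
    "f0 (pr1 (Cat K) A B) \<cdot> z = f0 (pr1 (Cat K) A B) \<cdot> w"
    "f0 (pr2 (Cat K) A B) \<cdot> z = f0 (pr2 (Cat K) A B) \<cdot> w"
  shows "z = w"
  by (rule product_ext[OF Cat_prod0[OF assms(1,2)]]) (use assms in simp_all)

lemma el1_ext:
  assumes "is_icat K A" "is_icat K B" "z \<in> Ar K" "w \<in> Ar K" "Dom K z = Dom K w"
    "Cod K z = C1 (prod_ob (Cat K) A B)" "Cod K w = C1 (prod_ob (Cat K) A B)"
    "f1 (pr1 (Cat K) A B) \<cdot> z = f1 (pr1 (Cat K) A B) \<cdot> w"
    "f1 (pr2 (Cat K) A B) \<cdot> z = f1 (pr2 (Cat K) A B) \<cdot> w"
  shows "z = w"
  by (rule product_ext[OF Cat_prod1[OF assms(1,2)]]) (use assms in simp_all)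

lemma el1_eta:
  assumes "is_icat K A" "is_icat K B" "z \<in> Ar K" "Cod K z = C1 (prod_ob (Cat K) A B)"
  shows "el1 A B (f1 (pr1 (Cat K) A B) \<cdot> z) (f1 (pr2 (Cat K) A B) \<cdot> z) = z"
  by (rule el1_ext[of A B]) (use assms in simp_all)

lemma src_el1 [simp]:
  assumes "is_icat K A" "is_icat K B" "x \<in> Ar K" "y \<in> Ar K" "Dom K x = Dom K y"
    "Cod K x = C1 A" "Cod K y = C1 B"
  shows "src (prod_ob (Cat K) A B) \<cdot> el1 A B x y = el0 A B (src A \<cdot> x) (src B \<cdot> y)"
    "tgt (prod_ob (Cat K) A B) \<cdot> el1 A B x y = el0 A B (tgt A \<cdot> x) (tgt B \<cdot> y)"
proof -
  have P: "is_icat K (prod_ob (Cat K) A B)" using Cat.prod_simps(7)[of A B] assms by simp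
  note e = ifun_elem[of "pr1 (Cat K) A B" A "el1 A B x y"] ifun_elem[of "pr2 (Cat K) A B" B "el1 A B x y"]
  show "src (prod_ob (Cat K) A B) \<cdot> el1 A B x y = el0 A B (src A \<cdot> x) (src B \<cdot> y)"
    by (rule el0_ext[of A B]) (use e[symmetric] assms P in \<open>simp_all del: ifun_elem\<close>)
  show "tgt (prod_ob (Cat K) A B) \<cdot> el1 A B x y = el0 A B (tgt A \<cdot> x) (tgt B \<cdot> y)"
    by (rule el0_ext[of A B]) (use e[symmetric] assms P in \<open>simp_all del: ifun_elem\<close>)
qed

lemma Cat_prod_icat [simp]: "is_icat K A \<Longrightarrow> is_icat K B \<Longrightarrow> is_icat K (prod_ob (Cat K) A B)"
  using Cat.prod_simps(7)[of A B] by simp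

lemma idn_el0 [simp]:
  assumes "is_icat K A" "is_icat K B" "x \<in> Ar K" "y \<in> Ar K" "Dom K x = Dom K y"
    "Cod K x = C0 A" "Cod K y = C0 B"
  shows "idn (prod_ob (Cat K) A B) \<cdot> el0 A B x y = el1 A B (idn A \<cdot> x) (idn B \<cdot> y)"
  by (rule el1_ext[of A B]) (use assms in simp_all)

lemma icomp_el1 [simp]:
  assumes "is_icat K A" "is_icat K B" "x \<in> Ar K" "y \<in> Ar K" "Dom K x = Dom K x'" "Dom K y = Dom K x'"
    "Dom K x' = Dom K y'" "x' \<in> Ar K" "y' \<in> Ar K"
    "Cod K x = C1 A" "Cod K y = C1 B" "Cod K x' = C1 A" "Cod K y' = C1 B"
    "tgt A \<cdot> x = src A \<cdot> x'" "tgt B \<cdot> y = src B \<cdot> y'"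
  shows "icomp K (prod_ob (Cat K) A B) (el1 A B x y) (el1 A B x' y')
    = el1 A B (icomp K A x x') (icomp K B y y')"
  by (rule el1_ext[of A B]) (use assms in simp_all)

lemma prod_pair_elem [simp]:
  assumes "F \<in> Ar (Cat K)" "G \<in> Ar (Cat K)" "Dom (Cat K) F = Dom (Cat K) G" "z \<in> Ar K"
  shows "Cod K z = C0 (Dom (Cat K) G) \<Longrightarrow>
      f0 (prod_pair (Cat K) F G) \<cdot> z = el0 (Cod (Cat K) F) (Cod (Cat K) G) (f0 F \<cdot> z) (f0 G \<cdot> z)"
    "Cod K z = C1 (Dom (Cat K) G) \<Longrightarrow>
      f1 (prod_pair (Cat K) F G) \<cdot> z = el1 (Cod (Cat K) F) (Cod (Cat K) G) (f1 F \<cdot> z) (f1 G \<cdot> z)"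
proof -
  let ?p = "pr1 (Cat K) (Cod (Cat K) F) (Cod (Cat K) G)" and ?q = "pr2 (Cat K) (Cod (Cat K) F) (Cod (Cat K) G)"
  have e: "?p \<odot> prod_pair (Cat K) F G = F" "?q \<odot> prod_pair (Cat K) F G = G" using assms by simp_all
  have e': "f0 ?p \<cdot> f0 (prod_pair (Cat K) F G) = f0 F" "f0 ?q \<cdot> f0 (prod_pair (Cat K) F G) = f0 G"
    "f1 ?p \<cdot> f1 (prod_pair (Cat K) F G) = f1 F" "f1 ?q \<cdot> f1 (prod_pair (Cat K) F G) = f1 G"
    using arg_cong[OF e(1), of f0] arg_cong[OF e(2), of f0] arg_cong[OF e(1), of f1] arg_cong[OF e(2), of f1]
    by simp_all
  show "f0 (prod_pair (Cat K) F G) \<cdot> z = el0 (Cod (Cat K) F) (Cod (Cat K) G) (f0 F \<cdot> z) (f0 G \<cdot> z)"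
    if z: "Cod K z = C0 (Dom (Cat K) G)"
    by (rule el0_ext[of "Cod (Cat K) F" "Cod (Cat K) G"])
      (use assms z in \<open>simp_all add: cmp_eq_assoc1[OF e'(1)] cmp_eq_assoc1[OF e'(2)]\<close>)
  show "f1 (prod_pair (Cat K) F G) \<cdot> z = el1 (Cod (Cat K) F) (Cod (Cat K) G) (f1 F \<cdot> z) (f1 G \<cdot> z)"
    if z: "Cod K z = C1 (Dom (Cat K) G)"
    by (rule el1_ext[of "Cod (Cat K) F" "Cod (Cat K) G"])
      (use assms z in \<open>simp_all add: cmp_eq_assoc1[OF e'(3)] cmp_eq_assoc1[OF e'(4)]\<close>)
qed

lemma prod_ar_elem [simp]:
  assumes "F \<in> Ar (Cat K)" "G \<in> Ar (Cat K)" "Dom (Cat K) F = A" "Dom (Cat K) G = B"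
    "x \<in> Ar K" "y \<in> Ar K" "Dom K x = Dom K y"
  shows "Cod K x = C0 A \<Longrightarrow> Cod K y = C0 B \<Longrightarrow>
      f0 (prod_ar (Cat K) F G) \<cdot> el0 A B x y = el0 (Cod (Cat K) F) (Cod (Cat K) G) (f0 F \<cdot> x) (f0 G \<cdot> y)"
    "Cod K x = C1 A \<Longrightarrow> Cod K y = C1 B \<Longrightarrow>
      f1 (prod_ar (Cat K) F G) \<cdot> el1 A B x y = el1 (Cod (Cat K) F) (Cod (Cat K) G) (f1 F \<cdot> x) (f1 G \<cdot> y)"
proof -
  have "is_icat K A" "is_icat K B" using assms by auto
  then show "Cod K x = C0 A \<Longrightarrow> Cod K y = C0 B \<Longrightarrow>
      f0 (prod_ar (Cat K) F G) \<cdot> el0 A B x y = el0 (Cod (Cat K) F) (Cod (Cat K) G) (f0 F \<cdot> x) (f0 G \<cdot> y)"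
    "Cod K x = C1 A \<Longrightarrow> Cod K y = C1 B \<Longrightarrow>
      f1 (prod_ar (Cat K) F G) \<cdot> el1 A B x y = el1 (Cod (Cat K) F) (Cod (Cat K) G) (f1 F \<cdot> x) (f1 G \<cdot> y)"
    using assms by (simp_all add: prod_ar_def)
qed

lemma ifun_prod_ext:
  assumes A: "is_icat K A" and B: "is_icat K B"
    and F: "F \<in> Ar (Cat K)" "Dom (Cat K) F = prod_ob (Cat K) A B"
    and G: "G \<in> Ar (Cat K)" "Dom (Cat K) G = prod_ob (Cat K) A B" "Cod (Cat K) F = Cod (Cat K) G"
    and e: "\<And>x y. x \<in> Ar K \<Longrightarrow> y \<in> Ar K \<Longrightarrow> Dom K x = Dom K y \<Longrightarrow> Cod K x = C1 A \<Longrightarrow> Cod K y = C1 B \<Longrightarrow>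
      f1 F \<cdot> el1 A B x y = f1 G \<cdot> el1 A B x y"
  shows "F = G"
proof (rule ifun_ext)
  let ?i = "Ide K (C1 (prod_ob (Cat K) A B))"
  have i: "el1 A B (f1 (pr1 (Cat K) A B) \<cdot> ?i) (f1 (pr2 (Cat K) A B) \<cdot> ?i) = ?i"
    by (rule el1_eta) (use A B in simp_all)
  have "f1 F \<cdot> ?i = f1 G \<cdot> ?i"
    by (subst (1 2) i[symmetric], rule e) (use A B in simp_all)
  then show "f1 F = f1 G" using F G A B by simp
qed (use F G in simp_all)

section \<open>Representable presheaves\<close>

text \<open>A presheaf is given by its sets of sections, all inside one type, and by the action of arrows
  on sections. Limits of representable presheaves are representable; this yields the objects of
  functors and of natural transformations without any computation with limits.\<close>

definition representable :: "('a \<Rightarrow> 'z set) \<Rightarrow> ('z \<Rightarrow> 'b \<Rightarrow> 'z) \<Rightarrow> bool" where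
  "representable S act \<longleftrightarrow>
     (\<forall>X z h. z \<in> S X \<longrightarrow> h \<in> Ar K \<longrightarrow> Cod K h = X \<longrightarrow> act z h \<in> S (Dom K h)) \<and>
     (\<forall>X z h k. z \<in> S X \<longrightarrow> h \<in> Ar K \<longrightarrow> Cod K h = X \<longrightarrow> k \<in> Ar K \<longrightarrow> Cod K k = Dom K h \<longrightarrow>
        act (act z h) k = act z (h \<cdot> k)) \<and>
     (\<exists>R\<in>Ob K. \<exists>u\<in>S R. \<forall>X\<in>Ob K. \<forall>z\<in>S X. \<exists>!f. f \<in> hom K X R \<and> act u f = z)"

lemma representable_act:
  "representable S act \<Longrightarrow> z \<in> S X \<Longrightarrow> h \<in> Ar K \<Longrightarrow> Cod K h = X \<Longrightarrow> act z h \<in> S (Dom K h)"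
  unfolding representable_def by blast

lemma representable_act_act:
  "representable S act \<Longrightarrow> z \<in> S X \<Longrightarrow> h \<in> Ar K \<Longrightarrow> Cod K h = X \<Longrightarrow> k \<in> Ar K \<Longrightarrow>
    Cod K k = Dom K h \<Longrightarrow> act (act z h) k = act z (h \<cdot> k)"
  unfolding representable_def by blast

lemma representableE:
  assumes "representable S act"
  obtains R u where "R \<in> Ob K" "u \<in> S R"
    "\<And>X z. X \<in> Ob K \<Longrightarrow> z \<in> S X \<Longrightarrow> \<exists>!f. f \<in> hom K X R \<and> act u f = z"
proof -
  have "\<exists>R\<in>Ob K. \<exists>u\<in>S R. \<forall>X\<in>Ob K. \<forall>z\<in>S X. \<exists>!f. f \<in> hom K X R \<and> act u f = z"
    using assms unfolding representable_def by (elim conjE)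
  then obtain R u where R: "R \<in> Ob K" "u \<in> S R"
    and uni: "\<forall>X\<in>Ob K. \<forall>z\<in>S X. \<exists>!f. f \<in> hom K X R \<and> act u f = z" by (elim bexE)
  show ?thesis
  proof (rule that[OF R])
    fix X z assume X: "X \<in> Ob K" and z: "z \<in> S X"
    show "\<exists>!f. f \<in> hom K X R \<and> act u f = z" by (rule bspec[OF bspec[OF uni X] z])
  qed
qed

lemma representable_hom:
  assumes "R \<in> Ob K"
  shows "representable (\<lambda>X. hom K X R) (\<cdot>)"
  unfolding representable_def
proof (intro conjI)
  show "\<exists>R'\<in>Ob K. \<exists>u\<in>hom K R' R. \<forall>X\<in>Ob K. \<forall>z\<in>hom K X R. \<exists>!f. f \<in> hom K X R' \<and> u \<cdot> f = z"
    by (rule bexI[of _ R], rule bexI[of _ "Ide K R"]) (use assms in auto)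
qed auto

lemma representable_exp:
  assumes T: "T \<in> Ob K" and V: "V \<in> Ob K"
  shows "representable (\<lambda>X. hom K (prod_ob K X T) V) (\<lambda>F h. F \<cdot> prod_ar K h (Ide K T))"
  unfolding representable_def
proof (intro conjI)
  show "\<exists>R\<in>Ob K. \<exists>u\<in>hom K (prod_ob K R T) V. \<forall>X\<in>Ob K. \<forall>z\<in>hom K (prod_ob K X T) V.
      \<exists>!f. f \<in> hom K X R \<and> u \<cdot> prod_ar K f (Ide K T) = z"
    using exponential[OF T V] unfolding is_exponential_def by blast
qed (use T V in auto)

lemma representable_Times:
  assumes R1: "representable S1 act1" and R2: "representable S2 act2"
  shows "representable (\<lambda>X. S1 X \<times> S2 X) (\<lambda>z h. (act1 (fst z) h, act2 (snd z) h))"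
  unfolding representable_def
proof (intro conjI allI impI)
  obtain Q1 u1 where u1: "Q1 \<in> Ob K" "u1 \<in> S1 Q1"
    "\<And>X z. X \<in> Ob K \<Longrightarrow> z \<in> S1 X \<Longrightarrow> \<exists>!f. f \<in> hom K X Q1 \<and> act1 u1 f = z"
    using representableE[OF R1] by blast
  obtain Q2 u2 where u2: "Q2 \<in> Ob K" "u2 \<in> S2 Q2"
    "\<And>X z. X \<in> Ob K \<Longrightarrow> z \<in> S2 X \<Longrightarrow> \<exists>!f. f \<in> hom K X Q2 \<and> act2 u2 f = z"
    using representableE[OF R2] by blast
  let ?p = "pr1 K Q1 Q2" and ?q = "pr2 K Q1 Q2" and ?R = "prod_ob K Q1 Q2"
  let ?act = "\<lambda>z h. (act1 (fst z) h, act2 (snd z) h)"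
  let ?u = "(act1 u1 ?p, act2 u2 ?q)"
  have uA: "act1 (act1 u1 ?p) f = act1 u1 (?p \<cdot> f)" "act2 (act2 u2 ?q) f = act2 u2 (?q \<cdot> f)"
    if "f \<in> Ar K" "Cod K f = ?R" for f
    using representable_act_act[OF R1 u1(2), of ?p f] representable_act_act[OF R2 u2(2), of ?q f] that u1(1) u2(1)
    by simp_all
  show "\<exists>R\<in>Ob K. \<exists>u\<in>S1 R \<times> S2 R. \<forall>X\<in>Ob K. \<forall>z\<in>S1 X \<times> S2 X. \<exists>!f. f \<in> hom K X R \<and> ?act u f = z"
  proof (rule bexI[of _ ?R], rule bexI[of _ ?u], intro ballI)
    fix X z assume X: "X \<in> Ob K" and z: "z \<in> S1 X \<times> S2 X"
    from z have z1: "fst z \<in> S1 X" and z2: "snd z \<in> S2 X" by auto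
    obtain f1 where f1: "f1 \<in> hom K X Q1" "act1 u1 f1 = fst z" using u1(3)[OF X z1] by blast
    obtain f2 where f2: "f2 \<in> hom K X Q2" "act2 u2 f2 = snd z" using u2(3)[OF X z2] by blast
    show "\<exists>!f. f \<in> hom K X ?R \<and> ?act ?u f = z"
    proof (rule ex1I[of _ "prod_pair K f1 f2"])
      show "prod_pair K f1 f2 \<in> hom K X ?R \<and> ?act ?u (prod_pair K f1 f2) = z"
        using f1 f2 uA[of "prod_pair K f1 f2"] u1(1) u2(1) by (simp add: prod_eq_iff)
    next
      fix f assume f: "f \<in> hom K X ?R \<and> ?act ?u f = z"
      then have "act1 u1 (?p \<cdot> f) = fst z" "act2 u2 (?q \<cdot> f) = snd z" using uA[of f] by auto
      then have "?p \<cdot> f = f1" "?q \<cdot> f = f2"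
        using u1(3)[OF X z1] u2(3)[OF X z2] f1 f2 f u1(1) u2(1) by auto
      then show "f = prod_pair K f1 f2"
        using f f1 f2 u1(1) u2(1) prod_pair_eta[of f Q1 Q2] by simp
    qed
  qed (use u1 u2 representable_act[OF R1 u1(2), of ?p] representable_act[OF R2 u2(2), of ?q] in auto)
next
  fix X z h assume "z \<in> S1 X \<times> S2 X" "h \<in> Ar K" "Cod K h = X"
  then show "(act1 (fst z) h, act2 (snd z) h) \<in> S1 (Dom K h) \<times> S2 (Dom K h)"
    using representable_act[OF R1, of "fst z" X h] representable_act[OF R2, of "snd z" X h] by auto
next
  fix X z h k assume "z \<in> S1 X \<times> S2 X" "h \<in> Ar K" "Cod K h = X" "k \<in> Ar K" "Cod K k = Dom K h"
  then show "(act1 (fst (act1 (fst z) h, act2 (snd z) h)) k, act2 (snd (act1 (fst z) h, act2 (snd z) h)) k)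
      = (act1 (fst z) (h \<cdot> k), act2 (snd z) (h \<cdot> k))"
    using representable_act_act[OF R1, of "fst z" X h k] representable_act_act[OF R2, of "snd z" X h k] by auto
qed

text \<open>A universally quantified equation between families of arrows \<open>X \<times> T \<rightarrow> V\<close> cuts out a
  representable presheaf: transposed to \<open>V\<^sup>T\<close>, it becomes an equation between two arrows out of
  the representing object, and their equalizer represents it.\<close>

lemma representable_eq:
  assumes R: "representable S act" and T: "T \<in> Ob K" and V: "V \<in> Ob K"
    and typed: "\<And>X z x y. z \<in> S X \<Longrightarrow> x \<in> Ar K \<Longrightarrow> Cod K x = X \<Longrightarrow> y \<in> Ar K \<Longrightarrow> Cod K y = T \<Longrightarrow>
      Dom K x = Dom K y \<Longrightarrow> \<phi> z x y \<in> hom K (Dom K y) V \<and> \<psi> z x y \<in> hom K (Dom K y) V"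
    and nat: "\<And>X z x y k. z \<in> S X \<Longrightarrow> x \<in> Ar K \<Longrightarrow> Cod K x = X \<Longrightarrow> y \<in> Ar K \<Longrightarrow> Cod K y = T \<Longrightarrow>
      Dom K x = Dom K y \<Longrightarrow> k \<in> Ar K \<Longrightarrow> Cod K k = Dom K y \<Longrightarrow>
      \<phi> z x y \<cdot> k = \<phi> z (x \<cdot> k) (y \<cdot> k) \<and> \<psi> z x y \<cdot> k = \<psi> z (x \<cdot> k) (y \<cdot> k)"
    and act: "\<And>X z h x y. z \<in> S X \<Longrightarrow> h \<in> Ar K \<Longrightarrow> Cod K h = X \<Longrightarrow> x \<in> Ar K \<Longrightarrow> Cod K x = Dom K h \<Longrightarrow>
      y \<in> Ar K \<Longrightarrow> Cod K y = T \<Longrightarrow> Dom K x = Dom K y \<Longrightarrow>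
      \<phi> (act z h) x y = \<phi> z (h \<cdot> x) y \<and> \<psi> (act z h) x y = \<psi> z (h \<cdot> x) y"
  shows "representable (\<lambda>X. {z \<in> S X. \<forall>x y. x \<in> Ar K \<longrightarrow> Cod K x = X \<longrightarrow> y \<in> Ar K \<longrightarrow> Cod K y = T \<longrightarrow>
      Dom K x = Dom K y \<longrightarrow> \<phi> z x y = \<psi> z x y}) act"
    (is "representable ?S act")
  unfolding representable_def
proof (intro conjI allI impI)
  obtain Q u where Q: "Q \<in> Ob K" and u: "u \<in> S Q"
    and uni: "\<And>X z. X \<in> Ob K \<Longrightarrow> z \<in> S X \<Longrightarrow> \<exists>!f. f \<in> hom K X Q \<and> act u f = z"
    using representableE[OF R] by blast
  let ?p = "pr1 K Q T" and ?q = "pr2 K Q T"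
  have ty: "\<phi> u ?p ?q \<in> hom K (prod_ob K Q T) V" "\<psi> u ?p ?q \<in> hom K (prod_ob K Q T) V"
    using typed[OF u, of ?p ?q] Q T by auto
  have el: "\<phi> u x y = \<phi> u ?p ?q \<cdot> prod_pair K x y" "\<psi> u x y = \<psi> u ?p ?q \<cdot> prod_pair K x y"
    if "x \<in> Ar K" "Cod K x = Q" "y \<in> Ar K" "Cod K y = T" "Dom K x = Dom K y" for x y
    using nat[OF u, of ?p ?q "prod_pair K x y"] Q T that by auto
  let ?c = "curry_ar K Q T V (\<phi> u ?p ?q)" and ?d = "curry_ar K Q T V (\<psi> u ?p ?q)"
  have cd: "?c \<in> Ar K" "?d \<in> Ar K" "Dom K ?c = Q" "Dom K ?d = Q" "Cod K ?c = exp_ob K T V" "Cod K ?d = exp_ob K T V"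
    "uncurry T V ?c = \<phi> u ?p ?q" "uncurry T V ?d = \<psi> u ?p ?q"
    using ty Q T V by simp_all
  obtain n where n: "n \<in> Ar K" "Cod K n = Q" "is_mono K n" "?c \<cdot> n = ?d \<cdot> n"
    and nu: "\<And>v. v \<in> Ar K \<Longrightarrow> Cod K v = Q \<Longrightarrow> ?c \<cdot> v = ?d \<cdot> v \<Longrightarrow>
      \<exists>k\<in>Ar K. Dom K k = Dom K v \<and> Cod K k = Dom K n \<and> n \<cdot> k = v"
    by (rule equalizer[of ?c ?d, unfolded cd(3)]) (use cd that in auto)
  have aA: "act (act u n) f = act u (n \<cdot> f)" if "f \<in> Ar K" "Cod K f = Dom K n" for f
    using representable_act_act[OF R u n(1,2) that] .
  have "act u n \<in> ?S (Dom K n)"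
  proof (intro CollectI conjI allI impI)
    show "act u n \<in> S (Dom K n)" using representable_act[OF R u n(1,2)] .
    fix x y assume xy: "x \<in> Ar K" "Cod K x = Dom K n" "y \<in> Ar K" "Cod K y = T" "Dom K x = Dom K y"
    have ucd: "uncurry T V (?c \<cdot> n) = uncurry T V (?d \<cdot> n)" by (simp only: n(4))
    have "\<phi> u ?p ?q \<cdot> prod_ar K n (Ide K T) = \<psi> u ?p ?q \<cdot> prod_ar K n (Ide K T)"
      using ucd uncurry_cmp[OF T V cd(1,5), of n] uncurry_cmp[OF T V cd(2,6), of n] cd n by simp
    then have "\<phi> u ?p ?q \<cdot> (prod_ar K n (Ide K T) \<cdot> prod_pair K x y)
        = \<psi> u ?p ?q \<cdot> (prod_ar K n (Ide K T) \<cdot> prod_pair K x y)"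
      by (rule cmp_eq_assoc) (use ty n xy Q T in simp_all)
    then have "\<phi> u (n \<cdot> x) y = \<psi> u (n \<cdot> x) y"
      using el[of "n \<cdot> x" y] n xy T by simp
    then show "\<phi> (act u n) x y = \<psi> (act u n) x y"
      using act[OF u n(1,2) xy] by simp
  qed
  moreover have "\<exists>!f. f \<in> hom K X (Dom K n) \<and> act (act u n) f = z" if X: "X \<in> Ob K" and z: "z \<in> ?S X" for X z
  proof -
    from z have zS: "z \<in> S X" and ze: "\<And>x y. x \<in> Ar K \<Longrightarrow> Cod K x = X \<Longrightarrow> y \<in> Ar K \<Longrightarrow> Cod K y = T \<Longrightarrow>
      Dom K x = Dom K y \<Longrightarrow> \<phi> z x y = \<psi> z x y" by auto
    obtain f where f: "f \<in> Ar K" "Dom K f = X" "Cod K f = Q" "act u f = z" using uni[OF X zS] by auto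
    have "?c \<cdot> f = ?d \<cdot> f"
    proof (rule uncurry_inj[of T V])
      have "\<phi> u (f \<cdot> pr1 K X T) (pr2 K X T) = \<psi> u (f \<cdot> pr1 K X T) (pr2 K X T)"
        using act[OF u f(1,3), of "pr1 K X T" "pr2 K X T"] ze[of "pr1 K X T" "pr2 K X T"] f X T by auto
      then have "\<phi> u ?p ?q \<cdot> prod_pair K (f \<cdot> pr1 K X T) (pr2 K X T)
          = \<psi> u ?p ?q \<cdot> prod_pair K (f \<cdot> pr1 K X T) (pr2 K X T)"
        using el[of "f \<cdot> pr1 K X T" "pr2 K X T"] f X T by simp
      then show "uncurry T V (?c \<cdot> f) = uncurry T V (?d \<cdot> f)"
        using uncurry_cmp[OF T V cd(1,5), of f] uncurry_cmp[OF T V cd(2,6), of f] cd f T X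
        by (simp add: prod_ar_def)
    qed (use cd f T V in simp_all)
    then obtain k where k: "k \<in> Ar K" "Dom K k = X" "Cod K k = Dom K n" "n \<cdot> k = f"
      using nu[of f] f by auto
    show ?thesis
    proof (rule ex1I[of _ k])
      show "k \<in> hom K X (Dom K n) \<and> act (act u n) k = z" using k f aA[of k] by simp
      fix k' assume k': "k' \<in> hom K X (Dom K n) \<and> act (act u n) k' = z"
      then have "act u (n \<cdot> k') = z" using aA[of k'] by simp
      then have "n \<cdot> k' = f" using uni[OF X zS] f k' n by auto
      then show "k' = k" using monoD[OF n(3), of k' k] k k' by simp
    qed
  qed
  ultimately show "\<exists>R\<in>Ob K. \<exists>u\<in>?S R. \<forall>X\<in>Ob K. \<forall>z\<in>?S X. \<exists>!f. f \<in> hom K X R \<and> act u f = z"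
    using n(1) Dom_Ob by blast
next
  fix X z h assume z: "z \<in> ?S X" and h: "h \<in> Ar K" "Cod K h = X"
  from z have zS: "z \<in> S X" and ze: "\<And>x y. x \<in> Ar K \<Longrightarrow> Cod K x = X \<Longrightarrow> y \<in> Ar K \<Longrightarrow> Cod K y = T \<Longrightarrow>
      Dom K x = Dom K y \<Longrightarrow> \<phi> z x y = \<psi> z x y" by auto
  show "act z h \<in> ?S (Dom K h)"
  proof (intro CollectI conjI allI impI)
    show "act z h \<in> S (Dom K h)" by (rule representable_act[OF R zS h])
    fix x y assume xy: "x \<in> Ar K" "Cod K x = Dom K h" "y \<in> Ar K" "Cod K y = T" "Dom K x = Dom K y"
    show "\<phi> (act z h) x y = \<psi> (act z h) x y"
      using act[OF zS h xy] ze[of "h \<cdot> x" y] xy h by simp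
  qed
next
  fix X z h k assume "z \<in> ?S X" "h \<in> Ar K" "Cod K h = X" "k \<in> Ar K" "Cod K k = Dom K h"
  then show "act (act z h) k = act z (h \<cdot> k)" using representable_act_act[OF R, of z X h k] by simp
qed

end

context topos
begin

section \<open>Exponentials of internal categories\<close>

text \<open>The internal functors \<open>dis X \<times> A \<rightarrow> B\<close> in terms of their object and arrow parts. Preservation of
  composition is formulated at the object \<open>C2 A\<close> of composable pairs, so that every clause has the
  shape of \<open>representable_eq\<close>.\<close>

definition fun_family :: "('a, 'b) icat \<Rightarrow> ('a, 'b) icat \<Rightarrow> 'a \<Rightarrow> 'b \<Rightarrow> 'b \<Rightarrow> bool" where
  "fun_family A B X F0 F1 \<longleftrightarrow>
     F0 \<in> hom K (prod_ob K X (C0 A)) (C0 B) \<and> F1 \<in> hom K (prod_ob K X (C1 A)) (C1 B) \<and>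
     (\<forall>x a. x \<in> Ar K \<longrightarrow> Cod K x = X \<longrightarrow> a \<in> Ar K \<longrightarrow> Cod K a = C1 A \<longrightarrow> Dom K x = Dom K a \<longrightarrow>
        src B \<cdot> (F1 \<cdot> prod_pair K x a) = F0 \<cdot> prod_pair K x (src A \<cdot> a)) \<and>
     (\<forall>x a. x \<in> Ar K \<longrightarrow> Cod K x = X \<longrightarrow> a \<in> Ar K \<longrightarrow> Cod K a = C1 A \<longrightarrow> Dom K x = Dom K a \<longrightarrow>
        tgt B \<cdot> (F1 \<cdot> prod_pair K x a) = F0 \<cdot> prod_pair K x (tgt A \<cdot> a)) \<and>
     (\<forall>x a. x \<in> Ar K \<longrightarrow> Cod K x = X \<longrightarrow> a \<in> Ar K \<longrightarrow> Cod K a = C0 A \<longrightarrow> Dom K x = Dom K a \<longrightarrow>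
        F1 \<cdot> prod_pair K x (idn A \<cdot> a) = idn B \<cdot> (F0 \<cdot> prod_pair K x a)) \<and>
     (\<forall>x a. x \<in> Ar K \<longrightarrow> Cod K x = X \<longrightarrow> a \<in> Ar K \<longrightarrow> Cod K a = C2 A \<longrightarrow> Dom K x = Dom K a \<longrightarrow>
        F1 \<cdot> prod_pair K x (mul A \<cdot> a)
          = icomp K B (F1 \<cdot> prod_pair K x (fstp A \<cdot> a)) (F1 \<cdot> prod_pair K x (sndp A \<cdot> a)))"

lemma fun_familyD:
  assumes "fun_family A B X F0 F1" and A: "is_icat K A"
  shows "F0 \<in> Ar K" "Dom K F0 = prod_ob K X (C0 A)" "Cod K F0 = C0 B"
    "F1 \<in> Ar K" "Dom K F1 = prod_ob K X (C1 A)" "Cod K F1 = C1 B"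
    "\<And>x a. x \<in> Ar K \<Longrightarrow> Cod K x = X \<Longrightarrow> a \<in> Ar K \<Longrightarrow> Cod K a = C1 A \<Longrightarrow> Dom K x = Dom K a \<Longrightarrow>
      src B \<cdot> (F1 \<cdot> prod_pair K x a) = F0 \<cdot> prod_pair K x (src A \<cdot> a)"
    "\<And>x a. x \<in> Ar K \<Longrightarrow> Cod K x = X \<Longrightarrow> a \<in> Ar K \<Longrightarrow> Cod K a = C1 A \<Longrightarrow> Dom K x = Dom K a \<Longrightarrow>
      tgt B \<cdot> (F1 \<cdot> prod_pair K x a) = F0 \<cdot> prod_pair K x (tgt A \<cdot> a)"
    "\<And>x a. x \<in> Ar K \<Longrightarrow> Cod K x = X \<Longrightarrow> a \<in> Ar K \<Longrightarrow> Cod K a = C0 A \<Longrightarrow> Dom K x = Dom K a \<Longrightarrow>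
      F1 \<cdot> prod_pair K x (idn A \<cdot> a) = idn B \<cdot> (F0 \<cdot> prod_pair K x a)"
    "\<And>x a b. x \<in> Ar K \<Longrightarrow> Cod K x = X \<Longrightarrow> a \<in> Ar K \<Longrightarrow> Cod K a = C1 A \<Longrightarrow> b \<in> Ar K \<Longrightarrow> Cod K b = C1 A \<Longrightarrow>
      Dom K x = Dom K b \<Longrightarrow> Dom K a = Dom K b \<Longrightarrow> tgt A \<cdot> a = src A \<cdot> b \<Longrightarrow>
      F1 \<cdot> prod_pair K x (icomp K A a b) = icomp K B (F1 \<cdot> prod_pair K x a) (F1 \<cdot> prod_pair K x b)"
proof -
  note * = assms(1)[unfolded fun_family_def]
  show "F0 \<in> Ar K" "Dom K F0 = prod_ob K X (C0 A)" "Cod K F0 = C0 B"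
    "F1 \<in> Ar K" "Dom K F1 = prod_ob K X (C1 A)" "Cod K F1 = C1 B" using * by simp_all
  fix x a assume x: "x \<in> Ar K" "Cod K x = X" and a: "a \<in> Ar K"
  show "Cod K a = C1 A \<Longrightarrow> Dom K x = Dom K a \<Longrightarrow> src B \<cdot> (F1 \<cdot> prod_pair K x a) = F0 \<cdot> prod_pair K x (src A \<cdot> a)"
    "Cod K a = C1 A \<Longrightarrow> Dom K x = Dom K a \<Longrightarrow> tgt B \<cdot> (F1 \<cdot> prod_pair K x a) = F0 \<cdot> prod_pair K x (tgt A \<cdot> a)"
    "Cod K a = C0 A \<Longrightarrow> Dom K x = Dom K a \<Longrightarrow> F1 \<cdot> prod_pair K x (idn A \<cdot> a) = idn B \<cdot> (F0 \<cdot> prod_pair K x a)"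
    using * x a by blast+
  fix b assume b: "b \<in> Ar K" "Cod K b = C1 A" "Dom K x = Dom K b" and ab: "Cod K a = C1 A" "Dom K a = Dom K b" "tgt A \<cdot> a = src A \<cdot> b"
  note I = icat_data[OF A]
  have aC: "Cod K a = Dom K (tgt A)" and bC: "Cod K b = Dom K (src A)" using A ab b by simp_all
  note Q = pair_pullback[OF I(1) a aC b(1) bC ab(2,3)]
  let ?p = "pair K (fstp A) (sndp A) a b"
  have "\<And>c. c \<in> Ar K \<Longrightarrow> Cod K c = C2 A \<Longrightarrow> Dom K x = Dom K c \<Longrightarrow> F1 \<cdot> prod_pair K x (mul A \<cdot> c)
          = icomp K B (F1 \<cdot> prod_pair K x (fstp A \<cdot> c)) (F1 \<cdot> prod_pair K x (sndp A \<cdot> c))"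
    using * x by blast
  from this[of ?p] show "F1 \<cdot> prod_pair K x (icomp K A a b) = icomp K B (F1 \<cdot> prod_pair K x a) (F1 \<cdot> prod_pair K x b)"
    using Q b I by (simp add: icomp_def[of K A])
qed

lemma fun_familyI:
  assumes "is_icat K A" "F0 \<in> Ar K" "Dom K F0 = prod_ob K X (C0 A)" "Cod K F0 = C0 B"
    "F1 \<in> Ar K" "Dom K F1 = prod_ob K X (C1 A)" "Cod K F1 = C1 B"
    "\<And>x a. x \<in> Ar K \<Longrightarrow> Cod K x = X \<Longrightarrow> a \<in> Ar K \<Longrightarrow> Cod K a = C1 A \<Longrightarrow> Dom K x = Dom K a \<Longrightarrow>
      src B \<cdot> (F1 \<cdot> prod_pair K x a) = F0 \<cdot> prod_pair K x (src A \<cdot> a)"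
    "\<And>x a. x \<in> Ar K \<Longrightarrow> Cod K x = X \<Longrightarrow> a \<in> Ar K \<Longrightarrow> Cod K a = C1 A \<Longrightarrow> Dom K x = Dom K a \<Longrightarrow>
      tgt B \<cdot> (F1 \<cdot> prod_pair K x a) = F0 \<cdot> prod_pair K x (tgt A \<cdot> a)"
    "\<And>x a. x \<in> Ar K \<Longrightarrow> Cod K x = X \<Longrightarrow> a \<in> Ar K \<Longrightarrow> Cod K a = C0 A \<Longrightarrow> Dom K x = Dom K a \<Longrightarrow>
      F1 \<cdot> prod_pair K x (idn A \<cdot> a) = idn B \<cdot> (F0 \<cdot> prod_pair K x a)"
    and c: "\<And>x a b. x \<in> Ar K \<Longrightarrow> Cod K x = X \<Longrightarrow> a \<in> Ar K \<Longrightarrow> Cod K a = C1 A \<Longrightarrow> b \<in> Ar K \<Longrightarrow> Cod K b = C1 A \<Longrightarrow>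
      Dom K x = Dom K b \<Longrightarrow> Dom K a = Dom K b \<Longrightarrow> tgt A \<cdot> a = src A \<cdot> b \<Longrightarrow>
      F1 \<cdot> prod_pair K x (icomp K A a b) = icomp K B (F1 \<cdot> prod_pair K x a) (F1 \<cdot> prod_pair K x b)"
  shows "fun_family A B X F0 F1"
  unfolding fun_family_def
proof (intro conjI allI impI)
  fix x a assume x: "x \<in> Ar K" "Cod K x = X" and a: "a \<in> Ar K" "Cod K a = C2 A" "Dom K x = Dom K a"
  note G = icomp_generic[OF assms(1)]
  have t: "tgt A \<cdot> (fstp A \<cdot> a) = src A \<cdot> (sndp A \<cdot> a)"
    by (rule cmp_eq_assoc) (use a G assms(1) in simp_all)
  have "mul A \<cdot> a = icomp K A (fstp A) (sndp A) \<cdot> a" using G by simp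
  also have "\<dots> = icomp K A (fstp A \<cdot> a) (sndp A \<cdot> a)"
    by (rule icomp_cmp) (use a G assms(1) in simp_all)
  finally show "F1 \<cdot> prod_pair K x (mul A \<cdot> a)
          = icomp K B (F1 \<cdot> prod_pair K x (fstp A \<cdot> a)) (F1 \<cdot> prod_pair K x (sndp A \<cdot> a))"
    using c[of x "fstp A \<cdot> a" "sndp A \<cdot> a"] x a G assms(1) t by simp
qed (use assms in auto)

lemma fun_family_representable:
  assumes A: "is_icat K A" and B: "is_icat K B"
  shows "representable (\<lambda>X. {z. fun_family A B X (fst z) (snd z)})
    (\<lambda>z h. (fst z \<cdot> prod_ar K h (Ide K (C0 A)), snd z \<cdot> prod_ar K h (Ide K (C1 A))))"
proof -
  let ?act = "\<lambda>z h. (fst z \<cdot> prod_ar K h (Ide K (C0 A)), snd z \<cdot> prod_ar K h (Ide K (C1 A)))"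
  let ?S = "\<lambda>X. hom K (prod_ob K X (C0 A)) (C0 B) \<times> hom K (prod_ob K X (C1 A)) (C1 B)"
  note I = icat_data[OF A]
  have "representable ?S ?act"
    by (rule representable_Times[OF representable_exp representable_exp]) (use A B in simp_all)
  note R1 = representable_eq[OF this, of "C1 A" "C0 B"
      "\<lambda>z x a. src B \<cdot> (snd z \<cdot> prod_pair K x a)" "\<lambda>z x a. fst z \<cdot> prod_pair K x (src A \<cdot> a)"]
  let ?S1 = "\<lambda>X. {z \<in> ?S X. \<forall>x a. x \<in> Ar K \<longrightarrow> Cod K x = X \<longrightarrow> a \<in> Ar K \<longrightarrow> Cod K a = C1 A \<longrightarrow> Dom K x = Dom K a \<longrightarrow>
      src B \<cdot> (snd z \<cdot> prod_pair K x a) = fst z \<cdot> prod_pair K x (src A \<cdot> a)}"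
  have R1: "representable ?S1 ?act" by (rule R1) (use A B in auto)
  note R2 = representable_eq[OF R1, of "C1 A" "C0 B"
      "\<lambda>z x a. tgt B \<cdot> (snd z \<cdot> prod_pair K x a)" "\<lambda>z x a. fst z \<cdot> prod_pair K x (tgt A \<cdot> a)"]
  let ?S2 = "\<lambda>X. {z \<in> ?S1 X. \<forall>x a. x \<in> Ar K \<longrightarrow> Cod K x = X \<longrightarrow> a \<in> Ar K \<longrightarrow> Cod K a = C1 A \<longrightarrow> Dom K x = Dom K a \<longrightarrow>
      tgt B \<cdot> (snd z \<cdot> prod_pair K x a) = fst z \<cdot> prod_pair K x (tgt A \<cdot> a)}"
  have R2: "representable ?S2 ?act" by (rule R2) (use A B in auto)
  note R3 = representable_eq[OF R2, of "C0 A" "C1 B"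
      "\<lambda>z x a. snd z \<cdot> prod_pair K x (idn A \<cdot> a)" "\<lambda>z x a. idn B \<cdot> (fst z \<cdot> prod_pair K x a)"]
  let ?S3 = "\<lambda>X. {z \<in> ?S2 X. \<forall>x a. x \<in> Ar K \<longrightarrow> Cod K x = X \<longrightarrow> a \<in> Ar K \<longrightarrow> Cod K a = C0 A \<longrightarrow> Dom K x = Dom K a \<longrightarrow>
      snd z \<cdot> prod_pair K x (idn A \<cdot> a) = idn B \<cdot> (fst z \<cdot> prod_pair K x a)}"
  have R3: "representable ?S3 ?act" by (rule R3) (use A B in auto)
  have ft: "tgt B \<cdot> (snd z \<cdot> prod_pair K x (fstp A \<cdot> a)) = src B \<cdot> (snd z \<cdot> prod_pair K x (sndp A \<cdot> a))"
    if z: "z \<in> ?S3 X" and x: "x \<in> Ar K" "Cod K x = X" and a: "a \<in> Ar K" "Cod K a = C2 A" "Dom K x = Dom K a"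
    for z x a X
  proof -
    have t: "tgt A \<cdot> (fstp A \<cdot> a) = src A \<cdot> (sndp A \<cdot> a)"
      by (rule cmp_eq_assoc) (use a icomp_generic[OF A] A in simp_all)
    have "tgt B \<cdot> (snd z \<cdot> prod_pair K x (fstp A \<cdot> a)) = fst z \<cdot> prod_pair K x (tgt A \<cdot> (fstp A \<cdot> a))"
      "src B \<cdot> (snd z \<cdot> prod_pair K x (sndp A \<cdot> a)) = fst z \<cdot> prod_pair K x (src A \<cdot> (sndp A \<cdot> a))"
      using z x a I by simp_all
    then show ?thesis using t by simp
  qed
  let ?l = "\<lambda>z x a. snd z \<cdot> prod_pair K x (mul A \<cdot> a)" and
    ?r = "\<lambda>z x a. icomp K B (snd z \<cdot> prod_pair K x (fstp A \<cdot> a)) (snd z \<cdot> prod_pair K x (sndp A \<cdot> a))"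
  have "representable (\<lambda>X. {z \<in> ?S3 X. \<forall>x a. x \<in> Ar K \<longrightarrow> Cod K x = X \<longrightarrow> a \<in> Ar K \<longrightarrow> Cod K a = C2 A \<longrightarrow>
      Dom K x = Dom K a \<longrightarrow> ?l z x a = ?r z x a}) ?act"
  proof (rule representable_eq[OF R3, of "C2 A" "C1 B" ?l ?r])
    fix X z x a assume z: "z \<in> ?S3 X" and x: "x \<in> Ar K" "Cod K x = X" and a: "a \<in> Ar K" "Cod K a = C2 A" "Dom K x = Dom K a"
    from z have zA: "snd z \<in> Ar K" "Dom K (snd z) = prod_ob K X (C1 A)" "Cod K (snd z) = C1 B" by auto
    note t = ft[OF z x a]
    show "?l z x a \<in> hom K (Dom K a) (C1 B) \<and> ?r z x a \<in> hom K (Dom K a) (C1 B)"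
      using x a zA t A B I by simp
    fix k assume k: "k \<in> Ar K" "Cod K k = Dom K a"
    show "?l z x a \<cdot> k = ?l z (x \<cdot> k) (a \<cdot> k) \<and> ?r z x a \<cdot> k = ?r z (x \<cdot> k) (a \<cdot> k)"
      using x a zA t A B I k by simp
  next
    fix X z h x a assume z: "z \<in> ?S3 X" and h: "h \<in> Ar K" "Cod K h = X" and x: "x \<in> Ar K" "Cod K x = Dom K h"
      and a: "a \<in> Ar K" "Cod K a = C2 A" "Dom K x = Dom K a"
    from z have zA: "snd z \<in> Ar K" "Dom K (snd z) = prod_ob K X (C1 A)" "Cod K (snd z) = C1 B" by auto
    show "?l (?act z h) x a = ?l z (h \<cdot> x) a \<and> ?r (?act z h) x a = ?r z (h \<cdot> x) a"
      using x a zA h A B I by simp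
  qed (use A B in simp_all)
  moreover have "(\<lambda>X. {z. fun_family A B X (fst z) (snd z)}) =
    (\<lambda>X. {z \<in> ?S3 X. \<forall>x a. x \<in> Ar K \<longrightarrow> Cod K x = X \<longrightarrow> a \<in> Ar K \<longrightarrow> Cod K a = C2 A \<longrightarrow>
      Dom K x = Dom K a \<longrightarrow> ?l z x a = ?r z x a})"
    unfolding fun_family_def mem_Times_iff mem_Collect_eq conj_assoc by (rule refl)
  ultimately show ?thesis by simp
qed

text \<open>The first of the two representing objects: the objects of the exponential \<open>B\<^sup>A\<close>. The universal
  property is split into existence and uniqueness.\<close>

lemma functor_object:
  assumes A: "is_icat K A" and B: "is_icat K B"
  obtains R U0 U1 where "R \<in> Ob K" "fun_family A B R U0 U1"
    "\<And>X F0 F1. X \<in> Ob K \<Longrightarrow> fun_family A B X F0 F1 \<Longrightarrow>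
      \<exists>f. f \<in> hom K X R \<and> U0 \<cdot> prod_ar K f (Ide K (C0 A)) = F0 \<and> U1 \<cdot> prod_ar K f (Ide K (C1 A)) = F1"
    "\<And>f g. f \<in> Ar K \<Longrightarrow> g \<in> Ar K \<Longrightarrow> Dom K f = Dom K g \<Longrightarrow> Cod K f = R \<Longrightarrow> Cod K g = R \<Longrightarrow>
      U0 \<cdot> prod_ar K f (Ide K (C0 A)) = U0 \<cdot> prod_ar K g (Ide K (C0 A)) \<Longrightarrow>
      U1 \<cdot> prod_ar K f (Ide K (C1 A)) = U1 \<cdot> prod_ar K g (Ide K (C1 A)) \<Longrightarrow> f = g"
proof -
  let ?act = "\<lambda>z h. (fst z \<cdot> prod_ar K h (Ide K (C0 A)), snd z \<cdot> prod_ar K h (Ide K (C1 A)))"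
  note R = fun_family_representable[OF A B]
  obtain Q u where Q: "Q \<in> Ob K" and u: "u \<in> {z. fun_family A B Q (fst z) (snd z)}"
    and uni: "\<And>X z. X \<in> Ob K \<Longrightarrow> z \<in> {z. fun_family A B X (fst z) (snd z)} \<Longrightarrow> \<exists>!f. f \<in> hom K X Q \<and> ?act u f = z"
    by (rule representableE[OF R]) (rule that)
  show ?thesis
  proof (rule that[of Q "fst u" "snd u"])
    fix X F0 F1 assume X: "X \<in> Ob K" and F: "fun_family A B X F0 F1"
    then have "\<exists>!f. f \<in> hom K X Q \<and> ?act u f = (F0, F1)" by (intro uni) simp_all
    then show "\<exists>f. f \<in> hom K X Q \<and> fst u \<cdot> prod_ar K f (Ide K (C0 A)) = F0 \<and> snd u \<cdot> prod_ar K f (Ide K (C1 A)) = F1"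
      by (auto simp del: hom_iff)
  next
    fix f g assume fg: "f \<in> Ar K" "g \<in> Ar K" "Dom K f = Dom K g" "Cod K f = Q" "Cod K g = Q"
      "fst u \<cdot> prod_ar K f (Ide K (C0 A)) = fst u \<cdot> prod_ar K g (Ide K (C0 A))"
      "snd u \<cdot> prod_ar K f (Ide K (C1 A)) = snd u \<cdot> prod_ar K g (Ide K (C1 A))"
    have "?act u g \<in> {z. fun_family A B (Dom K g) (fst z) (snd z)}"
      by (rule representable_act[OF R u]) (use fg in simp_all)
    then have "\<exists>!f. f \<in> hom K (Dom K g) Q \<and> ?act u f = ?act u g" by (intro uni) (use fg in simp_all)
    then show "f = g" using fg by auto
  qed (use Q u in simp_all)
qed

text \<open>The second representing object: the arrows of \<open>B\<^sup>A\<close>, that is natural transformations between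
  two functors given as generalised elements of \<open>R\<close>.\<close>

lemma transformation_object:
  assumes A: "is_icat K A" and B: "is_icat K B" and Q: "Q \<in> Ob K" and U: "fun_family A B Q U0 U1"
  defines "nat_family \<equiv> \<lambda>X x y \<tau>. x \<in> hom K X Q \<and> y \<in> hom K X Q \<and> \<tau> \<in> hom K (prod_ob K X (C0 A)) (C1 B) \<and>
      (\<forall>w a. w \<in> Ar K \<longrightarrow> Cod K w = X \<longrightarrow> a \<in> Ar K \<longrightarrow> Cod K a = C0 A \<longrightarrow> Dom K w = Dom K a \<longrightarrow>
        src B \<cdot> (\<tau> \<cdot> prod_pair K w a) = U0 \<cdot> prod_pair K (x \<cdot> w) a) \<and>
      (\<forall>w a. w \<in> Ar K \<longrightarrow> Cod K w = X \<longrightarrow> a \<in> Ar K \<longrightarrow> Cod K a = C0 A \<longrightarrow> Dom K w = Dom K a \<longrightarrow>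
        tgt B \<cdot> (\<tau> \<cdot> prod_pair K w a) = U0 \<cdot> prod_pair K (y \<cdot> w) a) \<and>
      (\<forall>w a. w \<in> Ar K \<longrightarrow> Cod K w = X \<longrightarrow> a \<in> Ar K \<longrightarrow> Cod K a = C1 A \<longrightarrow> Dom K w = Dom K a \<longrightarrow>
        icomp K B (U1 \<cdot> prod_pair K (x \<cdot> w) a) (\<tau> \<cdot> prod_pair K w (tgt A \<cdot> a))
          = icomp K B (\<tau> \<cdot> prod_pair K w (src A \<cdot> a)) (U1 \<cdot> prod_pair K (y \<cdot> w) a))"
  obtains M s t \<theta> where "M \<in> Ob K" "nat_family M s t \<theta>"
    "\<And>X x y \<tau>. X \<in> Ob K \<Longrightarrow> nat_family X x y \<tau> \<Longrightarrow>
      \<exists>f. f \<in> hom K X M \<and> s \<cdot> f = x \<and> t \<cdot> f = y \<and> \<theta> \<cdot> prod_ar K f (Ide K (C0 A)) = \<tau>"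
    "\<And>f g. f \<in> Ar K \<Longrightarrow> g \<in> Ar K \<Longrightarrow> Dom K f = Dom K g \<Longrightarrow> Cod K f = M \<Longrightarrow> Cod K g = M \<Longrightarrow>
      s \<cdot> f = s \<cdot> g \<Longrightarrow> t \<cdot> f = t \<cdot> g \<Longrightarrow>
      \<theta> \<cdot> prod_ar K f (Ide K (C0 A)) = \<theta> \<cdot> prod_ar K g (Ide K (C0 A)) \<Longrightarrow> f = g"
proof -
  let ?a2 = "\<lambda>z h. (fst z \<cdot> h, snd z \<cdot> h)"
  let ?act = "\<lambda>z h. (?a2 (fst z) h, snd z \<cdot> prod_ar K h (Ide K (C0 A)))"
  let ?S = "\<lambda>X. (hom K X Q \<times> hom K X Q) \<times> hom K (prod_ob K X (C0 A)) (C1 B)"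
  note U' = fun_familyD[OF U A]
  have R0: "representable ?S ?act"
    by (rule representable_Times[OF representable_Times[OF representable_hom representable_hom] representable_exp])
      (use A B Q in simp_all)
  let ?S1 = "\<lambda>X. {z \<in> ?S X. \<forall>w a. w \<in> Ar K \<longrightarrow> Cod K w = X \<longrightarrow> a \<in> Ar K \<longrightarrow> Cod K a = C0 A \<longrightarrow> Dom K w = Dom K a \<longrightarrow>
      src B \<cdot> (snd z \<cdot> prod_pair K w a) = U0 \<cdot> prod_pair K (fst (fst z) \<cdot> w) a}"
  have R1: "representable ?S1 ?act"
    by (rule representable_eq[OF R0, of "C0 A" "C0 B"
      "\<lambda>z w a. src B \<cdot> (snd z \<cdot> prod_pair K w a)" "\<lambda>z w a. U0 \<cdot> prod_pair K (fst (fst z) \<cdot> w) a"])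
     (use A B U' Q in auto)
  let ?S2 = "\<lambda>X. {z \<in> ?S1 X. \<forall>w a. w \<in> Ar K \<longrightarrow> Cod K w = X \<longrightarrow> a \<in> Ar K \<longrightarrow> Cod K a = C0 A \<longrightarrow> Dom K w = Dom K a \<longrightarrow>
      tgt B \<cdot> (snd z \<cdot> prod_pair K w a) = U0 \<cdot> prod_pair K (snd (fst z) \<cdot> w) a}"
  have R2: "representable ?S2 ?act"
    by (rule representable_eq[OF R1, of "C0 A" "C0 B"
      "\<lambda>z w a. tgt B \<cdot> (snd z \<cdot> prod_pair K w a)" "\<lambda>z w a. U0 \<cdot> prod_pair K (snd (fst z) \<cdot> w) a"])
     (use A B U' Q in auto)
  let ?l = "\<lambda>z w a. icomp K B (U1 \<cdot> prod_pair K (fst (fst z) \<cdot> w) a) (snd z \<cdot> prod_pair K w (tgt A \<cdot> a))"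
  let ?r = "\<lambda>z w a. icomp K B (snd z \<cdot> prod_pair K w (src A \<cdot> a)) (U1 \<cdot> prod_pair K (snd (fst z) \<cdot> w) a)"
  let ?S3 = "\<lambda>X. {z \<in> ?S2 X. \<forall>w a. w \<in> Ar K \<longrightarrow> Cod K w = X \<longrightarrow> a \<in> Ar K \<longrightarrow> Cod K a = C1 A \<longrightarrow> Dom K w = Dom K a \<longrightarrow>
      ?l z w a = ?r z w a}"
  have R3: "representable ?S3 ?act"
  proof (rule representable_eq[OF R2, of "C1 A" "C1 B" ?l ?r])
    fix X z w a assume z: "z \<in> ?S2 X" and w: "w \<in> Ar K" "Cod K w = X" and a: "a \<in> Ar K" "Cod K a = C1 A" "Dom K w = Dom K a"
    from z have zA: "snd z \<in> Ar K" "Dom K (snd z) = prod_ob K X (C0 A)" "Cod K (snd z) = C1 B"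
      "fst (fst z) \<in> Ar K" "snd (fst z) \<in> Ar K" "Dom K (fst (fst z)) = X" "Dom K (snd (fst z)) = X"
      "Cod K (fst (fst z)) = Q" "Cod K (snd (fst z)) = Q" by auto
    from z w a have e1: "src B \<cdot> (snd z \<cdot> prod_pair K w (tgt A \<cdot> a)) = U0 \<cdot> prod_pair K (fst (fst z) \<cdot> w) (tgt A \<cdot> a)"
      and e2: "tgt B \<cdot> (snd z \<cdot> prod_pair K w (src A \<cdot> a)) = U0 \<cdot> prod_pair K (snd (fst z) \<cdot> w) (src A \<cdot> a)"
      using A by simp_all
    show "?l z w a \<in> hom K (Dom K a) (C1 B) \<and> ?r z w a \<in> hom K (Dom K a) (C1 B)"
      using w a zA e1 e2 A B U' by simp
    fix k assume k: "k \<in> Ar K" "Cod K k = Dom K a"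
    show "?l z w a \<cdot> k = ?l z (w \<cdot> k) (a \<cdot> k) \<and> ?r z w a \<cdot> k = ?r z (w \<cdot> k) (a \<cdot> k)"
      using w a zA e1 e2 A B U' k by simp
  next
    fix X z h w a assume z: "z \<in> ?S2 X" and h: "h \<in> Ar K" "Cod K h = X" and w: "w \<in> Ar K" "Cod K w = Dom K h"
      and a: "a \<in> Ar K" "Cod K a = C1 A" "Dom K w = Dom K a"
    from z have zA: "snd z \<in> Ar K" "Dom K (snd z) = prod_ob K X (C0 A)" "Cod K (snd z) = C1 B"
      "fst (fst z) \<in> Ar K" "snd (fst z) \<in> Ar K" "Dom K (fst (fst z)) = X" "Dom K (snd (fst z)) = X"
      "Cod K (fst (fst z)) = Q" "Cod K (snd (fst z)) = Q" by auto
    show "?l (?act z h) w a = ?l z (h \<cdot> w) a \<and> ?r (?act z h) w a = ?r z (h \<cdot> w) a"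
      using w a zA h A B U' by simp
  qed (use A B in simp_all)
  have S3: "z \<in> ?S3 X \<longleftrightarrow> nat_family X (fst (fst z)) (snd (fst z)) (snd z)" for z X
    unfolding nat_family_def mem_Times_iff mem_Collect_eq conj_assoc by (rule refl)
  obtain M u where M: "M \<in> Ob K" and u: "u \<in> ?S3 M"
    and uni: "\<And>X z. X \<in> Ob K \<Longrightarrow> z \<in> ?S3 X \<Longrightarrow> \<exists>!f. f \<in> hom K X M \<and> ?act u f = z"
    by (rule representableE[OF R3]) (rule that)
  show ?thesis
  proof (rule that[of M "fst (fst u)" "snd (fst u)" "snd u"])
    show "nat_family M (fst (fst u)) (snd (fst u)) (snd u)" using u unfolding S3 .
    fix X x y \<tau> assume X: "X \<in> Ob K" and n: "nat_family X x y \<tau>"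
    have "((x, y), \<tau>) \<in> ?S3 X" unfolding S3 using n by simp
    then have "\<exists>!f. f \<in> hom K X M \<and> ?act u f = ((x, y), \<tau>)" by (rule uni[OF X])
    then show "\<exists>f. f \<in> hom K X M \<and> fst (fst u) \<cdot> f = x \<and> snd (fst u) \<cdot> f = y \<and> snd u \<cdot> prod_ar K f (Ide K (C0 A)) = \<tau>"
      by (auto simp del: hom_iff)
  next
    fix f g assume fg: "f \<in> Ar K" "g \<in> Ar K" "Dom K f = Dom K g" "Cod K f = M" "Cod K g = M"
      "fst (fst u) \<cdot> f = fst (fst u) \<cdot> g" "snd (fst u) \<cdot> f = snd (fst u) \<cdot> g"
      "snd u \<cdot> prod_ar K f (Ide K (C0 A)) = snd u \<cdot> prod_ar K g (Ide K (C0 A))"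
    have "?act u g \<in> ?S3 (Dom K g)" by (rule representable_act[OF R3 u fg(2,5)])
    then have "\<exists>!f. f \<in> hom K (Dom K g) M \<and> ?act u f = ?act u g" by (rule uni[rotated]) (use fg in simp)
    then show "f = g" using fg by auto
  qed (rule M)
qed

end

lemma (in topos) icomp_interchange:
  assumes B: "is_icat K B" and A: "a \<in> Ar K" "b \<in> Ar K" "c \<in> Ar K" "d \<in> Ar K" "b' \<in> Ar K" "c' \<in> Ar K"
    and C: "Cod K a = C1 B" "Cod K b = C1 B" "Cod K c = C1 B" "Cod K d = C1 B" "Cod K b' = C1 B" "Cod K c' = C1 B"
    and D: "Dom K a = Dom K d" "Dom K b = Dom K d" "Dom K c = Dom K d" "Dom K b' = Dom K d" "Dom K c' = Dom K d"
    and t: "tgt B \<cdot> a = src B \<cdot> b" "tgt B \<cdot> b = src B \<cdot> c" "tgt B \<cdot> c = src B \<cdot> d"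
      "tgt B \<cdot> a = src B \<cdot> b'" "tgt B \<cdot> b' = src B \<cdot> c'" "tgt B \<cdot> c' = src B \<cdot> d"
    and e: "icomp K B b c = icomp K B b' c'"
  shows "icomp K B (icomp K B a b) (icomp K B c d) = icomp K B (icomp K B a b') (icomp K B c' d)"
proof -
  have "icomp K B (icomp K B a b) (icomp K B c d) = icomp K B a (icomp K B (icomp K B b c) d)"
    using assms(1-21) by simp
  also have "\<dots> = icomp K B a (icomp K B (icomp K B b' c') d)" by (simp only: e)
  also have "\<dots> = icomp K B (icomp K B a b') (icomp K B c' d)"
    using assms(1-18,22-24) by simp
  finally show ?thesis .
qed

text \<open>Elements of \<open>R\<close> are functors, with universal functor \<open>(U0, U1)\<close>; elements of \<open>M\<close> are natural
  transformations from \<open>s\<close> to \<open>t\<close>, with universal transformation \<open>\<theta>\<close>. Evaluated at generalised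
  elements, the data obey the usual calculus of functors and transformations, and the proof that
  these form the exponential is the familiar one for categories of sets.\<close>

locale exponential_data = topos +
  fixes A B :: "('a, 'b) icat" and R :: 'a and U0 U1 :: 'b and M :: 'a and s t \<theta> :: 'b
  assumes A [simp]: "is_icat K A" and B [simp]: "is_icat K B" and R [simp]: "R \<in> Ob K" and M [simp]: "M \<in> Ob K"
    and U: "fun_family A B R U0 U1"
    and U_ex: "\<And>X F0 F1. X \<in> Ob K \<Longrightarrow> fun_family A B X F0 F1 \<Longrightarrow>
      \<exists>f. f \<in> hom K X R \<and> U0 \<cdot> prod_ar K f (Ide K (C0 A)) = F0 \<and> U1 \<cdot> prod_ar K f (Ide K (C1 A)) = F1"
    and U_eq: "\<And>f g. f \<in> Ar K \<Longrightarrow> g \<in> Ar K \<Longrightarrow> Dom K f = Dom K g \<Longrightarrow> Cod K f = R \<Longrightarrow> Cod K g = R \<Longrightarrow>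
      U0 \<cdot> prod_ar K f (Ide K (C0 A)) = U0 \<cdot> prod_ar K g (Ide K (C0 A)) \<Longrightarrow>
      U1 \<cdot> prod_ar K f (Ide K (C1 A)) = U1 \<cdot> prod_ar K g (Ide K (C1 A)) \<Longrightarrow> f = g"
    and st [simp]: "s \<in> Ar K" "Dom K s = M" "Cod K s = R" "t \<in> Ar K" "Dom K t = M" "Cod K t = R"
    and th [simp]: "\<theta> \<in> Ar K" "Dom K \<theta> = prod_ob K M (C0 A)" "Cod K \<theta> = C1 B"
    and src_th [simp]: "\<And>w a. w \<in> Ar K \<Longrightarrow> Cod K w = M \<Longrightarrow> a \<in> Ar K \<Longrightarrow> Cod K a = C0 A \<Longrightarrow> Dom K w = Dom K a \<Longrightarrow>
        src B \<cdot> (\<theta> \<cdot> prod_pair K w a) = U0 \<cdot> prod_pair K (s \<cdot> w) a"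
    and tgt_th [simp]: "\<And>w a. w \<in> Ar K \<Longrightarrow> Cod K w = M \<Longrightarrow> a \<in> Ar K \<Longrightarrow> Cod K a = C0 A \<Longrightarrow> Dom K w = Dom K a \<Longrightarrow>
        tgt B \<cdot> (\<theta> \<cdot> prod_pair K w a) = U0 \<cdot> prod_pair K (t \<cdot> w) a"
    and nat_th: "\<And>w a. w \<in> Ar K \<Longrightarrow> Cod K w = M \<Longrightarrow> a \<in> Ar K \<Longrightarrow> Cod K a = C1 A \<Longrightarrow> Dom K w = Dom K a \<Longrightarrow>
        icomp K B (U1 \<cdot> prod_pair K (s \<cdot> w) a) (\<theta> \<cdot> prod_pair K w (tgt A \<cdot> a))
          = icomp K B (\<theta> \<cdot> prod_pair K w (src A \<cdot> a)) (U1 \<cdot> prod_pair K (t \<cdot> w) a)"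
    and th_ex: "\<And>X x y \<tau>. X \<in> Ob K \<Longrightarrow> x \<in> hom K X R \<Longrightarrow> y \<in> hom K X R \<Longrightarrow>
      \<tau> \<in> hom K (prod_ob K X (C0 A)) (C1 B) \<Longrightarrow>
      (\<And>w a. w \<in> Ar K \<Longrightarrow> Cod K w = X \<Longrightarrow> a \<in> Ar K \<Longrightarrow> Cod K a = C0 A \<Longrightarrow> Dom K w = Dom K a \<Longrightarrow>
        src B \<cdot> (\<tau> \<cdot> prod_pair K w a) = U0 \<cdot> prod_pair K (x \<cdot> w) a) \<Longrightarrow>
      (\<And>w a. w \<in> Ar K \<Longrightarrow> Cod K w = X \<Longrightarrow> a \<in> Ar K \<Longrightarrow> Cod K a = C0 A \<Longrightarrow> Dom K w = Dom K a \<Longrightarrow>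
        tgt B \<cdot> (\<tau> \<cdot> prod_pair K w a) = U0 \<cdot> prod_pair K (y \<cdot> w) a) \<Longrightarrow>
      (\<And>w a. w \<in> Ar K \<Longrightarrow> Cod K w = X \<Longrightarrow> a \<in> Ar K \<Longrightarrow> Cod K a = C1 A \<Longrightarrow> Dom K w = Dom K a \<Longrightarrow>
        icomp K B (U1 \<cdot> prod_pair K (x \<cdot> w) a) (\<tau> \<cdot> prod_pair K w (tgt A \<cdot> a))
          = icomp K B (\<tau> \<cdot> prod_pair K w (src A \<cdot> a)) (U1 \<cdot> prod_pair K (y \<cdot> w) a)) \<Longrightarrow>
      \<exists>f. f \<in> hom K X M \<and> s \<cdot> f = x \<and> t \<cdot> f = y \<and> \<theta> \<cdot> prod_ar K f (Ide K (C0 A)) = \<tau>"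
    and th_eq: "\<And>f g. f \<in> Ar K \<Longrightarrow> g \<in> Ar K \<Longrightarrow> Dom K f = Dom K g \<Longrightarrow> Cod K f = M \<Longrightarrow> Cod K g = M \<Longrightarrow>
      s \<cdot> f = s \<cdot> g \<Longrightarrow> t \<cdot> f = t \<cdot> g \<Longrightarrow>
      \<theta> \<cdot> prod_ar K f (Ide K (C0 A)) = \<theta> \<cdot> prod_ar K g (Ide K (C0 A)) \<Longrightarrow> f = g"
begin

lemmas U_simps [simp] = fun_familyD[OF U A]

lemma U_ext:
  assumes "f \<in> Ar K" "g \<in> Ar K" "Dom K f = Dom K g" "Cod K f = R" "Cod K g = R"
    and e0: "\<And>w a. w \<in> Ar K \<Longrightarrow> Cod K w = Dom K g \<Longrightarrow> a \<in> Ar K \<Longrightarrow> Cod K a = C0 A \<Longrightarrow> Dom K w = Dom K a \<Longrightarrow>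
      U0 \<cdot> prod_pair K (f \<cdot> w) a = U0 \<cdot> prod_pair K (g \<cdot> w) a"
    and e1: "\<And>w a. w \<in> Ar K \<Longrightarrow> Cod K w = Dom K g \<Longrightarrow> a \<in> Ar K \<Longrightarrow> Cod K a = C1 A \<Longrightarrow> Dom K w = Dom K a \<Longrightarrow>
      U1 \<cdot> prod_pair K (f \<cdot> w) a = U1 \<cdot> prod_pair K (g \<cdot> w) a"
  shows "f = g"
  by (rule U_eq) (use assms in \<open>simp_all add: prod_ar_def\<close>)

lemma th_ext:
  assumes "f \<in> Ar K" "g \<in> Ar K" "Dom K f = Dom K g" "Cod K f = M" "Cod K g = M"
    "s \<cdot> f = s \<cdot> g" "t \<cdot> f = t \<cdot> g"
    and e: "\<And>w a. w \<in> Ar K \<Longrightarrow> Cod K w = Dom K g \<Longrightarrow> a \<in> Ar K \<Longrightarrow> Cod K a = C0 A \<Longrightarrow> Dom K w = Dom K a \<Longrightarrow>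
      \<theta> \<cdot> prod_pair K (f \<cdot> w) a = \<theta> \<cdot> prod_pair K (g \<cdot> w) a"
  shows "f = g"
  by (rule th_eq) (use assms in \<open>simp_all add: prod_ar_def\<close>)

lemma act_elem:
  assumes "F \<cdot> prod_ar K f (Ide K T) = G" "F \<in> Ar K" "Dom K F = prod_ob K V T" "T \<in> Ob K"
    "f \<in> Ar K" "Cod K f = V" "w \<in> Ar K" "Cod K w = Dom K f" "a \<in> Ar K" "Cod K a = T" "Dom K w = Dom K a"
  shows "F \<cdot> prod_pair K (f \<cdot> w) a = G \<cdot> prod_pair K w a"
proof -
  have "F \<cdot> (prod_ar K f (Ide K T) \<cdot> prod_pair K w a) = G \<cdot> prod_pair K w a"
    by (rule cmp_eq_assoc1[OF assms(1)]) (use assms(2-) in simp_all)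
  then show ?thesis using assms(2-) by simp
qed

lemma identity_ex:
  obtains i where "i \<in> Ar K" "Dom K i = R" "Cod K i = M" "s \<cdot> i = Ide K R" "t \<cdot> i = Ide K R"
    "\<And>x a. x \<in> Ar K \<Longrightarrow> Cod K x = R \<Longrightarrow> a \<in> Ar K \<Longrightarrow> Cod K a = C0 A \<Longrightarrow> Dom K x = Dom K a \<Longrightarrow>
      \<theta> \<cdot> prod_pair K (i \<cdot> x) a = idn B \<cdot> (U0 \<cdot> prod_pair K x a)"
proof -
  have "\<exists>f. f \<in> hom K R M \<and> s \<cdot> f = Ide K R \<and> t \<cdot> f = Ide K R \<and> \<theta> \<cdot> prod_ar K f (Ide K (C0 A)) = idn B \<cdot> U0"
    by (rule th_ex) simp_all
  then obtain i where i: "i \<in> Ar K" "Dom K i = R" "Cod K i = M" "s \<cdot> i = Ide K R" "t \<cdot> i = Ide K R"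
    and e: "\<theta> \<cdot> prod_ar K i (Ide K (C0 A)) = idn B \<cdot> U0" by auto
  show ?thesis
  proof (rule that[OF i])
    fix x a assume "x \<in> Ar K" "Cod K x = R" "a \<in> Ar K" "Cod K a = C0 A" "Dom K x = Dom K a"
    then show "\<theta> \<cdot> prod_pair K (i \<cdot> x) a = idn B \<cdot> (U0 \<cdot> prod_pair K x a)"
      using act_elem[OF e, of M x a] i by simp
  qed
qed

text \<open>The composite exists because naturality squares can be pasted along their common side.\<close>

lemma composite_ex:
  assumes f: "f \<in> Ar K" "Cod K f = M" and g: "g \<in> Ar K" "Cod K g = M" and D: "Dom K f = Dom K g"
    and e: "t \<cdot> f = s \<cdot> g"
  obtains h where "h \<in> Ar K" "Dom K h = Dom K g" "Cod K h = M" "s \<cdot> h = s \<cdot> f" "t \<cdot> h = t \<cdot> g"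
    "\<And>w a. w \<in> Ar K \<Longrightarrow> Cod K w = Dom K g \<Longrightarrow> a \<in> Ar K \<Longrightarrow> Cod K a = C0 A \<Longrightarrow> Dom K w = Dom K a \<Longrightarrow>
      \<theta> \<cdot> prod_pair K (h \<cdot> w) a = icomp K B (\<theta> \<cdot> prod_pair K (f \<cdot> w) a) (\<theta> \<cdot> prod_pair K (g \<cdot> w) a)"
proof -
  let ?X = "Dom K g"
  let ?p = "pr1 K ?X (C0 A)" and ?q = "pr2 K ?X (C0 A)"
  let ?\<tau> = "icomp K B (\<theta> \<cdot> prod_pair K (f \<cdot> ?p) ?q) (\<theta> \<cdot> prod_pair K (g \<cdot> ?p) ?q)"
  have e': "t \<cdot> (f \<cdot> w) = s \<cdot> (g \<cdot> w)" if "w \<in> Ar K" "Cod K w = ?X" for w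
    by (rule cmp_eq_assoc[OF e]) (use f g D that in simp_all)
  have tE: "?\<tau> \<cdot> prod_pair K w a = icomp K B (\<theta> \<cdot> prod_pair K (f \<cdot> w) a) (\<theta> \<cdot> prod_pair K (g \<cdot> w) a)"
    if "w \<in> Ar K" "Cod K w = ?X" "a \<in> Ar K" "Cod K a = C0 A" "Dom K w = Dom K a" for w a
    using that f g D e' by simp
  have "\<exists>h. h \<in> hom K ?X M \<and> s \<cdot> h = s \<cdot> f \<and> t \<cdot> h = t \<cdot> g \<and> \<theta> \<cdot> prod_ar K h (Ide K (C0 A)) = ?\<tau>"
  proof (rule th_ex)
    show "?\<tau> \<in> hom K (prod_ob K ?X (C0 A)) (C1 B)" using f g D e' by simp
    fix w a assume w: "w \<in> Ar K" "Cod K w = ?X" and a: "a \<in> Ar K" "Cod K a = C1 A" "Dom K w = Dom K a"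
    let ?fs = "\<theta> \<cdot> prod_pair K (f \<cdot> w) (src A \<cdot> a)" and ?ft = "\<theta> \<cdot> prod_pair K (f \<cdot> w) (tgt A \<cdot> a)"
    let ?gs = "\<theta> \<cdot> prod_pair K (g \<cdot> w) (src A \<cdot> a)" and ?gt = "\<theta> \<cdot> prod_pair K (g \<cdot> w) (tgt A \<cdot> a)"
    let ?x = "U1 \<cdot> prod_pair K (s \<cdot> (f \<cdot> w)) a" and ?y = "U1 \<cdot> prod_pair K (s \<cdot> (g \<cdot> w)) a"
      and ?z = "U1 \<cdot> prod_pair K (t \<cdot> (g \<cdot> w)) a"
    have n1: "icomp K B ?x ?ft = icomp K B ?fs ?y"
      using nat_th[of "f \<cdot> w" a] f g D e' w a by simp
    have n2: "icomp K B ?y ?gt = icomp K B ?gs ?z"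
      using nat_th[of "g \<cdot> w" a] f g D e' w a by simp
    have "icomp K B ?x (icomp K B ?ft ?gt) = icomp K B (icomp K B ?x ?ft) ?gt"
      using f g D e' w a by simp
    also have "\<dots> = icomp K B (icomp K B ?fs ?y) ?gt" by (simp only: n1)
    also have "\<dots> = icomp K B ?fs (icomp K B ?y ?gt)" using f g D e' w a by simp
    also have "\<dots> = icomp K B ?fs (icomp K B ?gs ?z)" by (simp only: n2)
    also have "\<dots> = icomp K B (icomp K B ?fs ?gs) ?z" using f g D e' w a by simp
    finally show "icomp K B (U1 \<cdot> prod_pair K ((s \<cdot> f) \<cdot> w) a) (?\<tau> \<cdot> prod_pair K w (tgt A \<cdot> a))
        = icomp K B (?\<tau> \<cdot> prod_pair K w (src A \<cdot> a)) (U1 \<cdot> prod_pair K ((t \<cdot> g) \<cdot> w) a)"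
      using f g D w a by (simp add: tE)
  qed (use f g D e' in \<open>simp_all add: tE\<close>)
  then obtain h where h: "h \<in> Ar K" "Dom K h = Dom K g" "Cod K h = M" "s \<cdot> h = s \<cdot> f" "t \<cdot> h = t \<cdot> g"
    and e: "\<theta> \<cdot> prod_ar K h (Ide K (C0 A)) = ?\<tau>" by auto
  show ?thesis
  proof (rule that[OF h])
    fix w a assume w: "w \<in> Ar K" "Cod K w = ?X" "a \<in> Ar K" "Cod K a = C0 A" "Dom K w = Dom K a"
    show "\<theta> \<cdot> prod_pair K (h \<cdot> w) a = icomp K B (\<theta> \<cdot> prod_pair K (f \<cdot> w) a) (\<theta> \<cdot> prod_pair K (g \<cdot> w) a)"
      using act_elem[OF e, of M w a] tE[OF w] h w by simp
  qed
qed

lemma exponential_icat: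
  obtains E where "is_icat K E" "C0 E = R" "C1 E = M" "src E = s" "tgt E = t"
    "\<And>x a. x \<in> Ar K \<Longrightarrow> Cod K x = R \<Longrightarrow> a \<in> Ar K \<Longrightarrow> Cod K a = C0 A \<Longrightarrow> Dom K x = Dom K a \<Longrightarrow>
      \<theta> \<cdot> prod_pair K (idn E \<cdot> x) a = idn B \<cdot> (U0 \<cdot> prod_pair K x a)"
    "\<And>f g a. f \<in> Ar K \<Longrightarrow> Cod K f = M \<Longrightarrow> g \<in> Ar K \<Longrightarrow> Cod K g = M \<Longrightarrow> Dom K f = Dom K a \<Longrightarrow> Dom K g = Dom K a \<Longrightarrow>
      t \<cdot> f = s \<cdot> g \<Longrightarrow> a \<in> Ar K \<Longrightarrow> Cod K a = C0 A \<Longrightarrow>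
      \<theta> \<cdot> prod_pair K (icomp K E f g) a = icomp K B (\<theta> \<cdot> prod_pair K f a) (\<theta> \<cdot> prod_pair K g a)"
proof -
  obtain i where i: "i \<in> Ar K" "Dom K i = R" "Cod K i = M" "s \<cdot> i = Ide K R" "t \<cdot> i = Ide K R"
    and ie: "\<And>x a. x \<in> Ar K \<Longrightarrow> Cod K x = R \<Longrightarrow> a \<in> Ar K \<Longrightarrow> Cod K a = C0 A \<Longrightarrow> Dom K x = Dom K a \<Longrightarrow>
      \<theta> \<cdot> prod_pair K (i \<cdot> x) a = idn B \<cdot> (U0 \<cdot> prod_pair K x a)"
    by (rule identity_ex) (rule that)
  define is_cmp where "is_cmp f g h \<longleftrightarrow> h \<in> Ar K \<and> Dom K h = Dom K g \<and> Cod K h = M \<and> s \<cdot> h = s \<cdot> f \<and> t \<cdot> h = t \<cdot> g \<and>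
    (\<forall>w a. w \<in> Ar K \<longrightarrow> Cod K w = Dom K g \<longrightarrow> a \<in> Ar K \<longrightarrow> Cod K a = C0 A \<longrightarrow> Dom K w = Dom K a \<longrightarrow>
      \<theta> \<cdot> prod_pair K (h \<cdot> w) a = icomp K B (\<theta> \<cdot> prod_pair K (f \<cdot> w) a) (\<theta> \<cdot> prod_pair K (g \<cdot> w) a))" for f g h
  define c where "c f g = (SOME h. is_cmp f g h)" for f g
  have c: "is_cmp f g (c f g)" if "f \<in> Ar K" "g \<in> Ar K" "Cod K f = M" "Cod K g = M" "Dom K f = Dom K g" "t \<cdot> f = s \<cdot> g" for f g
    unfolding c_def
  proof (rule someI_ex)
    show "\<exists>h. is_cmp f g h" using composite_ex[of f g] that unfolding is_cmp_def by metis
  qed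
  have cA: "c f g \<in> Ar K" "Dom K (c f g) = Dom K g" "Cod K (c f g) = M" "s \<cdot> c f g = s \<cdot> f" "t \<cdot> c f g = t \<cdot> g"
    and cE: "\<And>w a. w \<in> Ar K \<Longrightarrow> Cod K w = Dom K g \<Longrightarrow> a \<in> Ar K \<Longrightarrow> Cod K a = C0 A \<Longrightarrow> Dom K w = Dom K a \<Longrightarrow>
      \<theta> \<cdot> prod_pair K (c f g \<cdot> w) a = icomp K B (\<theta> \<cdot> prod_pair K (f \<cdot> w) a) (\<theta> \<cdot> prod_pair K (g \<cdot> w) a)"
    if "f \<in> Ar K" "g \<in> Ar K" "Cod K f = M" "Cod K g = M" "Dom K f = Dom K g" "t \<cdot> f = s \<cdot> g" for f g
    using c[OF that] unfolding is_cmp_def by blast+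
  obtain E where E: "is_icat K E" "C0 E = R" "C1 E = M" "src E = s" "tgt E = t" "idn E = i"
    and Ec: "\<And>f g. f \<in> Ar K \<Longrightarrow> g \<in> Ar K \<Longrightarrow> Cod K f = M \<Longrightarrow> Cod K g = M \<Longrightarrow> Dom K f = Dom K g \<Longrightarrow>
      t \<cdot> f = s \<cdot> g \<Longrightarrow> icomp K E f g = c f g"
  proof (rule icat_exists[of R M s t i c])
    fix f g assume fg: "f \<in> Ar K" "g \<in> Ar K" "Cod K f = M" "Cod K g = M" "Dom K f = Dom K g" "t \<cdot> f = s \<cdot> g"
    have e': "t \<cdot> (f \<cdot> w) = s \<cdot> (g \<cdot> w)" if "w \<in> Ar K" "Cod K w = Dom K g" for w
      by (rule cmp_eq_assoc[OF fg(6)]) (use fg that in simp_all)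
    show "c f g \<in> Ar K \<and> Dom K (c f g) = Dom K g \<and> Cod K (c f g) = M \<and> s \<cdot> c f g = s \<cdot> f \<and> t \<cdot> c f g = t \<cdot> g"
      using cA[OF fg] by simp
    fix h assume h: "h \<in> Ar K" "Cod K h = Dom K g"
    have fgh: "f \<cdot> h \<in> Ar K" "g \<cdot> h \<in> Ar K" "Cod K (f \<cdot> h) = M" "Cod K (g \<cdot> h) = M"
      "Dom K (f \<cdot> h) = Dom K (g \<cdot> h)" "t \<cdot> (f \<cdot> h) = s \<cdot> (g \<cdot> h)" using fg h e' by simp_all
    have sc: "s \<cdot> (c f g \<cdot> h) = s \<cdot> (f \<cdot> h)" "t \<cdot> (c f g \<cdot> h) = t \<cdot> (g \<cdot> h)"
      by (rule cmp_eq_assoc; use cA[OF fg] fg h in simp)+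
    show "c f g \<cdot> h = c (f \<cdot> h) (g \<cdot> h)"
      by (rule th_ext) (use sc cA[OF fg] cA[OF fgh] cE[OF fg] cE[OF fgh] fg h in simp_all)
  next
    fix f assume f: "f \<in> Ar K" "Cod K f = M"
    have ti: "t \<cdot> (i \<cdot> (s \<cdot> f)) = s \<cdot> f" "s \<cdot> (i \<cdot> (s \<cdot> f)) = s \<cdot> f" "s \<cdot> (i \<cdot> (t \<cdot> f)) = t \<cdot> f" "t \<cdot> (i \<cdot> (t \<cdot> f)) = t \<cdot> f"
      using f i cmp_eq_assoc1[OF i(4), of "s \<cdot> f"] cmp_eq_assoc1[OF i(5), of "s \<cdot> f"]
        cmp_eq_assoc1[OF i(4), of "t \<cdot> f"] cmp_eq_assoc1[OF i(5), of "t \<cdot> f"] by simp_all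
    have 1: "i \<cdot> (s \<cdot> f) \<in> Ar K" "Cod K (i \<cdot> (s \<cdot> f)) = M" "Dom K (i \<cdot> (s \<cdot> f)) = Dom K f"
      "i \<cdot> (t \<cdot> f) \<in> Ar K" "Cod K (i \<cdot> (t \<cdot> f)) = M" "Dom K (i \<cdot> (t \<cdot> f)) = Dom K f" using f i by simp_all
    note c1 = cA[OF 1(1) f(1) 1(2) f(2) 1(3) ti(1)] cE[OF 1(1) f(1) 1(2) f(2) 1(3) ti(1)]
    note c2 = cA[OF f(1) 1(4) f(2) 1(5) 1(6)[symmetric] ti(3)[symmetric]]
      cE[OF f(1) 1(4) f(2) 1(5) 1(6)[symmetric] ti(3)[symmetric]]
    have "c (i \<cdot> (s \<cdot> f)) f = f"
      by (rule th_ext) (use c1 f i ti ie in simp_all)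
    moreover have "c f (i \<cdot> (t \<cdot> f)) = f"
      by (rule th_ext) (use c2 f i ti ie in simp_all)
    ultimately show "c (i \<cdot> (s \<cdot> f)) f = f \<and> c f (i \<cdot> (t \<cdot> f)) = f" ..
  next
    fix f g h assume f: "f \<in> Ar K" "g \<in> Ar K" "h \<in> Ar K" "Cod K f = M" "Cod K g = M" "Cod K h = M"
      "Dom K f = Dom K h" "Dom K g = Dom K h" and e: "t \<cdot> f = s \<cdot> g" "t \<cdot> g = s \<cdot> h"
    have fg: "Dom K f = Dom K g" using f by simp
    have e': "t \<cdot> (f \<cdot> w) = s \<cdot> (g \<cdot> w)" "t \<cdot> (g \<cdot> w) = s \<cdot> (h \<cdot> w)" if "w \<in> Ar K" "Cod K w = Dom K h" for w
      by (rule cmp_eq_assoc[OF e(1)], use f that in simp_all) (rule cmp_eq_assoc[OF e(2)], use f that in simp_all)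
    note c1 = cA[OF f(1,2,4,5) fg e(1)] cE[OF f(1,2,4,5) fg e(1)]
    note c2 = cA[OF f(2,3,5,6,8) e(2)] cE[OF f(2,3,5,6,8) e(2)]
    have 3: "Dom K (c f g) = Dom K h" "t \<cdot> c f g = s \<cdot> h" and 4: "Dom K f = Dom K (c g h)" "t \<cdot> f = s \<cdot> c g h"
      using c1 c2 f e by simp_all
    note c3 = cA[OF c1(1) f(3) c1(3) f(6) 3] cE[OF c1(1) f(3) c1(3) f(6) 3]
    note c4 = cA[OF f(1) c2(1) f(4) c2(3) 4] cE[OF f(1) c2(1) f(4) c2(3) 4]
    show "c (c f g) h = c f (c g h)"
    proof (rule th_ext)
      fix w a assume w: "w \<in> Ar K" "Cod K w = Dom K (c f (c g h))" "a \<in> Ar K" "Cod K a = C0 A" "Dom K w = Dom K a"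
      then have wh: "Cod K w = Dom K h" "Cod K w = Dom K g" "Cod K w = Dom K (c g h)" using c4 c2 f by simp_all
      show "\<theta> \<cdot> prod_pair K (c (c f g) h \<cdot> w) a = \<theta> \<cdot> prod_pair K (c f (c g h) \<cdot> w) a"
        unfolding c3(6)[OF w(1) wh(1) w(3-5)] c4(6)[OF w(1) wh(3) w(3-5)]
          c1(6)[OF w(1) wh(2) w(3-5)] c2(6)[OF w(1) wh(1) w(3-5)]
        using f e'[OF w(1) wh(1)] w(1,3-5) wh(1) by simp
    qed (use c1(1-5) c2(1-5) c3(1-5) c4(1-5) f e in simp_all)
  qed (use i that in simp_all)
  show ?thesis
  proof (rule that[OF E(1-5)])
    show "\<theta> \<cdot> prod_pair K (idn E \<cdot> x) a = idn B \<cdot> (U0 \<cdot> prod_pair K x a)"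
      if "x \<in> Ar K" "Cod K x = R" "a \<in> Ar K" "Cod K a = C0 A" "Dom K x = Dom K a" for x a
      using ie[OF that] E by simp
    show "\<theta> \<cdot> prod_pair K (icomp K E f g) a = icomp K B (\<theta> \<cdot> prod_pair K f a) (\<theta> \<cdot> prod_pair K g a)"
      if "f \<in> Ar K" "Cod K f = M" "g \<in> Ar K" "Cod K g = M" "Dom K f = Dom K a" "Dom K g = Dom K a"
        "t \<cdot> f = s \<cdot> g" "a \<in> Ar K" "Cod K a = C0 A" for f g a
    proof -
      have D: "Dom K f = Dom K g" using that by simp
      have "\<theta> \<cdot> prod_pair K (c f g \<cdot> Ide K (Dom K g)) a
          = icomp K B (\<theta> \<cdot> prod_pair K (f \<cdot> Ide K (Dom K g)) a) (\<theta> \<cdot> prod_pair K (g \<cdot> Ide K (Dom K g)) a)"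
        by (rule cE[OF that(1,3,2,4) D that(7)]) (use that in simp_all)
      then show ?thesis using that D cA[OF that(1,3,2,4) D that(7)] Ec[OF that(1,3,2,4) D that(7)] by simp
    qed
  qed
qed

lemma is_exponential_ex: "\<exists>E ev. is_exponential (Cat K) A B E ev"
proof -
  obtain E where E [simp]: "is_icat K E" "C0 E = R" "C1 E = M" "src E = s" "tgt E = t"
    and Ei: "\<And>x a. x \<in> Ar K \<Longrightarrow> Cod K x = R \<Longrightarrow> a \<in> Ar K \<Longrightarrow> Cod K a = C0 A \<Longrightarrow> Dom K x = Dom K a \<Longrightarrow>
      \<theta> \<cdot> prod_pair K (idn E \<cdot> x) a = idn B \<cdot> (U0 \<cdot> prod_pair K x a)"
    and Ec: "\<And>f g a. f \<in> Ar K \<Longrightarrow> Cod K f = M \<Longrightarrow> g \<in> Ar K \<Longrightarrow> Cod K g = M \<Longrightarrow> Dom K f = Dom K a \<Longrightarrow> Dom K g = Dom K a \<Longrightarrow>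
      t \<cdot> f = s \<cdot> g \<Longrightarrow> a \<in> Ar K \<Longrightarrow> Cod K a = C0 A \<Longrightarrow>
      \<theta> \<cdot> prod_pair K (icomp K E f g) a = icomp K B (\<theta> \<cdot> prod_pair K f a) (\<theta> \<cdot> prod_pair K g a)"
    by (rule exponential_icat) (rule that)
  have Es: "s \<cdot> icomp K E f g = s \<cdot> f" "t \<cdot> icomp K E f g = t \<cdot> g" "icomp K E f g \<in> Ar K"
      "Dom K (icomp K E f g) = Dom K g" "Cod K (icomp K E f g) = M"
    if "f \<in> Ar K" "Cod K f = M" "g \<in> Ar K" "Cod K g = M" "Dom K f = Dom K g" "t \<cdot> f = s \<cdot> g" for f g
    using icomp_simps[of E f g] that by simp_all
  have Eid: "idn E \<in> Ar K" "Dom K (idn E) = R" "Cod K (idn E) = M" using icat_simps[OF E(1)] by simp_all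
  have Eid': "s \<cdot> (idn E \<cdot> x) = x" "t \<cdot> (idn E \<cdot> x) = x" if "x \<in> Ar K" "Cod K x = R" for x
    using icat_idn_elem[OF E(1), of x] that by simp_all
  let ?P = "prod_ob (Cat K) E A" and ?p = "pr1 (Cat K) E A" and ?q = "pr2 (Cat K) E A"
  \<comment> \<open>evaluation sends a transformation \<open>\<tau> : F \<Rightarrow> G\<close> and an arrow \<open>\<alpha>\<close> to \<open>F \<alpha>\<close> followed by
    \<open>\<tau>\<close> at the target of \<open>\<alpha>\<close>\<close>
  let ?ev0 = "U0 \<cdot> prod_pair K (f0 ?p) (f0 ?q)"
  let ?ev1 = "icomp K B (U1 \<cdot> prod_pair K (s \<cdot> f1 ?p) (f1 ?q)) (\<theta> \<cdot> prod_pair K (f1 ?p) (tgt A \<cdot> f1 ?q))"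
  have pq: "?p \<in> Ar (Cat K)" "?q \<in> Ar (Cat K)" "Dom (Cat K) ?p = ?P" "Dom (Cat K) ?q = ?P"
    "Cod (Cat K) ?p = E" "Cod (Cat K) ?q = A" "is_icat K ?P" by simp_all
  have pqA: "f0 ?p \<in> Ar K" "f0 ?q \<in> Ar K" "f1 ?p \<in> Ar K" "f1 ?q \<in> Ar K"
    "Dom K (f0 ?p) = C0 ?P" "Dom K (f0 ?q) = C0 ?P" "Dom K (f1 ?p) = C1 ?P" "Dom K (f1 ?q) = C1 ?P"
    "Cod K (f0 ?p) = R" "Cod K (f0 ?q) = C0 A" "Cod K (f1 ?p) = M" "Cod K (f1 ?q) = C1 A"
    by simp_all
  have ev1A: "?ev1 \<in> Ar K" "Dom K ?ev1 = C1 ?P" "Cod K ?ev1 = C1 B" by simp_all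
  have ev1: "?ev1 \<cdot> z = icomp K B (U1 \<cdot> prod_pair K (s \<cdot> (f1 ?p \<cdot> z)) (f1 ?q \<cdot> z))
      (\<theta> \<cdot> prod_pair K (f1 ?p \<cdot> z) (tgt A \<cdot> (f1 ?q \<cdot> z)))"
    if "z \<in> Ar K" "Cod K z = C1 ?P" for z
    using that by (subst icomp_cmp) simp_all
  have pqs: "s \<cdot> (f1 ?p \<cdot> z) = f0 ?p \<cdot> (src ?P \<cdot> z)" "t \<cdot> (f1 ?p \<cdot> z) = f0 ?p \<cdot> (tgt ?P \<cdot> z)"
    if "z \<in> Ar K" "Cod K z = C1 ?P" for z
    using ifun_elem[of ?p E z] that by simp_all
  obtain ev where ev: "ev \<in> Ar (Cat K)" "Dom (Cat K) ev = ?P" "Cod (Cat K) ev = B" "f0 ev = ?ev0" "f1 ev = ?ev1"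
  proof (rule ifunI[of ?P B ?ev0 ?ev1])
    show "src B \<cdot> ?ev1 = ?ev0 \<cdot> src ?P"
      using pqs[of "Ide K (C1 ?P)"] by simp
    show "tgt B \<cdot> ?ev1 = ?ev0 \<cdot> tgt ?P"
      using pqs[of "Ide K (C1 ?P)"] by simp
    show "?ev1 \<cdot> idn ?P = idn B \<cdot> ?ev0"
      by (subst ev1) (simp_all add: Eid' Ei)
  next
    fix f g assume fg: "f \<in> Ar K" "g \<in> Ar K" "Cod K f = C1 ?P" "Cod K g = C1 ?P" "Dom K f = Dom K g" "tgt ?P \<cdot> f = src ?P \<cdot> g"
    let ?m = "f1 ?p \<cdot> f" and ?n = "f1 ?p \<cdot> g" and ?a = "f1 ?q \<cdot> f" and ?b = "f1 ?q \<cdot> g"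
    have mn: "?m \<in> Ar K" "?n \<in> Ar K" "?a \<in> Ar K" "?b \<in> Ar K" "Cod K ?m = M" "Cod K ?n = M" "Cod K ?a = C1 A" "Cod K ?b = C1 A"
      "Dom K ?m = Dom K g" "Dom K ?n = Dom K g" "Dom K ?a = Dom K g" "Dom K ?b = Dom K g" using fg by simp_all
    have tm: "t \<cdot> ?m = s \<cdot> ?n" using fg pqs by simp
    have ta: "tgt A \<cdot> ?a = src A \<cdot> ?b" using fg by simp
    have pc: "f1 ?p \<cdot> icomp K ?P f g = icomp K E ?m ?n" "f1 ?q \<cdot> icomp K ?P f g = icomp K A ?a ?b"
      using fg by simp_all
    have L: "?ev1 \<cdot> icomp K ?P f g
      = icomp K B (icomp K B (U1 \<cdot> prod_pair K (s \<cdot> ?m) ?a) (U1 \<cdot> prod_pair K (s \<cdot> ?m) ?b))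
          (icomp K B (\<theta> \<cdot> prod_pair K ?m (tgt A \<cdot> ?b)) (\<theta> \<cdot> prod_pair K ?n (tgt A \<cdot> ?b)))"
      using ev1[of "icomp K ?P f g", unfolded pc] fg mn tm ta Es[of ?m ?n] Ec[of ?m ?n "tgt A \<cdot> ?b"]
      by (simp del: ifun_elem ifun_icomp)
    have Rr: "icomp K B (?ev1 \<cdot> f) (?ev1 \<cdot> g)
      = icomp K B (icomp K B (U1 \<cdot> prod_pair K (s \<cdot> ?m) ?a) (\<theta> \<cdot> prod_pair K ?m (src A \<cdot> ?b)))
          (icomp K B (U1 \<cdot> prod_pair K (t \<cdot> ?m) ?b) (\<theta> \<cdot> prod_pair K ?n (tgt A \<cdot> ?b)))"
      using fg(1-5) by (simp only: ev1 tm ta)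
    show "?ev1 \<cdot> icomp K ?P f g = icomp K B (?ev1 \<cdot> f) (?ev1 \<cdot> g)"
      unfolding L Rr
      by (rule icomp_interchange) (use mn tm ta nat_th[of ?m ?b] in \<open>simp_all del: ifun_elem\<close>)
  qed (use that ev1A in simp_all)
  have ev0E: "f0 ev \<cdot> el0 E A x a = U0 \<cdot> prod_pair K x a"
    if "x \<in> Ar K" "Cod K x = R" "a \<in> Ar K" "Cod K a = C0 A" "Dom K x = Dom K a" for x a
    using that ev by simp
  have ev1E: "f1 ev \<cdot> el1 E A x a = icomp K B (U1 \<cdot> prod_pair K (s \<cdot> x) a) (\<theta> \<cdot> prod_pair K x (tgt A \<cdot> a))"
    if "x \<in> Ar K" "Cod K x = M" "a \<in> Ar K" "Cod K a = C1 A" "Dom K x = Dom K a" for x a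
    using that ev(5) ev1[of "el1 E A x a"] by simp
  have "is_exponential (Cat K) A B E ev"
    unfolding is_exponential_def
  proof (intro conjI ballI)
    fix Z F assume "Z \<in> Ob (Cat K)" "F \<in> hom (Cat K) (prod_ob (Cat K) Z A) B"
    then have Z [simp]: "is_icat K Z" and F [simp]: "F \<in> Ar (Cat K)" "Dom (Cat K) F = prod_ob (Cat K) Z A" "Cod (Cat K) F = B"
      by simp_all
    let ?ZA = "prod_ob (Cat K) Z A"
    \<comment> \<open>the transpose of \<open>F\<close>: on objects \<open>z \<mapsto> F (z, -)\<close>, on arrows \<open>\<zeta> \<mapsto> F (\<zeta>, id)\<close>\<close>
    let ?F0 = "f0 F \<cdot> el0 Z A (pr1 K (C0 Z) (C0 A)) (pr2 K (C0 Z) (C0 A))"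
    let ?F1 = "f1 F \<cdot> el1 Z A (idn Z \<cdot> pr1 K (C0 Z) (C1 A)) (pr2 K (C0 Z) (C1 A))"
    have Fi: "f1 F \<cdot> el1 Z A (idn Z \<cdot> z) (idn A \<cdot> a) = idn B \<cdot> (f0 F \<cdot> el0 Z A z a)"
      if "z \<in> Ar K" "Cod K z = C0 Z" "a \<in> Ar K" "Cod K a = C0 A" "Dom K z = Dom K a" for z a
      using ifun_idn_elem[OF F(1,2), of "el0 Z A z a"] that by simp
    have Fc: "f1 F \<cdot> el1 Z A (icomp K Z z z') (icomp K A a a') = icomp K B (f1 F \<cdot> el1 Z A z a) (f1 F \<cdot> el1 Z A z' a')"
      if "z \<in> Ar K" "z' \<in> Ar K" "a \<in> Ar K" "a' \<in> Ar K" "Dom K z = Dom K z'" "Dom K a = Dom K z'"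
        "Dom K z' = Dom K a'" "Cod K z = C1 Z" "Cod K z' = C1 Z" "Cod K a = C1 A" "Cod K a' = C1 A"
        "tgt Z \<cdot> z = src Z \<cdot> z'" "tgt A \<cdot> a = src A \<cdot> a'" for z z' a a'
      using ifun_icomp[OF F(1,2), of "el1 Z A z a" "el1 Z A z' a'"] that by simp
    have Fl: "f1 F \<cdot> el1 Z A z a
        = icomp K B (f1 F \<cdot> el1 Z A (idn Z \<cdot> (src Z \<cdot> z)) a) (f1 F \<cdot> el1 Z A z (idn A \<cdot> (tgt A \<cdot> a)))"
      and Fr: "f1 F \<cdot> el1 Z A z a
        = icomp K B (f1 F \<cdot> el1 Z A z (idn A \<cdot> (src A \<cdot> a))) (f1 F \<cdot> el1 Z A (idn Z \<cdot> (tgt Z \<cdot> z)) a)"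
      if "z \<in> Ar K" "Cod K z = C1 Z" "a \<in> Ar K" "Cod K a = C1 A" "Dom K z = Dom K a" for z a
      by (subst Fc[symmetric]; use that in simp)+
    have Fca: "f1 F \<cdot> el1 Z A (icomp K Z z z') (idn A \<cdot> a)
        = icomp K B (f1 F \<cdot> el1 Z A z (idn A \<cdot> a)) (f1 F \<cdot> el1 Z A z' (idn A \<cdot> a))"
      if "z \<in> Ar K" "z' \<in> Ar K" "a \<in> Ar K" "Dom K z = Dom K z'" "Dom K z' = Dom K a"
        "Cod K z = C1 Z" "Cod K z' = C1 Z" "Cod K a = C0 A" "tgt Z \<cdot> z = src Z \<cdot> z'" for z z' a
      by (subst Fc[symmetric]) (use that in simp_all)
    have fam: "fun_family A B (C0 Z) ?F0 ?F1"
    proof (rule fun_familyI)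
      fix x a b assume *: "x \<in> Ar K" "Cod K x = C0 Z" "a \<in> Ar K" "Cod K a = C1 A" "b \<in> Ar K" "Cod K b = C1 A"
        "Dom K x = Dom K b" "Dom K a = Dom K b" "tgt A \<cdot> a = src A \<cdot> b"
      show "?F1 \<cdot> prod_pair K x (icomp K A a b) = icomp K B (?F1 \<cdot> prod_pair K x a) (?F1 \<cdot> prod_pair K x b)"
        using * Fc[of "idn Z \<cdot> x" "idn Z \<cdot> x" a b] by simp
    qed (simp_all add: Fi)
    from U_ex[OF _ fam] obtain g0 where g0: "g0 \<in> Ar K" "Dom K g0 = C0 Z" "Cod K g0 = R"
      and g0e: "U0 \<cdot> prod_ar K g0 (Ide K (C0 A)) = ?F0" "U1 \<cdot> prod_ar K g0 (Ide K (C1 A)) = ?F1"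
      by auto
    have g0E: "U0 \<cdot> prod_pair K (g0 \<cdot> z) a = f0 F \<cdot> el0 Z A z a"
      if "z \<in> Ar K" "Cod K z = C0 Z" "a \<in> Ar K" "Cod K a = C0 A" "Dom K z = Dom K a" for z a
      using act_elem[OF g0e(1), of R z a] g0 that by simp
    have g0E1: "U1 \<cdot> prod_pair K (g0 \<cdot> z) a = f1 F \<cdot> el1 Z A (idn Z \<cdot> z) a"
      if "z \<in> Ar K" "Cod K z = C0 Z" "a \<in> Ar K" "Cod K a = C1 A" "Dom K z = Dom K a" for z a
      using act_elem[OF g0e(2), of R z a] g0 that by simp
    let ?\<tau> = "f1 F \<cdot> el1 Z A (pr1 K (C1 Z) (C0 A)) (idn A \<cdot> pr2 K (C1 Z) (C0 A))"
    have "\<exists>f. f \<in> hom K (C1 Z) M \<and> s \<cdot> f = g0 \<cdot> src Z \<and> t \<cdot> f = g0 \<cdot> tgt Z \<and> \<theta> \<cdot> prod_ar K f (Ide K (C0 A)) = ?\<tau>"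
    proof (rule th_ex)
      fix w a assume *: "w \<in> Ar K" "Cod K w = C1 Z" "a \<in> Ar K" "Cod K a = C1 A" "Dom K w = Dom K a"
      show "icomp K B (U1 \<cdot> prod_pair K ((g0 \<cdot> src Z) \<cdot> w) a) (?\<tau> \<cdot> prod_pair K w (tgt A \<cdot> a))
          = icomp K B (?\<tau> \<cdot> prod_pair K w (src A \<cdot> a)) (U1 \<cdot> prod_pair K ((g0 \<cdot> tgt Z) \<cdot> w) a)"
        using * g0 by (simp add: g0E1 Fl[symmetric] Fr[symmetric])
    qed (use g0 in \<open>simp_all add: g0E\<close>)
    then obtain g1 where g1: "g1 \<in> Ar K" "Dom K g1 = C1 Z" "Cod K g1 = M" "s \<cdot> g1 = g0 \<cdot> src Z" "t \<cdot> g1 = g0 \<cdot> tgt Z"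
      and g1e: "\<theta> \<cdot> prod_ar K g1 (Ide K (C0 A)) = ?\<tau>" by auto
    have sg1: "s \<cdot> (g1 \<cdot> z) = g0 \<cdot> (src Z \<cdot> z)" "t \<cdot> (g1 \<cdot> z) = g0 \<cdot> (tgt Z \<cdot> z)" if "z \<in> Ar K" "Cod K z = C1 Z" for z
      using cmp_eq_assoc[OF g1(4), of z] cmp_eq_assoc[OF g1(5), of z] g1(1-3) g0 that by simp_all
    have g1E: "\<theta> \<cdot> prod_pair K (g1 \<cdot> z) a = f1 F \<cdot> el1 Z A z (idn A \<cdot> a)"
      if "z \<in> Ar K" "Cod K z = C1 Z" "a \<in> Ar K" "Cod K a = C0 A" "Dom K z = Dom K a" for z a
      using act_elem[OF g1e, of M z a] g1 that by simp
    obtain G where G: "G \<in> Ar (Cat K)" "Dom (Cat K) G = Z" "Cod (Cat K) G = E" "f0 G = g0" "f1 G = g1"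
    proof (rule ifunI[of Z E g0 g1])
      show "g1 \<cdot> idn Z = idn E \<cdot> g0"
        by (rule th_ext) (use g0 g1(1-3) Eid in \<open>simp_all add: Eid' sg1 Ei g1E g0E Fi\<close>)
      fix f g assume fg: "f \<in> Ar K" "g \<in> Ar K" "Cod K f = C1 Z" "Cod K g = C1 Z" "Dom K f = Dom K g" "tgt Z \<cdot> f = src Z \<cdot> g"
      have ts: "tgt Z \<cdot> (f \<cdot> w) = src Z \<cdot> (g \<cdot> w)" if "w \<in> Ar K" "Cod K w = Dom K g" for w
        by (rule cmp_eq_assoc[OF fg(6)]) (use fg that in simp_all)
      have e: "t \<cdot> (g1 \<cdot> f) = s \<cdot> (g1 \<cdot> g)" using fg by (simp add: sg1)
      have e': "icomp K E (g1 \<cdot> f) (g1 \<cdot> g) \<cdot> w = icomp K E (g1 \<cdot> (f \<cdot> w)) (g1 \<cdot> (g \<cdot> w))"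
        if "w \<in> Ar K" "Cod K w = Dom K g" for w
        using icomp_cmp[OF E(1), of "g1 \<cdot> f" "g1 \<cdot> g" w] fg g1(1-3) that e by simp
      show "g1 \<cdot> icomp K Z f g = icomp K E (g1 \<cdot> f) (g1 \<cdot> g)"
      proof (rule th_ext)
        fix w a assume w: "w \<in> Ar K" "Cod K w = Dom K (icomp K E (g1 \<cdot> f) (g1 \<cdot> g))" "a \<in> Ar K" "Cod K a = C0 A" "Dom K w = Dom K a"
        have wg: "Cod K w = Dom K g" using w Es[of "g1 \<cdot> f" "g1 \<cdot> g"] fg g1(1-3) e by simp
        have "\<theta> \<cdot> prod_pair K (icomp K E (g1 \<cdot> (f \<cdot> w)) (g1 \<cdot> (g \<cdot> w))) a
            = icomp K B (\<theta> \<cdot> prod_pair K (g1 \<cdot> (f \<cdot> w)) a) (\<theta> \<cdot> prod_pair K (g1 \<cdot> (g \<cdot> w)) a)"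
          by (rule Ec) (use fg g1(1-3) w(1,3-5) wg ts in \<open>simp_all add: sg1\<close>)
        then have R1: "\<theta> \<cdot> prod_pair K (icomp K E (g1 \<cdot> f) (g1 \<cdot> g) \<cdot> w) a
            = icomp K B (f1 F \<cdot> el1 Z A (f \<cdot> w) (idn A \<cdot> a)) (f1 F \<cdot> el1 Z A (g \<cdot> w) (idn A \<cdot> a))"
          using e'[OF w(1) wg] fg(1-5) w(1,3-5) wg by (simp add: g1E)
        have fgw: "(g1 \<cdot> icomp K Z f g) \<cdot> w = g1 \<cdot> icomp K Z (f \<cdot> w) (g \<cdot> w)"
          using fg g1(1-3) w(1) wg by simp
        show "\<theta> \<cdot> prod_pair K ((g1 \<cdot> icomp K Z f g) \<cdot> w) a = \<theta> \<cdot> prod_pair K (icomp K E (g1 \<cdot> f) (g1 \<cdot> g) \<cdot> w) a"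
          unfolding R1 fgw using fg(1-5) w(1,3-5) wg ts[OF w(1) wg] by (simp add: g1E Fca)
      qed (use fg g1(1-3) e Es[of "g1 \<cdot> f" "g1 \<cdot> g"] in \<open>simp_all add: sg1\<close>)
    qed (use g0 g1 that in simp_all)
    have evG: "ev \<odot> prod_ar (Cat K) G (Ide (Cat K) A) = F"
    proof (rule ifun_prod_ext[of Z A])
      fix x y assume xy: "x \<in> Ar K" "y \<in> Ar K" "Dom K x = Dom K y" "Cod K x = C1 Z" "Cod K y = C1 A"
      have "f1 (ev \<odot> prod_ar (Cat K) G (Ide (Cat K) A)) \<cdot> el1 Z A x y = f1 ev \<cdot> el1 E A (g1 \<cdot> x) y"
        using xy ev(1-3) G by simp
      also have "\<dots> = f1 F \<cdot> el1 Z A x y"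
        using xy ev1E[of "g1 \<cdot> x" y] g1(1-3) by (simp add: sg1 g0E1 g1E Fl[symmetric])
      finally show "f1 (ev \<odot> prod_ar (Cat K) G (Ide (Cat K) A)) \<cdot> el1 Z A x y = f1 F \<cdot> el1 Z A x y" .
    qed (use ev G in simp_all)
    show "\<exists>!g. g \<in> hom (Cat K) Z E \<and> ev \<odot> prod_ar (Cat K) g (Ide (Cat K) A) = F"
    proof (rule ex1I[of _ G])
      show "G \<in> hom (Cat K) Z E \<and> ev \<odot> prod_ar (Cat K) G (Ide (Cat K) A) = F" using G evG by simp
    next
      fix H assume "H \<in> hom (Cat K) Z E \<and> ev \<odot> prod_ar (Cat K) H (Ide (Cat K) A) = F"
      then have H: "H \<in> Ar (Cat K)" "Dom (Cat K) H = Z" "Cod (Cat K) H = E"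
        and He: "ev \<odot> prod_ar (Cat K) H (Ide (Cat K) A) = F" by simp_all
      have HA: "f0 H \<in> Ar K" "Dom K (f0 H) = C0 Z" "Cod K (f0 H) = R" "f1 H \<in> Ar K" "Dom K (f1 H) = C1 Z" "Cod K (f1 H) = M"
        using H ifun_simps[OF H(1)] by simp_all
      have Hs: "s \<cdot> (f1 H \<cdot> z) = f0 H \<cdot> (src Z \<cdot> z)" "t \<cdot> (f1 H \<cdot> z) = f0 H \<cdot> (tgt Z \<cdot> z)"
        if "z \<in> Ar K" "Cod K z = C1 Z" for z
        using ifun_elem[OF H(1,3), of z] H that by simp_all
      have Hi: "f1 H \<cdot> (idn Z \<cdot> z) = idn E \<cdot> (f0 H \<cdot> z)" if "z \<in> Ar K" "Cod K z = C0 Z" for z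
        using ifun_idn_elem[OF H(1,2) that] H by simp
      have F1: "f1 F \<cdot> el1 Z A x y = icomp K B (U1 \<cdot> prod_pair K (f0 H \<cdot> (src Z \<cdot> x)) y) (\<theta> \<cdot> prod_pair K (f1 H \<cdot> x) (tgt A \<cdot> y))"
        if xy: "x \<in> Ar K" "y \<in> Ar K" "Dom K x = Dom K y" "Cod K x = C1 Z" "Cod K y = C1 A" for x y
      proof -
        have "f1 (ev \<odot> prod_ar (Cat K) H (Ide (Cat K) A)) \<cdot> el1 Z A x y = f1 ev \<cdot> el1 E A (f1 H \<cdot> x) y"
          using xy ev(1-3) H by simp
        then show ?thesis using He ev1E[of "f1 H \<cdot> x" y] xy HA Hs by simp
      qed
      have F0: "f0 F \<cdot> el0 Z A x y = U0 \<cdot> prod_pair K (f0 H \<cdot> x) y"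
        if xy: "x \<in> Ar K" "y \<in> Ar K" "Dom K x = Dom K y" "Cod K x = C0 Z" "Cod K y = C0 A" for x y
      proof -
        have "f0 (ev \<odot> prod_ar (Cat K) H (Ide (Cat K) A)) \<cdot> el0 Z A x y = f0 ev \<cdot> el0 E A (f0 H \<cdot> x) y"
          using xy ev(1-3) H by simp
        then show ?thesis using He ev0E[of "f0 H \<cdot> x" y] xy HA by simp
      qed
      have "f0 H = g0"
      proof (rule U_ext)
        fix w a assume w: "w \<in> Ar K" "Cod K w = Dom K g0" "a \<in> Ar K" "Cod K a = C0 A" "Dom K w = Dom K a"
        then show "U0 \<cdot> prod_pair K (f0 H \<cdot> w) a = U0 \<cdot> prod_pair K (g0 \<cdot> w) a"
          using g0 by (simp add: g0E F0)
      next
        fix w a assume w: "w \<in> Ar K" "Cod K w = Dom K g0" "a \<in> Ar K" "Cod K a = C1 A" "Dom K w = Dom K a"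
        then show "U1 \<cdot> prod_pair K (f0 H \<cdot> w) a = U1 \<cdot> prod_pair K (g0 \<cdot> w) a"
          using g0 HA by (simp add: g0E1 F1 Hi Ei)
      qed (use HA g0 in simp_all)
      moreover have "f1 H = g1"
      proof (rule th_ext)
        show "s \<cdot> f1 H = s \<cdot> g1" "t \<cdot> f1 H = t \<cdot> g1"
          using Hs[of "Ide K (C1 Z)"] HA g1 \<open>f0 H = g0\<close> by simp_all
        fix w a assume w: "w \<in> Ar K" "Cod K w = Dom K g1" "a \<in> Ar K" "Cod K a = C0 A" "Dom K w = Dom K a"
        then show "\<theta> \<cdot> prod_pair K (f1 H \<cdot> w) a = \<theta> \<cdot> prod_pair K (g1 \<cdot> w) a"
          using g1 HA by (simp add: g1E F1 Hs)
      qed (use HA g1 in simp_all)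
      ultimately show "H = G" by (intro ifun_ext0) (use H G in simp_all)
    qed
  qed (use ev in simp_all)
  then show ?thesis by blast
qed

end

lemma (in topos) Cat_exponential:
  assumes A: "is_icat K A" and B: "is_icat K B"
  shows "\<exists>E ev. is_exponential (Cat K) A B E ev"
proof -
  obtain R U0 U1 where R: "R \<in> Ob K" "fun_family A B R U0 U1"
    "\<And>X F0 F1. X \<in> Ob K \<Longrightarrow> fun_family A B X F0 F1 \<Longrightarrow>
      \<exists>f. f \<in> hom K X R \<and> U0 \<cdot> prod_ar K f (Ide K (C0 A)) = F0 \<and> U1 \<cdot> prod_ar K f (Ide K (C1 A)) = F1"
    "\<And>f g. f \<in> Ar K \<Longrightarrow> g \<in> Ar K \<Longrightarrow> Dom K f = Dom K g \<Longrightarrow> Cod K f = R \<Longrightarrow> Cod K g = R \<Longrightarrow>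
      U0 \<cdot> prod_ar K f (Ide K (C0 A)) = U0 \<cdot> prod_ar K g (Ide K (C0 A)) \<Longrightarrow>
      U1 \<cdot> prod_ar K f (Ide K (C1 A)) = U1 \<cdot> prod_ar K g (Ide K (C1 A)) \<Longrightarrow> f = g"
    by (rule functor_object[OF A B]) (rule that)
  show ?thesis
  proof (rule transformation_object[OF A B R(1,2)], goal_cases)
    case (1 M s t \<theta>)
    interpret exponential_data K A B R U0 U1 M s t \<theta>
    proof (unfold_locales, goal_cases)
      case (6 X F0 F1)
      then show ?case by (rule R(3))
    next
      case (7 f g)
      then show ?case by (rule R(4))
    next
      case (20 X x y \<tau>)
      show ?case by (rule 1(3)[OF 20(1)]) (use 20 in auto)
    next
      case (21 f g)
      then show ?case by (rule 1(4))
    qed (use A B R(1,2) 1(1,2) in auto)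
    show ?case by (rule is_exponential_ex)
  qed
qed

sublocale topos \<subseteq> Cat: ccc "Cat K"
proof
  fix a b assume "a \<in> Ob (Cat K)" "b \<in> Ob (Cat K)"
  then show "\<exists>e ev. is_exponential (Cat K) a b e ev" by (intro Cat_exponential) simp_all
qed

section \<open>Constant arrows\<close>

context category
begin

lemma const_ar_simps [simp]:
  assumes T: "is_terminal K (Dom K \<alpha>)" and a: "\<alpha> \<in> Ar K" and W: "W \<in> Ob K"
  shows "const_ar K W \<alpha> \<in> Ar K" "Dom K (const_ar K W \<alpha>) = W" "Cod K (const_ar K W \<alpha>) = Cod K \<alpha>"
proof -
  have "\<exists>!h. h \<in> hom K W (Dom K \<alpha>)" using T W by (auto simp: is_terminal_def)
  from theI'[OF this] show "const_ar K W \<alpha> \<in> Ar K" "Dom K (const_ar K W \<alpha>) = W" "Cod K (const_ar K W \<alpha>) = Cod K \<alpha>"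
    unfolding const_ar_def using a by simp_all
qed

lemma const_ar_eq:
  assumes T: "is_terminal K (Dom K \<alpha>)" and u: "u \<in> Ar K" "Cod K u = Dom K \<alpha>" "Dom K u = W"
  shows "\<alpha> \<cdot> u = const_ar K W \<alpha>"
proof -
  have W: "W \<in> Ob K" using u by auto
  have "\<exists>!h. h \<in> hom K W (Dom K \<alpha>)" using T W by (auto simp: is_terminal_def)
  then have "(THE h. h \<in> hom K W (Dom K \<alpha>)) = u" using u by (intro the1_equality) simp_all
  then show ?thesis by (simp add: const_ar_def)
qed

lemma const_arE:
  assumes T: "is_terminal K (Dom K \<alpha>)" and W: "W \<in> Ob K"
  obtains u where "u \<in> Ar K" "Cod K u = Dom K \<alpha>" "Dom K u = W" "const_ar K W \<alpha> = \<alpha> \<cdot> u"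
proof -
  obtain u where "u \<in> hom K W (Dom K \<alpha>)" using T W unfolding is_terminal_def by blast
  then show ?thesis using that[of u] const_ar_eq[OF T, of u W] by simp
qed

lemma const_ar_cmp [simp]:
  assumes T: "is_terminal K (Dom K \<alpha>)" and a: "\<alpha> \<in> Ar K" and h: "h \<in> Ar K" "Cod K h = W"
  shows "const_ar K W \<alpha> \<cdot> h = const_ar K (Dom K h) \<alpha>"
proof -
  have W: "W \<in> Ob K" using h by auto
  obtain u where u: "u \<in> Ar K" "Cod K u = Dom K \<alpha>" "Dom K u = W" "const_ar K W \<alpha> = \<alpha> \<cdot> u"
    by (rule const_arE[OF T W])
  show ?thesis using const_ar_eq[OF T, of "u \<cdot> h" "Dom K h"] u a h by simp
qed

lemma cmp_const_ar:
  assumes T: "is_terminal K (Dom K \<alpha>)" and a: "\<alpha> \<in> Ar K" and W: "W \<in> Ob K" and k: "k \<in> Ar K" "Dom K k = Cod K \<alpha>"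
  shows "k \<cdot> const_ar K W \<alpha> = const_ar K W (k \<cdot> \<alpha>)"
proof -
  obtain u where u: "u \<in> Ar K" "Cod K u = Dom K \<alpha>" "Dom K u = W" "const_ar K W \<alpha> = \<alpha> \<cdot> u"
    by (rule const_arE[OF T W])
  show ?thesis using const_ar_eq[of "k \<cdot> \<alpha>" u W] u a k T by simp
qed

lemma const_ar_self [simp]:
  "is_terminal K (Dom K \<alpha>) \<Longrightarrow> \<alpha> \<in> Ar K \<Longrightarrow> Dom K \<alpha> = W \<Longrightarrow> const_ar K W \<alpha> = \<alpha>"
  using const_ar_eq[of \<alpha> "Ide K W" W] Dom_Ob[of \<alpha>] by simp

end

context topos
begin

section \<open>Discrete categories\<close>

definition dis :: "'a \<Rightarrow> ('a, 'b) icat" where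
  "dis W = \<lparr>C0 = W, C1 = W, C2 = W, src = Ide K W, tgt = Ide K W, idn = Ide K W,
     fstp = Ide K W, sndp = Ide K W, mul = Ide K W\<rparr>"

lemma dis_sel [simp]:
  "C0 (dis W) = W" "C1 (dis W) = W" "src (dis W) = Ide K W" "tgt (dis W) = Ide K W" "idn (dis W) = Ide K W"
  by (simp_all add: dis_def)

lemma dis_icat [simp]:
  assumes W: "W \<in> Ob K"
  shows "is_icat K (dis W)"
proof -
  have P: "is_pullback K (Ide K W) (Ide K W) (Ide K W) (Ide K W)"
    using W by (auto simp: is_pullback_def)
  have p: "pair K (Ide K W) (Ide K W) f f = f" if "f \<in> Ar K" "Cod K f = W" for f
    using pair_pullback[OF P, of f f] that W by simp
  have c: "icomp K (dis W) f f = f" if "f \<in> Ar K" "Cod K f = W" for f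
    using p[OF that] that W by (simp add: icomp_def dis_def)
  have as: "\<forall>x\<in>Ob K. \<forall>f\<in>hom K x (C1 (dis W)). \<forall>g\<in>hom K x (C1 (dis W)). \<forall>h\<in>hom K x (C1 (dis W)).
      tgt (dis W) \<cdot> f = src (dis W) \<cdot> g \<longrightarrow> tgt (dis W) \<cdot> g = src (dis W) \<cdot> h \<longrightarrow>
      icomp K (dis W) (icomp K (dis W) f g) h = icomp K (dis W) f (icomp K (dis W) g h)"
    using W by (auto simp: c)
  show ?thesis unfolding is_icat_def
    by (intro conjI as) (use W P c[of "Ide K W"] in \<open>simp_all add: dis_def\<close>)
qed

lemma icomp_dis [simp]: "f \<in> Ar K \<Longrightarrow> Cod K f = W \<Longrightarrow> icomp K (dis W) f f = f"
  using icomp_unit(1)[of "dis W" f f] Cod_Ob[of f] by simp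

definition dis_el :: "('a, 'b) icat \<Rightarrow> 'b \<Rightarrow> ('a, 'b) ifun" where
  "dis_el C x = \<lparr>fdom = dis (Dom K x), fcod = C, f0 = x, f1 = idn C \<cdot> x\<rparr>"

lemma dis_el_simps [simp]:
  assumes "is_icat K C" "x \<in> Ar K" "Cod K x = C0 C"
  shows "dis_el C x \<in> Ar (Cat K)" "Dom (Cat K) (dis_el C x) = dis (Dom K x)" "Cod (Cat K) (dis_el C x) = C"
    "f0 (dis_el C x) = x" "f1 (dis_el C x) = idn C \<cdot> x"
proof -
  obtain F where F: "F \<in> Ar (Cat K)" "Dom (Cat K) F = dis (Dom K x)" "Cod (Cat K) F = C" "f0 F = x" "f1 F = idn C \<cdot> x"
    by (rule ifunI[of "dis (Dom K x)" C x "idn C \<cdot> x"]) (use assms in auto)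
  then have "F = dis_el C x" by (intro ifun.equality) (auto simp: Cat_def dis_el_def)
  then show "dis_el C x \<in> Ar (Cat K)" "Dom (Cat K) (dis_el C x) = dis (Dom K x)" "Cod (Cat K) (dis_el C x) = C"
    "f0 (dis_el C x) = x" "f1 (dis_el C x) = idn C \<cdot> x" using F by simp_all
qed

lemma dis_fun_eq:
  assumes "F \<in> Ar (Cat K)" "G \<in> Ar (Cat K)" "Dom (Cat K) F = dis W" "Dom (Cat K) G = dis W" "W \<in> Ob K"
    "Cod (Cat K) F = Cod (Cat K) G" "f0 F = f0 G"
  shows "F = G"
proof (rule ifun_ext0)
  have "f1 F = idn (Cod (Cat K) F) \<cdot> f0 F" using ifun_idn[OF assms(1,3)] assms by simp
  moreover have "f1 G = idn (Cod (Cat K) G) \<cdot> f0 G" using ifun_idn[OF assms(2,4)] assms by simp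
  ultimately show "f1 F = f1 G" using assms by simp
qed (use assms in simp_all)

definition dis_ar :: "'b \<Rightarrow> ('a, 'b) ifun" where
  "dis_ar e = dis_el (dis (Cod K e)) e"

lemma dis_ar_simps [simp]:
  assumes "e \<in> Ar K"
  shows "dis_ar e \<in> Ar (Cat K)" "Dom (Cat K) (dis_ar e) = dis (Dom K e)"
    "Cod (Cat K) (dis_ar e) = dis (Cod K e)" "f0 (dis_ar e) = e" "f1 (dis_ar e) = e"
  using assms by (simp_all add: dis_ar_def)

text \<open>The functor \<open>f\<close> is an element of \<open>C\<^sup>a\<close> at stage \<open>W\<close>. Pulling back the epimorphism \<open>C\<^sup>k\<close> along it
  gives a cover of \<open>W\<close> over which the element comes from \<open>C\<^sup>b\<close>.\<close>

lemma local_lift: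
  assumes epi: "is_epi K (hom_pre K k C)" and k: "k \<in> Ar (Cat K)" and C: "is_icat K C" and W: "W \<in> Ob K"
    and f: "f \<in> Ar (Cat K)" "Dom (Cat K) f = prod_ob (Cat K) (dis W) (Dom (Cat K) k)" "Cod (Cat K) f = C"
  obtains e g where "is_epi K e" "e \<in> Ar K" "Cod K e = W" "g \<in> Ar (Cat K)"
    "Dom (Cat K) g = prod_ob (Cat K) (dis (Dom K e)) (Cod (Cat K) k)" "Cod (Cat K) g = C"
    "g \<odot> prod_ar (Cat K) (Ide (Cat K) (dis (Dom K e))) k
      = f \<odot> prod_ar (Cat K) (dis_ar e) (Ide (Cat K) (Dom (Cat K) k))"
proof -
  let ?a = "Dom (Cat K) k" and ?b = "Cod (Cat K) k"
  let ?f = "curry_ar (Cat K) (dis W) ?a C f"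
  let ?E = "exp_ob (Cat K) ?b C" and ?k = "exp_pre (Cat K) k C"
  have fc: "?f \<in> Ar (Cat K)" "Dom (Cat K) ?f = dis W" "Cod (Cat K) ?f = exp_ob (Cat K) ?a C" "Cat.uncurry ?a C ?f = f"
    using k C W f by simp_all
  have kc: "?k \<in> Ar (Cat K)" "Dom (Cat K) ?k = ?E" "Cod (Cat K) ?k = exp_ob (Cat K) ?a C"
    using k C by simp_all
  have Ei: "is_icat K ?E" "is_icat K (exp_ob (Cat K) ?a C)"
    using Cat.exp_simps(1)[of ?b C] Cat.exp_simps(1)[of ?a C] k C by simp_all
  have epi': "is_epi K (f0 ?k)" using epi by (simp add: hom_pre_def)
  have f0A: "f0 ?f \<in> Ar K" "Cod K (f0 ?f) = Cod K (f0 ?k)" "Dom K (f0 ?f) = W" using fc kc by simp_all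
  obtain e x where e: "is_epi K e" "e \<in> Ar K" "Cod K e = W" and x: "x \<in> Ar K" "Dom K x = Dom K e" "Cod K x = C0 ?E"
    and ex: "f0 ?f \<cdot> e = f0 ?k \<cdot> x"
  proof (rule epi_pullback[OF epi' f0A(1,2)])
    fix z t assume *: "is_epi K z" "z \<in> Ar K" "Cod K z = Dom K (f0 ?f)" "t \<in> Ar K"
      "Dom K t = Dom K z" "Cod K t = Dom K (f0 ?k)" "f0 ?f \<cdot> z = f0 ?k \<cdot> t"
    show thesis by (rule that[of z t]) (use * fc kc in simp_all)
  qed
  let ?g = "dis_el ?E x"
  have g: "?g \<in> Ar (Cat K)" "Dom (Cat K) ?g = dis (Dom K e)" "Cod (Cat K) ?g = ?E" "f0 ?g = x"
    using x Ei by simp_all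
  have de: "dis_ar e \<in> Ar (Cat K)" "Dom (Cat K) (dis_ar e) = dis (Dom K e)" "Cod (Cat K) (dis_ar e) = dis W" "f0 (dis_ar e) = e"
    using e W by simp_all
  have "?k \<odot> ?g = ?f \<odot> dis_ar e"
    by (rule dis_fun_eq[of _ _ "Dom K e"]) (use g de kc fc e(2) ex in simp_all)
  then have "Cat.uncurry ?a C (?k \<odot> ?g) = Cat.uncurry ?a C (?f \<odot> dis_ar e)" by simp
  moreover have "Cat.uncurry ?a C (?k \<odot> ?g) = Cat.uncurry ?b C ?g \<odot> prod_ar (Cat K) (Ide (Cat K) (dis (Dom K e))) k"
    using Cat.uncurry_exp_pre[of C k ?g] k C g by simp
  moreover have "Cat.uncurry ?a C (?f \<odot> dis_ar e) = f \<odot> prod_ar (Cat K) (dis_ar e) (Ide (Cat K) ?a)"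
    using Cat.uncurry_cmp[of ?a C ?f "dis_ar e"] k C fc de by simp
  ultimately have "Cat.uncurry ?b C ?g \<odot> prod_ar (Cat K) (Ide (Cat K) (dis (Dom K e))) k
      = f \<odot> prod_ar (Cat K) (dis_ar e) (Ide (Cat K) ?a)" by simp
  then show ?thesis
    by (intro that[of e "Cat.uncurry ?b C ?g"]) (use e g k C in simp_all)
qed

text \<open>The same for post-composition; the arrow of hom-objects being invertible, no cover is needed.\<close>

lemma hom_iso_lift:
  assumes iso: "is_iso K (hom_post K V i)" and i: "i \<in> Ar (Cat K)" and V: "is_icat K V" and W: "W \<in> Ob K"
    and f: "f \<in> Ar (Cat K)" "Dom (Cat K) f = prod_ob (Cat K) (dis W) V" "Cod (Cat K) f = Cod (Cat K) i"
  obtains g where "g \<in> Ar (Cat K)" "Dom (Cat K) g = prod_ob (Cat K) (dis W) V" "Cod (Cat K) g = Dom (Cat K) i"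
    "i \<odot> g = f"
proof -
  let ?c = "Dom (Cat K) i" and ?d = "Cod (Cat K) i"
  let ?f = "curry_ar (Cat K) (dis W) V ?d f" and ?i = "exp_post (Cat K) V i" and ?E = "exp_ob (Cat K) V ?c"
  have fc: "?f \<in> Ar (Cat K)" "Dom (Cat K) ?f = dis W" "Cod (Cat K) ?f = exp_ob (Cat K) V ?d" "Cat.uncurry V ?d ?f = f"
    using i V W f by simp_all
  have ic: "?i \<in> Ar (Cat K)" "Dom (Cat K) ?i = ?E" "Cod (Cat K) ?i = exp_ob (Cat K) V ?d" using i V by simp_all
  have Ei: "is_icat K ?E" using Cat.exp_simps(1)[of V ?c] i V by simp
  obtain j where j: "j \<in> Ar K" "Dom K j = Cod K (f0 ?i)" "Cod K j = Dom K (f0 ?i)" "f0 ?i \<cdot> j = Ide K (Cod K (f0 ?i))"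
    using iso unfolding is_iso_def hom_post_def by auto
  let ?x = "j \<cdot> f0 ?f"
  have x: "?x \<in> Ar K" "Dom K ?x = W" "Cod K ?x = C0 ?E" using j fc ic by simp_all
  let ?g = "dis_el ?E ?x"
  have g: "?g \<in> Ar (Cat K)" "Dom (Cat K) ?g = dis W" "Cod (Cat K) ?g = ?E" "f0 ?g = ?x"
    using x Ei by simp_all
  have "f0 ?i \<cdot> (j \<cdot> f0 ?f) = f0 ?f"
    using cmp_eq_assoc1[OF j(4), of "f0 ?f"] j fc ic by simp
  then have "?i \<odot> ?g = ?f" by (intro dis_fun_eq[of _ _ W]) (use g ic fc W in simp_all)
  then have "Cat.uncurry V ?d (?i \<odot> ?g) = f" using fc by simp
  then have "i \<odot> Cat.uncurry V ?c ?g = f" using Cat.uncurry_exp_post[of V i ?g] i V g by simp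
  then show ?thesis by (intro that[of "Cat.uncurry V ?c ?g"]) (use g i V in simp_all)
qed

section \<open>Evaluation at global arrows\<close>

text \<open>A functor \<open>p : dis W \<times> A \<rightarrow> B\<close> is a family of functors \<open>A \<rightarrow> B\<close> indexed by \<open>W\<close>. It sends a global
  arrow \<open>\<alpha> : 1 \<rightarrow> C1 A\<close> to an arrow of \<open>B\<close> at stage \<open>W\<close>.\<close>

definition app :: "'a \<Rightarrow> ('a, 'b) icat \<Rightarrow> 'b \<Rightarrow> ('a, 'b) ifun \<Rightarrow> 'b" where
  "app W A \<alpha> p = f1 p \<cdot> el1 (dis W) A (Ide K W) (const_ar K W \<alpha>)"

lemma app_simps [simp]:
  assumes "is_terminal K (Dom K \<alpha>)" "\<alpha> \<in> Ar K" "Cod K \<alpha> = C1 A" "is_icat K A" "W \<in> Ob K"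
    "p \<in> Ar (Cat K)" "Dom (Cat K) p = prod_ob (Cat K) (dis W) A"
  shows "app W A \<alpha> p \<in> Ar K" "Dom K (app W A \<alpha> p) = W" "Cod K (app W A \<alpha> p) = C1 (Cod (Cat K) p)"
  using assms by (simp_all add: app_def)

lemma app_elem:
  assumes "is_terminal K (Dom K \<alpha>)" "\<alpha> \<in> Ar K" "Cod K \<alpha> = C1 A" "is_icat K A" "W \<in> Ob K"
    "p \<in> Ar (Cat K)" "Dom (Cat K) p = prod_ob (Cat K) (dis W) A" "w \<in> Ar K" "Cod K w = W"
  shows "app W A \<alpha> p \<cdot> w = f1 p \<cdot> el1 (dis W) A w (const_ar K (Dom K w) \<alpha>)"
  using assms by (simp add: app_def)

lemma app_idn_src:
  assumes "is_terminal K (Dom K \<alpha>)" "\<alpha> \<in> Ar K" "Cod K \<alpha> = C1 A" "is_icat K A" "W \<in> Ob K"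
    "p \<in> Ar (Cat K)" "Dom (Cat K) p = prod_ob (Cat K) (dis W) A" "Cod (Cat K) p = B"
  shows "app W A (idn A \<cdot> (src A \<cdot> \<alpha>)) p = idn B \<cdot> (src B \<cdot> app W A \<alpha> p)"
    "app W A (idn A \<cdot> (tgt A \<cdot> \<alpha>)) p = idn B \<cdot> (tgt B \<cdot> app W A \<alpha> p)"
proof -
  let ?P = "prod_ob (Cat K) (dis W) A"
  let ?z = "el1 (dis W) A (Ide K W) (const_ar K W \<alpha>)"
  have "f1 p \<cdot> (idn ?P \<cdot> (src ?P \<cdot> ?z)) = idn B \<cdot> (src B \<cdot> (f1 p \<cdot> ?z))"
    "f1 p \<cdot> (idn ?P \<cdot> (tgt ?P \<cdot> ?z)) = idn B \<cdot> (tgt B \<cdot> (f1 p \<cdot> ?z))"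
    using assms by (simp_all del: src_el1 idn_el0)
  moreover have "idn ?P \<cdot> (src ?P \<cdot> ?z) = el1 (dis W) A (Ide K W) (const_ar K W (idn A \<cdot> (src A \<cdot> \<alpha>)))"
    "idn ?P \<cdot> (tgt ?P \<cdot> ?z) = el1 (dis W) A (Ide K W) (const_ar K W (idn A \<cdot> (tgt A \<cdot> \<alpha>)))"
    using assms by (simp_all add: cmp_const_ar)
  ultimately show "app W A (idn A \<cdot> (src A \<cdot> \<alpha>)) p = idn B \<cdot> (src B \<cdot> app W A \<alpha> p)"
    "app W A (idn A \<cdot> (tgt A \<cdot> \<alpha>)) p = idn B \<cdot> (tgt B \<cdot> app W A \<alpha> p)"
    unfolding app_def by simp_all
qed

lemma app_icomp:
  assumes "is_terminal K (Dom K \<alpha>)" "\<alpha> \<in> Ar K" "Cod K \<alpha> = C1 A" "\<beta> \<in> Ar K" "Cod K \<beta> = C1 A" "Dom K \<beta> = Dom K \<alpha>"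
    "tgt A \<cdot> \<alpha> = src A \<cdot> \<beta>" "is_icat K A" "W \<in> Ob K"
    "p \<in> Ar (Cat K)" "Dom (Cat K) p = prod_ob (Cat K) (dis W) A" "Cod (Cat K) p = B"
  shows "app W A (icomp K A \<alpha> \<beta>) p = icomp K B (app W A \<alpha> p) (app W A \<beta> p)"
    "tgt B \<cdot> app W A \<alpha> p = src B \<cdot> app W A \<beta> p"
proof -
  obtain u where u: "u \<in> Ar K" "Cod K u = Dom K \<alpha>" "Dom K u = W" "const_ar K W \<alpha> = \<alpha> \<cdot> u"
    by (rule const_arE[OF assms(1,9)])
  have t: "tgt A \<cdot> (\<alpha> \<cdot> u) = src A \<cdot> (\<beta> \<cdot> u)" by (rule cmp_eq_assoc[OF assms(7)]) (use assms u in simp_all)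
  have b: "const_ar K W \<beta> = \<beta> \<cdot> u" "const_ar K W (icomp K A \<alpha> \<beta>) = icomp K A (\<alpha> \<cdot> u) (\<beta> \<cdot> u)"
    using const_ar_eq[of \<beta> u W] const_ar_eq[of "icomp K A \<alpha> \<beta>" u W] assms u by simp_all
  let ?P = "prod_ob (Cat K) (dis W) A"
  let ?x = "el1 (dis W) A (Ide K W) (\<alpha> \<cdot> u)" and ?y = "el1 (dis W) A (Ide K W) (\<beta> \<cdot> u)"
  have xy: "?x \<in> Ar K" "?y \<in> Ar K" "Cod K ?x = C1 ?P" "Cod K ?y = C1 ?P" "Dom K ?x = Dom K ?y"
    "tgt ?P \<cdot> ?x = src ?P \<cdot> ?y" using assms u t by simp_all
  have "icomp K ?P ?x ?y = el1 (dis W) A (Ide K W) (icomp K A (\<alpha> \<cdot> u) (\<beta> \<cdot> u))"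
    using assms u t by simp
  then have "app W A (icomp K A \<alpha> \<beta>) p = f1 p \<cdot> icomp K ?P ?x ?y" by (simp add: app_def b)
  also have "\<dots> = icomp K B (f1 p \<cdot> ?x) (f1 p \<cdot> ?y)"
    using ifun_icomp[OF assms(10,11) xy(1,3,2,4,5,6)] assms(12) by simp
  finally show "app W A (icomp K A \<alpha> \<beta>) p = icomp K B (app W A \<alpha> p) (app W A \<beta> p)"
    by (simp add: app_def b u)
  show "tgt B \<cdot> app W A \<alpha> p = src B \<cdot> app W A \<beta> p"
    unfolding app_def b u(4) using ifun_elem[OF assms(10,12), of ?x] ifun_elem[OF assms(10,12), of ?y] xy assms(11)
    by simp
qed

lemma app_post:
  assumes "is_terminal K (Dom K \<alpha>)" "\<alpha> \<in> Ar K" "Cod K \<alpha> = C1 A" "is_icat K A" "W \<in> Ob K"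
    "p \<in> Ar (Cat K)" "Dom (Cat K) p = prod_ob (Cat K) (dis W) A" "G \<in> Ar (Cat K)" "Dom (Cat K) G = Cod (Cat K) p"
  shows "app W A \<alpha> (G \<odot> p) = f1 G \<cdot> app W A \<alpha> p"
  using assms by (simp add: app_def)

lemma app_pre:
  assumes "is_terminal K (Dom K \<alpha>)" "\<alpha> \<in> Ar K" "Cod K \<alpha> = C1 A" "W \<in> Ob K" "e \<in> Ar K" "Cod K e = W"
    "k \<in> Ar (Cat K)" "Dom (Cat K) k = A" "Cod (Cat K) k = B"
    "p \<in> Ar (Cat K)" "Dom (Cat K) p = prod_ob (Cat K) (dis W) B"
  shows "app (Dom K e) A \<alpha> (p \<odot> prod_ar (Cat K) (dis_ar e) k) = app W B (f1 k \<cdot> \<alpha>) p \<cdot> e"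
proof -
  have "is_icat K A" "is_icat K B" using assms by auto
  then show ?thesis using assms by (simp add: app_def cmp_const_ar)
qed

lemma dis_ar_Ide: "W \<in> Ob K \<Longrightarrow> dis_ar (Ide K W) = Ide (Cat K) (dis W)"
  by (rule dis_fun_eq[of _ _ W]) simp_all

lemma app_pre1:
  assumes "is_terminal K (Dom K \<alpha>)" "\<alpha> \<in> Ar K" "Cod K \<alpha> = C1 A" "W \<in> Ob K"
    "k \<in> Ar (Cat K)" "Dom (Cat K) k = A" "Cod (Cat K) k = B"
    "p \<in> Ar (Cat K)" "Dom (Cat K) p = prod_ob (Cat K) (dis W) B"
  shows "app W A \<alpha> (p \<odot> prod_ar (Cat K) (Ide (Cat K) (dis W)) k) = app W B (f1 k \<cdot> \<alpha>) p"
proof -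
  have "is_icat K A" "is_icat K B" using assms by auto
  then show ?thesis using assms by (simp add: app_def cmp_const_ar)
qed

section \<open>Coproducts of the terminal object\<close>

lemma coproduct_jointly_epic:
  assumes c: "is_coproduct K c is"
  shows "jointly_epic K c (set is)"
  unfolding jointly_epic_def
proof (intro conjI ballI impI)
  show "c \<in> Ob K" using c by (simp add: is_coproduct_def)
  show "f \<in> Ar K" "Cod K f = c" if "f \<in> set is" for f
    using c that by (auto simp: is_coproduct_def)
  fix g h assume *: "g \<in> Ar K" "h \<in> Ar K" "Dom K g = c" "Dom K h = c" "Cod K g = Cod K h" "\<forall>f\<in>set is. g \<cdot> f = h \<cdot> f"
  have "list_all2 (\<lambda>i f. f \<in> hom K (Dom K i) (Cod K h)) is (map (\<lambda>i. h \<cdot> i) is)"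
    using c * by (auto simp: list_all2_conv_all_nth is_coproduct_def)
  then have "\<exists>!k. k \<in> hom K c (Cod K h) \<and> map (\<lambda>i. k \<cdot> i) is = map (\<lambda>i. h \<cdot> i) is"
    using c * unfolding is_coproduct_def by (metis Cod_Ob)
  moreover have "map (\<lambda>i. g \<cdot> i) is = map (\<lambda>i. h \<cdot> i) is" using * by simp
  ultimately show "g = h" using * by auto
qed

text \<open>In a cartesian closed category \<open>W \<times> (-)\<close> preserves coproducts.\<close>

lemma coproduct_param:
  assumes c: "is_coproduct K c is" and T: "is_terminal K T" and D: "\<And>i. i \<in> set is \<Longrightarrow> Dom K i = T"
    and W: "W \<in> Ob K" and x: "x \<in> Ob K" and l: "length gs = length is" and gs: "\<And>g. g \<in> set gs \<Longrightarrow> g \<in> hom K W x"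
  obtains h where "h \<in> Ar K" "Dom K h = prod_ob K W c" "Cod K h = x"
    "\<And>n w. n < length is \<Longrightarrow> w \<in> Ar K \<Longrightarrow> Cod K w = W \<Longrightarrow>
      h \<cdot> prod_pair K w (const_ar K (Dom K w) (is ! n)) = gs ! n \<cdot> w"
proof -
  have cO: "c \<in> Ob K" and iA: "\<And>i. i \<in> set is \<Longrightarrow> i \<in> Ar K \<and> Cod K i = c" using c by (auto simp: is_coproduct_def)
  have TO: "T \<in> Ob K" using T by (simp add: is_terminal_def)
  let ?f = "\<lambda>g. curry_ar K T W x (g \<cdot> pr2 K T W)"
  have f: "?f g \<in> hom K T (exp_ob K W x)" "uncurry W x (?f g) = g \<cdot> pr2 K T W" if "g \<in> set gs" for g
    using gs[OF that] TO W x by simp_all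
  have "list_all2 (\<lambda>i f. f \<in> hom K (Dom K i) (exp_ob K W x)) is (map ?f gs)"
    unfolding list_all2_conv_all_nth using f l D by (auto simp del: hom_iff)
  moreover have "exp_ob K W x \<in> Ob K" using W x by simp
  ultimately have "\<exists>!h. h \<in> hom K c (exp_ob K W x) \<and> map (\<lambda>i. h \<cdot> i) is = map ?f gs"
    using c unfolding is_coproduct_def by blast
  then obtain k where k: "k \<in> Ar K" "Dom K k = c" "Cod K k = exp_ob K W x" "map (\<lambda>i. k \<cdot> i) is = map ?f gs" by auto
  let ?h = "uncurry W x k \<cdot> prod_pair K (pr2 K W c) (pr1 K W c)"
  show ?thesis
  proof (rule that[of ?h])
    show "?h \<in> Ar K" "Dom K ?h = prod_ob K W c" "Cod K ?h = x" using k W x cO by simp_all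
    fix n w assume n: "n < length is" and w: "w \<in> Ar K" "Cod K w = W"
    let ?i = "is ! n" and ?g = "gs ! n"
    have i: "?i \<in> Ar K" "Dom K ?i = T" "Cod K ?i = c" and g: "?g \<in> Ar K" "Dom K ?g = W" "Cod K ?g = x" and gm: "?g \<in> set gs"
      using iA[of ?i] D[of ?i] gs[of ?g] n l by simp_all
    have "map (\<lambda>i. k \<cdot> i) is ! n = map ?f gs ! n" using k(4) by simp
    then have ki: "k \<cdot> ?i = ?f ?g" using n l by simp
    have T': "is_terminal K (Dom K ?i)" using T i by simp
    have "Dom K w \<in> Ob K" using w by simp
    then obtain u where u: "u \<in> Ar K" "Cod K u = Dom K ?i" "Dom K u = Dom K w" "const_ar K (Dom K w) ?i = ?i \<cdot> u"
      by (rule const_arE[OF T'])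
    have "uncurry W x k \<cdot> prod_ar K ?i (Ide K W) = ?g \<cdot> pr2 K T W"
      using uncurry_cmp[OF W x k(1,3), of ?i] f(2)[OF gm] i k(2) by (simp add: ki)
    then have "uncurry W x k \<cdot> (prod_ar K ?i (Ide K W) \<cdot> prod_pair K u w) = ?g \<cdot> (pr2 K T W \<cdot> prod_pair K u w)"
      by (rule cmp_eq_assoc) (use k i g u w W x TO in simp_all)
    then show "?h \<cdot> prod_pair K w (const_ar K (Dom K w) ?i) = ?g \<cdot> w"
      using k i g u w W x cO by simp
  qed
qed

end

section \<open>The walking arrow\<close>

locale walking_arrow = topos +
  fixes one two :: "('a, 'b) icat" and s t :: "('a, 'b) ifun" and a :: 'b
  assumes walking: "is_walking_arrow K one two s t a"
begin

abbreviation T :: 'a where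
  "T \<equiv> C0 one"

lemma one_terminal: "is_terminal (Cat K) one"
  using walking by (simp add: is_walking_arrow_def)

lemma icats [simp]: "is_icat K one" "is_icat K two"
proof -
  show "is_icat K one" using one_terminal by (simp add: is_terminal_def)
  have "s \<in> hom (Cat K) one two" using walking by (simp add: is_walking_arrow_def del: hom_iff)
  then show "is_icat K two" using ifun_simps(2)[of s] by simp
qed

lemma st_simps [simp]:
  "s \<in> Ar (Cat K)" "Dom (Cat K) s = one" "Cod (Cat K) s = two"
  "t \<in> Ar (Cat K)" "Dom (Cat K) t = one" "Cod (Cat K) t = two"
  "a \<in> Ar K" "Dom K a = T" "Cod K a = C1 two" "src two \<cdot> a = f0 s" "tgt two \<cdot> a = f0 t"
  using walking by (simp_all add: is_walking_arrow_def)

lemma coproducts: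
  "is_coproduct K (C0 two) [f0 s, f0 t]"
  "is_coproduct K (C1 two) [idn two \<cdot> f0 s, idn two \<cdot> f0 t, a]"
  using walking by (simp_all add: is_walking_arrow_def)

lemma T_terminal [simp]: "is_terminal K T"
  unfolding is_terminal_def
proof (intro conjI ballI)
  fix X assume X: "X \<in> Ob K"
  have "\<exists>!F. F \<in> hom (Cat K) (dis X) one" using one_terminal X by (simp add: is_terminal_def)
  then obtain F where F: "F \<in> hom (Cat K) (dis X) one" and un: "\<And>G. G \<in> hom (Cat K) (dis X) one \<Longrightarrow> G = F" by blast
  show "\<exists>!f. f \<in> hom K X T"
  proof (rule ex1I[of _ "f0 F"])
    show "f0 F \<in> hom K X T" using F by simp
    fix f assume f: "f \<in> hom K X T"
    then have "dis_el one f = F" by (intro un) simp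
    moreover have "f0 (dis_el one f) = f" using f by simp
    ultimately show "f = f0 F" by simp
  qed
qed simp

lemma T_Ob [simp]: "T \<in> Ob K" by simp

text \<open>The functor \<open>one \<rightarrow> one\<close> that sends every arrow to the identity of its source is the identity, as
  \<open>one\<close> is terminal; so all arrows of \<open>one\<close> are identities.\<close>

lemma one_arrow:
  assumes "u \<in> Ar K" "Cod K u = C1 one"
  shows "u = const_ar K (Dom K u) (idn one)"
proof -
  have ts: "tgt one = src one" by (rule terminal_eq[OF T_terminal]) simp_all
  obtain F where F: "F \<in> Ar (Cat K)" "Dom (Cat K) F = one" "Cod (Cat K) F = one" "f0 F = Ide K T" "f1 F = idn one \<cdot> src one"
  proof (rule ifunI[of one one "Ide K T" "idn one \<cdot> src one"])
    show "tgt one \<cdot> (idn one \<cdot> src one) = Ide K T \<cdot> tgt one" using ts by simp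
    fix f g assume fg: "f \<in> Ar K" "g \<in> Ar K" "Cod K f = C1 one" "Cod K g = C1 one" "Dom K f = Dom K g" "tgt one \<cdot> f = src one \<cdot> g"
    have e: "src one \<cdot> f = src one \<cdot> g" using fg(6) unfolding ts .
    show "(idn one \<cdot> src one) \<cdot> icomp K one f g = icomp K one ((idn one \<cdot> src one) \<cdot> f) ((idn one \<cdot> src one) \<cdot> g)"
      using fg e by simp
  qed (use that in simp_all)
  have "F = Ide (Cat K) one"
    by (rule Cat.terminal_eq[OF one_terminal]) (use F in simp_all)
  then have "f1 F = Ide K (C1 one)" by simp
  then have e: "idn one \<cdot> src one = Ide K (C1 one)" using F by simp
  have "idn one \<cdot> (src one \<cdot> u) = Ide K (C1 one) \<cdot> u" by (rule cmp_eq_assoc1[OF e]) (use assms in simp_all)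
  then have "u = idn one \<cdot> (src one \<cdot> u)" using assms by simp
  also have "\<dots> = const_ar K (Dom K u) (idn one)" by (rule const_ar_eq) (use assms in simp_all)
  finally show ?thesis .
qed

lemma one_fun_eq:
  assumes W: "W \<in> Ob K" and F: "F \<in> Ar (Cat K)" "Dom (Cat K) F = prod_ob (Cat K) (dis W) one"
    and G: "G \<in> Ar (Cat K)" "Dom (Cat K) G = prod_ob (Cat K) (dis W) one" "Cod (Cat K) F = Cod (Cat K) G"
    and e: "app W one (idn one) F = app W one (idn one) G"
  shows "F = G"
proof (rule ifun_prod_ext[of "dis W" one])
  fix x y assume xy: "x \<in> Ar K" "y \<in> Ar K" "Dom K x = Dom K y" "Cod K x = C1 (dis W)" "Cod K y = C1 one"
  have y: "y = const_ar K (Dom K x) (idn one)" using one_arrow[of y] xy by simp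
  have "app W one (idn one) F \<cdot> x = app W one (idn one) G \<cdot> x" by (simp only: e)
  then show "f1 F \<cdot> el1 (dis W) one x y = f1 G \<cdot> el1 (dis W) one x y"
    unfolding y using app_elem[of "idn one" one W F x] app_elem[of "idn one" one W G x] W F G xy by simp
qed (use W F G in simp_all)

text \<open>The three coprojections are jointly epic, so every arrow of \<open>two\<close> is locally \<open>a\<close> or an identity
  of \<open>s\<close> or \<open>t\<close>.\<close>

lemma two_cases:
  assumes y: "y \<in> Ar K" "Cod K y = C1 two" and g: "g \<in> Ar K" "Dom K g = Dom K y"
    and h: "h \<in> Ar K" "Dom K h = Dom K y" "Cod K h = Cod K g"
    and idn: "\<And>z x. z \<in> Ar K \<Longrightarrow> Cod K z = Dom K y \<Longrightarrow> x = f0 s \<or> x = f0 t \<Longrightarrow>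
      y \<cdot> z = idn two \<cdot> const_ar K (Dom K z) x \<Longrightarrow> g \<cdot> z = h \<cdot> z"
    and arr: "\<And>z. z \<in> Ar K \<Longrightarrow> Cod K z = Dom K y \<Longrightarrow> y \<cdot> z = const_ar K (Dom K z) a \<Longrightarrow> g \<cdot> z = h \<cdot> z"
  shows "g = h"
proof (rule local_eq[OF coproduct_jointly_epic[OF coproducts(2)] y g h])
  fix f z u assume f: "f \<in> set [idn two \<cdot> f0 s, idn two \<cdot> f0 t, a]"
    and z: "z \<in> Ar K" "Cod K z = Dom K y" and u: "u \<in> Ar K" "Dom K u = Dom K z" "Cod K u = Dom K f" and e: "y \<cdot> z = f \<cdot> u"
  from f consider "f = idn two \<cdot> f0 s" | "f = idn two \<cdot> f0 t" | "f = a" by auto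
  then show "g \<cdot> z = h \<cdot> z"
  proof cases
    case 1
    then have "y \<cdot> z = idn two \<cdot> const_ar K (Dom K z) (f0 s)"
      using e u const_ar_eq[of "f0 s" u "Dom K z"] by simp
    then show ?thesis using idn[OF z, of "f0 s"] by simp
  next
    case 2
    then have "y \<cdot> z = idn two \<cdot> const_ar K (Dom K z) (f0 t)"
      using e u const_ar_eq[of "f0 t" u "Dom K z"] by simp
    then show ?thesis using idn[OF z, of "f0 t"] by simp
  next
    case 3
    then have "y \<cdot> z = const_ar K (Dom K z) a"
      using e u const_ar_eq[of a u "Dom K z"] by simp
    then show ?thesis using arr[OF z] by simp
  qed
qed

lemma two_ob_cases:
  assumes y: "y \<in> Ar K" "Cod K y = C0 two" and g: "g \<in> Ar K" "Dom K g = Dom K y"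
    and h: "h \<in> Ar K" "Dom K h = Dom K y" "Cod K h = Cod K g"
    and ob: "\<And>z x. z \<in> Ar K \<Longrightarrow> Cod K z = Dom K y \<Longrightarrow> x = f0 s \<or> x = f0 t \<Longrightarrow>
      y \<cdot> z = const_ar K (Dom K z) x \<Longrightarrow> g \<cdot> z = h \<cdot> z"
  shows "g = h"
proof (rule local_eq[OF coproduct_jointly_epic[OF coproducts(1)] y g h])
  fix f z u assume f: "f \<in> set [f0 s, f0 t]"
    and z: "z \<in> Ar K" "Cod K z = Dom K y" and u: "u \<in> Ar K" "Dom K u = Dom K z" "Cod K u = Dom K f" and e: "y \<cdot> z = f \<cdot> u"
  have x: "f = f0 s \<or> f = f0 t" using f by auto
  then have "y \<cdot> z = const_ar K (Dom K z) f" using e u const_ar_eq[of f u "Dom K z"] by auto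
  then show "g \<cdot> z = h \<cdot> z" using ob[OF z x] by simp
qed

lemma two_fun_eq:
  assumes W: "W \<in> Ob K" and F: "F \<in> Ar (Cat K)" "Dom (Cat K) F = prod_ob (Cat K) (dis W) two"
    and G: "G \<in> Ar (Cat K)" "Dom (Cat K) G = prod_ob (Cat K) (dis W) two" "Cod (Cat K) F = Cod (Cat K) G"
    and e: "app W two a F = app W two a G"
  shows "F = G"
proof (rule ifun_prod_ext[of "dis W" two])
  fix x y assume xy: "x \<in> Ar K" "y \<in> Ar K" "Dom K x = Dom K y" "Cod K x = C1 (dis W)" "Cod K y = C1 two"
  have es: "app W two (idn two \<cdot> f0 s) F = app W two (idn two \<cdot> f0 s) G"
    using app_idn_src(1)[of a two W F "Cod (Cat K) G"] app_idn_src(1)[of a two W G "Cod (Cat K) G"] W F G e by simp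
  have et: "app W two (idn two \<cdot> f0 t) F = app W two (idn two \<cdot> f0 t) G"
    using app_idn_src(2)[of a two W F "Cod (Cat K) G"] app_idn_src(2)[of a two W G "Cod (Cat K) G"] W F G e by simp
  have E: "f1 F \<cdot> el1 (dis W) two x' (const_ar K (Dom K x') \<alpha>) = f1 G \<cdot> el1 (dis W) two x' (const_ar K (Dom K x') \<alpha>)"
    if "app W two \<alpha> F = app W two \<alpha> G" "x' \<in> Ar K" "Cod K x' = W" "\<alpha> \<in> Ar K" "Dom K \<alpha> = T" "Cod K \<alpha> = C1 two" for x' \<alpha>
    using app_elem[of \<alpha> two W F x'] app_elem[of \<alpha> two W G x'] that W F G by simp
  show "f1 F \<cdot> el1 (dis W) two x y = f1 G \<cdot> el1 (dis W) two x y"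
  proof (rule two_cases[of y])
    fix z v assume z: "z \<in> Ar K" "Cod K z = Dom K y" and v: "v = f0 s \<or> v = f0 t" and yz: "y \<cdot> z = idn two \<cdot> const_ar K (Dom K z) v"
    have "y \<cdot> z = const_ar K (Dom K z) (idn two \<cdot> v)" using yz v z cmp_const_ar[of v "Dom K z" "idn two"] by auto
    then show "(f1 F \<cdot> el1 (dis W) two x y) \<cdot> z = (f1 G \<cdot> el1 (dis W) two x y) \<cdot> z"
      using E[of "idn two \<cdot> v" "x \<cdot> z"] es et v xy z W F G by auto
  next
    fix z assume z: "z \<in> Ar K" "Cod K z = Dom K y" and yz: "y \<cdot> z = const_ar K (Dom K z) a"
    then show "(f1 F \<cdot> el1 (dis W) two x y) \<cdot> z = (f1 G \<cdot> el1 (dis W) two x y) \<cdot> z"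
      using E[of a "x \<cdot> z"] e xy W F G by simp
  qed (use xy W F G in simp_all)
qed (use W F G in simp_all)

text \<open>Where the two objects of \<open>two\<close> coincide, any two parallel arrows are equal, as the values at \<open>s\<close>
  and at \<open>t\<close> of their copairing. This disposes of the composable pairs \<open>(a, a)\<close>, which exist only
  at such stages.\<close>

lemma degenerate:
  assumes e: "const_ar K V (f0 s) = const_ar K V (f0 t)" and g: "g \<in> Ar K" "Dom K g = V" and h: "h \<in> Ar K" "Dom K h = V" "Cod K h = Cod K g"
  shows "g = h"
proof -
  have V: "V \<in> Ob K" using g by auto
  obtain k where k: "k \<in> Ar K" "Dom K k = prod_ob K V (C0 two)" "Cod K k = Cod K g"
    and kE: "\<And>n w. n < length [f0 s, f0 t] \<Longrightarrow> w \<in> Ar K \<Longrightarrow> Cod K w = V \<Longrightarrow>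
      k \<cdot> prod_pair K w (const_ar K (Dom K w) ([f0 s, f0 t] ! n)) = [g, h] ! n \<cdot> w"
    by (rule coproduct_param[OF coproducts(1) T_terminal, of V "Cod K g" "[g, h]"]) (use g h V that in auto)
  show ?thesis using kE[of 0 "Ide K V"] kE[of 1 "Ide K V"] e V g h by simp
qed

text \<open>The components are defined by cases on the coproducts \<open>C0 two\<close> and \<open>C1 two\<close>, with \<open>a\<close> going to
  \<open>m\<close>. Functoriality is checked locally, where the arrows involved are identities or \<open>a\<close>.\<close>

lemma two_fun_ex:
  assumes W: "W \<in> Ob K" and C: "is_icat K C" and m: "m \<in> Ar K" "Dom K m = W" "Cod K m = C1 C"
  obtains F where "F \<in> Ar (Cat K)" "Dom (Cat K) F = prod_ob (Cat K) (dis W) two" "Cod (Cat K) F = C" "app W two a F = m"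
proof -
  obtain u where u: "u \<in> Ar K" "Dom K u = prod_ob K W (C0 two)" "Cod K u = C0 C"
    and uE: "\<And>n w. n < length [f0 s, f0 t] \<Longrightarrow> w \<in> Ar K \<Longrightarrow> Cod K w = W \<Longrightarrow>
      u \<cdot> prod_pair K w (const_ar K (Dom K w) ([f0 s, f0 t] ! n)) = [src C \<cdot> m, tgt C \<cdot> m] ! n \<cdot> w"
    by (rule coproduct_param[OF coproducts(1) T_terminal, of W "C0 C" "[src C \<cdot> m, tgt C \<cdot> m]"])
      (use C m W that in auto)
  let ?gs = "[idn C \<cdot> (src C \<cdot> m), idn C \<cdot> (tgt C \<cdot> m), m]" and ?is = "[idn two \<cdot> f0 s, idn two \<cdot> f0 t, a]"
  obtain v where v: "v \<in> Ar K" "Dom K v = prod_ob K W (C1 two)" "Cod K v = C1 C"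
    and vE: "\<And>n w. n < length ?is \<Longrightarrow> w \<in> Ar K \<Longrightarrow> Cod K w = W \<Longrightarrow>
      v \<cdot> prod_pair K w (const_ar K (Dom K w) (?is ! n)) = ?gs ! n \<cdot> w"
    by (rule coproduct_param[OF coproducts(2) T_terminal, of W "C1 C" ?gs]) (use C m W that in auto)
  have us: "u \<cdot> prod_pair K w (const_ar K (Dom K w) (f0 s)) = src C \<cdot> (m \<cdot> w)"
    and ut: "u \<cdot> prod_pair K w (const_ar K (Dom K w) (f0 t)) = tgt C \<cdot> (m \<cdot> w)"
    and vs: "v \<cdot> prod_pair K w (idn two \<cdot> const_ar K (Dom K w) (f0 s)) = idn C \<cdot> (src C \<cdot> (m \<cdot> w))"
    and vt: "v \<cdot> prod_pair K w (idn two \<cdot> const_ar K (Dom K w) (f0 t)) = idn C \<cdot> (tgt C \<cdot> (m \<cdot> w))"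
    and va: "v \<cdot> prod_pair K w (const_ar K (Dom K w) a) = m \<cdot> w" if "w \<in> Ar K" "Cod K w = W" for w
    using uE[of 0 w] uE[of 1 w] vE[of 0 w] vE[of 1 w] vE[of 2 w] that C m by (simp_all add: cmp_const_ar)
  have sta: "src two \<cdot> const_ar K V a = const_ar K V (f0 s)" "tgt two \<cdot> const_ar K V a = const_ar K V (f0 t)" if "V \<in> Ob K" for V
    using that by (simp_all add: cmp_const_ar)
  have src_v: "src C \<cdot> (v \<cdot> prod_pair K w k) = u \<cdot> prod_pair K w (src two \<cdot> k)"
    and tgt_v: "tgt C \<cdot> (v \<cdot> prod_pair K w k) = u \<cdot> prod_pair K w (tgt two \<cdot> k)"
    if wk: "w \<in> Ar K" "Cod K w = W" "k \<in> Ar K" "Cod K k = C1 two" "Dom K w = Dom K k" for w k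
  proof -
    show "src C \<cdot> (v \<cdot> prod_pair K w k) = u \<cdot> prod_pair K w (src two \<cdot> k)"
    proof (rule two_cases[of k])
      fix z x assume z: "z \<in> Ar K" "Cod K z = Dom K k" and x: "x = f0 s \<or> x = f0 t" and kz: "k \<cdot> z = idn two \<cdot> const_ar K (Dom K z) x"
      then show "(src C \<cdot> (v \<cdot> prod_pair K w k)) \<cdot> z = (u \<cdot> prod_pair K w (src two \<cdot> k)) \<cdot> z"
        using wk u v C m us[of "w \<cdot> z"] ut[of "w \<cdot> z"] vs[of "w \<cdot> z"] vt[of "w \<cdot> z"] by auto
    next
      fix z assume z: "z \<in> Ar K" "Cod K z = Dom K k" "k \<cdot> z = const_ar K (Dom K z) a"
      then show "(src C \<cdot> (v \<cdot> prod_pair K w k)) \<cdot> z = (u \<cdot> prod_pair K w (src two \<cdot> k)) \<cdot> z"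
        using wk u v C m us[of "w \<cdot> z"] va[of "w \<cdot> z"] by (simp add: sta)
    qed (use wk u v C in simp_all)
    show "tgt C \<cdot> (v \<cdot> prod_pair K w k) = u \<cdot> prod_pair K w (tgt two \<cdot> k)"
    proof (rule two_cases[of k])
      fix z x assume z: "z \<in> Ar K" "Cod K z = Dom K k" and x: "x = f0 s \<or> x = f0 t" and kz: "k \<cdot> z = idn two \<cdot> const_ar K (Dom K z) x"
      then show "(tgt C \<cdot> (v \<cdot> prod_pair K w k)) \<cdot> z = (u \<cdot> prod_pair K w (tgt two \<cdot> k)) \<cdot> z"
        using wk u v C m us[of "w \<cdot> z"] ut[of "w \<cdot> z"] vs[of "w \<cdot> z"] vt[of "w \<cdot> z"] by auto
    next
      fix z assume z: "z \<in> Ar K" "Cod K z = Dom K k" "k \<cdot> z = const_ar K (Dom K z) a"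
      then show "(tgt C \<cdot> (v \<cdot> prod_pair K w k)) \<cdot> z = (u \<cdot> prod_pair K w (tgt two \<cdot> k)) \<cdot> z"
        using wk u v C m ut[of "w \<cdot> z"] va[of "w \<cdot> z"] by (simp add: sta)
    qed (use wk u v C in simp_all)
  qed
  have idn_v: "v \<cdot> prod_pair K w (idn two \<cdot> k) = idn C \<cdot> (u \<cdot> prod_pair K w k)"
    if wk: "w \<in> Ar K" "Cod K w = W" "k \<in> Ar K" "Cod K k = C0 two" "Dom K w = Dom K k" for w k
  proof (rule two_ob_cases[of k])
    fix z x assume z: "z \<in> Ar K" "Cod K z = Dom K k" and x: "x = f0 s \<or> x = f0 t" and kz: "k \<cdot> z = const_ar K (Dom K z) x"
    then show "(v \<cdot> prod_pair K w (idn two \<cdot> k)) \<cdot> z = (idn C \<cdot> (u \<cdot> prod_pair K w k)) \<cdot> z"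
      using wk u v C m us[of "w \<cdot> z"] ut[of "w \<cdot> z"] vs[of "w \<cdot> z"] vt[of "w \<cdot> z"] by auto
  qed (use wk u v C in simp_all)
  have icomp_v: "v \<cdot> prod_pair K w (icomp K two k l) = icomp K C (v \<cdot> prod_pair K w k) (v \<cdot> prod_pair K w l)"
    if wk: "w \<in> Ar K" "Cod K w = W" "k \<in> Ar K" "Cod K k = C1 two" "Dom K w = Dom K l" "l \<in> Ar K" "Cod K l = C1 two"
      "Dom K k = Dom K l" and kl: "tgt two \<cdot> k = src two \<cdot> l" for w k l
  proof -
    have kl': "tgt two \<cdot> (k \<cdot> z) = src two \<cdot> (l \<cdot> z)" if "z \<in> Ar K" "Cod K z = Dom K l" for z
      by (rule cmp_eq_assoc[OF kl]) (use wk that in simp_all)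
    have cmp: "icomp K two k l \<cdot> z = icomp K two (k \<cdot> z) (l \<cdot> z)"
      "(v \<cdot> prod_pair K w (icomp K two k l)) \<cdot> z = v \<cdot> prod_pair K (w \<cdot> z) (icomp K two (k \<cdot> z) (l \<cdot> z))"
      "icomp K C (v \<cdot> prod_pair K w k) (v \<cdot> prod_pair K w l) \<cdot> z
        = icomp K C (v \<cdot> prod_pair K (w \<cdot> z) (k \<cdot> z)) (v \<cdot> prod_pair K (w \<cdot> z) (l \<cdot> z))"
      if "z \<in> Ar K" "Cod K z = Dom K l" for z
      using wk kl that v C by (simp_all add: src_v tgt_v)
    have ty: "v \<cdot> prod_pair K w (icomp K two k l) \<in> Ar K" "icomp K C (v \<cdot> prod_pair K w k) (v \<cdot> prod_pair K w l) \<in> Ar K"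
      "Dom K (v \<cdot> prod_pair K w (icomp K two k l)) = Dom K l" "Dom K (icomp K C (v \<cdot> prod_pair K w k) (v \<cdot> prod_pair K w l)) = Dom K l"
      "Cod K (v \<cdot> prod_pair K w (icomp K two k l)) = C1 C" "Cod K (icomp K C (v \<cdot> prod_pair K w k) (v \<cdot> prod_pair K w l)) = C1 C"
      using wk kl v C by (simp_all add: src_v tgt_v)
    have left: "v \<cdot> prod_pair K w' (icomp K two (idn two \<cdot> x) l') = icomp K C (v \<cdot> prod_pair K w' (idn two \<cdot> x)) (v \<cdot> prod_pair K w' l')"
      if "w' \<in> Ar K" "Cod K w' = W" "l' \<in> Ar K" "Cod K l' = C1 two" "Dom K w' = Dom K l'" "x = src two \<cdot> l'" for w' x l'
      using that v C by (simp add: idn_v src_v)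
    have right: "v \<cdot> prod_pair K w' (icomp K two l' (idn two \<cdot> x)) = icomp K C (v \<cdot> prod_pair K w' l') (v \<cdot> prod_pair K w' (idn two \<cdot> x))"
      if "w' \<in> Ar K" "Cod K w' = W" "l' \<in> Ar K" "Cod K l' = C1 two" "Dom K w' = Dom K l'" "x = tgt two \<cdot> l'" for w' x l'
      using that v C by (simp add: idn_v tgt_v)
    show ?thesis
    proof (rule two_cases[of k])
      fix z x assume z: "z \<in> Ar K" "Cod K z = Dom K k" and x: "x = f0 s \<or> x = f0 t" and kz: "k \<cdot> z = idn two \<cdot> const_ar K (Dom K z) x"
      have z': "Cod K z = Dom K l" using z wk by simp
      have xl: "const_ar K (Dom K z) x = src two \<cdot> (l \<cdot> z)"
        using kl'[OF z(1) z'] kz x z by auto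
      show "(v \<cdot> prod_pair K w (icomp K two k l)) \<cdot> z = icomp K C (v \<cdot> prod_pair K w k) (v \<cdot> prod_pair K w l) \<cdot> z"
        unfolding cmp[OF z(1) z'] kz by (rule left) (use wk z z' xl in simp_all)
    next
      fix z assume z: "z \<in> Ar K" "Cod K z = Dom K k" and kz: "k \<cdot> z = const_ar K (Dom K z) a"
      have z': "Cod K z = Dom K l" using z wk by simp
      show "(v \<cdot> prod_pair K w (icomp K two k l)) \<cdot> z = icomp K C (v \<cdot> prod_pair K w k) (v \<cdot> prod_pair K w l) \<cdot> z"
      proof (rule two_cases[of "l \<cdot> z"])
        fix y x assume y: "y \<in> Ar K" "Cod K y = Dom K (l \<cdot> z)" and x: "x = f0 s \<or> x = f0 t"
          and ly: "(l \<cdot> z) \<cdot> y = idn two \<cdot> const_ar K (Dom K y) x"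
        have yz: "Cod K y = Dom K z" "z \<cdot> y \<in> Ar K" "Cod K (z \<cdot> y) = Dom K l" using y z z' wk by simp_all
        have ly': "l \<cdot> (z \<cdot> y) = idn two \<cdot> const_ar K (Dom K y) x" using ly y(1) yz z z' wk by simp
        have xk: "const_ar K (Dom K y) x = tgt two \<cdot> (k \<cdot> (z \<cdot> y))"
          using kl'[OF yz(2,3)] ly' x y by auto
        have "(v \<cdot> prod_pair K w (icomp K two k l)) \<cdot> (z \<cdot> y) = icomp K C (v \<cdot> prod_pair K w k) (v \<cdot> prod_pair K w l) \<cdot> (z \<cdot> y)"
          unfolding cmp[OF yz(2,3)] ly' by (rule right) (use wk y(1) yz z xk in simp_all)
        then show "((v \<cdot> prod_pair K w (icomp K two k l)) \<cdot> z) \<cdot> y = (icomp K C (v \<cdot> prod_pair K w k) (v \<cdot> prod_pair K w l) \<cdot> z) \<cdot> y"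
          using y(1) yz(1) z z' ty by simp
      next
        fix y assume y: "y \<in> Ar K" "Cod K y = Dom K (l \<cdot> z)" and ly: "(l \<cdot> z) \<cdot> y = const_ar K (Dom K y) a"
        have yz: "Cod K y = Dom K z" "z \<cdot> y \<in> Ar K" "Cod K (z \<cdot> y) = Dom K l" using y z z' wk by simp_all
        have ly': "l \<cdot> (z \<cdot> y) = const_ar K (Dom K y) a" using ly y(1) yz z z' wk by simp
        have "(k \<cdot> z) \<cdot> y = const_ar K (Dom K z) a \<cdot> y" by (simp only: kz)
        then have ky': "k \<cdot> (z \<cdot> y) = const_ar K (Dom K y) a" using y(1) yz z wk by simp
        have "const_ar K (Dom K y) (f0 s) = const_ar K (Dom K y) (f0 t)"
          using kl'[OF yz(2,3)] ly' ky' sta[of "Dom K y"] y by simp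
        then show "((v \<cdot> prod_pair K w (icomp K two k l)) \<cdot> z) \<cdot> y = (icomp K C (v \<cdot> prod_pair K w k) (v \<cdot> prod_pair K w l) \<cdot> z) \<cdot> y"
          by (rule degenerate) (use y(1) yz(1) z z' ty in simp_all)
      qed (use z z' ty wk in simp_all)
    qed (use ty wk in simp_all)
  qed
  let ?P = "prod_ob (Cat K) (dis W) two" and ?p = "pr1 (Cat K) (dis W) two" and ?q = "pr2 (Cat K) (dis W) two"
  obtain F where F: "F \<in> Ar (Cat K)" "Dom (Cat K) F = ?P" "Cod (Cat K) F = C"
    "f0 F = u \<cdot> prod_pair K (f0 ?p) (f0 ?q)" "f1 F = v \<cdot> prod_pair K (f1 ?p) (f1 ?q)"
  proof (rule ifunI[of ?P C "u \<cdot> prod_pair K (f0 ?p) (f0 ?q)" "v \<cdot> prod_pair K (f1 ?p) (f1 ?q)"])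
    have ps: "f1 ?p = f0 ?p \<cdot> src ?P" "f1 ?p = f0 ?p \<cdot> tgt ?P"
      using ifun_eqs[of ?p "dis W"] W by simp_all
    show "src C \<cdot> (v \<cdot> prod_pair K (f1 ?p) (f1 ?q)) = (u \<cdot> prod_pair K (f0 ?p) (f0 ?q)) \<cdot> src ?P"
      using src_v[of "f1 ?p" "f1 ?q"] W u v ps(1) by simp
    show "tgt C \<cdot> (v \<cdot> prod_pair K (f1 ?p) (f1 ?q)) = (u \<cdot> prod_pair K (f0 ?p) (f0 ?q)) \<cdot> tgt ?P"
      using tgt_v[of "f1 ?p" "f1 ?q"] W u v ps(2) by simp
    show "(v \<cdot> prod_pair K (f1 ?p) (f1 ?q)) \<cdot> idn ?P = idn C \<cdot> (u \<cdot> prod_pair K (f0 ?p) (f0 ?q))"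
      using idn_v[of "f0 ?p" "f0 ?q"] W u v by simp
  next
    fix f g assume fg: "f \<in> Ar K" "g \<in> Ar K" "Cod K f = C1 ?P" "Cod K g = C1 ?P" "Dom K f = Dom K g" "tgt ?P \<cdot> f = src ?P \<cdot> g"
    have e: "f1 ?p \<cdot> f = f1 ?p \<cdot> g"
      using ifun_elem(2)[of ?p "dis W" f] ifun_elem(1)[of ?p "dis W" g] W fg by simp
    have ic: "icomp K (dis W) (f1 ?p \<cdot> f) (f1 ?p \<cdot> g) = f1 ?p \<cdot> g"
      unfolding e using fg W by simp
    have t: "tgt two \<cdot> (f1 ?q \<cdot> f) = src two \<cdot> (f1 ?q \<cdot> g)" using fg W by simp
    have pf: "f1 ?p \<cdot> icomp K ?P f g = f1 ?p \<cdot> g" "f1 ?q \<cdot> icomp K ?P f g = icomp K two (f1 ?q \<cdot> f) (f1 ?q \<cdot> g)"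
      using fg W ic by simp_all
    have "(v \<cdot> prod_pair K (f1 ?p) (f1 ?q)) \<cdot> icomp K ?P f g = v \<cdot> prod_pair K (f1 ?p \<cdot> g) (icomp K two (f1 ?q \<cdot> f) (f1 ?q \<cdot> g))"
      using pf fg v W by (simp del: ifun_icomp)
    also have "\<dots> = icomp K C (v \<cdot> prod_pair K (f1 ?p \<cdot> g) (f1 ?q \<cdot> f)) (v \<cdot> prod_pair K (f1 ?p \<cdot> g) (f1 ?q \<cdot> g))"
      by (rule icomp_v) (use fg W t in simp_all)
    also have "\<dots> = icomp K C ((v \<cdot> prod_pair K (f1 ?p) (f1 ?q)) \<cdot> f) ((v \<cdot> prod_pair K (f1 ?p) (f1 ?q)) \<cdot> g)"
      using fg v W e by simp
    finally show "(v \<cdot> prod_pair K (f1 ?p) (f1 ?q)) \<cdot> icomp K ?P f g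
        = icomp K C ((v \<cdot> prod_pair K (f1 ?p) (f1 ?q)) \<cdot> f) ((v \<cdot> prod_pair K (f1 ?p) (f1 ?q)) \<cdot> g)" .
  qed (use that W C u v in simp_all)
  have "app W two a F = m"
    using F(1-3,5) W v va[of "Ide K W"] m by (simp add: app_def)
  then show ?thesis using F that by simp
qed

lemma fun_of_two:
  assumes C: "is_icat K C" and m: "m \<in> Ar K" "Dom K m = T" "Cod K m = C1 C"
  shows "\<exists>!d. d \<in> hom (Cat K) two C \<and> f1 d \<cdot> a = m"
proof -
  obtain F where F: "F \<in> Ar (Cat K)" "Dom (Cat K) F = prod_ob (Cat K) (dis T) two" "Cod (Cat K) F = C" "app T two a F = m"
    by (rule two_fun_ex[OF T_Ob C m])
  obtain b0 where b0: "b0 \<in> Ar K" "Dom K b0 = C0 two" "Cod K b0 = T" using const_arE[of "Ide K T" "C0 two"] by auto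
  obtain b1 where b1: "b1 \<in> Ar K" "Dom K b1 = C1 two" "Cod K b1 = T" using const_arE[of "Ide K T" "C1 two"] by auto
  note T_eq = terminal_eq[OF T_terminal]
  obtain b where b: "b \<in> Ar (Cat K)" "Dom (Cat K) b = two" "Cod (Cat K) b = dis T" "f0 b = b0" "f1 b = b1"
  proof (rule ifunI[of two "dis T" b0 b1])
    fix f g assume fg: "f \<in> Ar K" "g \<in> Ar K" "Cod K f = C1 two" "Cod K g = C1 two" "Dom K f = Dom K g" "tgt two \<cdot> f = src two \<cdot> g"
    have e: "b1 \<cdot> f = b1 \<cdot> g" by (rule T_eq) (use fg b1 in simp_all)
    show "b1 \<cdot> icomp K two f g = icomp K (dis T) (b1 \<cdot> f) (b1 \<cdot> g)"
      by (rule T_eq) (use fg b1 in \<open>simp_all add: e\<close>)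
  qed (use b0 b1 that in \<open>auto intro: T_eq\<close>)
  let ?d = "F \<odot> prod_pair (Cat K) b (Ide (Cat K) two)"
  have ba: "f1 b \<cdot> a = Ide K T" by (rule T_eq) (use b b1 in simp_all)
  have d: "?d \<in> hom (Cat K) two C" "f1 ?d \<cdot> a = m" using F b ba by (simp_all add: app_def)
  show ?thesis
  proof (rule ex1I[of _ ?d])
    show "?d \<in> hom (Cat K) two C \<and> f1 ?d \<cdot> a = m" using d by blast
    fix d assume d': "d \<in> hom (Cat K) two C \<and> f1 d \<cdot> a = m"
    let ?q = "pr2 (Cat K) (dis T) two"
    have "d \<odot> ?q = F"
      by (rule two_fun_eq[of T]) (use d' F in \<open>simp_all add: app_def\<close>)
    then have "(d \<odot> ?q) \<odot> prod_pair (Cat K) b (Ide (Cat K) two) = ?d" by simp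
    then show "d = ?d" using d' b by simp
  qed
qed

end

section \<open>The lifting problem\<close>

context category
begin

lemma is_pushout_Ar:
  assumes "is_pushout K f g i j"
  shows "f \<in> Ar K" "g \<in> Ar K" "Dom K f = Dom K g" "i \<in> Ar K" "j \<in> Ar K"
    "Dom K i = Cod K f" "Dom K j = Cod K g" "Cod K j = Cod K i" "i \<cdot> f = j \<cdot> g"
  using assms by (simp_all add: is_pushout_def)

lemma copair_pushout:
  assumes P: "is_pushout K f g i j" and u: "u \<in> Ar K" "Dom K u = Cod K f" and v: "v \<in> Ar K" "Dom K v = Cod K g"
    and uv: "Cod K u = Cod K v" "u \<cdot> f = v \<cdot> g"
  shows "copair K i j u v \<in> Ar K" "Dom K (copair K i j u v) = Cod K i" "Cod K (copair K i j u v) = Cod K v"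
    "copair K i j u v \<cdot> i = u" "copair K i j u v \<cdot> j = v"
proof -
  have "\<exists>!h. h \<in> hom K (Cod K i) (Cod K u) \<and> h \<cdot> i = u \<and> h \<cdot> j = v"
    using P u v uv Cod_Ob[OF v(1)] unfolding is_pushout_def by simp
  from theI'[OF this] show "copair K i j u v \<in> Ar K" "Dom K (copair K i j u v) = Cod K i" "Cod K (copair K i j u v) = Cod K v"
    "copair K i j u v \<cdot> i = u" "copair K i j u v \<cdot> j = v"
    using uv by (simp_all add: copair_def)
qed

end

text \<open>In a cartesian closed category \<open>z \<times> (-)\<close> preserves pushouts, being a left adjoint.\<close>

lemma (in ccc) pushout_param:
  assumes P: "is_pushout K f g i j" and z: "z \<in> Ob K"
    and u: "u \<in> Ar K" "Dom K u = prod_ob K z (Cod K f)" and v: "v \<in> Ar K" "Dom K v = prod_ob K z (Cod K g)"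
    and uv: "Cod K u = Cod K v" "u \<cdot> prod_ar K (Ide K z) f = v \<cdot> prod_ar K (Ide K z) g"
  obtains h where "h \<in> Ar K" "Dom K h = prod_ob K z (Cod K i)" "Cod K h = Cod K v"
    "h \<cdot> prod_ar K (Ide K z) i = u" "h \<cdot> prod_ar K (Ide K z) j = v"
proof -
  note A = is_pushout_Ar[OF P]
  let ?x = "Cod K v"
  let ?sw = "\<lambda>c. prod_pair K (pr2 K c z) (pr1 K c z)" and ?ws = "\<lambda>c. prod_pair K (pr2 K z c) (pr1 K z c)"
  let ?u = "curry_ar K (Cod K f) z ?x (u \<cdot> ?sw (Cod K f))" and ?v = "curry_ar K (Cod K g) z ?x (v \<cdot> ?sw (Cod K g))"
  have uvA: "?u \<in> Ar K" "Dom K ?u = Cod K f" "Cod K ?u = exp_ob K z ?x" "uncurry z ?x ?u = u \<cdot> ?sw (Cod K f)"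
    "?v \<in> Ar K" "Dom K ?v = Cod K g" "Cod K ?v = exp_ob K z ?x" "uncurry z ?x ?v = v \<cdot> ?sw (Cod K g)"
    using A z u v uv by simp_all
  have "(u \<cdot> prod_ar K (Ide K z) f) \<cdot> ?sw (Dom K f) = (v \<cdot> prod_ar K (Ide K z) g) \<cdot> ?sw (Dom K g)"
    using uv(2) A(3) by simp
  then have e: "u \<cdot> (?sw (Cod K f) \<cdot> prod_ar K f (Ide K z)) = v \<cdot> (?sw (Cod K g) \<cdot> prod_ar K g (Ide K z))"
    using A z u v by simp
  have "?u \<cdot> f = ?v \<cdot> g"
  proof (rule uncurry_inj[of z ?x])
    have "uncurry z ?x (?u \<cdot> f) = (u \<cdot> ?sw (Cod K f)) \<cdot> prod_ar K f (Ide K z)"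
      using uncurry_cmp[of z ?x ?u f] uvA(1-4) A(1) z v(1) by simp
    also have "\<dots> = u \<cdot> (?sw (Cod K f) \<cdot> prod_ar K f (Ide K z))"
      by (rule assoc) (use A z u in simp_all)
    also have "\<dots> = v \<cdot> (?sw (Cod K g) \<cdot> prod_ar K g (Ide K z))" by (rule e)
    also have "\<dots> = (v \<cdot> ?sw (Cod K g)) \<cdot> prod_ar K g (Ide K z)"
      by (rule assoc[symmetric]) (use A z v in simp_all)
    also have "\<dots> = uncurry z ?x (?v \<cdot> g)"
      using uncurry_cmp[of z ?x ?v g] uvA(5-8) A(2) z v(1) by simp
    finally show "uncurry z ?x (?u \<cdot> f) = uncurry z ?x (?v \<cdot> g)" .
  qed (use uvA(1-3,5-7) A(1-3) z v(1) in simp_all)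
  note k = copair_pushout[OF P uvA(1,2,5,6) _ this]
  let ?k = "copair K i j ?u ?v"
  have kA: "?k \<in> Ar K" "Dom K ?k = Cod K i" "Cod K ?k = exp_ob K z ?x" "?k \<cdot> i = ?u" "?k \<cdot> j = ?v"
    using k uvA by simp_all
  let ?h = "uncurry z ?x ?k \<cdot> ?ws (Cod K i)"
  have hi: "uncurry z ?x ?k \<cdot> prod_ar K i (Ide K z) = u \<cdot> ?sw (Cod K f)"
    using uncurry_cmp[of z ?x ?k i] kA uvA(4) A(4) z v(1) by simp
  have hj: "uncurry z ?x ?k \<cdot> prod_ar K j (Ide K z) = v \<cdot> ?sw (Cod K g)"
    using uncurry_cmp[of z ?x ?k j] kA uvA(8) A(5,8) z v(1) by simp
  have hA: "uncurry z ?x ?k \<in> Ar K" "Dom K (uncurry z ?x ?k) = prod_ob K (Cod K i) z" "Cod K (uncurry z ?x ?k) = ?x"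
    using kA z v A by simp_all
  show ?thesis
  proof (rule that[of ?h])
    show "?h \<in> Ar K" "Dom K ?h = prod_ob K z (Cod K i)" "Cod K ?h = Cod K v" using hA A z by simp_all
    have "uncurry z ?x ?k \<cdot> (prod_ar K i (Ide K z) \<cdot> ?ws (Cod K f)) = u \<cdot> (?sw (Cod K f) \<cdot> ?ws (Cod K f))"
      by (rule cmp_eq_assoc[OF hi]) (use hA A z u in simp_all)
    then show "?h \<cdot> prod_ar K (Ide K z) i = u" using hA A z u by simp
    have "uncurry z ?x ?k \<cdot> (prod_ar K j (Ide K z) \<cdot> ?ws (Cod K g)) = v \<cdot> (?sw (Cod K g) \<cdot> ?ws (Cod K g))"
      by (rule cmp_eq_assoc[OF hj]) (use hA A z v in simp_all)
    then show "?h \<cdot> prod_ar K (Ide K z) j = v" using hA A z v by simp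
  qed
qed

text \<open>One lifting problem. Here \<open>I'\<close> and \<open>C'\<close> are the jet parts of \<open>I\<close> and \<open>C\<close>, with comparison
  functors \<open>i\<close> and \<open>\<iota>\<close>. The coreflection enters through three consequences: \<open>\<iota>\<close> is a
  monomorphism, endofunctors of \<open>I\<close> restrict to \<open>I'\<close>, and functors \<open>dis W \<times> I' \<rightarrow> C\<close> factor through
  \<open>\<iota>\<close>.\<close>

locale jet_setting = walking_arrow +
  fixes I I' :: "('a, 'b) icat" and l i :: "('a, 'b) ifun" and j1 j2 i1 i2 :: "('a, 'b) ifun"
    and C C' X Y :: "('a, 'b) icat" and \<iota> r \<phi> \<xi> :: "('a, 'b) ifun"
  assumes l [simp]: "l \<in> Ar (Cat K)" "Dom (Cat K) l = two" "Cod (Cat K) l = I"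
    and i [simp]: "i \<in> Ar (Cat K)" "Dom (Cat K) i = I'" "Cod (Cat K) i = I"
    and iota [simp]: "\<iota> \<in> Ar (Cat K)" "Dom (Cat K) \<iota> = C'" "Cod (Cat K) \<iota> = C"
    and iota_mono: "is_mono (Cat K) \<iota>"
    and jets: "\<And>u. u \<in> hom (Cat K) I I \<Longrightarrow> \<exists>u'. u' \<in> hom (Cat K) I' I' \<and> i \<odot> u' = u \<odot> i"
    and jet_iso: "is_iso K (hom_post K I' \<iota>)"
    and po1: "is_pushout (Cat K) (l \<odot> t) (l \<odot> s) j1 j2"
    and po2: "is_pushout (Cat K) (delta K a l j1 j2) (delta K a l j1 j2) i1 i2"
    and path_C: "is_epi K (hom_pre K l C)"
    and square_C: "is_epi K (hom_pre K (boundary_incl (Cat K) (l \<odot> s) (l \<odot> t) j1 j2 i1 i2) C)"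
    and path_C': "is_epi K (hom_pre K l C')"
    and r [simp]: "r \<in> Ar (Cat K)" "Dom (Cat K) r = X" "Cod (Cat K) r = Y"
    and r_right: "\<And>Z. Z \<in> Ob (Cat K) \<Longrightarrow> ortho (Cat K) (prod_ar (Cat K) (Ide (Cat K) Z) i) r"
    and phi [simp]: "\<phi> \<in> Ar (Cat K)" "Dom (Cat K) \<phi> = C'" "Cod (Cat K) \<phi> = X"
    and xi [simp]: "\<xi> \<in> Ar (Cat K)" "Dom (Cat K) \<xi> = C" "Cod (Cat K) \<xi> = Y"
    and rphi: "r \<odot> \<phi> = \<xi> \<odot> \<iota>"
begin

lemma icats' [simp]: "is_icat K I" "is_icat K I'" "is_icat K C" "is_icat K C'" "is_icat K X" "is_icat K Y"
  using ifun_simps(1,2)[OF i(1)] ifun_simps(1,2)[OF iota(1)] ifun_simps(1,2)[OF r(1)] by simp_all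

section \<open>Lifts\<close>

text \<open>\<open>P\<close> is over \<open>p\<close>, and on the part \<open>b\<close> of its domain that \<open>p\<close> sends into the jet part of \<open>C\<close> it is
  prescribed by \<open>\<phi>\<close>.\<close>

definition is_lift :: "('a, 'b) ifun \<Rightarrow> ('a, 'b) ifun \<Rightarrow> ('a, 'b) ifun \<Rightarrow> bool" where
  "is_lift b p P \<longleftrightarrow> P \<in> Ar (Cat K) \<and> Dom (Cat K) P = Dom (Cat K) p \<and> Cod (Cat K) P = X \<and> r \<odot> P = \<xi> \<odot> p \<and>
     (\<exists>p'. p' \<in> Ar (Cat K) \<and> Dom (Cat K) p' = Dom (Cat K) b \<and> Cod (Cat K) p' = C' \<and> \<iota> \<odot> p' = p \<odot> b \<and> P \<odot> b = \<phi> \<odot> p')"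

lemma is_lift_ex:
  assumes o: "ortho (Cat K) b r" and b: "b \<in> Ar (Cat K)"
    and p: "p \<in> Ar (Cat K)" "Dom (Cat K) p = Cod (Cat K) b" "Cod (Cat K) p = C"
    and p': "p' \<in> Ar (Cat K)" "Dom (Cat K) p' = Dom (Cat K) b" "Cod (Cat K) p' = C'" "\<iota> \<odot> p' = p \<odot> b"
  obtains P where "is_lift b p P"
proof -
  have "r \<odot> (\<phi> \<odot> p') = \<xi> \<odot> (\<iota> \<odot> p')" by (rule Cat.cmp_eq_assoc[OF rphi]) (use p' in simp_all)
  then have e: "r \<odot> (\<phi> \<odot> p') = (\<xi> \<odot> p) \<odot> b" using p p'(4) b by simp
  obtain P where "P \<in> Ar (Cat K)" "Dom (Cat K) P = Cod (Cat K) b" "Cod (Cat K) P = Dom (Cat K) r"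
      "P \<odot> b = \<phi> \<odot> p'" "r \<odot> P = \<xi> \<odot> p"
    by (rule ortho_ex[OF o _ _ _ _ _ _ e]) (use p p' b in simp_all)
  then have "is_lift b p P" unfolding is_lift_def using p p' by auto
  then show ?thesis by (rule that)
qed

lemma is_lift_unique:
  assumes o: "ortho (Cat K) b r" and b: "b \<in> Ar (Cat K)"
    and p: "p \<in> Ar (Cat K)" "Dom (Cat K) p = Cod (Cat K) b" "Cod (Cat K) p = C"
    and P: "is_lift b p P" and Q: "is_lift b p Q"
  shows "P = Q"
proof -
  obtain p' where p': "p' \<in> Ar (Cat K)" "Dom (Cat K) p' = Dom (Cat K) b" "Cod (Cat K) p' = C'" "\<iota> \<odot> p' = p \<odot> b" "P \<odot> b = \<phi> \<odot> p'"
    using P unfolding is_lift_def by blast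
  obtain q' where q': "q' \<in> Ar (Cat K)" "Dom (Cat K) q' = Dom (Cat K) b" "Cod (Cat K) q' = C'" "\<iota> \<odot> q' = p \<odot> b" "Q \<odot> b = \<phi> \<odot> q'"
    using Q unfolding is_lift_def by blast
  have pq: "p' = q'" by (rule Cat.monoD[OF iota_mono]) (use p' q' in simp_all)
  show ?thesis by (rule Cat.ortho_eq[OF o b]) (use P Q p p'(5) q'(5) pq in \<open>simp_all add: is_lift_def\<close>)
qed

text \<open>This makes every lift that is unique natural: in the stage, in endofunctors of \<open>I\<close>, and along
  the sides of a square.\<close>

lemma is_lift_reparam:
  assumes P: "is_lift b p P" and p: "p \<in> Ar (Cat K)" "Dom (Cat K) p = Cod (Cat K) b" "Cod (Cat K) p = C"
    and b: "b \<in> Ar (Cat K)" and c: "c \<in> Ar (Cat K)"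
    and k: "k \<in> Ar (Cat K)" "Dom (Cat K) k = Cod (Cat K) c" "Cod (Cat K) k = Cod (Cat K) b"
    and k': "k' \<in> Ar (Cat K)" "Dom (Cat K) k' = Dom (Cat K) c" "Cod (Cat K) k' = Dom (Cat K) b"
    and e: "k \<odot> c = b \<odot> k'"
  shows "is_lift c (p \<odot> k) (P \<odot> k)"
proof -
  from P have PA: "P \<in> Ar (Cat K)" "Dom (Cat K) P = Cod (Cat K) b" "Cod (Cat K) P = X" "r \<odot> P = \<xi> \<odot> p"
    using p by (simp_all add: is_lift_def)
  obtain p' where p': "p' \<in> Ar (Cat K)" "Dom (Cat K) p' = Dom (Cat K) b" "Cod (Cat K) p' = C'"
      and e1: "\<iota> \<odot> p' = p \<odot> b" and e2: "P \<odot> b = \<phi> \<odot> p'"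
    using P unfolding is_lift_def by blast
  have 1: "r \<odot> (P \<odot> k) = \<xi> \<odot> (p \<odot> k)" by (rule Cat.cmp_eq_assoc[OF PA(4)]) (use PA k p in simp_all)
  have 2: "\<iota> \<odot> (p' \<odot> k') = p \<odot> (b \<odot> k')" by (rule Cat.cmp_eq_assoc[OF e1]) (use p' k' p b in simp_all)
  have 3: "P \<odot> (b \<odot> k') = \<phi> \<odot> (p' \<odot> k')" by (rule Cat.cmp_eq_assoc[OF e2]) (use p' k' PA b in simp_all)
  show ?thesis unfolding is_lift_def
  proof (intro conjI exI[of _ "p' \<odot> k'"])
    show "\<iota> \<odot> (p' \<odot> k') = (p \<odot> k) \<odot> c" "(P \<odot> k) \<odot> c = \<phi> \<odot> (p' \<odot> k')"
      using 2 3 PA p k c by (simp_all add: e)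
  qed (use 1 PA p p' k k' c in simp_all)
qed

lemma is_lift_factor:
  assumes "q \<in> Ar (Cat K)" "Cod (Cat K) q = C'" "b \<in> Ar (Cat K)" "Cod (Cat K) b = Dom (Cat K) q"
  shows "is_lift b (\<iota> \<odot> q) (\<phi> \<odot> q)"
proof -
  have "r \<odot> (\<phi> \<odot> q) = \<xi> \<odot> (\<iota> \<odot> q)" by (rule Cat.cmp_eq_assoc[OF rphi]) (use assms in simp_all)
  then show ?thesis unfolding is_lift_def
    by (intro conjI exI[of _ "q \<odot> b"]) (use assms in simp_all)
qed

lemma is_lift_cmp:
  assumes \<psi>: "\<psi> \<in> Ar (Cat K)" "Dom (Cat K) \<psi> = C" "Cod (Cat K) \<psi> = X" "\<psi> \<odot> \<iota> = \<phi>" "r \<odot> \<psi> = \<xi>"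
    and p: "p \<in> Ar (Cat K)" "Dom (Cat K) p = Cod (Cat K) b" "Cod (Cat K) p = C" and b: "b \<in> Ar (Cat K)"
    and p': "p' \<in> Ar (Cat K)" "Dom (Cat K) p' = Dom (Cat K) b" "Cod (Cat K) p' = C'" "\<iota> \<odot> p' = p \<odot> b"
  shows "is_lift b p (\<psi> \<odot> p)"
proof -
  have "\<psi> \<odot> (\<iota> \<odot> p') = \<phi> \<odot> p'" by (rule Cat.cmp_eq_assoc1[OF \<psi>(4)]) (use \<psi> p' in simp_all)
  moreover have "r \<odot> (\<psi> \<odot> p) = \<xi> \<odot> p" by (rule Cat.cmp_eq_assoc1[OF \<psi>(5)]) (use \<psi> p in simp_all)
  ultimately show ?thesis unfolding is_lift_def
    by (intro conjI exI[of _ p']) (use assms in simp_all)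
qed

section \<open>Lifting paths\<close>

definition is_path :: "'a \<Rightarrow> ('a, 'b) ifun \<Rightarrow> bool" where
  "is_path W p \<longleftrightarrow> W \<in> Ob K \<and> p \<in> Ar (Cat K) \<and> Dom (Cat K) p = prod_ob (Cat K) (dis W) I \<and> Cod (Cat K) p = C"

text \<open>\<open>J W\<close> is the inclusion of \<open>W \<times> I'\<close> into the domain of a path; \<open>S W\<close> below plays this role for squares.\<close>

definition J :: "'a \<Rightarrow> ('a, 'b) ifun" where
  "J W = prod_ar (Cat K) (Ide (Cat K) (dis W)) i"

lemma J_simps [simp]:
  assumes "W \<in> Ob K"
  shows "J W \<in> Ar (Cat K)" "Dom (Cat K) (J W) = prod_ob (Cat K) (dis W) I'" "Cod (Cat K) (J W) = prod_ob (Cat K) (dis W) I"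
    "ortho (Cat K) (J W) r"
  using assms r_right[of "dis W"] by (simp_all add: J_def)

lemma is_pathD:
  assumes "is_path W p"
  shows "W \<in> Ob K" "p \<in> Ar (Cat K)" "Dom (Cat K) p = prod_ob (Cat K) (dis W) I" "Cod (Cat K) p = C"
  using assms by (simp_all add: is_path_def)

lemma path_jet:
  assumes "is_path W p"
  obtains p' where "p' \<in> Ar (Cat K)" "Dom (Cat K) p' = prod_ob (Cat K) (dis W) I'" "Cod (Cat K) p' = C'" "\<iota> \<odot> p' = p \<odot> J W"
proof -
  note p = is_pathD[OF assms]
  obtain g where "g \<in> Ar (Cat K)" "Dom (Cat K) g = prod_ob (Cat K) (dis W) I'" "Cod (Cat K) g = Dom (Cat K) \<iota>" "\<iota> \<odot> g = p \<odot> J W"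
    by (rule hom_iso_lift[OF jet_iso iota(1) icats'(2) p(1), of "p \<odot> J W"]) (use p in simp_all)
  then show ?thesis using that by simp
qed

definition lift :: "'a \<Rightarrow> ('a, 'b) ifun \<Rightarrow> ('a, 'b) ifun" where
  "lift W p = (THE P. is_lift (J W) p P)"

lemma lift_eqI:
  assumes p: "is_path W p" and P: "is_lift (J W) p P"
  shows "lift W p = P"
  unfolding lift_def
  by (rule the_equality[where P = "is_lift (J W) p"], rule P)
    (rule is_lift_unique[of "J W" p], use is_pathD[OF p] P in simp_all)

lemma lift_is_lift:
  assumes p: "is_path W p"
  shows "is_lift (J W) p (lift W p)"
proof -
  note pD = is_pathD[OF p]
  obtain p' where p': "p' \<in> Ar (Cat K)" "Dom (Cat K) p' = prod_ob (Cat K) (dis W) I'" "Cod (Cat K) p' = C'" "\<iota> \<odot> p' = p \<odot> J W"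
    by (rule path_jet[OF p])
  obtain P where P: "is_lift (J W) p P"
    by (rule is_lift_ex[of "J W" p p']) (use p' pD in simp_all)
  then show ?thesis using lift_eqI[OF p P] by simp
qed

lemma lift_simps:
  assumes p: "is_path W p"
  shows "lift W p \<in> Ar (Cat K)" "Dom (Cat K) (lift W p) = prod_ob (Cat K) (dis W) I" "Cod (Cat K) (lift W p) = X"
    "r \<odot> lift W p = \<xi> \<odot> p"
  using lift_is_lift[OF p] is_pathD[OF p] by (simp_all add: is_lift_def)

lemma path_reparam:
  assumes p: "is_path W p" and e: "e \<in> Ar K" "Cod K e = W" and k: "k \<in> Ar (Cat K)" "Dom (Cat K) k = I" "Cod (Cat K) k = I"
  shows "is_path (Dom K e) (p \<odot> prod_ar (Cat K) (dis_ar e) k)"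
  using is_pathD[OF p] e k by (simp add: is_path_def)

text \<open>The endofunctor \<open>k\<close> restricts to jets, so that the reparametrised lift has the property that
  characterises the lift of the reparametrised path.\<close>

lemma lift_reparam:
  assumes p: "is_path W p" and e: "e \<in> Ar K" "Cod K e = W" and k: "k \<in> Ar (Cat K)" "Dom (Cat K) k = I" "Cod (Cat K) k = I"
  shows "lift (Dom K e) (p \<odot> prod_ar (Cat K) (dis_ar e) k) = lift W p \<odot> prod_ar (Cat K) (dis_ar e) k"
proof (rule lift_eqI[OF path_reparam[OF p e k]])
  obtain k' where k': "k' \<in> Ar (Cat K)" "Dom (Cat K) k' = I'" "Cod (Cat K) k' = I'" "i \<odot> k' = k \<odot> i"
    using jets[of k] k by auto
  show "is_lift (J (Dom K e)) (p \<odot> prod_ar (Cat K) (dis_ar e) k) (lift W p \<odot> prod_ar (Cat K) (dis_ar e) k)"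
    by (rule is_lift_reparam[OF lift_is_lift[OF p], of _ _ "prod_ar (Cat K) (dis_ar e) k'"])
      (use is_pathD[OF p] e k k' in \<open>simp_all add: J_def\<close>)
qed

abbreviation at :: "('a, 'b) ifun \<Rightarrow> 'b \<Rightarrow> ('a, 'b) ifun" (infixl "at" 72) where
  "p at e \<equiv> p \<odot> prod_ar (Cat K) (dis_ar e) (Ide (Cat K) I)"

definition lam :: 'b where "lam = f1 l \<cdot> a"

lemma lam [simp]:
  "lam \<in> Ar K" "Dom K lam = T" "Cod K lam = C1 I"
  "src I \<cdot> lam = f0 l \<cdot> f0 s" "tgt I \<cdot> lam = f0 l \<cdot> f0 t"
  by (simp_all add: lam_def)

definition arr :: "'a \<Rightarrow> ('a, 'b) ifun \<Rightarrow> 'b" where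
  "arr W p = app W I lam p"

lemma arr_simps [simp]:
  assumes "W \<in> Ob K" "p \<in> Ar (Cat K)" "Dom (Cat K) p = prod_ob (Cat K) (dis W) I"
  shows "arr W p \<in> Ar K" "Dom K (arr W p) = W" "Cod K (arr W p) = C1 (Cod (Cat K) p)"
  using assms by (simp_all add: arr_def)

lemma arr_at:
  assumes "W \<in> Ob K" "p \<in> Ar (Cat K)" "Dom (Cat K) p = prod_ob (Cat K) (dis W) I" "e \<in> Ar K" "Cod K e = W"
  shows "arr (Dom K e) (p at e) = arr W p \<cdot> e"
  using app_pre[of lam I W e "Ide (Cat K) I" I p] assms by (simp add: arr_def)

lemma arr_post:
  assumes "W \<in> Ob K" "p \<in> Ar (Cat K)" "Dom (Cat K) p = prod_ob (Cat K) (dis W) I" "G \<in> Ar (Cat K)"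
    "Dom (Cat K) G = Cod (Cat K) p"
  shows "arr W (G \<odot> p) = f1 G \<cdot> arr W p"
  using app_post[of lam I W p G] assms by (simp add: arr_def)

lemma path_at: "is_path W p \<Longrightarrow> e \<in> Ar K \<Longrightarrow> Cod K e = W \<Longrightarrow> is_path (Dom K e) (p at e)"
  by (rule path_reparam) simp_all

lemma lift_at: "is_path W p \<Longrightarrow> e \<in> Ar K \<Longrightarrow> Cod K e = W \<Longrightarrow> lift (Dom K e) (p at e) = lift W p at e"
  by (rule lift_reparam) simp_all

lemma arr_lift_at:
  assumes p: "is_path W p" and e: "e \<in> Ar K" "Cod K e = W"
  shows "arr (Dom K e) (lift (Dom K e) (p at e)) = arr W (lift W p) \<cdot> e"
  using lift_at[OF p e] arr_at[of W "lift W p" e] lift_simps[OF p] is_pathD[OF p] e by simp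

section \<open>End points\<close>

text \<open>The constant endofunctors of \<open>I\<close> at its end points. Composing with them turns a path into the
  constant path at its source or target.\<close>

definition zero :: "('a, 'b) ifun" where "zero = const_ar (Cat K) I (l \<odot> s)"
definition unit :: "('a, 'b) ifun" where "unit = const_ar (Cat K) I (l \<odot> t)"

lemma ends [simp]:
  "zero \<in> Ar (Cat K)" "Dom (Cat K) zero = I" "Cod (Cat K) zero = I"
  "unit \<in> Ar (Cat K)" "Dom (Cat K) unit = I" "Cod (Cat K) unit = I"
  using one_terminal by (simp_all add: zero_def unit_def)

lemma ends_lam:
  "f1 zero \<cdot> lam = idn I \<cdot> (src I \<cdot> lam)" "f1 unit \<cdot> lam = idn I \<cdot> (tgt I \<cdot> lam)"
proof -
  have tm: "is_terminal (Cat K) (Dom (Cat K) (l \<odot> s))" "is_terminal (Cat K) (Dom (Cat K) (l \<odot> t))"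
    using one_terminal by simp_all
  have IO: "I \<in> Ob (Cat K)" by simp
  obtain u where u: "u \<in> Ar (Cat K)" "Cod (Cat K) u = one" "Dom (Cat K) u = I" "zero = (l \<odot> s) \<odot> u"
    using Cat.const_arE[OF tm(1) IO] by (auto simp: zero_def)
  obtain v where v: "v \<in> Ar (Cat K)" "Cod (Cat K) v = one" "Dom (Cat K) v = I" "unit = (l \<odot> t) \<odot> v"
    using Cat.const_arE[OF tm(2) IO] by (auto simp: unit_def)
  have "f1 u \<cdot> lam = idn one" "f1 v \<cdot> lam = idn one"
    using one_arrow[of "f1 u \<cdot> lam"] one_arrow[of "f1 v \<cdot> lam"] u v by simp_all
  then show "f1 zero \<cdot> lam = idn I \<cdot> (src I \<cdot> lam)" "f1 unit \<cdot> lam = idn I \<cdot> (tgt I \<cdot> lam)"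
    using u v by simp_all
qed

abbreviation reparam :: "'a \<Rightarrow> ('a, 'b) ifun \<Rightarrow> ('a, 'b) ifun \<Rightarrow> ('a, 'b) ifun" where
  "reparam W p k \<equiv> p \<odot> prod_ar (Cat K) (Ide (Cat K) (dis W)) k"

lemma arr_ends:
  assumes "W \<in> Ob K" "p \<in> Ar (Cat K)" "Dom (Cat K) p = prod_ob (Cat K) (dis W) I" "Cod (Cat K) p = B"
  shows "arr W (reparam W p zero) = idn B \<cdot> (src B \<cdot> arr W p)" "arr W (reparam W p unit) = idn B \<cdot> (tgt B \<cdot> arr W p)"
proof -
  have "arr W (reparam W p zero) = app W I (f1 zero \<cdot> lam) p" "arr W (reparam W p unit) = app W I (f1 unit \<cdot> lam) p"
    unfolding arr_def by (rule app_pre1; use assms in simp)+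
  then show "arr W (reparam W p zero) = idn B \<cdot> (src B \<cdot> arr W p)" "arr W (reparam W p unit) = idn B \<cdot> (tgt B \<cdot> arr W p)"
    unfolding ends_lam using app_idn_src[of lam I W p B] assms by (simp_all add: arr_def del: lam(4,5))
qed

text \<open>Lifts of constant paths are therefore constant.\<close>

lemma lift_ends:
  assumes p: "is_path W p"
  shows "is_path W (reparam W p zero)" "is_path W (reparam W p unit)"
    "lift W (reparam W p zero) = reparam W (lift W p) zero" "lift W (reparam W p unit) = reparam W (lift W p) unit"
  using path_reparam[OF p, of "Ide K W" zero] path_reparam[OF p, of "Ide K W" unit]
    lift_reparam[OF p, of "Ide K W" zero] lift_reparam[OF p, of "Ide K W" unit] is_pathD[OF p]
  by (simp_all add: dis_ar_Ide)

section \<open>Lifting squares\<close>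

text \<open>Arrows of \<open>C'\<close> at stage \<open>W\<close> are functors \<open>dis W \<times> two \<rightarrow> C'\<close>, and on those \<open>\<iota>\<close> can be
  cancelled.\<close>

lemma iota_f1_mono: "is_mono K (f1 \<iota>)"
proof (rule is_monoI)
  fix g h assume *: "g \<in> Ar K" "h \<in> Ar K" "Cod K g = Dom K (f1 \<iota>)" "Cod K h = Dom K (f1 \<iota>)" "Dom K g = Dom K h" "f1 \<iota> \<cdot> g = f1 \<iota> \<cdot> h"
  let ?W = "Dom K h"
  have W: "?W \<in> Ob K" using * by simp
  obtain G where G: "G \<in> Ar (Cat K)" "Dom (Cat K) G = prod_ob (Cat K) (dis ?W) two" "Cod (Cat K) G = C'" "app ?W two a G = g"
    by (rule two_fun_ex[OF W, of C' g]) (use * in simp_all)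
  obtain H where H: "H \<in> Ar (Cat K)" "Dom (Cat K) H = prod_ob (Cat K) (dis ?W) two" "Cod (Cat K) H = C'" "app ?W two a H = h"
    by (rule two_fun_ex[OF W, of C' h]) (use * in simp_all)
  have "\<iota> \<odot> G = \<iota> \<odot> H"
    by (rule two_fun_eq[OF W])
      (use G H *(6) W app_post[of a two ?W G \<iota>] app_post[of a two ?W H \<iota>] in simp_all)
  then have "G = H" by (rule Cat.monoD[OF iota_mono, rotated -1]) (use G H in simp_all)
  then show "g = h" using G H by simp
qed simp

lemma iota_f0_mono: "is_mono K (f0 \<iota>)"
proof (rule is_monoI)
  fix g h assume *: "g \<in> Ar K" "h \<in> Ar K" "Cod K g = Dom K (f0 \<iota>)" "Cod K h = Dom K (f0 \<iota>)" "Dom K g = Dom K h" "f0 \<iota> \<cdot> g = f0 \<iota> \<cdot> h"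
  have "f1 \<iota> \<cdot> (idn C' \<cdot> g) = f1 \<iota> \<cdot> (idn C' \<cdot> h)" using * by simp
  then have "idn C' \<cdot> g = idn C' \<cdot> h" by (rule monoD[OF iota_f1_mono, rotated -1]) (use *(1-5) in simp_all)
  then have "src C' \<cdot> (idn C' \<cdot> g) = src C' \<cdot> (idn C' \<cdot> h)" by simp
  then show "g = h" using *(1-5) by simp
qed simp

text \<open>Both components of \<open>\<iota>\<close> are monomorphisms, so the functor laws of \<open>G\<close> are inherited by the
  factorisation of its arrow part.\<close>

lemma factor_iota:
  assumes G: "G \<in> Ar (Cat K)" "Cod (Cat K) G = C"
    and g: "g \<in> Ar K" "Dom K g = C1 (Dom (Cat K) G)" "Cod K g = C1 C'" "f1 \<iota> \<cdot> g = f1 G"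
  obtains H where "H \<in> Ar (Cat K)" "Dom (Cat K) H = Dom (Cat K) G" "Cod (Cat K) H = C'" "\<iota> \<odot> H = G"
proof -
  let ?B = "Dom (Cat K) G"
  have B: "is_icat K ?B" using G by simp
  let ?u = "src C' \<cdot> (g \<cdot> idn ?B)"
  have gx: "f1 \<iota> \<cdot> (g \<cdot> x) = f1 G \<cdot> x" if "x \<in> Ar K" "Cod K x = C1 ?B" for x
    by (rule cmp_eq_assoc1[OF g(4)]) (use g that in simp_all)
  have "f0 \<iota> \<cdot> ?u = src C \<cdot> (f1 \<iota> \<cdot> (g \<cdot> idn ?B))" using B g by simp
  also have "\<dots> = src C \<cdot> (f1 G \<cdot> idn ?B)" using gx[of "idn ?B"] B by simp
  also have "\<dots> = f0 G" using G by simp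
  finally have u: "?u \<in> Ar K" "Dom K ?u = C0 ?B" "Cod K ?u = C0 C'" "f0 \<iota> \<cdot> ?u = f0 G"
    using B g by simp_all
  have ux: "f0 \<iota> \<cdot> (?u \<cdot> x) = f0 G \<cdot> x" if "x \<in> Ar K" "Cod K x = C0 ?B" for x
    by (rule cmp_eq_assoc1[OF u(4)]) (use u that in simp_all)
  have ig: "f0 \<iota> \<cdot> (src C' \<cdot> y) = src C \<cdot> (f1 \<iota> \<cdot> y)" "f0 \<iota> \<cdot> (tgt C' \<cdot> y) = tgt C \<cdot> (f1 \<iota> \<cdot> y)"
    if "y \<in> Ar K" "Cod K y = C1 C'" for y
    using ifun_elem[OF iota(1,3), of y] that by simp_all
  have sg: "src C' \<cdot> g = ?u \<cdot> src ?B"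
  proof (rule monoD[OF iota_f0_mono])
    show "f0 \<iota> \<cdot> (src C' \<cdot> g) = f0 \<iota> \<cdot> (?u \<cdot> src ?B)"
      unfolding ig[OF g(1,3)] using ux[of "src ?B"] B g G by (simp del: ifun_elem)
  qed (use B g u in simp_all)
  have tg: "tgt C' \<cdot> g = ?u \<cdot> tgt ?B"
  proof (rule monoD[OF iota_f0_mono])
    show "f0 \<iota> \<cdot> (tgt C' \<cdot> g) = f0 \<iota> \<cdot> (?u \<cdot> tgt ?B)"
      unfolding ig[OF g(1,3)] using ux[of "tgt ?B"] B g G by (simp del: ifun_elem)
  qed (use B g u in simp_all)
  obtain H where H: "H \<in> Ar (Cat K)" "Dom (Cat K) H = ?B" "Cod (Cat K) H = C'" "f0 H = ?u" "f1 H = g"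
  proof (rule ifunI[OF B icats'(4) u(1-3) g(1-3) sg tg])
    show "g \<cdot> idn ?B = idn C' \<cdot> ?u"
    proof (rule monoD[OF iota_f1_mono])
      have "f1 \<iota> \<cdot> (idn C' \<cdot> ?u) = idn C \<cdot> (f0 \<iota> \<cdot> ?u)" using ifun_idn_elem[OF iota(1,2) u(1,3)] by (simp only: iota(3))
      then show "f1 \<iota> \<cdot> (g \<cdot> idn ?B) = f1 \<iota> \<cdot> (idn C' \<cdot> ?u)"
        using gx[of "idn ?B"] u(4) B G by simp
    qed (use B g u in simp_all)
    fix f h assume fh: "f \<in> Ar K" "h \<in> Ar K" "Cod K f = C1 ?B" "Cod K h = C1 ?B" "Dom K f = Dom K h" "tgt ?B \<cdot> f = src ?B \<cdot> h"
    have t: "tgt C' \<cdot> (g \<cdot> f) = src C' \<cdot> (g \<cdot> h)"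
    proof -
      have "tgt C' \<cdot> (g \<cdot> f) = ?u \<cdot> (tgt ?B \<cdot> f)" by (rule cmp_eq_assoc[OF tg]) (use g u(1-3) fh B in simp_all)
      moreover have "src C' \<cdot> (g \<cdot> h) = ?u \<cdot> (src ?B \<cdot> h)" by (rule cmp_eq_assoc[OF sg]) (use g u(1-3) fh B in simp_all)
      ultimately show ?thesis using fh(6) by simp
    qed
    show "g \<cdot> icomp K ?B f h = icomp K C' (g \<cdot> f) (g \<cdot> h)"
    proof (rule monoD[OF iota_f1_mono])
      have "f1 \<iota> \<cdot> icomp K C' (g \<cdot> f) (g \<cdot> h) = icomp K C (f1 \<iota> \<cdot> (g \<cdot> f)) (f1 \<iota> \<cdot> (g \<cdot> h))"
        using t fh g by (subst ifun_icomp) simp_all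
      then show "f1 \<iota> \<cdot> (g \<cdot> icomp K ?B f h) = f1 \<iota> \<cdot> icomp K C' (g \<cdot> f) (g \<cdot> h)"
        using gx[of f] gx[of h] gx[of "icomp K ?B f h"] fh B G by simp
    qed (use t fh g B in simp_all)
  qed (rule that)
  have "\<iota> \<odot> H = G" by (rule ifun_ext) (use H G g in simp_all)
  then show ?thesis using that[of H] H by simp
qed

definition S :: "'a \<Rightarrow> ('a, 'b) ifun" where
  "S W = prod_ar (Cat K) (Ide (Cat K) (dis W)) (prod_ar (Cat K) i i)"

lemma S_simps [simp]:
  assumes "W \<in> Ob K"
  shows "S W \<in> Ar (Cat K)" "Dom (Cat K) (S W) = prod_ob (Cat K) (dis W) (prod_ob (Cat K) I' I')"
    "Cod (Cat K) (S W) = prod_ob (Cat K) (dis W) (prod_ob (Cat K) I I)"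
  using assms by (simp_all add: S_def)

text \<open>\<open>i \<times> i\<close> is \<open>i \<times> I'\<close> followed by \<open>I \<times> i\<close>, and after multiplication with \<open>dis W\<close> each of the two
  factors is, up to a permutation, of the form \<open>Z \<times> i\<close>.\<close>

lemma S_ortho:
  assumes W: "W \<in> Ob K"
  shows "ortho (Cat K) (S W) r"
proof -
  let ?D = "dis W" and ?pr = "prod_ob (Cat K)" and ?id = "Ide (Cat K)"
  let ?p = "pr1 (Cat K)" and ?q = "pr2 (Cat K)" and ?m = "prod_pair (Cat K)"
  let ?b1 = "prod_ar (Cat K) (?id ?D) (prod_ar (Cat K) i (?id I'))"
  let ?b2 = "prod_ar (Cat K) (?id ?D) (prod_ar (Cat K) (?id I) i)"
  have e: "S W = ?b2 \<odot> ?b1" using W by (simp add: S_def)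
  let ?h = "\<lambda>A B. ?m (?m (?p ?D (?pr A B)) (?q A B \<odot> ?q ?D (?pr A B))) (?p A B \<odot> ?q ?D (?pr A B))"
  let ?h' = "\<lambda>A B. ?m (?p ?D B \<odot> ?p (?pr ?D B) A) (?m (?q (?pr ?D B) A) (?q ?D B \<odot> ?p (?pr ?D B) A))"
  have o1: "ortho (Cat K) (prod_ar (Cat K) (?id (?pr ?D I')) i) r" using r_right[of "?pr ?D I'"] W by simp
  have "ortho (Cat K) ?b1 r"
    by (rule Cat.ortho_iso[OF o1, of _ "?h I' I'" "?h' I' I'" "?h I I'" "?h' I I'"]) (use W in simp_all)
  moreover
  let ?k = "\<lambda>A B. ?m (?m (?p ?D (?pr A B)) (?p A B \<odot> ?q ?D (?pr A B))) (?q A B \<odot> ?q ?D (?pr A B))"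
  let ?k' = "\<lambda>A B. ?m (?p ?D A \<odot> ?p (?pr ?D A) B) (?m (?q ?D A \<odot> ?p (?pr ?D A) B) (?q (?pr ?D A) B))"
  have o2: "ortho (Cat K) (prod_ar (Cat K) (?id (?pr ?D I)) i) r" using r_right[of "?pr ?D I"] W by simp
  have "ortho (Cat K) ?b2 r"
    by (rule Cat.ortho_iso[OF o2, of _ "?k I I'" "?k' I I'" "?k I I" "?k' I I"]) (use W in simp_all)
  ultimately show ?thesis unfolding e by (intro Cat.ortho_cmp) (use W in simp_all)
qed

text \<open>The product \<open>I' \<times> I'\<close> need not be the jet part of anything, so this does not follow from the
  isomorphism of hom-objects alone. But an arrow \<open>(x, y)\<close> of the product is \<open>(x, id)\<close> followed
  by \<open>(id, y)\<close>. Each of these is a value of a functor \<open>dis V \<times> I' \<rightarrow> dis W \<times> (I' \<times> I')\<close> that holds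
  one coordinate fixed, and the composite of that functor with \<open>G\<close> does factor through \<open>\<iota>\<close>. The
  two arrows of \<open>C'\<close> so obtained are composable because \<open>\<iota>\<close> is a monomorphism.\<close>

lemma square_jet:
  assumes W: "W \<in> Ob K" and G: "G \<in> Ar (Cat K)"
    "Dom (Cat K) G = prod_ob (Cat K) (dis W) (prod_ob (Cat K) I' I')" "Cod (Cat K) G = C"
  obtains H where "H \<in> Ar (Cat K)" "Dom (Cat K) H = Dom (Cat K) G" "Cod (Cat K) H = C'" "\<iota> \<odot> H = G"
proof -
  let ?II = "prod_ob (Cat K) I' I'" and ?D = "dis W"
  let ?P = "prod_ob (Cat K) ?D ?II"
  let ?e = "\<lambda>w x y. el1 ?D ?II w (el1 I' I' x y)"
  have jetN: "\<exists>k. k \<in> Ar K \<and> Dom K k = Dom K b \<and> Cod K k = C1 C' \<and> f1 \<iota> \<cdot> k = f1 (G \<odot> N) \<cdot> el1 (dis (Dom K b)) I' (Ide K (Dom K b)) b"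
    if b: "b \<in> Ar K" "Cod K b = C1 I'" and N: "N \<in> Ar (Cat K)" "Dom (Cat K) N = prod_ob (Cat K) (dis (Dom K b)) I'" "Cod (Cat K) N = ?P" for b N
  proof -
    have V: "Dom K b \<in> Ob K" using b by simp
    obtain g where g: "g \<in> Ar (Cat K)" "Dom (Cat K) g = prod_ob (Cat K) (dis (Dom K b)) I'" "Cod (Cat K) g = Dom (Cat K) \<iota>" "\<iota> \<odot> g = G \<odot> N"
      by (rule hom_iso_lift[OF jet_iso iota(1) icats'(2) V, of "G \<odot> N"]) (use N G in simp_all)
    have "f1 \<iota> \<cdot> (f1 g \<cdot> el1 (dis (Dom K b)) I' (Ide K (Dom K b)) b) = f1 (\<iota> \<odot> g) \<cdot> el1 (dis (Dom K b)) I' (Ide K (Dom K b)) b"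
      using g(1-3) b V by simp
    also have "\<dots> = f1 (G \<odot> N) \<cdot> el1 (dis (Dom K b)) I' (Ide K (Dom K b)) b" by (simp only: g(4))
    finally show ?thesis using g b V by (intro exI[of _ "f1 g \<cdot> el1 (dis (Dom K b)) I' (Ide K (Dom K b)) b"]) (simp del: Cat_sel)
  qed
  have right: "\<exists>k. k \<in> Ar K \<and> Dom K k = Dom K b \<and> Cod K k = C1 C' \<and> f1 \<iota> \<cdot> k = f1 G \<cdot> ?e w (idn I' \<cdot> y) b"
    if w: "w \<in> Ar K" "Cod K w = W" "Dom K w = Dom K b" and y: "y \<in> Ar K" "Cod K y = C0 I'" "Dom K y = Dom K b"
      and b: "b \<in> Ar K" "Cod K b = C1 I'" for w y b
  proof -
    let ?p = "pr1 (Cat K) (dis (Dom K b)) I'" and ?q = "pr2 (Cat K) (dis (Dom K b)) I'"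
    let ?N = "prod_pair (Cat K) (dis_ar w \<odot> ?p) (prod_pair (Cat K) (dis_el I' y \<odot> ?p) ?q)"
    show ?thesis using jetN[of b ?N] w y b W G by simp
  qed
  have left: "\<exists>k. k \<in> Ar K \<and> Dom K k = Dom K b \<and> Cod K k = C1 C' \<and> f1 \<iota> \<cdot> k = f1 G \<cdot> ?e w b (idn I' \<cdot> y)"
    if w: "w \<in> Ar K" "Cod K w = W" "Dom K w = Dom K b" and y: "y \<in> Ar K" "Cod K y = C0 I'" "Dom K y = Dom K b"
      and b: "b \<in> Ar K" "Cod K b = C1 I'" for w y b
  proof -
    let ?p = "pr1 (Cat K) (dis (Dom K b)) I'" and ?q = "pr2 (Cat K) (dis (Dom K b)) I'"
    let ?N = "prod_pair (Cat K) (dis_ar w \<odot> ?p) (prod_pair (Cat K) ?q (dis_el I' y \<odot> ?p))"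
    show ?thesis using jetN[of b ?N] w y b W G by simp
  qed
  let ?Y = "C1 ?P"
  let ?w = "f1 (pr1 (Cat K) ?D ?II)" and ?z = "f1 (pr2 (Cat K) ?D ?II)"
  let ?x = "f1 (pr1 (Cat K) I' I') \<cdot> ?z" and ?y = "f1 (pr2 (Cat K) I' I') \<cdot> ?z"
  have wz: "?w \<in> Ar K" "Dom K ?w = ?Y" "Cod K ?w = W" "?z \<in> Ar K" "Dom K ?z = ?Y" "Cod K ?z = C1 ?II"
    "?x \<in> Ar K" "Dom K ?x = ?Y" "Cod K ?x = C1 I'" "?y \<in> Ar K" "Dom K ?y = ?Y" "Cod K ?y = C1 I'"
    using W by simp_all
  have z: "el1 I' I' ?x ?y = ?z" by (rule el1_eta) (use W in simp_all)
  have "el1 ?D ?II (?w \<cdot> Ide K ?Y) (?z \<cdot> Ide K ?Y) = Ide K ?Y" by (rule el1_eta) (use W in simp_all)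
  then have gen: "?e ?w ?x ?y = Ide K ?Y" using wz z by simp
  obtain k where k: "k \<in> Ar K" "Dom K k = ?Y" "Cod K k = C1 C'" "f1 \<iota> \<cdot> k = f1 G \<cdot> ?e ?w ?x (idn I' \<cdot> (src I' \<cdot> ?y))"
    using left[of ?w ?x "src I' \<cdot> ?y"] wz by auto
  obtain k' where k': "k' \<in> Ar K" "Dom K k' = ?Y" "Cod K k' = C1 C'" "f1 \<iota> \<cdot> k' = f1 G \<cdot> ?e ?w (idn I' \<cdot> (tgt I' \<cdot> ?x)) ?y"
    using right[of ?w ?y "tgt I' \<cdot> ?x"] wz by auto
  let ?u = "?e ?w ?x (idn I' \<cdot> (src I' \<cdot> ?y))" and ?v = "?e ?w (idn I' \<cdot> (tgt I' \<cdot> ?x)) ?y"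
  have uv: "?u \<in> Ar K" "?v \<in> Ar K" "Cod K ?u = C1 ?P" "Cod K ?v = C1 ?P" "Dom K ?u = Dom K ?v" "tgt ?P \<cdot> ?u = src ?P \<cdot> ?v"
    using W wz by (simp_all del: ifun_elem)
  have "icomp K ?P ?u ?v = ?e ?w ?x ?y" using W wz by (simp del: ifun_elem)
  then have comp: "f1 G = icomp K C (f1 G \<cdot> ?u) (f1 G \<cdot> ?v)"
    using ifun_icomp[OF G(1,2) uv(1,3,2,4,5,6)] gen G W by simp
  have "f0 \<iota> \<cdot> (tgt C' \<cdot> k) = f0 \<iota> \<cdot> (src C' \<cdot> k')"
  proof -
    have "tgt C \<cdot> (f1 \<iota> \<cdot> k) = src C \<cdot> (f1 \<iota> \<cdot> k')"
      unfolding k(4) k'(4) using uv ifun_elem[OF G(1,3), of ?u] ifun_elem[OF G(1,3), of ?v] G by (simp del: ifun_elem)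
    then show ?thesis using k(1-3) k'(1-3) by simp
  qed
  then have t: "tgt C' \<cdot> k = src C' \<cdot> k'"
    by (rule monoD[OF iota_f0_mono, rotated -1]) (use k(1-3) k'(1-3) in simp_all)
  have "f1 \<iota> \<cdot> icomp K C' k k' = icomp K C (f1 \<iota> \<cdot> k) (f1 \<iota> \<cdot> k')"
    using ifun_icomp[of \<iota> C' k k'] k(1-3) k'(1-3) t by simp
  then have fac: "f1 \<iota> \<cdot> icomp K C' k k' = f1 G" by (simp only: k(4) k'(4) comp[symmetric])
  show ?thesis
    by (rule factor_iota[OF G(1,3), of "icomp K C' k k'"])
      (use k(1-3) k'(1-3) t G fac that in simp_all)
qed

text \<open>The lift of a square restricts to the lifts of its sides, because \<open>(u, v)\<close> restricts to
  \<open>I' \<rightarrow> I' \<times> I'\<close>. This covers end points which are not points of \<open>I'\<close>: a constant endofunctor of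
  \<open>I\<close> restricts to \<open>I'\<close> all the same.\<close>

lemma square_lift:
  assumes W: "W \<in> Ob K" and h: "h \<in> Ar (Cat K)" "Dom (Cat K) h = prod_ob (Cat K) (dis W) (prod_ob (Cat K) I I)" "Cod (Cat K) h = C"
  obtains H where "H \<in> Ar (Cat K)" "Dom (Cat K) H = prod_ob (Cat K) (dis W) (prod_ob (Cat K) I I)" "Cod (Cat K) H = X"
    "\<And>u v. u \<in> hom (Cat K) I I \<Longrightarrow> v \<in> hom (Cat K) I I \<Longrightarrow>
      lift W (reparam W h (prod_pair (Cat K) u v)) = reparam W H (prod_pair (Cat K) u v)"
proof -
  obtain h' where h': "h' \<in> Ar (Cat K)" "Dom (Cat K) h' = Dom (Cat K) (h \<odot> S W)" "Cod (Cat K) h' = C'" "\<iota> \<odot> h' = h \<odot> S W"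
    by (rule square_jet[OF W, of "h \<odot> S W"]) (use W h in simp_all)
  obtain H where H: "is_lift (S W) h H"
    by (rule is_lift_ex[OF S_ortho[OF W], of h h']) (use W h h' in simp_all)
  show ?thesis
  proof (rule that[of H])
    show "H \<in> Ar (Cat K)" "Dom (Cat K) H = prod_ob (Cat K) (dis W) (prod_ob (Cat K) I I)" "Cod (Cat K) H = X"
      using H h by (simp_all add: is_lift_def)
    fix u v assume uv: "u \<in> hom (Cat K) I I" "v \<in> hom (Cat K) I I"
    obtain u' where u': "u' \<in> Ar (Cat K)" "Dom (Cat K) u' = I'" "Cod (Cat K) u' = I'" "i \<odot> u' = u \<odot> i"
      using jets[OF uv(1)] by auto
    obtain v' where v': "v' \<in> Ar (Cat K)" "Dom (Cat K) v' = I'" "Cod (Cat K) v' = I'" "i \<odot> v' = v \<odot> i"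
      using jets[OF uv(2)] by auto
    show "lift W (reparam W h (prod_pair (Cat K) u v)) = reparam W H (prod_pair (Cat K) u v)"
    proof (rule lift_eqI)
      show "is_path W (reparam W h (prod_pair (Cat K) u v))" using W h uv by (simp add: is_path_def)
      show "is_lift (J W) (reparam W h (prod_pair (Cat K) u v)) (reparam W H (prod_pair (Cat K) u v))"
        by (rule is_lift_reparam[OF H, of _ _ "prod_ar (Cat K) (Ide (Cat K) (dis W)) (prod_pair (Cat K) u' v')"])
          (use W h uv u' v' in \<open>simp_all add: J_def S_def\<close>)
    qed
  qed
qed

end

context jet_setting
begin

section \<open>Concatenation of paths\<close>

abbreviation dlt :: "('a, 'b) ifun" where "dlt \<equiv> delta K a l j1 j2"

abbreviation bdr :: "('a, 'b) ifun" where "bdr \<equiv> boundary_incl (Cat K) (l \<odot> s) (l \<odot> t) j1 j2 i1 i2"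

abbreviation II :: "('a, 'b) icat" where "II \<equiv> Cod (Cat K) j1"

lemma j_simps [simp]:
  "j1 \<in> Ar (Cat K)" "j2 \<in> Ar (Cat K)" "Dom (Cat K) j1 = I" "Dom (Cat K) j2 = I" "Cod (Cat K) j2 = II"
  "is_icat K II"
  using Cat.is_pushout_Ar[OF po1] by simp_all

lemma j_glue: "tgt II \<cdot> (f1 j1 \<cdot> lam) = src II \<cdot> (f1 j2 \<cdot> lam)"
proof -
  have "j1 \<odot> (l \<odot> t) = j2 \<odot> (l \<odot> s)" using Cat.is_pushout_Ar[OF po1] by simp
  from arg_cong[OF this, of f0] show ?thesis by simp
qed

lemma delta:
  "dlt \<in> Ar (Cat K)" "Dom (Cat K) dlt = two" "Cod (Cat K) dlt = II"
  "f1 dlt \<cdot> a = icomp K II (f1 j1 \<cdot> lam) (f1 j2 \<cdot> lam)"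
proof -
  let ?m = "icomp K II (f1 j1 \<cdot> lam) (f1 j2 \<cdot> lam)"
  have "\<exists>!d. d \<in> hom (Cat K) two II \<and> f1 d \<cdot> a = ?m"
    by (rule fun_of_two) (use j_glue in \<open>simp_all del: ifun_elem\<close>)
  from theI'[OF this] have "(THE d. d \<in> hom (Cat K) two II \<and> f1 d \<cdot> a = ?m) \<in> hom (Cat K) two II \<and>
      f1 (THE d. d \<in> hom (Cat K) two II \<and> f1 d \<cdot> a = ?m) \<cdot> a = ?m" .
  moreover have "dlt = (THE d. d \<in> hom (Cat K) two II \<and> f1 d \<cdot> a = ?m)"
  proof -
    have "fdom l = two" "fcod j1 = II" using l(2) by (simp_all add: Cat_def)
    moreover have "f1 (j1 \<odot> l) \<cdot> a = f1 j1 \<cdot> lam" "f1 (j2 \<odot> l) \<cdot> a = f1 j2 \<cdot> lam" by (simp_all add: lam_def)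
    ultimately show ?thesis unfolding delta_def by simp
  qed
  ultimately show "dlt \<in> Ar (Cat K)" "Dom (Cat K) dlt = two" "Cod (Cat K) dlt = II" "f1 dlt \<cdot> a = ?m"
    by simp_all
qed

declare delta(1-3) [simp]

lemma i_simps [simp]:
  "i1 \<in> Ar (Cat K)" "i2 \<in> Ar (Cat K)" "Dom (Cat K) i1 = II" "Dom (Cat K) i2 = II" "Cod (Cat K) i2 = Cod (Cat K) i1"
  "is_icat K (Cod (Cat K) i1)"
  using Cat.is_pushout_Ar[OF po2] by simp_all

text \<open>Paths \<open>p\<close> and \<open>q\<close> that match at their ends glue to a functor on the pushout, whose value at
  \<open>dlt\<close> is the composite of the arrows of \<open>p\<close> and \<open>q\<close>.\<close>

lemma concatenation:
  assumes W: "W \<in> Ob K" and p: "p \<in> Ar (Cat K)" "Dom (Cat K) p = prod_ob (Cat K) (dis W) I"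
    and q: "q \<in> Ar (Cat K)" "Dom (Cat K) q = prod_ob (Cat K) (dis W) I" "Cod (Cat K) p = Cod (Cat K) q"
    and e: "tgt (Cod (Cat K) q) \<cdot> arr W p = src (Cod (Cat K) q) \<cdot> arr W q"
  obtains c where "c \<in> Ar (Cat K)" "Dom (Cat K) c = prod_ob (Cat K) (dis W) II" "Cod (Cat K) c = Cod (Cat K) q"
    "reparam W c j1 = p" "reparam W c j2 = q"
    "app W two a (reparam W c dlt) = icomp K (Cod (Cat K) q) (arr W p) (arr W q)"
proof -
  let ?B = "Cod (Cat K) q"
  have lti: "f1 (l \<odot> t) \<cdot> idn one = idn I \<cdot> (tgt I \<cdot> lam)" "f1 (l \<odot> s) \<cdot> idn one = idn I \<cdot> (src I \<cdot> lam)" by simp_all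
  have glue: "reparam W p (l \<odot> t) = reparam W q (l \<odot> s)"
  proof (rule one_fun_eq[OF W])
    have "app W one (idn one) (reparam W p (l \<odot> t)) = app W I (f1 (l \<odot> t) \<cdot> idn one) p"
      "app W one (idn one) (reparam W q (l \<odot> s)) = app W I (f1 (l \<odot> s) \<cdot> idn one) q"
      by (rule app_pre1; use W p q in simp)+
    then show "app W one (idn one) (reparam W p (l \<odot> t)) = app W one (idn one) (reparam W q (l \<odot> s))"
      unfolding lti using app_idn_src(2)[of lam I W p ?B] app_idn_src(1)[of lam I W q ?B] W p q e
      by (simp add: arr_def del: lam(4,5))
  qed (use W p q in simp_all)
  obtain c where c: "c \<in> Ar (Cat K)" "Dom (Cat K) c = prod_ob (Cat K) (dis W) II" "Cod (Cat K) c = ?B"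
      "reparam W c j1 = p" "reparam W c j2 = q"
    by (rule Cat.pushout_param[OF po1 _ _ _ _ _ _ glue]) (use W p q that in simp_all)
  have "app W two a (reparam W c dlt) = app W II (f1 dlt \<cdot> a) c" by (rule app_pre1) (use W c in simp_all)
  also have "\<dots> = icomp K ?B (app W II (f1 j1 \<cdot> lam) c) (app W II (f1 j2 \<cdot> lam) c)"
    unfolding delta(4) by (rule app_icomp(1)) (use W c(1-3) j_glue in \<open>simp_all del: ifun_elem\<close>)
  also have "app W II (f1 j1 \<cdot> lam) c = arr W p" unfolding c(4)[symmetric] arr_def
    by (rule app_pre1[symmetric]) (use W c(1-3) in simp_all)
  also have "app W II (f1 j2 \<cdot> lam) c = arr W q" unfolding c(5)[symmetric] arr_def
    by (rule app_pre1[symmetric]) (use W c(1-3) in simp_all)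
  finally show ?thesis using that c by simp
qed

abbreviation fpair :: "('a, 'b) ifun \<Rightarrow> ('a, 'b) ifun \<Rightarrow> ('a, 'b) ifun" where
  "fpair \<equiv> prod_pair (Cat K)"

abbreviation idI :: "('a, 'b) ifun" where "idI \<equiv> Ide (Cat K) I"

lemma side_arrows:
  "icomp K (prod_ob (Cat K) I I) (f1 (fpair zero idI) \<cdot> lam) (f1 (fpair idI unit) \<cdot> lam) = el1 I I lam lam"
  "icomp K (prod_ob (Cat K) I I) (f1 (fpair idI zero) \<cdot> lam) (f1 (fpair unit idI) \<cdot> lam) = el1 I I lam lam"
  "tgt (prod_ob (Cat K) I I) \<cdot> (f1 (fpair zero idI) \<cdot> lam) = src (prod_ob (Cat K) I I) \<cdot> (f1 (fpair idI unit) \<cdot> lam)"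
  "tgt (prod_ob (Cat K) I I) \<cdot> (f1 (fpair idI zero) \<cdot> lam) = src (prod_ob (Cat K) I I) \<cdot> (f1 (fpair unit idI) \<cdot> lam)"
proof -
  have e: "f1 (fpair zero idI) \<cdot> lam = el1 I I (idn I \<cdot> (src I \<cdot> lam)) lam" "f1 (fpair idI zero) \<cdot> lam = el1 I I lam (idn I \<cdot> (src I \<cdot> lam))"
    "f1 (fpair unit idI) \<cdot> lam = el1 I I (idn I \<cdot> (tgt I \<cdot> lam)) lam" "f1 (fpair idI unit) \<cdot> lam = el1 I I lam (idn I \<cdot> (tgt I \<cdot> lam))"
    using ends_lam by (simp_all del: lam(4,5))
  show "icomp K (prod_ob (Cat K) I I) (f1 (fpair zero idI) \<cdot> lam) (f1 (fpair idI unit) \<cdot> lam) = el1 I I lam lam"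
    "icomp K (prod_ob (Cat K) I I) (f1 (fpair idI zero) \<cdot> lam) (f1 (fpair unit idI) \<cdot> lam) = el1 I I lam lam"
    "tgt (prod_ob (Cat K) I I) \<cdot> (f1 (fpair zero idI) \<cdot> lam) = src (prod_ob (Cat K) I I) \<cdot> (f1 (fpair idI unit) \<cdot> lam)"
    "tgt (prod_ob (Cat K) I I) \<cdot> (f1 (fpair idI zero) \<cdot> lam) = src (prod_ob (Cat K) I I) \<cdot> (f1 (fpair unit idI) \<cdot> lam)"
    unfolding e by (simp_all del: lam(4,5))
qed

lemma ends_glue:
  "zero \<odot> (l \<odot> s) = l \<odot> s" "zero \<odot> (l \<odot> t) = l \<odot> s" "unit \<odot> (l \<odot> s) = l \<odot> t" "unit \<odot> (l \<odot> t) = l \<odot> t"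
  using one_terminal by (simp_all add: zero_def unit_def)

text \<open>The two arrows out of the pushout agree on \<open>dlt\<close>, since both send it to the diagonal arrow of
  \<open>I \<times> I\<close>; hence \<open>bdr\<close> is well defined, and it is determined by its four sides.\<close>

lemma boundary:
  "bdr \<in> Ar (Cat K)" "Dom (Cat K) bdr = Cod (Cat K) i1" "Cod (Cat K) bdr = prod_ob (Cat K) I I"
  "bdr \<odot> (i1 \<odot> j1) = fpair zero idI" "bdr \<odot> (i1 \<odot> j2) = fpair idI unit"
  "bdr \<odot> (i2 \<odot> j1) = fpair idI zero" "bdr \<odot> (i2 \<odot> j2) = fpair unit idI"
proof -
  let ?Q = "prod_ob (Cat K) I I"
  have g1: "fpair zero idI \<odot> (l \<odot> t) = fpair idI unit \<odot> (l \<odot> s)" by (simp add: ends_glue)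
  have g2: "fpair idI zero \<odot> (l \<odot> t) = fpair unit idI \<odot> (l \<odot> s)" by (simp add: ends_glue)
  let ?c1 = "copair (Cat K) j1 j2 (fpair zero idI) (fpair idI unit)"
  let ?c2 = "copair (Cat K) j1 j2 (fpair idI zero) (fpair unit idI)"
  note c1 = Cat.copair_pushout[OF po1 _ _ _ _ _ g1]
  note c2 = Cat.copair_pushout[OF po1 _ _ _ _ _ g2]
  have c1A: "?c1 \<in> Ar (Cat K)" "Dom (Cat K) ?c1 = II" "Cod (Cat K) ?c1 = ?Q" "?c1 \<odot> j1 = fpair zero idI" "?c1 \<odot> j2 = fpair idI unit"
    using c1 by simp_all
  have c2A: "?c2 \<in> Ar (Cat K)" "Dom (Cat K) ?c2 = II" "Cod (Cat K) ?c2 = ?Q" "?c2 \<odot> j1 = fpair idI zero" "?c2 \<odot> j2 = fpair unit idI"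
    using c2 by simp_all
  have arrs: "f1 ?c1 \<cdot> (f1 j1 \<cdot> lam) = f1 (fpair zero idI) \<cdot> lam" "f1 ?c1 \<cdot> (f1 j2 \<cdot> lam) = f1 (fpair idI unit) \<cdot> lam"
    "f1 ?c2 \<cdot> (f1 j1 \<cdot> lam) = f1 (fpair idI zero) \<cdot> lam" "f1 ?c2 \<cdot> (f1 j2 \<cdot> lam) = f1 (fpair unit idI) \<cdot> lam"
    using arg_cong[OF c1A(4), of f1] arg_cong[OF c1A(5), of f1] arg_cong[OF c2A(4), of f1] arg_cong[OF c2A(5), of f1]
    by (intro cmp_eq_assoc1; use c1A(1-3) c2A(1-3) in simp)+
  have d1: "f1 (?c1 \<odot> dlt) \<cdot> a = el1 I I lam lam"
  proof -
    have "f1 (?c1 \<odot> dlt) \<cdot> a = f1 ?c1 \<cdot> (f1 dlt \<cdot> a)" using c1A(1-3) by simp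
    also have "\<dots> = icomp K ?Q (f1 ?c1 \<cdot> (f1 j1 \<cdot> lam)) (f1 ?c1 \<cdot> (f1 j2 \<cdot> lam))"
      unfolding delta(4) using ifun_icomp[OF c1A(1,2), of "f1 j1 \<cdot> lam" "f1 j2 \<cdot> lam"] j_glue c1A(3) by (simp del: ifun_elem)
    finally show ?thesis unfolding arrs side_arrows .
  qed
  have d2: "f1 (?c2 \<odot> dlt) \<cdot> a = el1 I I lam lam"
  proof -
    have "f1 (?c2 \<odot> dlt) \<cdot> a = f1 ?c2 \<cdot> (f1 dlt \<cdot> a)" using c2A(1-3) by simp
    also have "\<dots> = icomp K ?Q (f1 ?c2 \<cdot> (f1 j1 \<cdot> lam)) (f1 ?c2 \<cdot> (f1 j2 \<cdot> lam))"
      unfolding delta(4) using ifun_icomp[OF c2A(1,2), of "f1 j1 \<cdot> lam" "f1 j2 \<cdot> lam"] j_glue c2A(3) by (simp del: ifun_elem)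
    finally show ?thesis unfolding arrs side_arrows .
  qed
  have "\<exists>!d. d \<in> hom (Cat K) two ?Q \<and> f1 d \<cdot> a = el1 I I lam lam" by (rule fun_of_two) simp_all
  then have g: "?c1 \<odot> dlt = ?c2 \<odot> dlt" using d1 d2 c1A(1-3) c2A(1-3) by (auto simp del: Cat_sel)
  have b: "bdr = copair (Cat K) i1 i2 ?c1 ?c2"
    by (simp add: boundary_incl_def Let_def zero_def unit_def)
  note bb = Cat.copair_pushout[OF po2 c1A(1) _ c2A(1) _ _ g]
  have bA: "bdr \<in> Ar (Cat K)" "Dom (Cat K) bdr = Cod (Cat K) i1" "Cod (Cat K) bdr = ?Q" "bdr \<odot> i1 = ?c1" "bdr \<odot> i2 = ?c2"
    unfolding b using bb c1A(1-3) c2A(1-3) by simp_all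
  then show "bdr \<in> Ar (Cat K)" "Dom (Cat K) bdr = Cod (Cat K) i1" "Cod (Cat K) bdr = ?Q" by simp_all
  have "bdr \<odot> (i1 \<odot> j1) = ?c1 \<odot> j1" "bdr \<odot> (i1 \<odot> j2) = ?c1 \<odot> j2"
    "bdr \<odot> (i2 \<odot> j1) = ?c2 \<odot> j1" "bdr \<odot> (i2 \<odot> j2) = ?c2 \<odot> j2"
    by (rule Cat.cmp_eq_assoc1; use bA in simp)+
  then show "bdr \<odot> (i1 \<odot> j1) = fpair zero idI" "bdr \<odot> (i1 \<odot> j2) = fpair idI unit"
    "bdr \<odot> (i2 \<odot> j1) = fpair idI zero" "bdr \<odot> (i2 \<odot> j2) = fpair unit idI"
    by (simp_all only: c1A(4,5) c2A(4,5))
qed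

text \<open>As the two composites agree, the four paths form the boundary of a square. The category \<open>C\<close> is
  simply connected, so that locally the boundary is filled by a square, which lifts to \<open>X\<close>. In
  the lifted square the two ways around have the same composite, namely the value of the square at
  the diagonal arrow, and its sides are the lifts of the given paths.\<close>

lemma square_key:
  assumes p: "is_path W p1" "is_path W p2" and q: "is_path W q1" "is_path W q2"
    and tp: "tgt C \<cdot> arr W p1 = src C \<cdot> arr W p2" and tq: "tgt C \<cdot> arr W q1 = src C \<cdot> arr W q2"
    and e: "icomp K C (arr W p1) (arr W p2) = icomp K C (arr W q1) (arr W q2)"
  shows "icomp K X (arr W (lift W p1)) (arr W (lift W p2)) = icomp K X (arr W (lift W q1)) (arr W (lift W q2))"
    "tgt X \<cdot> arr W (lift W p1) = src X \<cdot> arr W (lift W p2)"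
proof -
  note p1 = is_pathD[OF p(1)] and p2 = is_pathD[OF p(2)] and q1 = is_pathD[OF q(1)] and q2 = is_pathD[OF q(2)]
  have W: "W \<in> Ob K" by (rule p1(1))
  obtain cp where cp: "cp \<in> Ar (Cat K)" "Dom (Cat K) cp = prod_ob (Cat K) (dis W) II" "Cod (Cat K) cp = C"
    "reparam W cp j1 = p1" "reparam W cp j2 = p2" "app W two a (reparam W cp dlt) = icomp K C (arr W p1) (arr W p2)"
    by (rule concatenation[OF W p1(2,3) p2(2,3)]) (use p1 p2 tp that in simp_all)
  obtain cq where cq: "cq \<in> Ar (Cat K)" "Dom (Cat K) cq = prod_ob (Cat K) (dis W) II" "Cod (Cat K) cq = C"
    "reparam W cq j1 = q1" "reparam W cq j2 = q2" "app W two a (reparam W cq dlt) = icomp K C (arr W q1) (arr W q2)"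
    by (rule concatenation[OF W q1(2,3) q2(2,3)]) (use q1 q2 tq that in simp_all)
  have glue: "reparam W cp dlt = reparam W cq dlt"
    by (rule two_fun_eq[OF W]) (use W cp(1-3,6) cq(1-3,6) e in simp_all)
  obtain b where b: "b \<in> Ar (Cat K)" "Dom (Cat K) b = prod_ob (Cat K) (dis W) (Cod (Cat K) i1)" "Cod (Cat K) b = C"
      "reparam W b i1 = cp" "reparam W b i2 = cq"
    by (rule Cat.pushout_param[OF po2 _ _ _ _ _ _ glue]) (use W cp(1-3) cq(1-3) that in simp_all)
  note B = boundary
  obtain f h where f: "is_epi K f" "f \<in> Ar K" "Cod K f = W" and h: "h \<in> Ar (Cat K)"
    "Dom (Cat K) h = prod_ob (Cat K) (dis (Dom K f)) (Cod (Cat K) bdr)" "Cod (Cat K) h = C"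
    "reparam (Dom K f) h bdr = b \<odot> prod_ar (Cat K) (dis_ar f) (Ide (Cat K) (Dom (Cat K) bdr))"
    by (rule local_lift[OF square_C B(1) icats'(3) W b(1)]) (use B b that in simp_all)
  let ?V = "Dom K f"
  have V: "?V \<in> Ob K" using f by simp
  have h2: "Dom (Cat K) h = prod_ob (Cat K) (dis ?V) (prod_ob (Cat K) I I)" using h(2) B(3) by simp
  have side: "reparam ?V h (bdr \<odot> (x \<odot> j)) = reparam W (reparam W b x) j at f"
    if x: "x \<in> Ar (Cat K)" "Dom (Cat K) x = II" "Cod (Cat K) x = Cod (Cat K) i1"
      and j: "j \<in> Ar (Cat K)" "Dom (Cat K) j = I" "Cod (Cat K) j = II" for x j
  proof -
    have "reparam ?V h bdr \<odot> prod_ar (Cat K) (Ide (Cat K) (dis ?V)) (x \<odot> j)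
        = (b \<odot> prod_ar (Cat K) (dis_ar f) (Ide (Cat K) (Dom (Cat K) bdr))) \<odot> prod_ar (Cat K) (Ide (Cat K) (dis ?V)) (x \<odot> j)"
      by (simp only: h(4))
    then show ?thesis using x j b(1-3) f(2,3) h(1,3) h2 B(1-3) V W by simp
  qed
  obtain H where H: "H \<in> Ar (Cat K)" "Dom (Cat K) H = prod_ob (Cat K) (dis ?V) (prod_ob (Cat K) I I)" "Cod (Cat K) H = X"
    and Hl: "\<And>u v. u \<in> hom (Cat K) I I \<Longrightarrow> v \<in> hom (Cat K) I I \<Longrightarrow>
      lift ?V (reparam ?V h (fpair u v)) = reparam ?V H (fpair u v)"
    by (rule square_lift[OF V h(1) h2 h(3)]) (rule that)
  have sides: "arr W (lift W p1) \<cdot> f = app ?V (prod_ob (Cat K) I I) (f1 (fpair zero idI) \<cdot> lam) H"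
    "arr W (lift W p2) \<cdot> f = app ?V (prod_ob (Cat K) I I) (f1 (fpair idI unit) \<cdot> lam) H"
    "arr W (lift W q1) \<cdot> f = app ?V (prod_ob (Cat K) I I) (f1 (fpair idI zero) \<cdot> lam) H"
    "arr W (lift W q2) \<cdot> f = app ?V (prod_ob (Cat K) I I) (f1 (fpair unit idI) \<cdot> lam) H"
  proof -
    have gen: "arr W (lift W p) \<cdot> f = app ?V (prod_ob (Cat K) I I) (f1 (fpair u v) \<cdot> lam) H"
      if p: "is_path W p" and pe: "reparam ?V h (fpair u v) = p at f" and uv: "u \<in> hom (Cat K) I I" "v \<in> hom (Cat K) I I" for p u v
    proof -
      have "arr W (lift W p) \<cdot> f = arr ?V (lift ?V (p at f))" using arr_lift_at[OF p f(2,3)] by simp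
      also have "\<dots> = arr ?V (reparam ?V H (fpair u v))" using Hl[OF uv] pe by simp
      also have "\<dots> = app ?V (prod_ob (Cat K) I I) (f1 (fpair u v) \<cdot> lam) H"
        unfolding arr_def by (rule app_pre1) (use V H uv in simp_all)
      finally show ?thesis .
    qed
    show "arr W (lift W p1) \<cdot> f = app ?V (prod_ob (Cat K) I I) (f1 (fpair zero idI) \<cdot> lam) H"
      by (rule gen[OF p(1)]) (use side[of i1 j1] B(4) b(4) cp(4) in simp_all)
    show "arr W (lift W p2) \<cdot> f = app ?V (prod_ob (Cat K) I I) (f1 (fpair idI unit) \<cdot> lam) H"
      by (rule gen[OF p(2)]) (use side[of i1 j2] B(5) b(4) cp(5) in simp_all)
    show "arr W (lift W q1) \<cdot> f = app ?V (prod_ob (Cat K) I I) (f1 (fpair idI zero) \<cdot> lam) H"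
      by (rule gen[OF q(1)]) (use side[of i2 j1] B(6) b(5) cq(4) in simp_all)
    show "arr W (lift W q2) \<cdot> f = app ?V (prod_ob (Cat K) I I) (f1 (fpair unit idI) \<cdot> lam) H"
      by (rule gen[OF q(2)]) (use side[of i2 j2] B(7) b(5) cq(5) in simp_all)
  qed
  note L = lift_simps[OF p(1)] lift_simps[OF p(2)] lift_simps[OF q(1)] lift_simps[OF q(2)]
  have LA: "arr W (lift W x) \<in> Ar K" "Dom K (arr W (lift W x)) = W" "Cod K (arr W (lift W x)) = C1 X" if "is_path W x" for x
    using lift_simps[OF that] W by simp_all
  have A1: "app ?V (prod_ob (Cat K) I I) (icomp K (prod_ob (Cat K) I I) (f1 (fpair zero idI) \<cdot> lam) (f1 (fpair idI unit) \<cdot> lam)) H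
      = icomp K X (arr W (lift W p1) \<cdot> f) (arr W (lift W p2) \<cdot> f)"
    "tgt X \<cdot> (arr W (lift W p1) \<cdot> f) = src X \<cdot> (arr W (lift W p2) \<cdot> f)"
    unfolding sides by (rule app_icomp; use V H side_arrows(3) in \<open>simp del: ifun_elem prod_pair_elem\<close>)+
  have A2: "app ?V (prod_ob (Cat K) I I) (icomp K (prod_ob (Cat K) I I) (f1 (fpair idI zero) \<cdot> lam) (f1 (fpair unit idI) \<cdot> lam)) H
      = icomp K X (arr W (lift W q1) \<cdot> f) (arr W (lift W q2) \<cdot> f)"
    "tgt X \<cdot> (arr W (lift W q1) \<cdot> f) = src X \<cdot> (arr W (lift W q2) \<cdot> f)"
    unfolding sides by (rule app_icomp; use V H side_arrows(4) in \<open>simp del: ifun_elem prod_pair_elem\<close>)+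
  have t1: "tgt X \<cdot> arr W (lift W p1) = src X \<cdot> arr W (lift W p2)"
    by (rule epiD[OF f(1)]) (use LA[OF p(1)] LA[OF p(2)] A1(2) f in simp_all)
  have t2: "tgt X \<cdot> arr W (lift W q1) = src X \<cdot> arr W (lift W q2)"
    by (rule epiD[OF f(1)]) (use LA[OF q(1)] LA[OF q(2)] A2(2) f in simp_all)
  show "tgt X \<cdot> arr W (lift W p1) = src X \<cdot> arr W (lift W p2)" by (rule t1)
  show "icomp K X (arr W (lift W p1)) (arr W (lift W p2)) = icomp K X (arr W (lift W q1)) (arr W (lift W q2))"
  proof (rule epiD[OF f(1)])
    show "icomp K X (arr W (lift W p1)) (arr W (lift W p2)) \<cdot> f = icomp K X (arr W (lift W q1)) (arr W (lift W q2)) \<cdot> f"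
      using A1(1)[unfolded side_arrows] A2(1)[unfolded side_arrows]
        LA[OF p(1)] LA[OF p(2)] LA[OF q(1)] LA[OF q(2)] t1 t2 f by simp
  qed (use LA[OF p(1)] LA[OF p(2)] LA[OF q(1)] LA[OF q(2)] t1 t2 f in simp_all)
qed

text \<open>The fourth side is the constant path at the target of \<open>q\<close>, whose lift is constant.\<close>

lemma triangle_key:
  assumes p: "is_path W p1" "is_path W p2" and q: "is_path W q"
    and tp: "tgt C \<cdot> arr W p1 = src C \<cdot> arr W p2" and e: "icomp K C (arr W p1) (arr W p2) = arr W q"
  shows "icomp K X (arr W (lift W p1)) (arr W (lift W p2)) = arr W (lift W q)"
    "tgt X \<cdot> arr W (lift W p1) = src X \<cdot> arr W (lift W p2)"
proof -
  note qD = is_pathD[OF q] and qe = lift_ends[OF q] and lq = lift_simps[OF q]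
  have a1: "arr W (reparam W q unit) = idn C \<cdot> (tgt C \<cdot> arr W q)" by (rule arr_ends(2)[OF qD])
  have a2: "arr W (lift W (reparam W q unit)) = idn X \<cdot> (tgt X \<cdot> arr W (lift W q))"
    unfolding qe(4) by (rule arr_ends(2)[OF qD(1) lq(1-3)])
  have tq: "tgt C \<cdot> arr W q = src C \<cdot> arr W (reparam W q unit)" unfolding a1 using qD by simp
  have e': "icomp K C (arr W p1) (arr W p2) = icomp K C (arr W q) (arr W (reparam W q unit))"
    unfolding a1 using e qD by simp
  show "tgt X \<cdot> arr W (lift W p1) = src X \<cdot> arr W (lift W p2)" by (rule square_key(2)[OF p q qe(2) tp tq e'])
  show "icomp K X (arr W (lift W p1)) (arr W (lift W p2)) = arr W (lift W q)"
    using square_key(1)[OF p q qe(2) tp tq e'] unfolding a2 using qD lq by simp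
qed

text \<open>The crucial independence: the arrow of the lift of a path depends on the arrow of the path
  only.\<close>

lemma arr_lift_cong:
  assumes p: "is_path W p" and q: "is_path W q" and e: "arr W p = arr W q"
  shows "arr W (lift W p) = arr W (lift W q)"
proof -
  note pD = is_pathD[OF p] and pe = lift_ends[OF p] and lp = lift_simps[OF p]
  have a1: "arr W (reparam W p unit) = idn C \<cdot> (tgt C \<cdot> arr W p)" by (rule arr_ends(2)[OF pD])
  have a2: "arr W (lift W (reparam W p unit)) = idn X \<cdot> (tgt X \<cdot> arr W (lift W p))"
    unfolding pe(4) by (rule arr_ends(2)[OF pD(1) lp(1-3)])
  have "icomp K X (arr W (lift W p)) (arr W (lift W (reparam W p unit))) = arr W (lift W q)"
    by (rule triangle_key(1)[OF p pe(2) q]) (use pD is_pathD[OF q] e a1 in simp_all)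
  then show ?thesis unfolding a2 using pD lp by simp
qed

section \<open>The lifted functor\<close>

text \<open>Path connectedness lifts the generic arrow of \<open>B\<close>, the identity of \<open>C1 B\<close>, to a path over a
  cover. All other arrows are restrictions of the generic one.\<close>

lemma generic_path:
  assumes B: "is_icat K B" and epi: "is_epi K (hom_pre K l B)"
  obtains W g where "W \<in> Ob K" "g \<in> Ar (Cat K)" "Dom (Cat K) g = prod_ob (Cat K) (dis W) I" "Cod (Cat K) g = B"
    "is_epi K (arr W g)"
proof -
  let ?M = "C1 B"
  have M: "?M \<in> Ob K" using B by simp
  obtain F where F: "F \<in> Ar (Cat K)" "Dom (Cat K) F = prod_ob (Cat K) (dis ?M) two" "Cod (Cat K) F = B" "app ?M two a F = Ide K ?M"
    by (rule two_fun_ex[OF M B, of "Ide K ?M"]) (use M in simp_all)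
  obtain e g where e: "is_epi K e" "e \<in> Ar K" "Cod K e = ?M" and g: "g \<in> Ar (Cat K)"
    "Dom (Cat K) g = prod_ob (Cat K) (dis (Dom K e)) I" "Cod (Cat K) g = B"
    "reparam (Dom K e) g l = F \<odot> prod_ar (Cat K) (dis_ar e) (Ide (Cat K) two)"
    by (rule local_lift[OF epi l(1) B M F(1)]) (use F that in simp_all)
  have "arr (Dom K e) g = app (Dom K e) two a (reparam (Dom K e) g l)"
    unfolding arr_def lam_def by (rule app_pre1[symmetric]) (use g e in simp_all)
  also have "\<dots> = app ?M two (f1 (Ide (Cat K) two) \<cdot> a) F \<cdot> e"
    unfolding g(4) by (rule app_pre) (use F M e in simp_all)
  also have "\<dots> = e" using F e by simp
  finally have "is_epi K (arr (Dom K e) g)" using e by simp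
  then show ?thesis using that[of "Dom K e" g] g e by simp
qed

text \<open>Choose a path \<open>g\<close> whose arrow is epic. The arrow part \<open>v\<close> of \<open>\<psi>\<close> is obtained from the arrow of
  the lift of \<open>g\<close> by descent along that epimorphism; it then sends the arrow of every path to the
  arrow of its lift. Every law to be checked is local, hence may be verified on arrows of paths.\<close>

lemma functor_exists:
  obtains \<psi> where "\<psi> \<in> Ar (Cat K)" "Dom (Cat K) \<psi> = C" "Cod (Cat K) \<psi> = X" "\<psi> \<odot> \<iota> = \<phi>" "r \<odot> \<psi> = \<xi>"
proof -
  obtain V g where V: "V \<in> Ob K" and g: "g \<in> Ar (Cat K)" "Dom (Cat K) g = prod_ob (Cat K) (dis V) I" "Cod (Cat K) g = C"
    and e: "is_epi K (arr V g)"
    by (rule generic_path[OF icats'(3) path_C])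
  let ?e = "arr V g"
  have gp: "is_path V g" using V g by (simp add: is_path_def)
  have eA: "?e \<in> Ar K" "Dom K ?e = V" "Cod K ?e = C1 C" using V g by simp_all
  note lg = lift_simps[OF gp]
  let ?t = "arr V (lift V g)"
  have tA: "?t \<in> Ar K" "Dom K ?t = V" "Cod K ?t = C1 X" using V lg by simp_all
  have ker: "?t \<cdot> p = ?t \<cdot> p'"
    if "p \<in> Ar K" "p' \<in> Ar K" "Cod K p = V" "Cod K p' = V" "Dom K p = Dom K p'" "?e \<cdot> p = ?e \<cdot> p'" for p p'
  proof -
    have "arr (Dom K p) (lift (Dom K p) (g at p)) = arr (Dom K p) (lift (Dom K p) (g at p'))"
    proof (rule arr_lift_cong)
      show "is_path (Dom K p) (g at p)" "is_path (Dom K p) (g at p')"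
        using path_at[OF gp, of p] path_at[OF gp, of p'] that by simp_all
      show "arr (Dom K p) (g at p) = arr (Dom K p) (g at p')"
        using arr_at[OF V g(1,2), of p] arr_at[OF V g(1,2), of p'] that by simp
    qed
    then show ?thesis using arr_lift_at[OF gp, of p] arr_lift_at[OF gp, of p'] that by simp
  qed
  obtain v where v: "v \<in> Ar K" "Dom K v = C1 C" "Cod K v = C1 X" "v \<cdot> ?e = ?t"
  proof (rule epi_descent[OF e tA(1)])
    show "Dom K ?t = Dom K ?e" using eA tA by simp
    fix p p' assume "p \<in> Ar K" "p' \<in> Ar K" "Cod K p = Dom K ?e" "Cod K p' = Dom K ?e" "Dom K p = Dom K p'"
      "?e \<cdot> p = ?e \<cdot> p'"
    then show "?t \<cdot> p = ?t \<cdot> p'" by (intro ker) (simp_all add: eA)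
  next
    fix d assume d: "d \<in> Ar K" "Dom K d = Cod K ?e" "Cod K d = Cod K ?t" "d \<cdot> ?e = ?t"
    show thesis by (rule that[OF d(1) _ _ d(4)]) (use d(2,3) eA tA in simp_all)
  qed
  \<comment> \<open>every arrow is locally the arrow of a path\<close>
  have locally: "x = y"
    if m: "m \<in> Ar K" "Cod K m = C1 C" and x: "x \<in> Ar K" "Dom K x = Dom K m" and y: "y \<in> Ar K" "Dom K y = Dom K m" "Cod K y = Cod K x"
      and loc: "\<And>z q. z \<in> Ar K \<Longrightarrow> Cod K z = Dom K m \<Longrightarrow> is_path (Dom K z) q \<Longrightarrow> arr (Dom K z) q = m \<cdot> z \<Longrightarrow> x \<cdot> z = y \<cdot> z"
    for m x y
  proof (rule local_eq_epi[OF e, of m])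
    fix z w assume z: "z \<in> Ar K" "Cod K z = Dom K m" "w \<in> Ar K" "Dom K w = Dom K z" "Cod K w = Dom K ?e" "m \<cdot> z = ?e \<cdot> w"
    show "x \<cdot> z = y \<cdot> z"
      by (rule loc[OF z(1,2), of "g at w"])
        (use path_at[OF gp, of w] arr_at[OF V g(1,2), of w] z eA in simp_all)
  qed (use m x y eA in simp_all)
  have v_path: "v \<cdot> arr W q = arr W (lift W q)" if q: "is_path W q" for W q
  proof (rule locally[of "arr W q"])
    note qD = is_pathD[OF q] and lq = lift_simps[OF q]
    show "arr W q \<in> Ar K" "Cod K (arr W q) = C1 C" "v \<cdot> arr W q \<in> Ar K" "Dom K (v \<cdot> arr W q) = Dom K (arr W q)"
      "arr W (lift W q) \<in> Ar K" "Dom K (arr W (lift W q)) = Dom K (arr W q)" "Cod K (arr W (lift W q)) = Cod K (v \<cdot> arr W q)"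
      using qD lq v by simp_all
    fix z q' assume "z \<in> Ar K" "Cod K z = Dom K (arr W q)" "is_path (Dom K z) q'" "arr (Dom K z) q' = arr W q \<cdot> z"
    show "(v \<cdot> arr W q) \<cdot> z = arr W (lift W q) \<cdot> z"
    proof (rule local_eq_epi[OF e, of "arr W q \<cdot> z"])
      fix w u assume w: "w \<in> Ar K" "Cod K w = Dom K (arr W q \<cdot> z)" "u \<in> Ar K" "Dom K u = Dom K w" "Cod K u = Dom K ?e"
        "(arr W q \<cdot> z) \<cdot> w = ?e \<cdot> u"
      have zw: "z \<cdot> w \<in> Ar K" "Cod K (z \<cdot> w) = W" "Dom K (z \<cdot> w) = Dom K w" "Cod K w = Dom K z"
        using w \<open>z \<in> Ar K\<close> \<open>Cod K z = _\<close> qD by simp_all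
      have eq: "arr W q \<cdot> (z \<cdot> w) = ?e \<cdot> u" using w(1,6) zw(4) \<open>z \<in> Ar K\<close> \<open>Cod K z = _\<close> qD by simp
      have "arr (Dom K w) (lift (Dom K w) (q at (z \<cdot> w))) = arr (Dom K w) (lift (Dom K w) (g at u))"
      proof (rule arr_lift_cong)
        show "is_path (Dom K w) (q at (z \<cdot> w))" using path_at[OF q zw(1,2)] zw(3) by simp
        show "is_path (Dom K w) (g at u)" using path_at[OF gp w(3)] w eA by simp
        show "arr (Dom K w) (q at (z \<cdot> w)) = arr (Dom K w) (g at u)"
          using arr_at[OF qD(1-3) zw(1,2)] arr_at[OF V g(1,2) w(3)] zw(3) w(4,5) eA(2) eq by simp
      qed
      then have "arr W (lift W q) \<cdot> (z \<cdot> w) = ?t \<cdot> u"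
        using arr_lift_at[OF q zw(1,2)] arr_lift_at[OF gp w(3)] zw(3) w(4,5) eA(2) by simp
      also have "\<dots> = v \<cdot> (?e \<cdot> u)" by (rule cmp_eq_assoc1[OF v(4), symmetric]) (use v eA w in simp_all)
      also have "\<dots> = v \<cdot> (arr W q \<cdot> (z \<cdot> w))" by (simp only: eq)
      finally show "((v \<cdot> arr W q) \<cdot> z) \<cdot> w = (arr W (lift W q) \<cdot> z) \<cdot> w"
        using w(1) zw(4) \<open>z \<in> Ar K\<close> \<open>Cod K z = _\<close> qD lq v(1-3) by simp
    qed (use \<open>z \<in> Ar K\<close> \<open>Cod K z = _\<close> qD lq v(1-3) eA in simp_all)
  qed
  have v_idn: "v \<cdot> (idn C \<cdot> (src C \<cdot> m)) = idn X \<cdot> (src X \<cdot> (v \<cdot> m))" "v \<cdot> (idn C \<cdot> (tgt C \<cdot> m)) = idn X \<cdot> (tgt X \<cdot> (v \<cdot> m))"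
    if m: "m \<in> Ar K" "Cod K m = C1 C" for m
  proof -
    have 1: "v \<cdot> (idn C \<cdot> (src C \<cdot> arr W q)) = idn X \<cdot> (src X \<cdot> (v \<cdot> arr W q))"
      "v \<cdot> (idn C \<cdot> (tgt C \<cdot> arr W q)) = idn X \<cdot> (tgt X \<cdot> (v \<cdot> arr W q))" if q: "is_path W q" for W q
    proof -
      note qD = is_pathD[OF q] and qe = lift_ends[OF q] and lq = lift_simps[OF q]
      show "v \<cdot> (idn C \<cdot> (src C \<cdot> arr W q)) = idn X \<cdot> (src X \<cdot> (v \<cdot> arr W q))"
        using v_path[OF qe(1)] v_path[OF q] arr_ends(1)[OF qD] arr_ends(1)[OF qD(1) lq(1-3)] qe(3) by simp
      show "v \<cdot> (idn C \<cdot> (tgt C \<cdot> arr W q)) = idn X \<cdot> (tgt X \<cdot> (v \<cdot> arr W q))"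
        using v_path[OF qe(2)] v_path[OF q] arr_ends(2)[OF qD] arr_ends(2)[OF qD(1) lq(1-3)] qe(4) by simp
    qed
    show "v \<cdot> (idn C \<cdot> (src C \<cdot> m)) = idn X \<cdot> (src X \<cdot> (v \<cdot> m))"
    proof (rule locally[OF m])
      fix z q assume z: "z \<in> Ar K" "Cod K z = Dom K m" "is_path (Dom K z) q" "arr (Dom K z) q = m \<cdot> z"
      show "(v \<cdot> (idn C \<cdot> (src C \<cdot> m))) \<cdot> z = (idn X \<cdot> (src X \<cdot> (v \<cdot> m))) \<cdot> z"
        using 1(1)[OF z(3)] m v(1-3) z(1,2) by (simp add: z(4))
    qed (use m v in simp_all)
    show "v \<cdot> (idn C \<cdot> (tgt C \<cdot> m)) = idn X \<cdot> (tgt X \<cdot> (v \<cdot> m))"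
    proof (rule locally[OF m])
      fix z q assume z: "z \<in> Ar K" "Cod K z = Dom K m" "is_path (Dom K z) q" "arr (Dom K z) q = m \<cdot> z"
      show "(v \<cdot> (idn C \<cdot> (tgt C \<cdot> m))) \<cdot> z = (idn X \<cdot> (tgt X \<cdot> (v \<cdot> m))) \<cdot> z"
        using 1(2)[OF z(3)] m v(1-3) z(1,2) by (simp add: z(4))
    qed (use m v in simp_all)
  qed
  let ?u = "src X \<cdot> (v \<cdot> idn C)"
  have u: "?u \<in> Ar K" "Dom K ?u = C0 C" "Cod K ?u = C0 X" using v by simp_all
  have us: "?u \<cdot> src C = src X \<cdot> v" "?u \<cdot> tgt C = tgt X \<cdot> v"
    using v_idn[of "Ide K (C1 C)"] v(1-3) by simp_all
  have v_icomp: "v \<cdot> icomp K C m n = icomp K X (v \<cdot> m) (v \<cdot> n)"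
    if m: "m \<in> Ar K" "Cod K m = C1 C" and n: "n \<in> Ar K" "Cod K n = C1 C" "Dom K m = Dom K n" and tm: "tgt C \<cdot> m = src C \<cdot> n" for m n
  proof -
    have tm': "tgt C \<cdot> (m \<cdot> z) = src C \<cdot> (n \<cdot> z)" if "z \<in> Ar K" "Cod K z = Dom K n" for z
      by (rule cmp_eq_assoc[OF tm]) (use m n that in simp_all)
    have sv: "src X \<cdot> (v \<cdot> x) = ?u \<cdot> (src C \<cdot> x)" "tgt X \<cdot> (v \<cdot> x) = ?u \<cdot> (tgt C \<cdot> x)" if "x \<in> Ar K" "Cod K x = C1 C" for x
      using cmp_eq_assoc[OF us(1), of x] cmp_eq_assoc[OF us(2), of x] that v(1-3) u by simp_all
    have tv: "tgt X \<cdot> (v \<cdot> m) = src X \<cdot> (v \<cdot> n)" unfolding sv[OF m] sv[OF n(1,2)] tm ..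
    have vA: "v \<cdot> icomp K C m n \<in> Ar K" "Dom K (v \<cdot> icomp K C m n) = Dom K n" "Cod K (v \<cdot> icomp K C m n) = C1 X"
      "icomp K X (v \<cdot> m) (v \<cdot> n) \<in> Ar K" "Dom K (icomp K X (v \<cdot> m) (v \<cdot> n)) = Dom K n" "Cod K (icomp K X (v \<cdot> m) (v \<cdot> n)) = C1 X"
      "icomp K C m n \<in> Ar K" "Dom K (icomp K C m n) = Dom K n" "Cod K (icomp K C m n) = C1 C"
      using m n tm tv v(1-3) by simp_all
    have vz: "(v \<cdot> icomp K C m n) \<cdot> z = v \<cdot> icomp K C (m \<cdot> z) (n \<cdot> z)"
      "icomp K X (v \<cdot> m) (v \<cdot> n) \<cdot> z = icomp K X (v \<cdot> (m \<cdot> z)) (v \<cdot> (n \<cdot> z))" "icomp K C m n \<cdot> z = icomp K C (m \<cdot> z) (n \<cdot> z)"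
      if "z \<in> Ar K" "Cod K z = Dom K n" for z
      using m n tm tv v(1-3) that by simp_all
    show ?thesis
    proof (rule locally[OF m])
      fix z q1 assume z: "z \<in> Ar K" "Cod K z = Dom K m" "is_path (Dom K z) q1" "arr (Dom K z) q1 = m \<cdot> z"
      have zn: "Cod K z = Dom K n" using z n by simp
      show "(v \<cdot> icomp K C m n) \<cdot> z = icomp K X (v \<cdot> m) (v \<cdot> n) \<cdot> z"
      proof (rule locally[of "n \<cdot> z"])
        fix y q2 assume y: "y \<in> Ar K" "Cod K y = Dom K (n \<cdot> z)" "is_path (Dom K y) q2" "arr (Dom K y) q2 = (n \<cdot> z) \<cdot> y"
        have yz: "Cod K y = Dom K z" using y z zn n by simp
        show "((v \<cdot> icomp K C m n) \<cdot> z) \<cdot> y = (icomp K X (v \<cdot> m) (v \<cdot> n) \<cdot> z) \<cdot> y"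
        proof (rule locally[of "(icomp K C m n \<cdot> z) \<cdot> y"])
          fix x q3 assume x: "x \<in> Ar K" "Cod K x = Dom K ((icomp K C m n \<cdot> z) \<cdot> y)" "is_path (Dom K x) q3"
            "arr (Dom K x) q3 = ((icomp K C m n \<cdot> z) \<cdot> y) \<cdot> x"
          have xy: "Cod K x = Dom K y" using x(2) y(1) yz z(1) zn vA by simp
          let ?z = "z \<cdot> (y \<cdot> x)"
          have zA: "?z \<in> Ar K" "Cod K ?z = Dom K n" "Dom K ?z = Dom K x" using x xy y yz z zn by simp_all
          have P1: "is_path (Dom K x) (q1 at (y \<cdot> x))" "arr (Dom K x) (q1 at (y \<cdot> x)) = m \<cdot> ?z"
            using path_at[OF z(3), of "y \<cdot> x"] is_pathD[OF z(3)] arr_at[of "Dom K z" q1 "y \<cdot> x"] z(1,2) m x(1) xy y(1) yz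
            by (simp_all add: z(4))
          have P2: "is_path (Dom K x) (q2 at x)" "arr (Dom K x) (q2 at x) = n \<cdot> ?z"
            using path_at[OF y(3), of x] is_pathD[OF y(3)] arr_at[of "Dom K y" q2 x] z(1) zn n x(1) xy y(1) yz
            by (simp_all add: y(4))
          have P3: "arr (Dom K x) q3 = icomp K C (m \<cdot> ?z) (n \<cdot> ?z)"
            unfolding x(4) vz(3)[OF zA(1,2), symmetric] using x(1) xy y(1) yz z(1) zn vA by simp
          have "icomp K X (arr (Dom K x) (lift (Dom K x) (q1 at (y \<cdot> x)))) (arr (Dom K x) (lift (Dom K x) (q2 at x)))
              = arr (Dom K x) (lift (Dom K x) q3)"
            by (rule triangle_key(1)[OF P1(1) P2(1) x(3)]) (simp_all only: P1(2) P2(2) P3 tm'[OF zA(1,2)])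
          then have E: "icomp K X (v \<cdot> (m \<cdot> ?z)) (v \<cdot> (n \<cdot> ?z)) = v \<cdot> icomp K C (m \<cdot> ?z) (n \<cdot> ?z)"
            unfolding v_path[OF P1(1), symmetric] v_path[OF P2(1), symmetric] v_path[OF x(3), symmetric] P1(2) P2(2) P3 .
          have "(v \<cdot> icomp K C m n) \<cdot> ?z = icomp K X (v \<cdot> m) (v \<cdot> n) \<cdot> ?z" unfolding vz[OF zA(1,2)] E ..
          then show "(((v \<cdot> icomp K C m n) \<cdot> z) \<cdot> y) \<cdot> x = ((icomp K X (v \<cdot> m) (v \<cdot> n) \<cdot> z) \<cdot> y) \<cdot> x"
            using x(1) xy y(1) yz z(1) zn vA by (simp del: icomp_cmp)
        qed (use y(1) yz z(1) zn vA n in \<open>simp_all del: icomp_cmp\<close>)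
      qed (use z(1) zn vA n in \<open>simp_all del: icomp_cmp\<close>)
    qed (use vA n in simp_all)
  qed
  obtain \<psi> where \<psi>: "\<psi> \<in> Ar (Cat K)" "Dom (Cat K) \<psi> = C" "Cod (Cat K) \<psi> = X" "f0 \<psi> = ?u" "f1 \<psi> = v"
  proof (rule ifunI[OF icats'(3,5) u v(1-3) us[symmetric]])
    show "v \<cdot> idn C = idn X \<cdot> ?u" using v_idn(1)[of "idn C"] v(1-3) by simp
    show "v \<cdot> icomp K C f g = icomp K X (v \<cdot> f) (v \<cdot> g)"
      if "f \<in> Ar K" "g \<in> Ar K" "Cod K f = C1 C" "Cod K g = C1 C" "Dom K f = Dom K g" "tgt C \<cdot> f = src C \<cdot> g" for f g
      by (rule v_icomp[OF that(1,3,2,4,5,6)])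
  qed (rule that)
  have "r \<odot> \<psi> = \<xi>"
  proof (rule ifun_ext)
    have "f1 r \<cdot> v = f1 \<xi>"
    proof (rule epiD[OF e])
      have "f1 r \<cdot> ?t = arr V (r \<odot> lift V g)" using arr_post[OF V lg(1,2), of r] lg(3) by simp
      also have "\<dots> = f1 \<xi> \<cdot> ?e" unfolding lg(4) using arr_post[OF V g(1,2), of \<xi>] g(3) by simp
      finally show "(f1 r \<cdot> v) \<cdot> ?e = f1 \<xi> \<cdot> ?e" using v eA by simp
    qed (use v eA in simp_all)
    then show "f1 (r \<odot> \<psi>) = f1 \<xi>" using \<psi> by simp
  qed (use \<psi> in simp_all)
  moreover have "\<psi> \<odot> \<iota> = \<phi>"
  proof (rule ifun_ext)
    obtain W h where W: "W \<in> Ob K" and h: "h \<in> Ar (Cat K)" "Dom (Cat K) h = prod_ob (Cat K) (dis W) I" "Cod (Cat K) h = C'"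
      and e': "is_epi K (arr W h)"
      by (rule generic_path[OF icats'(4) path_C'])
    have hp: "is_path W (\<iota> \<odot> h)" using W h by (simp add: is_path_def)
    have hl: "lift W (\<iota> \<odot> h) = \<phi> \<odot> h"
      by (rule lift_eqI[OF hp]) (rule is_lift_factor, use W h in simp_all)
    have "v \<cdot> f1 \<iota> = f1 \<phi>"
    proof (rule epiD[OF e'])
      have "v \<cdot> (f1 \<iota> \<cdot> arr W h) = v \<cdot> arr W (\<iota> \<odot> h)" using arr_post[OF W h(1,2), of \<iota>] h by simp
      also have "\<dots> = f1 \<phi> \<cdot> arr W h" unfolding v_path[OF hp] hl using arr_post[OF W h(1,2), of \<phi>] h by simp
      finally show "(v \<cdot> f1 \<iota>) \<cdot> arr W h = f1 \<phi> \<cdot> arr W h" using v W h by simp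
    qed (use v W h in simp_all)
    then show "f1 (\<psi> \<odot> \<iota>) = f1 \<phi>" using \<psi> by simp
  qed (use \<psi> in simp_all)
  ultimately show ?thesis using that \<psi> by blast
qed

text \<open>Any solution composed with a path is the lift of that path.\<close>

lemma functor_unique:
  assumes \<psi>: "\<psi> \<in> Ar (Cat K)" "Dom (Cat K) \<psi> = C" "Cod (Cat K) \<psi> = X" "\<psi> \<odot> \<iota> = \<phi>" "r \<odot> \<psi> = \<xi>"
    and \<chi>: "\<chi> \<in> Ar (Cat K)" "Dom (Cat K) \<chi> = C" "Cod (Cat K) \<chi> = X" "\<chi> \<odot> \<iota> = \<phi>" "r \<odot> \<chi> = \<xi>"
  shows "\<psi> = \<chi>"
proof -
  obtain V g where V: "V \<in> Ob K" and g: "g \<in> Ar (Cat K)" "Dom (Cat K) g = prod_ob (Cat K) (dis V) I" "Cod (Cat K) g = C"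
    and e: "is_epi K (arr V g)"
    by (rule generic_path[OF icats'(3) path_C])
  have gp: "is_path V g" using V g by (simp add: is_path_def)
  obtain g' where g': "g' \<in> Ar (Cat K)" "Dom (Cat K) g' = prod_ob (Cat K) (dis V) I'" "Cod (Cat K) g' = C'" "\<iota> \<odot> g' = g \<odot> J V"
    by (rule path_jet[OF gp])
  have "lift V g = \<psi> \<odot> g"
    by (rule lift_eqI[OF gp], rule is_lift_cmp[OF \<psi>]) (use V g g' in simp_all)
  moreover have "lift V g = \<chi> \<odot> g"
    by (rule lift_eqI[OF gp], rule is_lift_cmp[OF \<chi>]) (use V g g' in simp_all)
  ultimately have "arr V (\<psi> \<odot> g) = arr V (\<chi> \<odot> g)" by simp
  then have "f1 \<psi> \<cdot> arr V g = f1 \<chi> \<cdot> arr V g"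
    using arr_post[OF V g(1,2), of \<psi>] arr_post[OF V g(1,2), of \<chi>] g \<psi> \<chi> by simp
  then have "f1 \<psi> = f1 \<chi>" by (rule epiD[OF e, rotated -1]) (use V g \<psi> \<chi> in simp_all)
  then show ?thesis by (intro ifun_ext) (use \<psi> \<chi> in simp_all)
qed

end

section \<open>The jet part of a simply connected category\<close>

theorem theorem8p1:
  fixes E :: "('o, 'a) cat" and U :: "('u, 'v) cat"
    and Lo :: "'u \<Rightarrow> ('o, 'a) icat" and La :: "'v \<Rightarrow> ('o, 'a) ifun"
    and Ro :: "('o, 'a) icat \<Rightarrow> 'u" and Ra :: "('o, 'a) ifun \<Rightarrow> 'v"
    and \<eta> :: "'u \<Rightarrow> 'v" and \<epsilon> :: "('o, 'a) icat \<Rightarrow> ('o, 'a) ifun"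
    and one two \<I> \<C> :: "('o, 'a) icat" and s t l j1 j2 i1 i2 :: "('o, 'a) ifun" and a :: 'a
  assumes "topos E"
    and "mono_coreflective E U Lo La Ro Ra \<eta> \<epsilon>"
    and "is_walking_arrow E one two s t a"
    and "l \<in> hom (Cat E) two \<I>"
    and "is_pushout (Cat E) (l \<cdot>\<^bsub>Cat E\<^esub> t) (l \<cdot>\<^bsub>Cat E\<^esub> s) j1 j2"
    and "is_pushout (Cat E) (delta E a l j1 j2) (delta E a l j1 j2) i1 i2"
    and "simply_connected E l
          (boundary_incl (Cat E) (l \<cdot>\<^bsub>Cat E\<^esub> s) (l \<cdot>\<^bsub>Cat E\<^esub> t) j1 j2 i1 i2) \<C>"
    and "path_connected E l (Lo (Ro \<C>))"
  shows "\<epsilon> \<C> \<in> left_class (Cat E) (\<epsilon> \<I>) \<and>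
    (\<forall>\<X> \<Y>. \<forall>r \<in> right_class (Cat E) (\<epsilon> \<I>) \<inter> hom (Cat E) \<X> \<Y>.
       \<forall>\<phi> \<in> hom (Cat E) (Lo (Ro \<C>)) \<X>. \<forall>\<xi> \<in> hom (Cat E) \<C> \<Y>.
         r \<cdot>\<^bsub>Cat E\<^esub> \<phi> = \<xi> \<cdot>\<^bsub>Cat E\<^esub> \<epsilon> \<C> \<longrightarrow>
         (\<exists>!\<psi>. \<psi> \<in> hom (Cat E) \<C> \<X> \<and>
            \<psi> \<cdot>\<^bsub>Cat E\<^esub> \<epsilon> \<C> = \<phi> \<and> r \<cdot>\<^bsub>Cat E\<^esub> \<psi> = \<xi>))"
proof -
  interpret topos E by (rule assms(1))
  interpret W: walking_arrow E one two s t a using assms(3) by unfold_locales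
  interpret M: mono_coreflective E U Lo La Ro Ra \<eta> \<epsilon> by (rule assms(2))
  have IO: "\<I> \<in> Ob (Cat E)" using assms(4) by auto
  have CO: "\<C> \<in> Ob (Cat E)" using assms(7) by (simp add: simply_connected_def path_connected_def)
  have eI: "\<epsilon> \<I> \<in> Ar (Cat E)" "Dom (Cat E) (\<epsilon> \<I>) = Lo (Ro \<I>)" "Cod (Cat E) (\<epsilon> \<I>) = \<I>"
    using M.counit_in[OF IO] by simp_all
  have eC: "\<epsilon> \<C> \<in> Ar (Cat E)" "Dom (Cat E) (\<epsilon> \<C>) = Lo (Ro \<C>)" "Cod (Cat E) (\<epsilon> \<C>) = \<C>"
    using M.counit_in[OF CO] by simp_all
  have jets: "\<exists>u'. u' \<in> hom (Cat E) (Lo (Ro \<I>)) (Lo (Ro \<I>)) \<and> \<epsilon> \<I> \<cdot>\<^bsub>Cat E\<^esub> u' = u \<cdot>\<^bsub>Cat E\<^esub> \<epsilon> \<I>"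
    if u: "u \<in> hom (Cat E) \<I> \<I>" for u
    using M.counit_natural[OF u] M.L.Fa_in[OF M.R.Fa_in[OF u]] by blast
  have o: "ortho (Cat E) (\<epsilon> \<C>) r" if r: "r \<in> right_class (Cat E) (\<epsilon> \<I>)" for r
  proof -
    have rA: "r \<in> Ar (Cat E)" and rP: "exp_square_pullback (Cat E) (\<epsilon> \<I>) r"
      using r by (simp_all add: right_class_def)
    obtain \<X> \<Y> where XY: "Dom (Cat E) r = \<X>" "Cod (Cat E) r = \<Y>" by blast
    have setting: "jet_setting E one two s t a \<I> (Lo (Ro \<I>)) l (\<epsilon> \<I>) j1 j2 i1 i2 \<C> (Lo (Ro \<C>))
        \<X> \<Y> (\<epsilon> \<C>) r \<phi> \<xi>"
      if "\<phi> \<in> Ar (Cat E)" "Dom (Cat E) \<phi> = Lo (Ro \<C>)" "Cod (Cat E) \<phi> = \<X>"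
        "\<xi> \<in> Ar (Cat E)" "Dom (Cat E) \<xi> = \<C>" "Cod (Cat E) \<xi> = \<Y>"
        "r \<cdot>\<^bsub>Cat E\<^esub> \<phi> = \<xi> \<cdot>\<^bsub>Cat E\<^esub> \<epsilon> \<C>" for \<phi> \<xi>
    proof (unfold_locales, goal_cases)
      case (11 u)
      then show ?case by (rule jets)
    next
      case 12
      show ?case by (rule M.counit_hom_iso[OF _ CO]) (use M.R.Fo_in[OF IO] in simp)
    qed (use that eI eC assms rA rP XY Cat.exp_square_pullback_iff[of "\<epsilon> \<I>" r] M.counit_mono[OF CO]
        in \<open>simp_all add: simply_connected_def path_connected_def\<close>)
    show ?thesis
    proof (rule orthoI, unfold XY eC(2,3))
      fix \<phi> \<xi> assume *: "\<phi> \<in> Ar (Cat E)" "Dom (Cat E) \<phi> = Lo (Ro \<C>)" "Cod (Cat E) \<phi> = \<X>"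
        "\<xi> \<in> Ar (Cat E)" "Dom (Cat E) \<xi> = \<C>" "Cod (Cat E) \<xi> = \<Y>"
        "r \<cdot>\<^bsub>Cat E\<^esub> \<phi> = \<xi> \<cdot>\<^bsub>Cat E\<^esub> \<epsilon> \<C>"
      interpret J: jet_setting E one two s t a \<I> "Lo (Ro \<I>)" l "\<epsilon> \<I>" j1 j2 i1 i2 \<C> "Lo (Ro \<C>)"
        \<X> \<Y> "\<epsilon> \<C>" r \<phi> \<xi> by (rule setting[OF *])
      show "\<exists>d. d \<in> hom (Cat E) \<C> \<X> \<and> d \<cdot>\<^bsub>Cat E\<^esub> \<epsilon> \<C> = \<phi> \<and> r \<cdot>\<^bsub>Cat E\<^esub> d = \<xi>"
      proof (rule J.functor_exists)
        fix \<psi> assume "\<psi> \<in> Ar (Cat E)" "Dom (Cat E) \<psi> = \<C>" "Cod (Cat E) \<psi> = \<X>"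
          "\<psi> \<cdot>\<^bsub>Cat E\<^esub> \<epsilon> \<C> = \<phi>" "r \<cdot>\<^bsub>Cat E\<^esub> \<psi> = \<xi>"
        then show ?thesis using eC(3) by (intro exI[of _ \<psi>]) simp
      qed
    next
      fix d d' assume d: "d \<in> Ar (Cat E)" "Dom (Cat E) d = \<C>" "Cod (Cat E) d = \<X>"
        and d': "d' \<in> Ar (Cat E)" "Dom (Cat E) d' = \<C>" "Cod (Cat E) d' = \<X>"
        and e: "d \<cdot>\<^bsub>Cat E\<^esub> \<epsilon> \<C> = d' \<cdot>\<^bsub>Cat E\<^esub> \<epsilon> \<C>" "r \<cdot>\<^bsub>Cat E\<^esub> d = r \<cdot>\<^bsub>Cat E\<^esub> d'"
      interpret J: jet_setting E one two s t a \<I> "Lo (Ro \<I>)" l "\<epsilon> \<I>" j1 j2 i1 i2 \<C> "Lo (Ro \<C>)"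
        \<X> \<Y> "\<epsilon> \<C>" r "d \<cdot>\<^bsub>Cat E\<^esub> \<epsilon> \<C>" "r \<cdot>\<^bsub>Cat E\<^esub> d"
        by (rule setting) (use d rA eC XY in simp_all)
      show "d = d'" by (rule J.functor_unique) (use d d' e eC in simp_all)
    qed
  qed
  have "\<epsilon> \<C> \<in> left_class (Cat E) (\<epsilon> \<I>)" by (rule Cat.left_class_of_ortho[OF eC(1) eI(1) o])
  moreover have "\<exists>!\<psi>. \<psi> \<in> hom (Cat E) \<C> \<X> \<and> \<psi> \<cdot>\<^bsub>Cat E\<^esub> \<epsilon> \<C> = \<phi> \<and> r \<cdot>\<^bsub>Cat E\<^esub> \<psi> = \<xi>"
    if r: "r \<in> right_class (Cat E) (\<epsilon> \<I>)" "r \<in> hom (Cat E) \<X> \<Y>" and \<phi>: "\<phi> \<in> hom (Cat E) (Lo (Ro \<C>)) \<X>"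
      and \<xi>: "\<xi> \<in> hom (Cat E) \<C> \<Y>" and e: "r \<cdot>\<^bsub>Cat E\<^esub> \<phi> = \<xi> \<cdot>\<^bsub>Cat E\<^esub> \<epsilon> \<C>" for \<X> \<Y> r \<phi> \<xi>
  proof -
    have D: "Dom (Cat E) r = \<X>" "Cod (Cat E) r = \<Y>" using r(2) by simp_all
    have "\<phi> \<in> hom (Cat E) (Dom (Cat E) (\<epsilon> \<C>)) (Dom (Cat E) r) \<and> \<xi> \<in> hom (Cat E) (Cod (Cat E) (\<epsilon> \<C>)) (Cod (Cat E) r) \<and>
        r \<cdot>\<^bsub>Cat E\<^esub> \<phi> = \<xi> \<cdot>\<^bsub>Cat E\<^esub> \<epsilon> \<C>"
      using \<phi> \<xi> e unfolding D eC(2,3) by blast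
    then have "\<exists>!\<psi>. \<psi> \<in> hom (Cat E) (Cod (Cat E) (\<epsilon> \<C>)) (Dom (Cat E) r) \<and> \<psi> \<cdot>\<^bsub>Cat E\<^esub> \<epsilon> \<C> = \<phi> \<and> r \<cdot>\<^bsub>Cat E\<^esub> \<psi> = \<xi>"
      using o[OF r(1)] unfolding ortho_def by blast
    then show ?thesis unfolding D eC(3) .
  qed
  ultimately show ?thesis by (simp only: ball_simps Int_iff) blast
qed

end
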